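(* Fix an integer $m\ge 1$ and let $\{B_{i,j} : i\in\mathbb{N},\ 1\le j\le m\}$ be independent standard Brownian motions on $[0,\infty)$. For $i\in\mathbb{N}$ let $$\xi_i(t)=B_{i,1}^2(t)+\dots+B_{i,m}^2(t),\qquad t\ge 0,$$ be the squared Bessel process of dimension $m$. Put $$b_n=2\ln n+(m-2)\ln(\ln n)-2\ln\Gamma(m/2),$$ and, for $1\le i\le n$ (with $n$ large enough that $b_n$ is defined and positive), define $$\xi_{i,n}(t)=\frac{\xi_i\left(1+t/b_n\right)-b_n\left(1+t/b_n\right)}{2},\qquad t\ge 0.$$ Then, as $n\to\infty$, $$\max_{i=1,\dots,n}\xi_{i,n}(t)\ \stackrel{d}{\to}\ M_B(t),\qquad t\in[0,1],$$ weakly on the space of continuous functions $C[0,1]$, where $M_B$ is the original Brown-Resnick process.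
   Context: $C[0,1]$ is the space of real-valued continuous functions on $[0,1]$ with the topology of uniform convergence; weak convergence means weak convergence of the laws of the processes as random elements of $C[0,1]$. The original Brown-Resnick process $M_B$ is defined as follows: let $\{X_i, i\in\mathbb{N}\}$ be the points of a Poisson point process on $\mathbb{R}$ with intensity measure $e^{-x}\,dx$, and let $\{B_i,i\in\mathbb{N}\}$ be independent standard Brownian motions on $[0,\infty)$, independent of $\{X_i,i\in\mathbb{N}\}$; then $M_B(t)=\max_{i\in\mathbb{N}}\bigl(X_i+B_i(t)-t/2\bigr)$, $t\ge 0$. *)

theory Defs
  imports "HOL-Probability.Probability"
begin

section \<open>Brownian motion and Poisson point processes\<close>

text \<open>A process is a function of time and outcome; only its values at times \<open>t \<ge> 0\<close> matter.\<close>

definition (in prob_space) std_brownian_motion :: "(real \<Rightarrow> 'a \<Rightarrow> real) \<Rightarrow> bool" where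
  "std_brownian_motion B \<longleftrightarrow>
     (\<forall>t\<ge>0. random_variable borel (B t)) \<and>
     (AE \<omega> in M. B 0 \<omega> = 0) \<and>
     (\<forall>(k::nat) \<tau>. 0 \<le> \<tau> 0 \<longrightarrow> strict_mono_on {..k} \<tau> \<longrightarrow>
        indep_vars (\<lambda>_. borel) (\<lambda>i \<omega>. B (\<tau> (Suc i)) \<omega> - B (\<tau> i) \<omega>) {..<k}) \<and>
     (\<forall>s t. 0 \<le> s \<longrightarrow> s < t \<longrightarrow>
        distributed M lborel (\<lambda>\<omega>. B t \<omega> - B s \<omega>) (normal_density 0 (sqrt (t - s)))) \<and>
     (AE \<omega> in M. continuous_on {0..} (\<lambda>t. B t \<omega>))"

definition path_space :: "(real \<Rightarrow> real) measure" where
  "path_space = (\<Pi>\<^sub>M t\<in>{0..}. borel)"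

definition path :: "(real \<Rightarrow> 'a \<Rightarrow> real) \<Rightarrow> 'a \<Rightarrow> real \<Rightarrow> real" where
  "path B \<omega> = (\<lambda>t\<in>{0..}. B t \<omega>)"

definition (in prob_space) indep_brownian_motions ::
    "('i \<Rightarrow> real \<Rightarrow> 'a \<Rightarrow> real) \<Rightarrow> 'i set \<Rightarrow> bool" where
  "indep_brownian_motions B I \<longleftrightarrow>
     (\<forall>i\<in>I. std_brownian_motion (B i)) \<and>
     indep_vars (\<lambda>_. path_space) (\<lambda>i. path (B i)) I"

definition point_count :: "(nat \<Rightarrow> 'a \<Rightarrow> real) \<Rightarrow> real set \<Rightarrow> 'a \<Rightarrow> ennreal" where
  "point_count X A \<omega> = emeasure (count_space UNIV) {i. X i \<omega> \<in> A}"

text \<open>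
  The family \<open>X\<close> enumerates, with multiplicity, the points of a Poisson point process
  with (infinite) intensity measure \<open>\<mu>\<close>. Since \<open>0 ^ 0 = 1\<close>, the formula also covers sets of
  intensity zero, which the library's Poisson distribution (with positive rate) does not.
\<close>

definition (in prob_space) poisson_points :: "real measure \<Rightarrow> (nat \<Rightarrow> 'a \<Rightarrow> real) \<Rightarrow> bool" where
  "poisson_points \<mu> X \<longleftrightarrow>
     (\<forall>i. random_variable borel (X i)) \<and>
     (\<forall>A\<in>sets borel. emeasure \<mu> A < \<infinity> \<longrightarrow>
        (\<forall>k::nat. prob {\<omega>\<in>space M. point_count X A \<omega> = of_nat k}
                  = measure \<mu> A ^ k / fact k * exp (- measure \<mu> A))) \<and>
     (\<forall>(k::nat) A. A ` {..<k} \<subseteq> sets borel \<longrightarrow> disjoint_family_on A {..<k} \<longrightarrow>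
        indep_vars (\<lambda>_. borel) (\<lambda>j. point_count X (A j)) {..<k})"

section \<open>The Brown-Resnick process\<close>

definition (in prob_space) brown_resnick_data ::
    "(nat \<Rightarrow> 'a \<Rightarrow> real) \<Rightarrow> (nat \<Rightarrow> real \<Rightarrow> 'a \<Rightarrow> real) \<Rightarrow> bool" where
  "brown_resnick_data X B \<longleftrightarrow>
     poisson_points (density lborel (\<lambda>x. ennreal (exp (- x)))) X \<and>
     indep_brownian_motions B UNIV \<and>
     indep_set
       (sets (vimage_algebra (space M) (\<lambda>\<omega> i. X i \<omega>) (\<Pi>\<^sub>M i\<in>UNIV. borel)))
       (sets (vimage_algebra (space M) (\<lambda>\<omega> i. path (B i) \<omega>) (\<Pi>\<^sub>M i\<in>UNIV. path_space)))"

text \<open>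
  The maximum of the infinite family is its greatest element, hence unspecified on the
  (null) set of outcomes where the family has no greatest element for some \<open>t\<close>.
\<close>

definition brown_resnick ::
    "(nat \<Rightarrow> 'a \<Rightarrow> real) \<Rightarrow> (nat \<Rightarrow> real \<Rightarrow> 'a \<Rightarrow> real) \<Rightarrow> real \<Rightarrow> 'a \<Rightarrow> real" where
  "brown_resnick X B t \<omega> = (GREATEST y. \<exists>i. y = X i \<omega> + B i t \<omega> - t / 2)"

section \<open>Weak convergence on \<open>C[0,1]\<close>\<close>

text \<open>Elements of \<open>C[0,1]\<close> are extensional: they take the value \<open>undefined\<close> off the unit interval.\<close>

definition C01 :: "(real \<Rightarrow> real) metric" where
  "C01 = cfunspace (top_of_set {0..1}) euclidean_metric"

lemma mspace_C01: "mspace C01 = {f \<in> extensional {0..1}. continuous_on {0..1} f}"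
proof -
  have "bounded (f ` {0..1})" if "continuous_on {0..1} f" for f :: "real \<Rightarrow> real"
    using that by (intro compact_imp_bounded compact_continuous_image) auto
  then show ?thesis
    by (auto simp: C01_def)
qed

lemma mdist_C01:
  assumes "f \<in> mspace C01" "g \<in> mspace C01"
  shows "mdist C01 f g = (SUP t\<in>{0..1}. \<bar>f t - g t\<bar>)"
proof -
  have M: "Metric_space (UNIV :: real set) dist"
    by (rule Met_TC.Metric_space_axioms)
  have "mspace C01 \<subseteq> Metric_space.fspace UNIV dist {0..1}"
    using cfunspace_subset_funspace[of "top_of_set {0..1::real}" "euclidean_metric :: real metric"]
    by (simp add: C01_def)
  with assms show ?thesis
    by (auto simp: C01_def mdist_cfunspace_eq_mdist_funspace Metric_space.fdist_def[OF M] dist_real_def)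
qed

definition borel_C01 :: "(real \<Rightarrow> real) measure" where
  "borel_C01 = sigma (mspace C01) {U. openin (mtopology_of C01) U}"

text \<open>
  The process \<open>Y\<close>, restricted to the unit interval, is almost surely equal to a random
  element \<open>Z\<close> of \<open>C[0,1]\<close>, whose law is \<open>\<mu>\<close>. Passing to \<open>Z\<close> only accounts for processes
  whose paths are continuous merely almost surely; the law does not depend on its choice.
\<close>

definition has_law_C01 ::
    "'a measure \<Rightarrow> (real \<Rightarrow> 'a \<Rightarrow> real) \<Rightarrow> (real \<Rightarrow> real) measure \<Rightarrow> bool" where
  "has_law_C01 M Y \<mu> \<longleftrightarrow>
     (\<exists>Z \<in> measurable M borel_C01.
        (AE \<omega> in M. \<forall>t\<in>{0..1}. Z \<omega> t = Y t \<omega>) \<and> \<mu> = distr M borel_C01 Z)"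

definition weak_conv_C01 ::
    "(nat \<Rightarrow> (real \<Rightarrow> real) measure) \<Rightarrow> (real \<Rightarrow> real) measure \<Rightarrow> bool" where
  "weak_conv_C01 \<mu>s \<mu> \<longleftrightarrow>
     (\<forall>F. continuous_map (mtopology_of C01) euclideanreal F \<longrightarrow> bounded (F ` mspace C01) \<longrightarrow>
        (\<lambda>n. \<integral>f. F f \<partial>\<mu>s n) \<longlonglongrightarrow> (\<integral>f. F f \<partial>\<mu>))"

text \<open>
  The processes \<open>Y n\<close> need to be random elements of \<open>C[0,1]\<close> only for large \<open>n\<close>; the limit
  process may live on a different probability space.
\<close>

definition converges_in_law_C01 ::
    "'a measure \<Rightarrow> (nat \<Rightarrow> real \<Rightarrow> 'a \<Rightarrow> real) \<Rightarrow> 'b measure \<Rightarrow> (real \<Rightarrow> 'b \<Rightarrow> real) \<Rightarrow> bool" where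
  "converges_in_law_C01 M Y N L \<longleftrightarrow>
     (\<exists>\<mu>s \<mu>. (\<forall>\<^sub>F n in sequentially. has_law_C01 M (Y n) (\<mu>s n)) \<and>
             has_law_C01 N L \<mu> \<and> weak_conv_C01 \<mu>s \<mu>)"

section \<open>Rescaled squared Bessel processes\<close>

definition sq_bessel :: "nat \<Rightarrow> (nat \<times> nat \<Rightarrow> real \<Rightarrow> 'a \<Rightarrow> real) \<Rightarrow> nat \<Rightarrow> real \<Rightarrow> 'a \<Rightarrow> real" where
  "sq_bessel m B i t \<omega> = (\<Sum>j=1..m. (B (i, j) t \<omega>)\<^sup>2)"

definition norming :: "nat \<Rightarrow> nat \<Rightarrow> real" where
  "norming m n =
     2 * ln (real n) + (real m - 2) * ln (ln (real n)) - 2 * ln (Gamma (real m / 2))"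

definition rescaled ::
    "nat \<Rightarrow> (nat \<times> nat \<Rightarrow> real \<Rightarrow> 'a \<Rightarrow> real) \<Rightarrow> nat \<Rightarrow> nat \<Rightarrow> real \<Rightarrow> 'a \<Rightarrow> real" where
  "rescaled m B n i t \<omega> =
     (sq_bessel m B i (1 + t / norming m n) \<omega> - norming m n * (1 + t / norming m n)) / 2"

end

theory Submission
  imports Defs "HOL-Real_Asymp.Real_Asymp" "HOL-Combinatorics.Multiset_Permutations"
begin

text \<open>
  Why the theorem holds. Write \<open>b\<close> for the norming constant, \<open>s\<close> for the value at time 1 of the
  \<open>m\<close>-dimensional Brownian motion with index \<open>i\<close>, and \<open>w(t)\<close> for its increment from time 1 to time
  \<open>1 + t/b\<close>, magnified by \<open>sqrt b\<close>. By Brownian scaling \<open>w\<close> is again an \<open>m\<close>-dimensional Brownian motion,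
  independent of \<open>s\<close>. Expanding the square of the norm of \<open>s + w(t) / sqrt b\<close> shows that the rescaled process is
  \<open>p + (|s| / sqrt b) * \<beta>(t) + |w(t)|\<^sup>2 / (2b) - t/2\<close>, where \<open>p = (|s|\<^sup>2 - b) / 2\<close> and \<open>\<beta>\<close> is the
  component of \<open>w\<close> in the direction of \<open>s\<close>. Given \<open>s\<close>, this \<open>\<beta>\<close> is a standard Brownian motion. As long as
  \<open>p\<close> stays bounded, \<open>|s| / sqrt b\<close> tends to 1, so the curve is nearly \<open>p + \<beta>(t) - t/2\<close>, which is the form of
  the curves of the Brown-Resnick process (\<open>curve_decomposition\<close>, \<open>curve_close\<close>). The constant \<open>b\<close> is such
  that the expected number of points \<open>p\<close> above \<open>x\<close> tends to \<open>exp (- x)\<close> (\<open>norming_tail_limit\<close>), so the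
  points converge to a Poisson process with intensity \<open>exp (- x) dx\<close>.

  Making this rigorous needs control of infinitely many low points. A point near \<open>- k\<close> matters only
  if its curve climbs by about \<open>k\<close>; the maximal inequality of Levy makes this exponentially unlikely at any
  prescribed rate, while the expected number of points above \<open>- k\<close> is at most a constant times
  \<open>exp (2k)\<close>, uniformly in \<open>n\<close> (\<open>norming_tail_bound\<close>, \<open>low_points_bound\<close>).

  The convergence itself is reduced to that of finitely many probabilities. It is enough to treat
  bounded Lipschitz functionals (\<open>weak_conv_C01_lipI\<close>). First the maximum is floored at a level \<open>- C\<close>. Then
  the points outside a window \<open>(- a, a]\<close> are dropped and those inside it are rounded up to a grid of bins of
  width \<open>\<delta>\<close>; both are harmless in either model (the two lemmas \<open>binned_approximation\<close>). For the binned
  maximum the curves in a bin are interchangeable, so in both models the conditional expectation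
  of the functional, given the points, is the same function of the numbers of points in the bins
  (\<open>binned_expectation_limit\<close>). Therefore the difference of the two expectations is controlled by the total variation distance
  between the laws of these numbers (\<open>binned_compare\<close>), and this distance tends to 0,
  since a multinomial law with small probabilities is nearly a product of Poisson laws
  (\<open>multinomial_poisson_limit\<close>, \<open>poisson_occupancy_limit\<close>). Finally the floor is removed:
  how far a path dips below the floor is itself a Lipschitz functional, so its expectation converges too (\<open>remove_floor\<close>).

  Functionals of continuous paths are handled through the values of the path on finite grids: a continuous
  path is the uniform limit of the Bernstein polynomials built from these values.
\<close>

section \<open>Functionals on \<open>C[0,1]\<close>\<close>

text \<open>
  Functionals act on arbitrary real functions, and only their behaviour on functions that are continuous
  on the unit interval is constrained. This spares the passage to extensional functions until the very end.
\<close>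

definition seq_cont :: "((real \<Rightarrow> real) \<Rightarrow> real) \<Rightarrow> bool" where
  "seq_cont \<Phi> \<longleftrightarrow>
     (\<forall>f fs. continuous_on {0..1} f \<longrightarrow> (\<forall>k::nat. continuous_on {0..1} (fs k)) \<longrightarrow>
        uniform_limit {0..1} fs f sequentially \<longrightarrow> (\<lambda>k. \<Phi> (fs k)) \<longlonglongrightarrow> \<Phi> f)"

definition lip :: "real \<Rightarrow> ((real \<Rightarrow> real) \<Rightarrow> real) \<Rightarrow> bool" where
  "lip L \<Phi> \<longleftrightarrow> 0 \<le> L \<and>
     (\<forall>f g e. continuous_on {0..1} f \<longrightarrow> continuous_on {0..1} g \<longrightarrow>
        (\<forall>t\<in>{0..1}. \<bar>f t - g t\<bar> \<le> e) \<longrightarrow> \<bar>\<Phi> f - \<Phi> g\<bar> \<le> L * e)"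

lemma lipD:
  assumes "lip L \<Phi>" "continuous_on {0..1} f" "continuous_on {0..1} g"
    "\<And>t. t \<in> {0..1} \<Longrightarrow> \<bar>f t - g t\<bar> \<le> e"
  shows "\<bar>\<Phi> f - \<Phi> g\<bar> \<le> L * e"
  using assms unfolding lip_def by blast

lemma lip_cong:
  assumes "lip L \<Phi>" "continuous_on {0..1} f" "\<And>t. t \<in> {0..1} \<Longrightarrow> f t = g t"
  shows "\<Phi> f = \<Phi> g"
proof -
  have "continuous_on {0..1} g"
    by (rule continuous_on_eq[OF assms(2)]) (use assms(3) in auto)
  then show ?thesis
    using lipD[OF assms(1,2), of g 0] assms(3) by simp
qed

lemma seq_contD:
  fixes fs :: "nat \<Rightarrow> real \<Rightarrow> real"
  assumes "seq_cont \<Phi>" "continuous_on {0..1} f" "\<And>k. continuous_on {0..1} (fs k)"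
    "uniform_limit {0..1} fs f sequentially"
  shows "(\<lambda>k. \<Phi> (fs k)) \<longlonglongrightarrow> \<Phi> f"
  using assms(1)[unfolded seq_cont_def, rule_format, of f fs] assms(2-) by simp

lemma lip_seq_cont:
  assumes "lip L \<Phi>"
  shows "seq_cont \<Phi>"
  unfolding seq_cont_def
proof (intro allI impI)
  fix f :: "real \<Rightarrow> real" and fs :: "nat \<Rightarrow> real \<Rightarrow> real"
  assume f: "continuous_on {0..1} f" and fs: "\<forall>k::nat. continuous_on {0..1} (fs k)"
    and lim: "uniform_limit {0..1} fs f sequentially"
  have L: "0 \<le> L" using assms by (simp add: lip_def)
  show "(\<lambda>k. \<Phi> (fs k)) \<longlonglongrightarrow> \<Phi> f"
  proof (rule tendstoI)
    fix e :: real assume e: "0 < e"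
    define d where "d = e / (L + 1)"
    have d: "0 < d" "L * d < e"
      using e L by (auto simp: d_def field_simps)
    have "\<forall>\<^sub>F k in sequentially. \<forall>t\<in>{0..1}. dist (fs k t) (f t) < d"
      using lim d(1) by (simp add: uniform_limit_iff)
    then show "\<forall>\<^sub>F k in sequentially. dist (\<Phi> (fs k)) (\<Phi> f) < e"
    proof eventually_elim
      case (elim k)
      have "\<bar>\<Phi> (fs k) - \<Phi> f\<bar> \<le> L * d"
        by (intro lipD[OF assms]) (use elim f fs in \<open>auto simp: dist_real_def less_imp_le\<close>)
      then show ?case using d(2) by (simp add: dist_real_def)
    qed
  qed
qed

text \<open>
  The Bernstein polynomial of degree \<open>K\<close> that has the coefficients \<open>v 0, \<dots>, v K\<close>. With the values of a
  path on the grid of mesh \<open>1 / K\<close> as coefficients, it recovers the path from finitely many of its values.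
\<close>

definition bernstein_poly :: "nat \<Rightarrow> (nat \<Rightarrow> real) \<Rightarrow> real \<Rightarrow> real" where
  "bernstein_poly K v t = (\<Sum>l\<le>K. v l * Bernstein K l t)"

lemma continuous_bernstein_poly: "continuous_on S (bernstein_poly K v)"
  unfolding bernstein_poly_def Bernstein_def by (intro continuous_intros)

lemma bernstein_poly_cong:
  assumes "\<And>l. l \<le> K \<Longrightarrow> v l = w l"
  shows "bernstein_poly K v = bernstein_poly K w"
  unfolding bernstein_poly_def using assms by (intro ext sum.cong) auto

lemma bernstein_poly_limit:
  assumes "continuous_on {0..1} f"
  shows "uniform_limit {0..1} (\<lambda>K. bernstein_poly K (\<lambda>l. f (real l / real K))) f sequentially"
  unfolding uniform_limit_iff
proof (intro allI impI)
  fix e :: real assume "0 < e"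
  from Bernstein_Weierstrass[OF assms this]
  obtain N where "\<forall>n x. N \<le> n \<and> x \<in> {0..1} \<longrightarrow>
      \<bar>f x - (\<Sum>k\<le>n. f (real k / real n) * Bernstein n k x)\<bar> < e" by blast
  then show "\<forall>\<^sub>F n in sequentially. \<forall>x\<in>{0..1}.
      dist (bernstein_poly n (\<lambda>l. f (real l / real n)) x) (f x) < e"
    unfolding eventually_sequentially bernstein_poly_def dist_real_def
    by (intro exI[of _ N]) (auto simp: abs_minus_commute)
qed

lemma seq_cont_bernstein:
  assumes "seq_cont \<Phi>" "continuous_on {0..1} f"
  shows "(\<lambda>K. \<Phi> (bernstein_poly K (\<lambda>l. f (real l / real K)))) \<longlonglongrightarrow> \<Phi> f"
  by (intro seq_contD[OF assms] continuous_bernstein_poly bernstein_poly_limit[OF assms(2)])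

lemma seq_cont_grid_measurable:
  assumes "seq_cont \<Phi>"
  shows "(\<lambda>v. \<Phi> (bernstein_poly K v)) \<in> borel_measurable (\<Pi>\<^sub>M l\<in>UNIV. borel)"
proof -
  \<comment> \<open>the Bernstein weights are nonnegative with sum 1, so the polynomial moves by no more than its coefficients\<close>
  have "continuous_on UNIV (\<lambda>v. \<Phi> (bernstein_poly K v))"
    unfolding continuous_on_sequentially
  proof (intro allI ballI impI)
    fix x :: "nat \<Rightarrow> nat \<Rightarrow> real" and a
    assume "(\<forall>n. x n \<in> UNIV) \<and> x \<longlonglongrightarrow> a"
    then have xa: "x \<longlonglongrightarrow> a" by simp
    have xl: "(\<lambda>n. x n l) \<longlonglongrightarrow> a l" for l
    proof -
      have "continuous_on UNIV (\<lambda>f::nat \<Rightarrow> real. f l)"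
        by (rule continuous_on_product_coordinates)
      then have "isCont (\<lambda>f::nat \<Rightarrow> real. f l) a"
        unfolding continuous_on_eq_continuous_at[OF open_UNIV] by (rule bspec) simp
      from isCont_tendsto_compose[OF this xa] show ?thesis .
    qed
    have "uniform_limit {0..1} (\<lambda>n. bernstein_poly K (x n)) (bernstein_poly K a) sequentially"
      unfolding uniform_limit_iff
    proof (intro allI impI)
      fix e :: real assume e: "0 < e"
      have "\<forall>\<^sub>F n in sequentially. \<forall>l\<in>{..K}. \<bar>x n l - a l\<bar> < e"
        using xl e by (intro eventually_ball_finite) (auto simp: tendsto_iff dist_real_def)
      then show "\<forall>\<^sub>F n in sequentially. \<forall>t\<in>{0..1}.
          dist (bernstein_poly K (x n) t) (bernstein_poly K a t) < e"
      proof eventually_elim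
        case (elim n)
        define s where "s = Max ((\<lambda>l. \<bar>x n l - a l\<bar>) ` {..K})"
        have s: "s < e" "\<And>l. l \<le> K \<Longrightarrow> \<bar>x n l - a l\<bar> \<le> s"
          using elim by (auto simp: s_def)
        show ?case
        proof
          fix t :: real assume t: "t \<in> {0..1}"
          have "\<bar>bernstein_poly K (x n) t - bernstein_poly K a t\<bar>
              = \<bar>\<Sum>l\<le>K. (x n l - a l) * Bernstein K l t\<bar>"
            by (simp add: bernstein_poly_def sum_subtractf left_diff_distrib)
          also have "\<dots> \<le> (\<Sum>l\<le>K. \<bar>(x n l - a l) * Bernstein K l t\<bar>)"
            by (rule sum_abs)
          also have "\<dots> \<le> (\<Sum>l\<le>K. s * Bernstein K l t)"
            using t s(2) by (intro sum_mono)
              (auto simp: abs_mult Bernstein_nonneg intro!: mult_right_mono)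
          also have "\<dots> = s" by (simp flip: sum_distrib_left)
          finally show "dist (bernstein_poly K (x n) t) (bernstein_poly K a t) < e"
            using s(1) by (simp add: dist_real_def)
        qed
      qed
    qed
    then show "((\<lambda>v. \<Phi> (bernstein_poly K v)) \<circ> x) \<longlonglongrightarrow> \<Phi> (bernstein_poly K a)"
      unfolding comp_def by (intro seq_contD[OF assms] continuous_bernstein_poly)
  qed
  then have "(\<lambda>v. \<Phi> (bernstein_poly K v)) \<in> borel_measurable borel"
    by (rule borel_measurable_continuous_onI)
  moreover have "sets (\<Pi>\<^sub>M l\<in>(UNIV :: nat set). (borel :: real measure)) = sets borel"
    by (rule sets_PiM_equal_borel)
  ultimately show ?thesis
    using measurable_cong_sets by blast
qed

text \<open>
  Measurability of a functional of a continuous process reduces to finitely many times: the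
  Bernstein polynomials of a path depend on finitely many of its values and converge uniformly to it.
\<close>

lemma seq_cont_measurable:
  assumes \<Phi>: "seq_cont \<Phi>"
    and cont: "\<And>\<omega>. \<omega> \<in> space M \<Longrightarrow> continuous_on {0..1} (\<lambda>t. Y t \<omega>)"
    and meas: "\<And>t. t \<in> {0..1} \<Longrightarrow> Y t \<in> borel_measurable M"
  shows "(\<lambda>\<omega>. \<Phi> (\<lambda>t. Y t \<omega>)) \<in> borel_measurable M"
proof (rule borel_measurable_LIMSEQ_metric)
  fix \<omega> assume "\<omega> \<in> space M"
  then show "(\<lambda>K. \<Phi> (bernstein_poly K (\<lambda>l. if l \<le> K then Y (real l / real K) \<omega> else 0)))
      \<longlonglongrightarrow> \<Phi> (\<lambda>t. Y t \<omega>)"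
    using seq_cont_bernstein[OF \<Phi> cont]
      bernstein_poly_cong[of K "\<lambda>l. if l \<le> K then Y (real l / real K) \<omega> else 0"
        "\<lambda>l. Y (real l / real K) \<omega>" for K]
    by simp
next
  fix K
  have "(\<lambda>\<omega>. \<lambda>l::nat. if l \<le> K then Y (real l / real K) \<omega> else 0)
      \<in> measurable M (\<Pi>\<^sub>M l\<in>UNIV. borel)"
  proof (rule measurable_PiM_single')
    fix l :: nat
    show "(\<lambda>\<omega>. if l \<le> K then Y (real l / real K) \<omega> else 0) \<in> borel_measurable M"
      using meas[of "real l / real K"] by (cases "l \<le> K") (auto simp: divide_le_eq_1)
  qed auto
  from measurable_compose[OF this seq_cont_grid_measurable[OF \<Phi>, of K]]
  show "(\<lambda>\<omega>. \<Phi> (bernstein_poly K (\<lambda>l. if l \<le> K then Y (real l / real K) \<omega> else 0)))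
      \<in> borel_measurable M" .
qed

lemma restrict_mspace_C01 [simp]:
  assumes "continuous_on {0..1} f"
  shows "restrict f {0..1} \<in> mspace C01"
proof -
  have "continuous_on {0..1} (restrict f {0..1})"
    by (rule continuous_on_eq[OF assms]) simp
  then show ?thesis by (simp add: mspace_C01)
qed

lemma mdist_C01_le:
  assumes "continuous_on {0..1} f" "continuous_on {0..1} g"
    "\<And>t. t \<in> {0..1} \<Longrightarrow> \<bar>f t - g t\<bar> \<le> e"
  shows "mdist C01 (restrict f {0..1}) (restrict g {0..1}) \<le> e"
proof -
  have "mdist C01 (restrict f {0..1}) (restrict g {0..1})
      = (SUP t\<in>{0..1}. \<bar>restrict f {0..1} t - restrict g {0..1} t\<bar>)"
    using assms(1,2) by (intro mdist_C01) simp_all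
  also have "\<dots> \<le> e"
    using assms(3) by (intro cSUP_least) auto
  finally show ?thesis .
qed

text \<open>
  The infimal convolution of \<open>h\<close> with \<open>k\<close> times the metric: the largest \<open>k\<close>-Lipschitz function that is at most
  \<open>h\<close> on \<open>S\<close>. For \<open>h = 0\<close> and \<open>k = 1\<close> it is the distance to \<open>S\<close>.
\<close>

definition inf_conv :: "(real \<Rightarrow> real) set \<Rightarrow> ((real \<Rightarrow> real) \<Rightarrow> real) \<Rightarrow> real \<Rightarrow> (real \<Rightarrow> real) \<Rightarrow> real" where
  "inf_conv S h k f = (INF g\<in>S. h g + k * mdist C01 (restrict f {0..1}) g)"

lemma inf_conv_le:
  assumes "\<And>g. g \<in> S \<Longrightarrow> a \<le> h g" "0 \<le> k" "g \<in> S"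
  shows "inf_conv S h k f \<le> h g + k * mdist C01 (restrict f {0..1}) g"
  unfolding inf_conv_def
proof (rule cINF_lower[OF _ assms(3)])
  show "bdd_below ((\<lambda>g. h g + k * mdist C01 (restrict f {0..1}) g) ` S)"
    by (rule bdd_belowI2[of _ a]) (use assms(1,2) in \<open>auto intro: add_increasing2\<close>)
qed

lemma inf_conv_ge:
  assumes "\<And>g. g \<in> S \<Longrightarrow> b \<le> h g + k * mdist C01 (restrict f {0..1}) g" "S \<noteq> {}"
  shows "b \<le> inf_conv S h k f"
  unfolding inf_conv_def using assms by (intro cINF_greatest) auto

lemma lip_inf_conv:
  assumes S: "S \<subseteq> mspace C01" "S \<noteq> {}" and h: "\<And>g. g \<in> S \<Longrightarrow> a \<le> h g" and k: "0 \<le> k"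
  shows "lip k (inf_conv S h k)"
proof -
  have *: "inf_conv S h k f \<le> inf_conv S h k g + k * e"
    if f: "continuous_on {0..1} f" and g: "continuous_on {0..1} g"
      and e: "\<forall>t\<in>{0..1}. \<bar>f t - g t\<bar> \<le> e" for f g e
  proof -
    have "inf_conv S h k f - k * e \<le> h w + k * mdist C01 (restrict g {0..1}) w" if w: "w \<in> S" for w
    proof -
      have 1: "inf_conv S h k f \<le> h w + k * mdist C01 (restrict f {0..1}) w"
        using h k w by (intro inf_conv_le)
      have "mdist C01 (restrict f {0..1}) w
          \<le> mdist C01 (restrict f {0..1}) (restrict g {0..1}) + mdist C01 (restrict g {0..1}) w"
        by (rule mdist_triangle) (use f g w S in auto)
      moreover have "mdist C01 (restrict f {0..1}) (restrict g {0..1}) \<le> e"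
        using f g e by (intro mdist_C01_le) auto
      ultimately have "mdist C01 (restrict f {0..1}) w \<le> e + mdist C01 (restrict g {0..1}) w"
        by linarith
      from mult_left_mono[OF this k] 1 show ?thesis unfolding distrib_left by linarith
    qed
    from inf_conv_ge[OF this S(2)] show ?thesis by simp
  qed
  show ?thesis
    unfolding lip_def
  proof (intro conjI allI impI k)
    fix f g :: "real \<Rightarrow> real" and e :: real
    assume "continuous_on {0..1} f" "continuous_on {0..1} g" "\<forall>t\<in>{0..1}. \<bar>f t - g t\<bar> \<le> e"
    with *[of f g e] *[of g f e] show "\<bar>inf_conv S h k f - inf_conv S h k g\<bar> \<le> k * e"
      by (auto simp: abs_minus_commute abs_le_iff)
  qed
qed

text \<open>
  An open set is where the distance to its complement is positive, and this distance is a Lipschitz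
  functional, so its value at a continuous process is a random variable.
\<close>

lemma restrict_C01_measurable:
  assumes cont: "\<And>\<omega>. \<omega> \<in> space M \<Longrightarrow> continuous_on {0..1} (\<lambda>t. Y t \<omega>)"
    and meas: "\<And>t. t \<in> {0..1} \<Longrightarrow> Y t \<in> borel_measurable M"
  shows "(\<lambda>\<omega>. restrict (\<lambda>t. Y t \<omega>) {0..1}) \<in> measurable M borel_C01"
  unfolding borel_C01_def
proof (rule measurable_measure_of)
  interpret C: Metric_space "mspace C01" "mdist C01" by (rule Metric_space_mspace_mdist)
  show "{U. openin (mtopology_of C01) U} \<subseteq> Pow (mspace C01)"
    using openin_subset by fastforce
  show "(\<lambda>\<omega>. restrict (\<lambda>t. Y t \<omega>) {0..1}) \<in> space M \<rightarrow> mspace C01"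
    using cont by auto
  fix U assume "U \<in> {U. openin (mtopology_of C01) U}"
  then have U: "openin C.mtopology U" by (simp add: mtopology_of_def)
  show "(\<lambda>\<omega>. restrict (\<lambda>t. Y t \<omega>) {0..1}) -` U \<inter> space M \<in> sets M"
  proof (cases "mspace C01 - U = {}")
    case True
    then have "(\<lambda>\<omega>. restrict (\<lambda>t. Y t \<omega>) {0..1}) -` U \<inter> space M = space M"
      using cont restrict_mspace_C01 by blast
    then show ?thesis by simp
  next
    case False
    \<comment> \<open>the distance to the complement of \<open>U\<close>\<close>
    define \<Phi> where "\<Phi> = inf_conv (mspace C01 - U) (\<lambda>_. 0) 1"
    have "seq_cont \<Phi>"
      unfolding \<Phi>_def using False by (intro lip_seq_cont[OF lip_inf_conv[where a = 0]]) auto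
    from seq_cont_measurable[OF this, of M Y] cont meas
    have [measurable]: "(\<lambda>\<omega>. \<Phi> (\<lambda>t. Y t \<omega>)) \<in> borel_measurable M" by simp
    have *: "restrict f {0..1} \<in> U \<longleftrightarrow> 0 < \<Phi> f" if f: "continuous_on {0..1} f" for f
    proof
      assume "restrict f {0..1} \<in> U"
      then obtain r where r: "r > 0" "C.mball (restrict f {0..1}) r \<subseteq> U"
        using U unfolding C.openin_mtopology by blast
      have "r \<le> 0 + 1 * mdist C01 (restrict f {0..1}) g" if "g \<in> mspace C01 - U" for g
        using that r(2) f by (auto simp: subset_iff C.in_mball intro: leI)
      from inf_conv_ge[of "mspace C01 - U" r "\<lambda>_. 0" 1 f, OF this False] r(1)
      show "0 < \<Phi> f" by (simp add: \<Phi>_def)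
    next
      assume pos: "0 < \<Phi> f"
      show "restrict f {0..1} \<in> U"
      proof (rule ccontr)
        assume "restrict f {0..1} \<notin> U"
        then have "restrict f {0..1} \<in> mspace C01 - U" using f by auto
        from inf_conv_le[OF _ _ this, of 0 "\<lambda>_. 0" 1 f] pos
        show False using f by (simp add: \<Phi>_def)
      qed
    qed
    have "(\<lambda>\<omega>. restrict (\<lambda>t. Y t \<omega>) {0..1}) -` U \<inter> space M = {\<omega>\<in>space M. 0 < \<Phi> (\<lambda>t. Y t \<omega>)}"
      using * cont by auto
    then show ?thesis by simp
  qed
qed

lemma continuous_map_C01_measurable:
  assumes "continuous_map (mtopology_of C01) euclideanreal F"
  shows "F \<in> borel_measurable borel_C01"
proof (rule borel_measurableI)
  fix S :: "real set" assume "open S"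
  then have "openin (mtopology_of C01) {x \<in> topspace (mtopology_of C01). F x \<in> S}"
    using assms by (intro openin_continuous_map_preimage[where Y = euclideanreal]) auto
  moreover have "F -` S \<inter> space borel_C01 = {x \<in> topspace (mtopology_of C01). F x \<in> S}"
    by (auto simp: borel_C01_def space_measure_of_conv)
  moreover have "{U. openin (mtopology_of C01) U} \<subseteq> Pow (mspace C01)"
    using openin_subset by fastforce
  ultimately show "F -` S \<inter> space borel_C01 \<in> sets borel_C01"
    by (auto simp: borel_C01_def)
qed

lemma space_borel_C01: "space borel_C01 = mspace C01"
  by (simp add: borel_C01_def space_measure_of_conv)

lemma lip_C01_measurable:
  assumes "lip L \<Phi>" "Z \<in> measurable M borel_C01"
  shows "(\<lambda>\<omega>. \<Phi> (Z \<omega>)) \<in> borel_measurable M"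
proof -
  interpret C: Metric_space "mspace C01" "mdist C01" by (rule Metric_space_mspace_mdist)
  have L: "0 \<le> L" using assms by (simp add: lip_def)
  have "continuous_map (mtopology_of C01) (mtopology_of euclidean_metric) \<Phi>"
  proof (rule Lipschitz_continuous_imp_continuous_map)
    show "Lipschitz_continuous_map C01 euclidean_metric \<Phi>"
      unfolding Lipschitz_continuous_map_def
    proof (intro conjI exI[of _ L] ballI)
      fix f g assume fg: "f \<in> mspace C01" "g \<in> mspace C01"
      have cf: "continuous_on {0..1} f" "continuous_on {0..1} g"
        using fg by (auto simp: mspace_C01)
      have "\<bar>\<Phi> f - \<Phi> g\<bar> \<le> L * mdist C01 f g"
      proof (rule lipD[OF assms(1) cf])
        fix t :: real assume t: "t \<in> {0..1}"
        have "compact ((\<lambda>t. \<bar>f t - g t\<bar>) ` {0..1})"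
          using cf by (intro compact_continuous_image continuous_intros) auto
        then have "bdd_above ((\<lambda>t. \<bar>f t - g t\<bar>) ` {0..1})"
          by (intro bounded_imp_bdd_above compact_imp_bounded)
        then show "\<bar>f t - g t\<bar> \<le> mdist C01 f g"
          using t unfolding mdist_C01[OF fg] by (intro cSUP_upper)
      qed
      then show "mdist euclidean_metric (\<Phi> f) (\<Phi> g) \<le> L * mdist C01 f g"
        by (simp add: dist_real_def)
    qed auto
  qed
  then have "\<Phi> \<in> borel_measurable borel_C01"
    by (intro continuous_map_C01_measurable) simp
  with assms(2) show ?thesis by (rule measurable_compose)
qed

text \<open>
  Lipschitz functionals determine weak convergence: a bounded continuous \<open>F\<close> is the increasing limit of
  its Lipschitz infimal convolutions. The convergence of the means of these gives the lower bound
  \<open>liminf E F(Zn) \<ge> E F(Z)\<close>, and the same bound for \<open>- F\<close> is the upper one.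
\<close>

lemma weak_conv_C01_lipI:
  assumes M: "prob_space M" and N: "prob_space N"
    and Zn: "\<forall>\<^sub>F n in sequentially. Zn n \<in> measurable M borel_C01"
    and Z: "Z \<in> measurable N borel_C01"
    and lim: "\<And>\<Phi> L c. lip L \<Phi> \<Longrightarrow> (\<And>f. continuous_on {0..1} f \<Longrightarrow> \<bar>\<Phi> f\<bar> \<le> c) \<Longrightarrow>
      (\<lambda>n. \<integral>\<omega>. \<Phi> (Zn n \<omega>) \<partial>M) \<longlonglongrightarrow> (\<integral>\<omega>. \<Phi> (Z \<omega>) \<partial>N)"
  shows "weak_conv_C01 (\<lambda>n. distr M borel_C01 (Zn n)) (distr N borel_C01 Z)"
proof -
  interpret M: prob_space M by fact
  interpret N: prob_space N by fact
  interpret C: Metric_space "mspace C01" "mdist C01" by (rule Metric_space_mspace_mdist)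
  have C0: "mspace C01 \<noteq> {}"
    using restrict_mspace_C01[of "\<lambda>_. 0"] continuous_on_const by blast
  have lower: "\<forall>\<^sub>F n in sequentially. (\<integral>\<omega>. F (Z \<omega>) \<partial>N) - e < (\<integral>\<omega>. F (Zn n \<omega>) \<partial>M)"
    if F: "continuous_map (mtopology_of C01) euclideanreal F"
      and bd: "\<And>f. f \<in> mspace C01 \<Longrightarrow> \<bar>F f\<bar> \<le> c" and e: "0 < e" for F c and e :: real
  proof -
    have Fm[measurable]: "F \<in> borel_measurable borel_C01"
      by (rule continuous_map_C01_measurable[OF F])
    have bd': "- c \<le> F g" "F g \<le> c" if "g \<in> mspace C01" for g
      using bd[OF that] by auto
    define G where "G k = inf_conv (mspace C01) F (real k)" for k
    have lipG: "lip (real k) (G k)" for k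
      unfolding G_def by (rule lip_inf_conv[where a = "- c"]) (use C0 bd' in auto)
    have GF: "G k f \<le> F f" if f: "f \<in> mspace C01" for f k
    proof -
      have "restrict f {0..1} = f" using f by (auto simp: mspace_C01 extensional_restrict)
      then show ?thesis
        using inf_conv_le[of "mspace C01" "- c" F "real k" f f] bd' f by (simp add: G_def)
    qed
    have Glow: "- c \<le> G k f" for k f
      unfolding G_def using C0 bd' by (intro inf_conv_ge) (auto intro: add_increasing2)
    have Gbd: "\<bar>G k f\<bar> \<le> c" if "continuous_on {0..1} f" for k f
    proof -
      have "G k f = G k (restrict f {0..1})" by (simp add: G_def inf_conv_def)
      then show ?thesis
        using GF[of "restrict f {0..1}" k] Glow[of k f] bd'[of "restrict f {0..1}"] that
        by (auto simp: abs_le_iff)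
    qed
    have Gbd': "\<bar>G k f\<bar> \<le> c" if "f \<in> mspace C01" for k f
      using Gbd that by (auto simp: mspace_C01)
    have conv: "(\<lambda>k. G k f) \<longlonglongrightarrow> F f" if f: "f \<in> mspace C01" for f
    proof (rule tendstoI)
      fix d :: real assume d: "0 < d"
      have rf: "restrict f {0..1} = f" using f by (auto simp: mspace_C01 extensional_restrict)
      have "openin C.mtopology {x \<in> topspace C.mtopology. F x \<in> {F f - d / 2<..}}"
        using F by (intro openin_continuous_map_preimage[where Y = euclideanreal])
          (auto simp: mtopology_of_def)
      then obtain r where r: "r > 0"
        "C.mball f r \<subseteq> {x \<in> topspace C.mtopology. F x \<in> {F f - d / 2<..}}"
        using f d unfolding C.openin_mtopology by force
      \<comment> \<open>for such \<open>k\<close>, functions outside the ball of radius \<open>r\<close> are too expensive to lower the infimum\<close>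
      have "\<forall>\<^sub>F k in sequentially. 2 * c / r < real k"
        using filterlim_real_sequentially unfolding filterlim_at_top_dense by auto
      then show "\<forall>\<^sub>F k in sequentially. dist (G k f) (F f) < d"
      proof eventually_elim
        case (elim k)
        have "F f - d / 2 \<le> G k f"
          unfolding G_def
        proof (rule inf_conv_ge[OF _ C0])
          fix g assume g: "g \<in> mspace C01"
          show "F f - d / 2 \<le> F g + real k * mdist C01 (restrict f {0..1}) g"
          proof (cases "mdist C01 f g < r")
            case True
            then have "F f - d / 2 \<le> F g"
              using r(2) f g by (auto simp: subset_iff C.in_mball less_imp_le)
            then show ?thesis by (rule order_trans) simp
          next
            case False
            have "2 * c \<le> real k * r" using elim r(1) by (simp add: field_simps)
            also have "\<dots> \<le> real k * mdist C01 f g"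
              using False by (intro mult_left_mono) auto
            finally show ?thesis
              using bd'[OF f] bd'[OF g] d unfolding rf by linarith
          qed
        qed
        with GF[OF f, of k] d show ?case by (simp add: dist_real_def)
      qed
    qed
    have ZC: "Z \<omega> \<in> mspace C01" if "\<omega> \<in> space N" for \<omega>
      using measurable_space[OF Z that] by (simp add: space_borel_C01)
    have "(\<lambda>k. \<integral>\<omega>. G k (Z \<omega>) \<partial>N) \<longlonglongrightarrow> (\<integral>\<omega>. F (Z \<omega>) \<partial>N)"
    proof (rule integral_dominated_convergence[where w = "\<lambda>_. c"])
      show "(\<lambda>\<omega>. F (Z \<omega>)) \<in> borel_measurable N" using Z by measurable
      show "(\<lambda>\<omega>. G k (Z \<omega>)) \<in> borel_measurable N" for k
        by (rule lip_C01_measurable[OF lipG Z])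
    qed (use ZC conv Gbd' in auto)
    then have "\<forall>\<^sub>F k in sequentially. (\<integral>\<omega>. F (Z \<omega>) \<partial>N) - e < (\<integral>\<omega>. G k (Z \<omega>) \<partial>N)"
      using e by (intro order_tendstoD(1)) auto
    then obtain k where k: "(\<integral>\<omega>. F (Z \<omega>) \<partial>N) - e < (\<integral>\<omega>. G k (Z \<omega>) \<partial>N)"
      by (auto simp: eventually_sequentially)
    have "\<forall>\<^sub>F n in sequentially. (\<integral>\<omega>. F (Z \<omega>) \<partial>N) - e < (\<integral>\<omega>. G k (Zn n \<omega>) \<partial>M)"
      using order_tendstoD(1)[OF lim[OF lipG Gbd] k] .
    then show ?thesis using Zn
    proof eventually_elim
      case (elim n)
      have ZC: "Zn n \<omega> \<in> mspace C01" if "\<omega> \<in> space M" for \<omega>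
        using measurable_space[OF elim(2) that] by (simp add: space_borel_C01)
      have "(\<integral>\<omega>. G k (Zn n \<omega>) \<partial>M) \<le> (\<integral>\<omega>. F (Zn n \<omega>) \<partial>M)"
      proof (rule integral_mono)
        show "integrable M (\<lambda>\<omega>. G k (Zn n \<omega>))"
          by (rule M.integrable_const_bound[where B = c])
            (use ZC Gbd' lip_C01_measurable[OF lipG elim(2)] in auto)
        show "integrable M (\<lambda>\<omega>. F (Zn n \<omega>))"
          by (rule M.integrable_const_bound[where B = c])
            (use ZC bd measurable_compose[OF elim(2) Fm] in auto)
      qed (use GF ZC in auto)
      with elim(1) show ?case by linarith
    qed
  qed
  show ?thesis
    unfolding weak_conv_C01_def
  proof (intro allI impI)
    fix F assume F: "continuous_map (mtopology_of C01) euclideanreal F"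
      and "bounded (F ` mspace C01)"
    then obtain c where c: "\<And>f. f \<in> mspace C01 \<Longrightarrow> \<bar>F f\<bar> \<le> c"
      by (auto simp: bounded_iff)
    have Fm: "F \<in> borel_measurable borel_C01"
      by (rule continuous_map_C01_measurable[OF F])
    have mF: "continuous_map (mtopology_of C01) euclideanreal (\<lambda>f. - F f)"
      using F by (intro continuous_map_minus) auto
    have "(\<lambda>n. \<integral>\<omega>. F (Zn n \<omega>) \<partial>M) \<longlonglongrightarrow> (\<integral>\<omega>. F (Z \<omega>) \<partial>N)"
    proof (rule tendstoI)
      fix e :: real assume e: "0 < e"
      show "\<forall>\<^sub>F n in sequentially. dist (\<integral>\<omega>. F (Zn n \<omega>) \<partial>M) (\<integral>\<omega>. F (Z \<omega>) \<partial>N) < e"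
        using lower[OF F c e] lower[OF mF _ e, of c] c
        by (auto simp: dist_real_def elim: eventually_elim2)
    qed
    then have "(\<lambda>n. \<integral>\<omega>. F (Zn n \<omega>) \<partial>M) \<longlonglongrightarrow> (\<integral>f. F f \<partial>distr N borel_C01 Z)"
      by (simp add: integral_distr[OF Z Fm])
    moreover have "\<forall>\<^sub>F n in sequentially.
        (\<integral>\<omega>. F (Zn n \<omega>) \<partial>M) = (\<integral>f. F f \<partial>distr M borel_C01 (Zn n))"
      using Zn by eventually_elim (simp add: integral_distr[OF _ Fm])
    ultimately show "(\<lambda>n. \<integral>f. F f \<partial>distr M borel_C01 (Zn n)) \<longlonglongrightarrow> (\<integral>f. F f \<partial>distr N borel_C01 Z)"
      by (rule Lim_transform_eventually)
  qed
qed

section \<open>Tails of the chi-square distribution\<close>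

definition std_gauss :: "real measure" where
  "std_gauss = density lborel (\<lambda>x. ennreal (std_normal_density x))"

lemma prob_space_std_gauss: "prob_space std_gauss"
  unfolding std_gauss_def by (intro prob_space_normal_density) simp

lemma sets_std_gauss [measurable_cong, simp]: "sets std_gauss = sets borel"
  by (simp add: std_gauss_def)

lemma space_std_gauss [simp]: "space std_gauss = UNIV"
  by (simp add: std_gauss_def)

text \<open>
  The probability that a chi-square variable with \<open>m\<close> degrees of freedom exceeds \<open>y\<close>.
\<close>

definition chi_tail :: "nat \<Rightarrow> real \<Rightarrow> real" where
  "chi_tail m y = measure (\<Pi>\<^sub>M j\<in>{1..m}. std_gauss)
     {z \<in> space (\<Pi>\<^sub>M j\<in>{1..m}. std_gauss). y < (\<Sum>j=1..m. (z j)\<^sup>2)}"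

lemma PiM_std_gauss:
  assumes "finite A"
  shows "(\<Pi>\<^sub>M j\<in>A. std_gauss) = density (\<Pi>\<^sub>M j\<in>A. lborel) (\<lambda>z. \<Prod>j\<in>A. ennreal (std_normal_density (z j)))"
proof -
  interpret G: product_prob_space "\<lambda>_. std_gauss" A
    by (intro product_prob_spaceI prob_space_std_gauss)
  interpret L: product_sigma_finite "\<lambda>_. lborel :: real measure" by standard
  interpret LA: finite_product_sigma_finite "\<lambda>_. lborel :: real measure" A by standard fact
  show ?thesis
  proof (rule G.PiM_eqI[OF assms, symmetric])
    show "sets (density (Pi\<^sub>M A (\<lambda>j. lborel)) (\<lambda>z. \<Prod>j\<in>A. ennreal (std_normal_density (z j))))
        = sets (\<Pi>\<^sub>M j\<in>A. std_gauss)"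
      by (auto intro!: sets_PiM_cong)
    fix E assume E: "\<And>i. i \<in> A \<Longrightarrow> E i \<in> sets std_gauss"
    then have Eb: "\<And>i. i \<in> A \<Longrightarrow> E i \<in> sets borel" by simp
    have PE: "Pi\<^sub>E A E \<in> sets (\<Pi>\<^sub>M j\<in>A. lborel)"
      using Eb assms by (intro sets_PiM_I_finite) auto
    have "emeasure (density (Pi\<^sub>M A (\<lambda>j. lborel)) (\<lambda>z. \<Prod>j\<in>A. ennreal (std_normal_density (z j)))) (Pi\<^sub>E A E)
        = (\<integral>\<^sup>+z. (\<Prod>j\<in>A. ennreal (std_normal_density (z j))) * indicator (Pi\<^sub>E A E) z \<partial>Pi\<^sub>M A (\<lambda>j. lborel))"
      by (intro emeasure_density PE) measurable
    also have "\<dots> = (\<integral>\<^sup>+z. (\<Prod>j\<in>A. ennreal (std_normal_density (z j)) * indicator (E j) (z j)) \<partial>Pi\<^sub>M A (\<lambda>j. lborel))"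
    proof (intro nn_integral_cong)
      fix z assume z: "z \<in> space (Pi\<^sub>M A (\<lambda>j. lborel :: real measure))"
      have "indicator (Pi\<^sub>E A E) z = (\<Prod>j\<in>A. indicator (E j) (z j) :: ennreal)"
      proof (cases "\<forall>j\<in>A. z j \<in> E j")
        case True
        then show ?thesis using z by (auto simp: space_PiM PiE_iff)
      next
        case False
        then have "(\<Prod>j\<in>A. indicator (E j) (z j) :: ennreal) = 0"
          using assms by (intro prod_zero) (auto simp: indicator_def)
        with False show ?thesis by (auto simp: PiE_iff)
      qed
      then show "(\<Prod>j\<in>A. ennreal (std_normal_density (z j))) * indicator (Pi\<^sub>E A E) z
          = (\<Prod>j\<in>A. ennreal (std_normal_density (z j)) * indicator (E j) (z j))"
        by (simp add: prod.distrib)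
    qed
    also have "\<dots> = (\<Prod>j\<in>A. \<integral>\<^sup>+x. ennreal (std_normal_density x) * indicator (E j) x \<partial>lborel)"
      using Eb by (intro L.product_nn_integral_prod assms) auto
    also have "\<dots> = (\<Prod>j\<in>A. emeasure std_gauss (E j))"
      unfolding std_gauss_def using Eb by (intro prod.cong refl emeasure_density[symmetric]) auto
    finally show "emeasure (density (Pi\<^sub>M A (\<lambda>j. lborel)) (\<lambda>z. \<Prod>j\<in>A. ennreal (std_normal_density (z j)))) (Pi\<^sub>E A E)
        = (\<Prod>i\<in>A. emeasure std_gauss (E i))" .
  qed
qed

text \<open>
  Writing the Gaussian weight \<open>exp (- q / 2)\<close> as an integral over the levels \<open>s \<ge> q\<close> turns an integral against the
  Gaussian density into volumes of balls, for which the dimension enters only through a formula.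
\<close>

lemma nn_integral_exp_tail:
  "(\<integral>\<^sup>+s. ennreal (exp (- s / 2) / 2) * indicator {q..} s \<partial>lborel) = ennreal (exp (- q / 2))"
proof -
  have "(\<integral>\<^sup>+s. ennreal (exp (- s / 2) / 2) * indicator {q..} s \<partial>lborel)
      = ennreal (0 - (- exp (- q / 2)))"
  proof (rule nn_integral_FTC_atLeast)
    show "((\<lambda>s::real. - exp (- s / 2)) \<longlongrightarrow> 0) at_top" by real_asymp
  qed (auto intro!: derivative_eq_intros)
  then show ?thesis by simp
qed

lemma prod_std_normal_density:
  assumes "finite A"
  shows "(\<Prod>j\<in>A. std_normal_density (z j)) = (1 / sqrt (2 * pi)) ^ card A * exp (- (\<Sum>j\<in>A. (z j)\<^sup>2) / 2)"
  using assms
proof induction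
  case (insert a A)
  then show ?case
    by (simp add: std_normal_density_def exp_add[symmetric] field_simps exp_minus)
qed simp

definition chi_const :: "nat \<Rightarrow> real" where
  "chi_const m = (1 / sqrt (2 * pi)) ^ m * unit_ball_vol (real m)"

text \<open>
  Up to a constant, the volume of the shell \<open>y < |z|\<^sup>2 \<le> y + 2u\<close> in dimension \<open>m\<close>, weighted by \<open>exp (- u)\<close>.
\<close>

definition chi_kernel :: "nat \<Rightarrow> real \<Rightarrow> real \<Rightarrow> real" where
  "chi_kernel m y u = (if 0 < u then exp (- u) * (sqrt (y + 2 * u) ^ m - sqrt y ^ m) else 0)"

lemma chi_kernel_measurable [measurable]: "chi_kernel m y \<in> borel_measurable borel"
  unfolding chi_kernel_def by measurable

lemma chi_kernel_nonneg: "0 < y \<Longrightarrow> 0 \<le> chi_kernel m y u"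
  unfolding chi_kernel_def by (auto intro!: mult_nonneg_nonneg power_mono)

text \<open>
  Fubini for the layer-cake representation above: the tail is the integral over \<open>s > y\<close> of \<open>exp (- s / 2) / 2\<close> times
  the volume of the shell \<open>y < |z|\<^sup>2 \<le> s\<close>, and \<open>s = y + 2u\<close>.
\<close>

lemma chi_tail_nn_integral:
  assumes y: "0 < y"
  shows "ennreal (chi_tail m y) =
    ennreal (chi_const m * exp (- y / 2)) * (\<integral>\<^sup>+u. ennreal (chi_kernel m y u) \<partial>lborel)"
proof -
  let ?A = "{1..m}"
  let ?L = "\<Pi>\<^sub>M j\<in>?A. (lborel :: real measure)"
  let ?q = "\<lambda>z. (\<Sum>j\<in>?A. (z j)\<^sup>2)"
  let ?k = "(1 / sqrt (2 * pi)) ^ m"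
  interpret G: prob_space "\<Pi>\<^sub>M j\<in>?A. std_gauss"
    by (intro prob_space_PiM prob_space_std_gauss)
  interpret L: product_sigma_finite "\<lambda>_. lborel :: real measure" by standard
  interpret LA: finite_product_sigma_finite "\<lambda>_. lborel :: real measure" ?A by standard simp
  interpret P: pair_sigma_finite ?L lborel by standard
  have qm[measurable]: "?q \<in> borel_measurable ?L" by measurable
  have sp: "space (\<Pi>\<^sub>M j\<in>?A. std_gauss) = space ?L" by (simp add: space_PiM)
  have ball: "emeasure ?L {z\<in>space ?L. ?q z \<le> r} = ennreal (unit_ball_vol (real m) * sqrt r ^ m)"
    if r: "0 < r" for r
  proof -
    have "{z\<in>space ?L. ?q z \<le> r} = {f. sqrt (?q f) \<le> sqrt r} \<inter> space ?L" by auto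
    then show ?thesis using emeasure_cball_aux[of ?A "sqrt r"] r by simp
  qed
  have shell: "emeasure ?L {z\<in>space ?L. y < ?q z \<and> ?q z \<le> s}
      = ennreal (unit_ball_vol (real m) * (sqrt s ^ m - sqrt y ^ m))" if s: "y < s" for s
  proof -
    have eq: "{z\<in>space ?L. y < ?q z \<and> ?q z \<le> s} = {z\<in>space ?L. ?q z \<le> s} - {z\<in>space ?L. ?q z \<le> y}"
      by auto
    have "emeasure ?L ({z\<in>space ?L. ?q z \<le> s} - {z\<in>space ?L. ?q z \<le> y}) = emeasure ?L {z\<in>space ?L. ?q z \<le> s} - emeasure ?L {z\<in>space ?L. ?q z \<le> y}"
    proof (rule emeasure_Diff)
      show "emeasure ?L {z\<in>space ?L. ?q z \<le> y} \<noteq> \<infinity>" unfolding ball[OF y] by simp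
    qed (use s in auto)
    also have "\<dots> = ennreal (unit_ball_vol (real m) * sqrt s ^ m - unit_ball_vol (real m) * sqrt y ^ m)"
      unfolding ball[OF y] ball[OF less_trans[OF y s]]
      by (rule ennreal_minus) (use y in simp)
    finally show ?thesis unfolding eq right_diff_distrib .
  qed
  have "ennreal (chi_tail m y) = emeasure (\<Pi>\<^sub>M j\<in>?A. std_gauss) {z\<in>space ?L. y < ?q z}"
    unfolding chi_tail_def sp G.emeasure_eq_measure ..
  also have "\<dots> = (\<integral>\<^sup>+z. (\<Prod>j\<in>?A. ennreal (std_normal_density (z j))) * indicator {z\<in>space ?L. y < ?q z} z \<partial>?L)"
    unfolding PiM_std_gauss[OF finite_atLeastAtMost]
    by (intro emeasure_density) measurable
  also have "\<dots> = (\<integral>\<^sup>+z. (\<integral>\<^sup>+s. ennreal ?k * (ennreal (exp (- s / 2) / 2) *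
      indicator {z\<in>space ?L. y < ?q z \<and> ?q z \<le> s} z) \<partial>lborel) \<partial>?L)"
  proof (intro nn_integral_cong)
    fix z assume z: "z \<in> space ?L"
    have "(\<Prod>j\<in>?A. ennreal (std_normal_density (z j))) = ennreal ?k * ennreal (exp (- ?q z / 2))"
      using prod_std_normal_density[of ?A z]
      by (simp add: prod_ennreal ennreal_mult[symmetric])
    also have "\<dots> = ennreal ?k * (\<integral>\<^sup>+s. ennreal (exp (- s / 2) / 2) * indicator {?q z..} s \<partial>lborel)"
      by (simp only: nn_integral_exp_tail)
    finally have "(\<Prod>j\<in>?A. ennreal (std_normal_density (z j))) * indicator {z\<in>space ?L. y < ?q z} z
        = ennreal ?k * (\<integral>\<^sup>+s. ennreal (exp (- s / 2) / 2) * indicator {?q z..} s \<partial>lborel) *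
          indicator {z\<in>space ?L. y < ?q z} z" by simp
    also have "\<dots> = (\<integral>\<^sup>+s. ennreal ?k * (ennreal (exp (- s / 2) / 2) * indicator {?q z..} s) \<partial>lborel) *
          indicator {z\<in>space ?L. y < ?q z} z"
      by (subst nn_integral_cmult) auto
    also have "\<dots> = (\<integral>\<^sup>+s. ennreal ?k * (ennreal (exp (- s / 2) / 2) * indicator {?q z..} s) *
          indicator {z\<in>space ?L. y < ?q z} z \<partial>lborel)"
      by (subst nn_integral_multc) auto
    also have "\<dots> = (\<integral>\<^sup>+s. ennreal ?k * (ennreal (exp (- s / 2) / 2) *
      indicator {z\<in>space ?L. y < ?q z \<and> ?q z \<le> s} z) \<partial>lborel)"
      using z by (intro nn_integral_cong) (auto split: split_indicator)
    finally show "(\<Prod>j\<in>?A. ennreal (std_normal_density (z j))) * indicator {z\<in>space ?L. y < ?q z} z = \<dots>" .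
  qed
  also have "\<dots> = (\<integral>\<^sup>+s. (\<integral>\<^sup>+z. ennreal ?k * (ennreal (exp (- s / 2) / 2) *
      indicator {z\<in>space ?L. y < ?q z \<and> ?q z \<le> s} z) \<partial>?L) \<partial>lborel)"
    by (rule P.Fubini'[symmetric]) measurable
  also have "\<dots> = (\<integral>\<^sup>+s. ennreal ?k * (ennreal (exp (- s / 2) / 2) *
      emeasure ?L {z\<in>space ?L. y < ?q z \<and> ?q z \<le> s}) \<partial>lborel)"
    by (intro nn_integral_cong) (simp add: nn_integral_cmult)
  also have "\<dots> = (\<integral>\<^sup>+s. ennreal (chi_const m * exp (- y / 2) / 2) *
      ennreal (chi_kernel m y ((s - y) / 2)) \<partial>lborel)"
  proof (intro nn_integral_cong)
    fix s :: real
    show "ennreal ?k * (ennreal (exp (- s / 2) / 2) * emeasure ?L {z\<in>space ?L. y < ?q z \<and> ?q z \<le> s})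
      = ennreal (chi_const m * exp (- y / 2) / 2) * ennreal (chi_kernel m y ((s - y) / 2))"
    proof (cases "y < s")
      case True
      have e: "exp (- s / 2) = exp (- y / 2) * exp (- ((s - y) / 2))"
        by (simp add: exp_add[symmetric] field_simps)
      have "0 \<le> sqrt s ^ m - sqrt y ^ m" using True y by (auto intro: power_mono)
      then show ?thesis
        using True y unfolding shell[OF True] e chi_const_def chi_kernel_def
        by (simp add: ennreal_mult[symmetric] field_simps)
    next
      case False
      then have "{z\<in>space ?L. y < ?q z \<and> ?q z \<le> s} = {}" by auto
      with False show ?thesis unfolding chi_kernel_def by (simp only:) simp
    qed
  qed
  also have "\<dots> = ennreal (chi_const m * exp (- y / 2) / 2) * (\<integral>\<^sup>+s. ennreal (chi_kernel m y ((s - y) / 2)) \<partial>lborel)"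
    by (intro nn_integral_cmult) measurable
  also have "(\<integral>\<^sup>+s. ennreal (chi_kernel m y ((s - y) / 2)) \<partial>lborel)
      = ennreal 2 * (\<integral>\<^sup>+u. ennreal (chi_kernel m y u) \<partial>lborel)"
    using nn_integral_real_affine[of "\<lambda>s. ennreal (chi_kernel m y ((s - y) / 2))" 2 y] by simp
  also have "ennreal (chi_const m * exp (- y / 2) / 2) * (ennreal 2 * (\<integral>\<^sup>+u. ennreal (chi_kernel m y u) \<partial>lborel))
      = ennreal (chi_const m * exp (- y / 2)) * (\<integral>\<^sup>+u. ennreal (chi_kernel m y u) \<partial>lborel)"
  proof -
    have "ennreal (chi_const m * exp (- y / 2) / 2) * ennreal 2 = ennreal (chi_const m * exp (- y / 2))"
      by (subst ennreal_mult[symmetric]) (auto simp: chi_const_def)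
    then show ?thesis by (simp only: mult.assoc[symmetric])
  qed
  finally show ?thesis .
qed

lemma chi_const_pos: "0 < chi_const m"
  by (simp add: chi_const_def)

lemma chi_kernel_integrable:
  assumes y: "0 < y"
  shows "integrable lborel (chi_kernel m y)"
proof (rule integrableI_nonneg)
  show "(\<integral>\<^sup>+u. ennreal (chi_kernel m y u) \<partial>lborel) < \<infinity>"
  proof -
    have "ennreal (chi_const m * exp (- y / 2)) * (\<integral>\<^sup>+u. ennreal (chi_kernel m y u) \<partial>lborel) < \<top>"
      unfolding chi_tail_nn_integral[OF y, symmetric] by simp
    then show ?thesis
      using chi_const_pos[of m] unfolding ennreal_mult_less_top by auto
  qed
qed (use y in \<open>auto simp: chi_kernel_nonneg\<close>)

lemma chi_tail_integral:
  assumes y: "0 < y"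
  shows "chi_tail m y = chi_const m * exp (- y / 2) * (\<integral>u. chi_kernel m y u \<partial>lborel)"
proof -
  have "ennreal (chi_tail m y) = ennreal (chi_const m * exp (- y / 2) * (\<integral>u. chi_kernel m y u \<partial>lborel))"
    unfolding chi_tail_nn_integral[OF y]
    using chi_const_pos[of m]
    by (subst nn_integral_eq_integral[OF chi_kernel_integrable[OF y]])
       (use y in \<open>auto simp: chi_kernel_nonneg ennreal_mult[symmetric]\<close>)
  moreover have "0 \<le> chi_tail m y" by (simp add: chi_tail_def)
  moreover have "0 \<le> chi_const m * exp (- y / 2) * (\<integral>u. chi_kernel m y u \<partial>lborel)"
    using chi_const_pos[of m] by (intro mult_nonneg_nonneg integral_nonneg) (use y in \<open>auto simp: chi_kernel_nonneg\<close>)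
  ultimately show ?thesis by simp
qed

text \<open>
  For \<open>m = 1\<close> the difference of the powers decreases in \<open>y\<close>, like \<open>u / sqrt y\<close>; the factor \<open>sqrt y\<close> restores
  monotonicity in every dimension.
\<close>

lemma sqrt_diff_mono:
  assumes "0 < y" "y \<le> y'" "0 < u" "1 \<le> m"
  shows "sqrt y * (sqrt (y + 2 * u) ^ m - sqrt y ^ m) \<le> sqrt y' * (sqrt (y' + 2 * u) ^ m - sqrt y' ^ m)"
proof -
  \<comment> \<open>both factors of this factorization increase with \<open>y\<close>\<close>
  have *: "sqrt y * (sqrt (y + 2 * u) ^ m - sqrt y ^ m)
      = (sqrt (y\<^sup>2 + 2 * u * y) - y) * (\<Sum>i<m. sqrt (y + 2 * u) ^ i * sqrt y ^ (m - Suc i))"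
    if "0 < y" for y
  proof -
    have "sqrt y * (sqrt (y + 2 * u) ^ m - sqrt y ^ m)
        = sqrt y * (sqrt (y + 2 * u) - sqrt y) * (\<Sum>i<m. sqrt (y + 2 * u) ^ i * sqrt y ^ (m - Suc i))"
      by (subst power_diff_sumr2) (simp add: mult_ac)
    also have "sqrt y * (sqrt (y + 2 * u) - sqrt y) = sqrt (y\<^sup>2 + 2 * u * y) - y"
      using that by (simp add: right_diff_distrib real_sqrt_mult[symmetric] power2_eq_square algebra_simps)
    finally show ?thesis .
  qed
  have "sqrt (y\<^sup>2 + 2 * u * y) - y \<le> sqrt (y'\<^sup>2 + 2 * u * y') - y'"
  proof -
    have s0: "y \<le> sqrt (y\<^sup>2 + 2 * u * y)" using assms by (intro real_le_rsqrt) simp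
    have su: "sqrt (y\<^sup>2 + 2 * u * y) \<le> y + u"
      using assms by (intro real_le_lsqrt) (auto simp: power2_eq_square algebra_simps)
    have "(sqrt (y\<^sup>2 + 2 * u * y) + (y' - y))\<^sup>2
        = y\<^sup>2 + 2 * u * y + (y' - y)\<^sup>2 + 2 * sqrt (y\<^sup>2 + 2 * u * y) * (y' - y)"
      using assms by (simp add: power2_sum)
    also have "\<dots> \<le> y\<^sup>2 + 2 * u * y + (y' - y)\<^sup>2 + 2 * (y + u) * (y' - y)"
      using su assms by (intro add_left_mono mult_right_mono) auto
    also have "\<dots> = y'\<^sup>2 + 2 * u * y'"
      by (simp add: power2_eq_square algebra_simps)
    finally have "sqrt (y\<^sup>2 + 2 * u * y) + (y' - y) \<le> sqrt (y'\<^sup>2 + 2 * u * y')"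
      by (rule real_le_rsqrt)
    then show ?thesis by simp
  qed
  moreover have "(\<Sum>i<m. sqrt (y + 2 * u) ^ i * sqrt y ^ (m - Suc i))
      \<le> (\<Sum>i<m. sqrt (y' + 2 * u) ^ i * sqrt y' ^ (m - Suc i))"
    using assms by (intro sum_mono mult_mono power_mono) auto
  moreover have "0 \<le> sqrt (y'\<^sup>2 + 2 * u * y') - y'"
    using assms by (simp add: real_le_rsqrt)
  moreover have "0 \<le> (\<Sum>i<m. sqrt (y + 2 * u) ^ i * sqrt y ^ (m - Suc i))"
    using assms by (intro sum_nonneg) auto
  ultimately show ?thesis
    using *[of y] *[of y'] assms by (simp add: mult_mono)
qed

text \<open>
  Compares tails at different levels with explicit constants. Together with the asymptotics at the
  single level \<open>norming m n\<close> it controls the tails at all lower levels uniformly.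
\<close>

lemma chi_tail_ratio:
  assumes "0 < y" "y \<le> y'" "1 \<le> m"
  shows "chi_tail m y \<le> sqrt (y' / y) * exp ((y' - y) / 2) * chi_tail m y'"
proof -
  have y': "0 < y'" using assms by simp
  have "(\<integral>u. sqrt y * chi_kernel m y u \<partial>lborel) \<le> (\<integral>u. sqrt y' * chi_kernel m y' u \<partial>lborel)"
  proof (intro integral_mono)
    fix u :: real
    show "sqrt y * chi_kernel m y u \<le> sqrt y' * chi_kernel m y' u"
      using sqrt_diff_mono[OF assms(1,2) _ assms(3), of u]
      by (auto simp: chi_kernel_def mult.left_commute)
  qed (use chi_kernel_integrable[OF assms(1)] chi_kernel_integrable[OF y'] in auto)
  then have "sqrt y * (\<integral>u. chi_kernel m y u \<partial>lborel) \<le> sqrt y' * (\<integral>u. chi_kernel m y' u \<partial>lborel)"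
    by simp
  then have I: "(\<integral>u. chi_kernel m y u \<partial>lborel) \<le> sqrt (y' / y) * (\<integral>u. chi_kernel m y' u \<partial>lborel)"
    using assms(1) by (simp add: real_sqrt_divide field_simps)
  have "chi_tail m y \<le> chi_const m * exp (- y / 2) * (sqrt (y' / y) * (\<integral>u. chi_kernel m y' u \<partial>lborel))"
    unfolding chi_tail_integral[OF assms(1)]
    using chi_const_pos[of m] by (intro mult_left_mono I) auto
  also have "exp (- y / 2) = exp ((y' - y) / 2) * exp (- y' / 2)"
    by (simp add: exp_add[symmetric] field_simps)
  also have "chi_const m * (exp ((y' - y) / 2) * exp (- y' / 2)) *
      (sqrt (y' / y) * (\<integral>u. chi_kernel m y' u \<partial>lborel)) = sqrt (y' / y) * exp ((y' - y) / 2) * chi_tail m y'"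
    unfolding chi_tail_integral[OF y'] by (simp only: mult_ac)
  finally show ?thesis .
qed

text \<open>
  Only a dominating integrable function is wanted, so the powers of \<open>x = (1 + 2 u) / 4\<close> are read off from the
  exponential series.
\<close>

lemma Suc_power_le_exp:
  fixes u :: real
  assumes "0 \<le> u"
  shows "(1 + 2 * u) ^ k \<le> 4 ^ k * fact k * exp (1 / 4) * exp (u / 2)"
proof -
  define x where "x = (1 + 2 * u) / 4"
  have x: "0 \<le> x" using assms by (simp add: x_def)
  have "(\<Sum>n\<in>{k}. x ^ n /\<^sub>R fact n) \<le> (\<Sum>n. x ^ n /\<^sub>R fact n)"
    using x by (intro sum_le_suminf summable_exp_generic) auto
  then have "x ^ k / fact k \<le> exp x" by (simp add: exp_def field_simps)
  then have "((1 + 2 * u) / 4) ^ k / fact k \<le> exp ((1 + 2 * u) / 4)" by (simp add: x_def)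
  then have "(1 + 2 * u) ^ k \<le> 4 ^ k * fact k * exp ((1 + 2 * u) / 4)"
    by (simp add: power_divide field_simps)
  also have "exp ((1 + 2 * u) / 4) = exp (1 / 4) * exp (u / 2)"
    by (simp add: exp_add[symmetric] add_divide_distrib)
  finally show ?thesis by (simp add: mult.assoc)
qed

text \<open>
  Dominated convergence: after division by \<open>y ^ (m / 2 - 1)\<close> the kernel tends to \<open>m * u * exp (- u)\<close>, whose integral is \<open>m\<close>.
\<close>

lemma chi_kernel_limit:
  "((\<lambda>y. (\<integral>u. chi_kernel m y u \<partial>lborel) * (y / sqrt y ^ m)) \<longlongrightarrow> real m) at_top"
proof -
  define C where "C = real m * (4 ^ Suc m * fact (Suc m) * exp (1 / 4))"
  have lim0: "((\<lambda>y. \<integral>u. chi_kernel m y u * (y / sqrt y ^ m) \<partial>lborel) \<longlongrightarrow>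
      (\<integral>u. (if 0 < u then exp (- u) * (real m * u) else 0) \<partial>lborel)) at_top"
  proof (rule integral_dominated_convergence_at_top[where w = "\<lambda>u. if 0 < u then C * exp (- u / 2) else 0"])
    show "integrable lborel (\<lambda>u::real. if 0 < u then C * exp (- u / 2) else 0)"
    proof (rule integrableI_nonneg)
      have "(\<integral>\<^sup>+u. ennreal (if 0 < u then C * exp (- u / 2) else 0) \<partial>lborel)
          \<le> (\<integral>\<^sup>+u. ennreal (2 * C) * (ennreal (exp (- u / 2) / 2) * indicator {0..} u) \<partial>lborel)"
        by (intro nn_integral_mono)
          (auto simp: ennreal_mult[symmetric] C_def split: split_indicator)
      also have "\<dots> = ennreal (2 * C) * 1"
        using nn_integral_exp_tail[of 0] by (subst nn_integral_cmult) auto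
      finally show "(\<integral>\<^sup>+u. ennreal (if 0 < u then C * exp (- u / 2) else 0) \<partial>lborel) < \<infinity>"
        by (simp add: order_le_less_trans)
    qed (auto simp: C_def)
    show "AE u in lborel. ((\<lambda>y. chi_kernel m y u * (y / sqrt y ^ m)) \<longlongrightarrow>
        (if 0 < u then exp (- u) * (real m * u) else 0)) at_top"
    proof (intro AE_I2)
      fix u :: real
      show "((\<lambda>y. chi_kernel m y u * (y / sqrt y ^ m)) \<longlongrightarrow>
        (if 0 < u then exp (- u) * (real m * u) else 0)) at_top"
      proof (cases "0 < u")
        case True
        have "((\<lambda>y. exp (- u) * (y * (sqrt (1 + 2 * u / y) ^ m - 1))) \<longlongrightarrow> exp (- u) * (real m * u)) at_top"
        proof (rule tendsto_mult_left)
          show "((\<lambda>y. y * (sqrt (1 + 2 * u / y) ^ m - 1)) \<longlongrightarrow> real m * u) at_top"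
            by real_asymp
        qed
        moreover have "\<forall>\<^sub>F y in at_top. exp (- u) * (y * (sqrt (1 + 2 * u / y) ^ m - 1))
            = chi_kernel m y u * (y / sqrt y ^ m)"
          using eventually_gt_at_top[of 0]
        proof eventually_elim
          case (elim y)
          have "sqrt (y + 2 * u) = sqrt y * sqrt (1 + 2 * u / y)"
            using elim by (simp add: real_sqrt_mult[symmetric] field_simps)
          then show ?case using True elim
            by (simp add: chi_kernel_def power_mult_distrib field_simps)
        qed
        ultimately show ?thesis using True by (simp cong: tendsto_cong add: filterlim_cong)
      qed (simp add: chi_kernel_def)
    qed
    show "\<forall>\<^sub>F y in at_top. AE u in lborel. norm (chi_kernel m y u * (y / sqrt y ^ m))
        \<le> (if 0 < u then C * exp (- u / 2) else 0)"
      using eventually_ge_at_top[of 1]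
    proof eventually_elim
      case (elim y)
      show ?case
      proof (intro AE_I2)
        fix u :: real
        show "norm (chi_kernel m y u * (y / sqrt y ^ m)) \<le> (if 0 < u then C * exp (- u / 2) else 0)"
        proof (cases "0 < u")
          case True
          define v where "v = 2 * u / y"
          have v: "0 < v" "v \<le> 2 * u" using True elim by (auto simp: v_def field_simps)
          have "sqrt (y + 2 * u) = sqrt y * sqrt (1 + v)"
            using elim by (simp add: real_sqrt_mult[symmetric] v_def field_simps)
          then have "chi_kernel m y u * (y / sqrt y ^ m) = exp (- u) * (y * (sqrt (1 + v) ^ m - 1))"
            using True elim by (simp add: chi_kernel_def power_mult_distrib field_simps)
          also have "\<dots> \<le> exp (- u) * (y * ((1 + v) ^ m - 1))"
          proof -
            have "sqrt (1 + v) \<le> 1 + v" using v by (intro real_le_lsqrt) (auto simp: power2_eq_square algebra_simps)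
            then show ?thesis using elim v by (intro mult_left_mono diff_right_mono power_mono) auto
          qed
          also have "(1 + v) ^ m - 1 = v * (\<Sum>i<m. (1 + v) ^ i)"
            using power_diff_1_eq[of "1 + v" m] by simp
          also have "exp (- u) * (y * (v * (\<Sum>i<m. (1 + v) ^ i))) = exp (- u) * (2 * u * (\<Sum>i<m. (1 + v) ^ i))"
            using elim by (simp add: v_def)
          also have "\<dots> \<le> exp (- u) * ((1 + 2 * u) * (\<Sum>i<m. (1 + 2 * u) ^ m))"
          proof (intro mult_left_mono mult_mono sum_mono)
            fix i assume "i \<in> {..<m}"
            then have "(1 + v) ^ i \<le> (1 + v) ^ m" using v by (intro power_increasing) auto
            also have "\<dots> \<le> (1 + 2 * u) ^ m" using v by (intro power_mono) auto
            finally show "(1 + v) ^ i \<le> (1 + 2 * u) ^ m" .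
          qed (use True v in \<open>auto intro!: sum_nonneg\<close>)
          also have "\<dots> = exp (- u) * (real m * (1 + 2 * u) ^ Suc m)" by simp
          also have "\<dots> \<le> exp (- u) * (real m * (4 ^ Suc m * fact (Suc m) * exp (1 / 4) * exp (u / 2)))"
            using True by (intro mult_left_mono Suc_power_le_exp) auto
          also have "\<dots> = C * (exp (- u) * exp (u / 2))" by (simp add: C_def mult_ac)
          also have "exp (- u) * exp (u / 2) = exp (- u / 2)" by (simp add: exp_add[symmetric])
          finally have "chi_kernel m y u * (y / sqrt y ^ m) \<le> C * exp (- u / 2)" .
          moreover have "0 \<le> chi_kernel m y u * (y / sqrt y ^ m)"
            using elim chi_kernel_nonneg by simp
          ultimately show ?thesis using True by simp
        qed (simp add: chi_kernel_def)
      qed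
    qed
  qed measurable
  have "(\<integral>u. (if 0 < u then exp (- u) * (real m * u) else 0) \<partial>lborel) = real m"
  proof (rule integral_eq_nn_integral[THEN trans])
    have "(\<integral>\<^sup>+u. ennreal (if 0 < u then exp (- u) * (real m * u) else 0) \<partial>lborel)
        = (\<integral>\<^sup>+u. ennreal (real m) * ennreal (erlang_density 0 1 u * u ^ 1) \<partial>lborel)"
      by (intro nn_integral_cong) (auto simp: erlang_density_def ennreal_mult[symmetric] mult_ac)
    also have "\<dots> = ennreal (real m) * (\<integral>\<^sup>+u. ennreal (erlang_density 0 1 u * u ^ 1) \<partial>lborel)"
      by (rule nn_integral_cmult) measurable
    also have "\<dots> = ennreal (real m)"
      by (subst nn_integral_erlang_ith_moment) auto
    finally show "enn2real (\<integral>\<^sup>+u. ennreal (if 0 < u then exp (- u) * (real m * u) else 0) \<partial>lborel) = real m"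
      by simp
  qed auto
  with lim0 show ?thesis by simp
qed


text \<open>
  The value of the volume of the unit ball turns the limit of the kernel integral into the classical
  asymptotics of the incomplete Gamma function.
\<close>

lemma chi_tail_asymp:
  assumes m: "1 \<le> m"
  shows "((\<lambda>y. chi_tail m y / ((y / 2) powr (m / 2 - 1) * exp (- y / 2) / Gamma (m / 2))) \<longlongrightarrow> 1) at_top"
proof -
  define a where "a = real m / 2"
  have a: "0 < a" using m by (simp add: a_def)
  have G: "0 < Gamma a" using a by simp
  define c where "c = chi_const m * Gamma a * 2 powr (a - 1)"
  \<comment> \<open>this is \<open>Gamma (a + 1) = a * Gamma a\<close>, the Gamma function coming from the volume of the unit ball\<close>
  have "c * real m = 1"
  proof -
    have "(1 / sqrt (2 * pi)) ^ m = (2 * pi) powr (- a)"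
    proof -
      have "1 / sqrt (2 * pi) = (2 * pi) powr (- (1 / 2))"
        by (simp add: powr_minus powr_half_sqrt field_simps)
      then have "(1 / sqrt (2 * pi)) ^ m = ((2 * pi) powr (- (1 / 2))) powr real m"
        by (simp add: powr_realpow)
      also have "\<dots> = (2 * pi) powr (- a)" by (simp add: powr_powr a_def)
      finally show ?thesis .
    qed
    also have "\<dots> = 2 powr (- a) * pi powr (- a)" by (simp add: powr_mult)
    finally have "c * real m = (2 powr (- a) * 2 powr (a - 1)) * (pi powr (- a) * pi powr a) *
        (Gamma a / Gamma (a + 1)) * real m"
      by (simp add: c_def chi_const_def unit_ball_vol_def a_def mult_ac)
    also have "2 powr (- a) * 2 powr (a - 1) = (1 / 2 :: real)"
      by (subst powr_add[symmetric]) (simp add: powr_minus)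
    also have "pi powr (- a) * pi powr a = 1" by (simp add: powr_add[symmetric])
    also have "Gamma a / Gamma (a + 1) = 1 / a"
    proof -
      have "a \<notin> \<int>\<^sub>\<le>\<^sub>0" using a by (auto elim!: nonpos_Ints_cases)
      then have "Gamma (a + 1) = a * Gamma a" by (rule Gamma_plus1)
      moreover have "Gamma a \<noteq> 0" using G by linarith
      ultimately show ?thesis by simp
    qed
    finally show ?thesis using a by (simp add: a_def)
  qed
  moreover have "((\<lambda>y. c * ((\<integral>u. chi_kernel m y u \<partial>lborel) * (y / sqrt y ^ m))) \<longlongrightarrow> c * real m) at_top"
    by (intro tendsto_mult_left chi_kernel_limit)
  moreover have "\<forall>\<^sub>F y in at_top. c * ((\<integral>u. chi_kernel m y u \<partial>lborel) * (y / sqrt y ^ m))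
      = chi_tail m y / ((y / 2) powr (m / 2 - 1) * exp (- y / 2) / Gamma (m / 2))"
    using eventually_gt_at_top[of 0]
  proof eventually_elim
    case (elim y)
    have "sqrt y ^ m = y powr a"
      using elim by (simp add: powr_realpow[symmetric] powr_half_sqrt[symmetric] powr_powr a_def)
    then have "(y / 2) powr (a - 1) = sqrt y ^ m / y / 2 powr (a - 1)"
      using elim by (simp add: powr_divide powr_diff)
    then show ?case
      using elim G unfolding chi_tail_integral[OF elim] c_def a_def by (simp add: field_simps)
  qed
  ultimately show ?thesis by (simp add: filterlim_cong)
qed

lemma norming_at_top: "filterlim (\<lambda>n. norming m n + 2 * x) at_top sequentially"
  unfolding norming_def
proof -
  define a c where "a = real m - 2" and "c = ln (Gamma (real m / 2))"
  have "filterlim (\<lambda>n::nat. 2 * ln (real n) + a * ln (ln (real n)) - 2 * c + 2 * x) at_top at_top"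
    by real_asymp
  then show "filterlim (\<lambda>n. 2 * ln (real n) + (real m - 2) * ln (ln (real n)) -
      2 * ln (Gamma (real m / 2)) + 2 * x) at_top sequentially"
    by (simp add: a_def c_def)
qed

text \<open>
  The choice of \<open>norming\<close>: the logarithmic correction cancels the power of \<open>y / 2\<close>, which is asymptotically
  \<open>ln n\<close>, and the constant cancels \<open>Gamma (m / 2)\<close>.
\<close>

lemma norming_tail_limit:
  assumes m: "1 \<le> m"
  shows "(\<lambda>n. real n * chi_tail m (norming m n + 2 * x)) \<longlonglongrightarrow> exp (- x)"
proof -
  define a where "a = real m / 2"
  have G: "0 < Gamma a" using m by (simp add: a_def)
  define y where "y n = norming m n + 2 * x" for n
  have "(\<lambda>n. y n / (2 * ln (real n))) \<longlonglongrightarrow> 1"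
  proof -
    define a' c where "a' = real m - 2" and "c = ln (Gamma (real m / 2))"
    have "((\<lambda>n::nat. (2 * ln (real n) + a' * ln (ln (real n)) - 2 * c + 2 * x) / (2 * ln (real n))) \<longlongrightarrow> 1) at_top"
      by real_asymp
    then show ?thesis by (simp add: y_def norming_def a'_def c_def)
  qed
  then have "(\<lambda>n. (y n / (2 * ln (real n))) powr (a - 1) * exp (- x)) \<longlonglongrightarrow> 1 powr (a - 1) * exp (- x)"
    by (intro tendsto_intros) auto
  moreover have "(\<lambda>n. chi_tail m (y n) / ((y n / 2) powr (a - 1) * exp (- y n / 2) / Gamma a)) \<longlonglongrightarrow> 1"
    unfolding a_def y_def by (rule filterlim_compose[OF chi_tail_asymp[OF m] norming_at_top])
  ultimately have "(\<lambda>n. chi_tail m (y n) / ((y n / 2) powr (a - 1) * exp (- y n / 2) / Gamma a) *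
      ((y n / (2 * ln (real n))) powr (a - 1) * exp (- x))) \<longlonglongrightarrow> 1 * (1 powr (a - 1) * exp (- x))"
    by (rule tendsto_mult[rotated])
  moreover have "\<forall>\<^sub>F n in sequentially. chi_tail m (y n) / ((y n / 2) powr (a - 1) * exp (- y n / 2) / Gamma a) *
      ((y n / (2 * ln (real n))) powr (a - 1) * exp (- x)) = real n * chi_tail m (y n)"
  proof -
    have "\<forall>\<^sub>F n in sequentially. 0 < y n"
      using norming_at_top[of m x] unfolding y_def filterlim_at_top_dense by blast
    then show ?thesis using eventually_gt_at_top[of 3]
    proof eventually_elim
      case (elim n)
      have n: "1 < real n" "0 < ln (real n)" using elim by auto
      have "exp (- y n / 2) = exp (- ln (real n) - (a - 1) * ln (ln (real n)) + ln (Gamma a) - x)"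
        by (simp add: y_def norming_def a_def field_simps)
      also have "\<dots> = exp (ln (Gamma a)) * exp (- x) / (exp (ln (real n)) * exp ((a - 1) * ln (ln (real n))))"
        by (simp add: exp_add exp_diff exp_minus field_simps)
      also have "\<dots> = Gamma a * exp (- x) / (real n * ln (real n) powr (a - 1))"
        using n G by (simp add: powr_def)
      finally have e: "exp (- y n / 2) = Gamma a * exp (- x) / (real n * ln (real n) powr (a - 1))" .
      have p: "(y n / (2 * ln (real n))) powr (a - 1) = (y n / 2) powr (a - 1) / ln (real n) powr (a - 1)"
        using n elim(1) by (simp add: powr_divide powr_mult)
      have nz: "(y n / 2) powr (a - 1) \<noteq> 0" "ln (real n) powr (a - 1) \<noteq> 0"
        using n elim(1) by auto
      show ?case
        unfolding e p using nz n G by (simp add: field_simps)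
    qed
  qed
  ultimately show ?thesis
    unfolding y_def by (simp add: filterlim_cong)
qed

lemma chi_tail_le_1: "chi_tail m y \<le> 1"
proof -
  interpret G: prob_space "\<Pi>\<^sub>M j\<in>{1..m}. std_gauss"
    by (intro prob_space_PiM prob_space_std_gauss)
  show ?thesis unfolding chi_tail_def by (rule G.prob_le_1)
qed

lemma chi_tail_antimono:
  assumes "y \<le> y'"
  shows "chi_tail m y' \<le> chi_tail m y"
proof -
  interpret G: prob_space "\<Pi>\<^sub>M j\<in>{1..m}. std_gauss"
    by (intro prob_space_PiM prob_space_std_gauss)
  show ?thesis
    unfolding chi_tail_def using assms by (intro G.finite_measure_mono) auto
qed

text \<open>
  The limit above is not uniform in \<open>x\<close>. The ratio bound costs a factor \<open>exp k\<close> for the square root and another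
  for the exponential, which gives the rate 2, where the limit has rate 1; any fixed rate serves the estimate of the low points.
\<close>

lemma norming_tail_bound:
  assumes m: "1 \<le> m"
  shows "\<exists>K>0. \<forall>\<^sub>F n in sequentially. \<forall>k::nat.
    real n * chi_tail m (norming m n - 2 * real k) \<le> K * exp (2 * real k)"
proof -
  have lim: "(\<lambda>n. real n * chi_tail m (norming m n)) \<longlonglongrightarrow> 1"
    using norming_tail_limit[OF m, of 0] by simp
  have ev: "\<forall>\<^sub>F n in sequentially. 0 < real n * chi_tail m (norming m n) \<and>
      real n * chi_tail m (norming m n) < 2 \<and> 1 \<le> norming m n"
    using order_tendstoD(1)[OF lim, of 0] order_tendstoD(2)[OF lim, of 2]
      norming_at_top[of m 0] unfolding filterlim_at_top
    by (simp add: eventually_conj_iff)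
  then obtain n0 where n0: "0 < real n0 * chi_tail m (norming m n0)" "1 \<le> norming m n0"
    by (auto simp: eventually_sequentially)
  define c1 where "c1 = chi_tail m 1"
  have "0 < chi_tail m (norming m n0)" using n0(1) by (simp add: zero_less_mult_iff)
  with chi_tail_antimono[OF n0(2), of m] have c1: "0 < c1" by (simp add: c1_def)
  show ?thesis
  proof (intro exI[of _ "2 / c1"] conjI)
    show "\<forall>\<^sub>F n in sequentially. \<forall>k::nat.
      real n * chi_tail m (norming m n - 2 * real k) \<le> 2 / c1 * exp (2 * real k)"
      using ev
    proof eventually_elim
      case (elim n)
      show ?case
      proof
        fix k :: nat
        define b where "b = norming m n"
        \<comment> \<open>below level 1 the ratio bound is useless, but there the tail is at most \<open>1 = chi_tail m 1 / c1\<close>\<close>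
        define y where "y = max 1 (b - 2 * real k)"
        have y: "1 \<le> y" "y \<le> b" "b - y \<le> 2 * real k" using elim by (auto simp: y_def b_def)
        have "chi_tail m (b - 2 * real k) \<le> chi_tail m y / c1"
        proof (cases "1 \<le> b - 2 * real k")
          case True
          then have "chi_tail m (b - 2 * real k) = chi_tail m y" by (simp add: y_def)
          moreover have "chi_tail m y * c1 \<le> chi_tail m y * 1"
            unfolding c1_def by (intro mult_left_mono chi_tail_le_1) (simp add: chi_tail_def)
          ultimately show ?thesis using c1 by (simp add: field_simps)
        next
          case False
          then have "y = 1" by (simp add: y_def)
          then show ?thesis using c1 chi_tail_le_1 by (simp add: c1_def)
        qed
        also have "\<dots> \<le> sqrt (b / y) * exp ((b - y) / 2) * chi_tail m b / c1"
          using y c1 m by (intro divide_right_mono chi_tail_ratio) auto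
        also have "\<dots> \<le> exp (real k) * exp (real k) * chi_tail m b / c1"
        proof (intro divide_right_mono mult_right_mono mult_mono)
          have "b / y = 1 + (b - y) / y" using y by (simp add: field_simps)
          moreover have "(b - y) / y \<le> (b - y) / 1" using y by (intro divide_left_mono) auto
          ultimately have "b / y \<le> 1 + 2 * real k" using y by simp
          also have "\<dots> \<le> exp (2 * real k)" by (rule exp_ge_add_one_self)
          also have "\<dots> = (exp (real k))\<^sup>2" by (simp add: power2_eq_square exp_add[symmetric])
          finally show "sqrt (b / y) \<le> exp (real k)" by (intro real_le_lsqrt) auto
        qed (use y c1 in \<open>auto simp: chi_tail_def\<close>)
        finally have "real n * chi_tail m (b - 2 * real k) \<le> real n * (exp (real k) * exp (real k) * chi_tail m b / c1)"
          by (intro mult_left_mono) auto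
        also have "\<dots> = (real n * chi_tail m b) * (exp (real k) * exp (real k) / c1)" by simp
        also have "\<dots> \<le> 2 * (exp (real k) * exp (real k) / c1)"
          using elim c1 by (intro mult_right_mono) (auto simp: b_def)
        also have "\<dots> = 2 / c1 * exp (2 * real k)" by (simp add: exp_add[symmetric])
        finally show "real n * chi_tail m (norming m n - 2 * real k) \<le> 2 / c1 * exp (2 * real k)"
          by (simp add: b_def)
      qed
    qed
  qed (use c1 in simp)
qed

section \<open>Standard Gaussian vectors and the maximal inequality of Levy\<close>

context prob_space
begin

definition gauss_vector :: "('t \<Rightarrow> 'a \<Rightarrow> real) \<Rightarrow> 't set \<Rightarrow> bool" where
  "gauss_vector Z T \<longleftrightarrow> finite T \<and> indep_vars (\<lambda>_. borel) Z T \<and> (\<forall>t\<in>T. distr M borel (Z t) = std_gauss)"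

lemma gauss_vector_measurable:
  "gauss_vector Z T \<Longrightarrow> t \<in> T \<Longrightarrow> Z t \<in> borel_measurable M"
  by (auto simp: gauss_vector_def indep_vars_def)

lemma gauss_vector_restrict_measurable:
  "gauss_vector Z T \<Longrightarrow> (\<lambda>\<omega>. \<lambda>t\<in>T. Z t \<omega>) \<in> measurable M (\<Pi>\<^sub>M t\<in>T. borel)"
  by (intro measurable_restrict gauss_vector_measurable)

lemma gauss_vector_distr:
  assumes Z: "gauss_vector Z T" and T: "T \<noteq> {}"
  shows "distr M (\<Pi>\<^sub>M t\<in>T. borel) (\<lambda>\<omega>. \<lambda>t\<in>T. Z t \<omega>) = (\<Pi>\<^sub>M t\<in>T. std_gauss)"
proof -
  have "distr M (\<Pi>\<^sub>M t\<in>T. borel) (\<lambda>\<omega>. \<lambda>t\<in>T. Z t \<omega>) = (\<Pi>\<^sub>M t\<in>T. distr M borel (Z t))"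
    using indep_vars_iff_distr_eq_PiM'[OF T, where M' = "\<lambda>_. borel" and X = Z] Z gauss_vector_measurable[OF Z]
    by (auto simp: gauss_vector_def)
  also have "\<dots> = (\<Pi>\<^sub>M t\<in>T. std_gauss)"
    using Z by (intro PiM_cong) (auto simp: gauss_vector_def)
  finally show ?thesis .
qed

lemma gauss_vector_cong:
  assumes "gauss_vector Z T" "\<And>t. t \<in> T \<Longrightarrow> Z t = Y t"
  shows "gauss_vector Y T"
proof -
  have "indep_vars (\<lambda>_. borel) Z T = indep_vars (\<lambda>_. borel) Y T"
    using assms by (intro indep_vars_cong) auto
  with assms show ?thesis by (auto simp: gauss_vector_def)
qed

lemma gauss_vector_distrI:
  assumes "finite T" "T \<noteq> {}" and Z: "\<And>t. t \<in> T \<Longrightarrow> Z t \<in> borel_measurable M"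
    and d: "distr M (\<Pi>\<^sub>M t\<in>T. borel) (\<lambda>\<omega>. \<lambda>t\<in>T. Z t \<omega>) = (\<Pi>\<^sub>M t\<in>T. std_gauss)"
  shows "gauss_vector Z T"
proof -
  have marg: "distr M borel (Z t) = std_gauss" if t: "t \<in> T" for t
  proof -
    have "distr M borel (Z t) = distr (distr M (\<Pi>\<^sub>M t\<in>T. borel) (\<lambda>\<omega>. \<lambda>t\<in>T. Z t \<omega>)) borel (\<lambda>z. z t)"
      using t by (subst distr_distr) (auto simp: comp_def intro!: Z measurable_restrict)
    also have "\<dots> = distr (\<Pi>\<^sub>M t\<in>T. std_gauss) std_gauss (\<lambda>z. z t)"
      unfolding d by (rule distr_cong) auto
    also have "\<dots> = std_gauss"
      using t by (intro distr_PiM_component prob_space_std_gauss)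
    finally show ?thesis .
  qed
  have "(\<Pi>\<^sub>M t\<in>T. distr M borel (Z t)) = (\<Pi>\<^sub>M t\<in>T. std_gauss)"
    by (intro PiM_cong marg) auto
  then have "indep_vars (\<lambda>_. borel) Z T"
    using indep_vars_iff_distr_eq_PiM'[OF assms(2), where M' = "\<lambda>_. borel" and X = Z] Z d by auto
  then show ?thesis using marg assms(1) by (auto simp: gauss_vector_def)
qed

lemma gauss_vector_boxI:
  assumes T: "finite T" "T \<noteq> {}" and Z: "\<And>t. t \<in> T \<Longrightarrow> Z t \<in> borel_measurable M"
    and box: "\<And>E. (\<And>t. t \<in> T \<Longrightarrow> E t \<in> sets borel) \<Longrightarrow>
      prob {\<omega>\<in>space M. \<forall>t\<in>T. Z t \<omega> \<in> E t} = (\<Prod>t\<in>T. measure std_gauss (E t))"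
  shows "gauss_vector Z T"
proof (rule gauss_vector_distrI[OF T Z])
  interpret g: prob_space std_gauss by (rule prob_space_std_gauss)
  interpret G: product_prob_space "\<lambda>_. std_gauss" T
    by (intro product_prob_spaceI prob_space_std_gauss)
  show "distr M (\<Pi>\<^sub>M t\<in>T. borel) (\<lambda>\<omega>. \<lambda>t\<in>T. Z t \<omega>) = (\<Pi>\<^sub>M t\<in>T. std_gauss)"
  proof (rule G.PiM_eqI[OF T(1)])
    show "sets (distr M (\<Pi>\<^sub>M t\<in>T. borel) (\<lambda>\<omega>. \<lambda>t\<in>T. Z t \<omega>)) = sets (\<Pi>\<^sub>M t\<in>T. std_gauss)"
      by (auto intro!: sets_PiM_cong)
    fix E assume "\<And>i. i \<in> T \<Longrightarrow> E i \<in> sets std_gauss"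
    then have E: "\<And>i. i \<in> T \<Longrightarrow> E i \<in> sets borel" by simp
    have "emeasure (distr M (\<Pi>\<^sub>M t\<in>T. borel) (\<lambda>\<omega>. \<lambda>t\<in>T. Z t \<omega>)) (Pi\<^sub>E T E)
        = emeasure M ((\<lambda>\<omega>. \<lambda>t\<in>T. Z t \<omega>) -` Pi\<^sub>E T E \<inter> space M)"
      by (intro emeasure_distr measurable_restrict Z sets_PiM_I_finite T E)
    also have "(\<lambda>\<omega>. \<lambda>t\<in>T. Z t \<omega>) -` Pi\<^sub>E T E \<inter> space M = {\<omega>\<in>space M. \<forall>t\<in>T. Z t \<omega> \<in> E t}"
      by (auto simp: PiE_iff)
    also have "emeasure M {\<omega>\<in>space M. \<forall>t\<in>T. Z t \<omega> \<in> E t} = ennreal (\<Prod>t\<in>T. measure std_gauss (E t))"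
      by (simp add: emeasure_eq_measure box[OF E])
    also have "\<dots> = (\<Prod>t\<in>T. emeasure std_gauss (E t))"
      by (simp add: g.emeasure_eq_measure prod_ennreal)
    finally show "emeasure (distr M (\<Pi>\<^sub>M t\<in>T. borel) (\<lambda>\<omega>. \<lambda>t\<in>T. Z t \<omega>)) (Pi\<^sub>E T E)
        = (\<Prod>i\<in>T. emeasure std_gauss (E i))" .
  qed
qed

lemma std_gauss_distributed:
  assumes "X \<in> borel_measurable M" "distr M borel X = std_gauss"
  shows "distributed M lborel X std_normal_density"
proof -
  have "distr M lborel X = distr M borel X" by (rule distr_cong) auto
  with assms show ?thesis by (auto simp: distributed_def std_gauss_def)
qed

lemma distributed_std_gauss:
  assumes "distributed M lborel X std_normal_density"
  shows "distr M borel X = std_gauss"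
proof -
  have "distr M borel X = distr M lborel X" by (rule distr_cong) auto
  with assms show ?thesis by (auto simp: distributed_def std_gauss_def)
qed

text \<open>
  Terms with coefficient 0 have no density, and are left out before the summation of independent normal variables.
\<close>

lemma gauss_vector_sum:
  assumes Z: "gauss_vector Z T" and T: "T' \<subseteq> T" and c: "(\<Sum>t\<in>T'. (c t)\<^sup>2) = s\<^sup>2" "0 < s"
  shows "distributed M lborel (\<lambda>\<omega>. \<Sum>t\<in>T'. c t * Z t \<omega>) (normal_density 0 s)"
proof -
  define T1 where "T1 = {t\<in>T'. c t \<noteq> 0}"
  have fin: "finite T'" using Z T finite_subset by (auto simp: gauss_vector_def)
  have T1: "T1 \<subseteq> T" "finite T1" using T fin by (auto simp: T1_def)
  have c1: "(\<Sum>t\<in>T1. (c t)\<^sup>2) = s\<^sup>2"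
    unfolding c(1)[symmetric] T1_def using fin by (intro sum.mono_neutral_left) auto
  then have ne: "T1 \<noteq> {}" using c(2) by auto
  have ind: "indep_vars (\<lambda>_. borel) Z T1"
    using Z T1 indep_vars_subset by (auto simp: gauss_vector_def)
  have "distributed M lborel (\<lambda>\<omega>. \<Sum>t\<in>T1. c t * Z t \<omega>) (normal_density (\<Sum>t\<in>T1. 0) (sqrt (\<Sum>t\<in>T1. \<bar>c t\<bar>\<^sup>2)))"
  proof (rule sum_indep_normal[OF T1(2) ne])
    show "indep_vars (\<lambda>i. borel) (\<lambda>t \<omega>. c t * Z t \<omega>) T1"
      using indep_vars_compose2[OF ind, of "\<lambda>t x. c t * x" "\<lambda>_. borel"] by simp
    fix t assume t: "t \<in> T1"
    then show "0 < \<bar>c t\<bar>" by (simp add: T1_def)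
    have "distributed M lborel (Z t) std_normal_density"
      using t T1 Z by (intro std_gauss_distributed gauss_vector_measurable[OF Z]) (auto simp: gauss_vector_def)
    from normal_density_affine[OF this, of "c t" 0] t
    show "distributed M lborel (\<lambda>\<omega>. c t * Z t \<omega>) (normal_density 0 \<bar>c t\<bar>)"
      by (simp add: T1_def)
  qed
  moreover have "(\<lambda>\<omega>. \<Sum>t\<in>T1. c t * Z t \<omega>) = (\<lambda>\<omega>. \<Sum>t\<in>T'. c t * Z t \<omega>)"
    unfolding T1_def using fin by (intro ext sum.mono_neutral_left) auto
  ultimately show ?thesis using c1 c(2) by simp
qed

lemma gauss_vector_uminus:
  assumes "gauss_vector Z T"
  shows "gauss_vector (\<lambda>t \<omega>. - Z t \<omega>) T"
  unfolding gauss_vector_def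
proof (intro conjI ballI)
  show "finite T" using assms by (simp add: gauss_vector_def)
  show "indep_vars (\<lambda>_. borel) (\<lambda>t \<omega>. - Z t \<omega>) T"
    using assms indep_vars_compose2[of "\<lambda>_. borel" Z T "\<lambda>t x. - x" "\<lambda>_. borel"] by (simp add: gauss_vector_def)
  fix t assume t: "t \<in> T"
  have "distributed M lborel (\<lambda>\<omega>. \<Sum>t\<in>{t}. - 1 * Z t \<omega>) (normal_density 0 1)"
    using t by (intro gauss_vector_sum[OF assms]) auto
  then show "distr M borel (\<lambda>\<omega>. - Z t \<omega>) = std_gauss"
    by (intro distributed_std_gauss) simp
qed

lemma normal_nonneg_prob:
  assumes X: "distributed M lborel X (normal_density 0 s)" and s: "0 < s"
  shows "1 / 2 \<le> prob {\<omega>\<in>space M. 0 \<le> X \<omega>}"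
proof -
  have Xm[measurable]: "X \<in> borel_measurable M" using X by (auto simp: distributed_def)
  have "distributed M lborel (\<lambda>\<omega>. 0 + (- 1) * X \<omega>) (normal_density (0 + (- 1) * 0) (\<bar>- 1\<bar> * s))"
    by (rule normal_density_affine[OF X s]) simp
  then have "distr M lborel (\<lambda>\<omega>. - X \<omega>) = distr M lborel X"
    using X by (simp add: distributed_def)
  then have "measure (distr M lborel (\<lambda>\<omega>. - X \<omega>)) {0..} = measure (distr M lborel X) {0..}" by simp
  moreover have "measure (distr M lborel X) {0..} = prob {\<omega>\<in>space M. 0 \<le> X \<omega>}"
    by (subst measure_distr) (auto intro!: arg_cong[where f = prob])
  moreover have "measure (distr M lborel (\<lambda>\<omega>. - X \<omega>)) {0..} = prob {\<omega>\<in>space M. X \<omega> \<le> 0}"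
    by (subst measure_distr) (auto intro!: arg_cong[where f = prob])
  moreover have "1 = prob ({\<omega>\<in>space M. 0 \<le> X \<omega>} \<union> {\<omega>\<in>space M. X \<omega> \<le> 0})"
    by (subst prob_space[symmetric]) (auto intro!: arg_cong[where f = prob])
  moreover have "prob ({\<omega>\<in>space M. 0 \<le> X \<omega>} \<union> {\<omega>\<in>space M. X \<omega> \<le> 0})
      \<le> prob {\<omega>\<in>space M. 0 \<le> X \<omega>} + prob {\<omega>\<in>space M. X \<omega> \<le> 0}"
    by (rule measure_Un_le) auto
  ultimately show ?thesis by simp
qed

text \<open>
  At the first index \<open>l\<close> where the walk exceeds \<open>v\<close>, the remaining increment up to \<open>K\<close> is symmetric and
  independent of the past, so with conditional probability at least \<open>1 / 2\<close> the walk ends above \<open>v\<close>.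
\<close>

lemma levy_maximal_inequality:
  fixes K :: nat
  assumes X: "gauss_vector X {..<K}"
  shows "prob {\<omega>\<in>space M. \<exists>l\<le>K. v < (\<Sum>k<l. X k \<omega>)} \<le> 2 * prob {\<omega>\<in>space M. v < (\<Sum>k<K. X k \<omega>)}"
proof -
  have Xm: "X k \<in> borel_measurable M" if "k < K" for k
    using gauss_vector_measurable[OF X] that by simp
  define S where "S l \<omega> = (\<Sum>k<l. X k \<omega>)" for l \<omega>
  have Sm: "S l \<in> borel_measurable M" if "l \<le> K" for l
    unfolding S_def
  proof (intro borel_measurable_sum Xm)
    fix k assume "k \<in> {..<l}"
    with that show "k < K" by simp
  qed
  \<comment> \<open>on \<open>A l\<close> the first passage above \<open>v\<close> happens at \<open>l\<close>; on \<open>B l\<close> the walk does not lose ground after \<open>l\<close>\<close>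
  define A where "A l = {\<omega>\<in>space M. v < S l \<omega> \<and> (\<forall>k<l. S k \<omega> \<le> v)}" for l
  define B where "B l = {\<omega>\<in>space M. 0 \<le> S K \<omega> - S l \<omega>}" for l
  have Am: "A l \<in> sets M" if "l \<le> K" for l
  proof -
    have [measurable]: "S l \<in> borel_measurable M" "\<And>k. k < l \<Longrightarrow> S k \<in> borel_measurable M"
      using Sm that by auto
    have "A l = {\<omega>\<in>space M. v < S l \<omega>} \<inter> {\<omega>\<in>space M. \<forall>k\<in>{..<l}. S k \<omega> \<le> v}"
      by (auto simp: A_def)
    also have "\<dots> \<in> sets M" by (intro sets.Int sets.sets_Collect_finite_All) auto
    finally show ?thesis .
  qed
  have Bm: "B l \<in> sets M" if "l \<le> K" for l
    unfolding B_def using Sm[OF that] Sm[of K] by measurable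
  have SK: "S K \<omega> - S l \<omega> = (\<Sum>k\<in>{l..<K}. X k \<omega>)" if "l \<le> K" for l \<omega>
    unfolding S_def lessThan_atLeast0 using sum_diff_nat_ivl[of 0 l K "\<lambda>k. X k \<omega>"] that by simp
  have half: "1 / 2 \<le> prob (B l)" if l: "l \<le> K" for l
  proof (cases "l = K")
    case True
    then have "B l = space M" by (auto simp: B_def)
    then show ?thesis by (simp add: prob_space)
  next
    case False
    have "distributed M lborel (\<lambda>\<omega>. \<Sum>k\<in>{l..<K}. 1 * X k \<omega>) (normal_density 0 (sqrt (real (K - l))))"
      using l False by (intro gauss_vector_sum[OF X]) auto
    from normal_nonneg_prob[OF this] False l SK[OF l] show ?thesis
      by (simp add: B_def)
  qed
  have ind: "prob (A l \<inter> B l) = prob (A l) * prob (B l)" if l: "l \<le> K" for l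
  proof -
    let ?P = "\<Pi>\<^sub>M k\<in>{..<l}. (borel :: real measure)" and ?Q = "\<Pi>\<^sub>M k\<in>{l..<K}. (borel :: real measure)"
    define FA where "FA = {x\<in>space ?P. v < (\<Sum>j<l. x j) \<and> (\<forall>k\<in>{..<l}. (\<Sum>j<k. x j) \<le> v)}"
    define FB where "FB = {x\<in>space ?Q. 0 \<le> (\<Sum>j\<in>{l..<K}. x j)}"
    have m: "(\<lambda>x. \<Sum>j<k. x j) \<in> borel_measurable ?P" if "k \<le> l" for k
      using that by (intro borel_measurable_sum measurable_component_singleton) auto
    have FA: "FA \<in> sets ?P"
    proof -
      have "FA = {x\<in>space ?P. v < (\<Sum>j<l. x j)} \<inter> {x\<in>space ?P. \<forall>k\<in>{..<l}. (\<Sum>j<k. x j) \<le> v}"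
        by (auto simp: FA_def)
      also have "\<dots> \<in> sets ?P"
        by (intro sets.Int sets.sets_Collect_finite_All borel_measurable_less borel_measurable_le m) auto
      finally show ?thesis .
    qed
    have FB: "FB \<in> sets ?Q"
      unfolding FB_def by (intro borel_measurable_le borel_measurable_sum measurable_component_singleton) auto
    have iv: "indep_var ?P (\<lambda>\<omega>. restrict (\<lambda>k. X k \<omega>) {..<l}) ?Q (\<lambda>\<omega>. restrict (\<lambda>k. X k \<omega>) {l..<K})"
      using X l unfolding gauss_vector_def by (intro indep_var_restrict[where I = "{..<K}"]) auto
    have rA: "(\<lambda>\<omega>. restrict (\<lambda>k. X k \<omega>) {..<l}) -` FA \<inter> space M = A l"
      by (auto simp: A_def FA_def S_def space_PiM)
    have rB: "(\<lambda>\<omega>. restrict (\<lambda>k. X k \<omega>) {l..<K}) -` FB \<inter> space M = B l"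
      using SK[OF l] by (auto simp: B_def FB_def space_PiM)
    have "(\<lambda>\<omega>. (restrict (\<lambda>k. X k \<omega>) {..<l}, restrict (\<lambda>k. X k \<omega>) {l..<K})) -` (FA \<times> FB) \<inter> space M = A l \<inter> B l"
      unfolding rA[symmetric] rB[symmetric] by auto
    then show ?thesis
      using indep_varD[OF iv FA FB] unfolding rA rB by simp
  qed
  have disj: "disjoint_family_on A {..K}"
  proof (unfold disjoint_family_on_def, intro ballI impI)
    fix a b :: nat assume "a \<noteq> b"
    then consider "a < b" | "b < a" by linarith
    then show "A a \<inter> A b = {}" by cases (force simp: A_def)+
  qed
  have "{\<omega>\<in>space M. \<exists>l\<le>K. v < (\<Sum>k<l. X k \<omega>)} \<subseteq> (\<Union>l\<in>{..K}. A l)"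
  proof safe
    fix \<omega> l assume \<omega>: "\<omega> \<in> space M" and l: "l \<le> K" "v < (\<Sum>k<l. X k \<omega>)"
    define l0 where "l0 = (LEAST l. v < S l \<omega>)"
    have "v < S l0 \<omega>" "l0 \<le> l"
      unfolding l0_def using l by (auto intro: LeastI Least_le simp: S_def)
    moreover have "S k \<omega> \<le> v" if "k < l0" for k
      using not_less_Least[of k "\<lambda>l. v < S l \<omega>"] that by (auto simp: l0_def)
    ultimately show "\<omega> \<in> (\<Union>l\<in>{..K}. A l)" using l \<omega> by (auto simp: A_def)
  qed
  then have "prob {\<omega>\<in>space M. \<exists>l\<le>K. v < (\<Sum>k<l. X k \<omega>)} \<le> prob (\<Union>l\<in>{..K}. A l)"
    using Am by (intro finite_measure_mono) auto
  also have "\<dots> = (\<Sum>l\<le>K. prob (A l))"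
    using Am disj by (intro finite_measure_finite_Union) auto
  also have "\<dots> \<le> (\<Sum>l\<le>K. 2 * prob (A l \<inter> B l))"
  proof (intro sum_mono)
    fix l assume "l \<in> {..K}"
    then have "prob (A l) * (1 / 2) \<le> prob (A l) * prob (B l)"
      by (intro mult_left_mono half) auto
    then show "prob (A l) \<le> 2 * prob (A l \<inter> B l)" using ind \<open>l \<in> {..K}\<close> by simp
  qed
  also have "\<dots> = 2 * prob (\<Union>l\<in>{..K}. A l \<inter> B l)"
  proof -
    have "prob (\<Union>l\<in>{..K}. A l \<inter> B l) = (\<Sum>l\<le>K. prob (A l \<inter> B l))"
    proof (rule finite_measure_finite_Union)
      show "disjoint_family_on (\<lambda>l. A l \<inter> B l) {..K}"
        using disj unfolding disjoint_family_on_def by blast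
    qed (use Am Bm in auto)
    then show ?thesis by (simp add: sum_distrib_left)
  qed
  also have "prob (\<Union>l\<in>{..K}. A l \<inter> B l) \<le> prob {\<omega>\<in>space M. v < (\<Sum>k<K. X k \<omega>)}"
  proof (rule finite_measure_mono)
    show "{\<omega>\<in>space M. v < (\<Sum>k<K. X k \<omega>)} \<in> sets M"
      using Sm[of K] unfolding S_def by measurable
  qed (auto simp: A_def B_def S_def)
  finally show ?thesis by simp
qed

text \<open>
  The density above \<open>u\<close> is at most the density shifted by \<open>r\<close>, times \<open>exp (r\<^sup>2 / 2 - r * u)\<close>. Keeping \<open>r\<close> free allows any
  exponential rate of decay later on.
\<close>

lemma std_gauss_tail:
  assumes "0 \<le> r"
  shows "measure std_gauss {u<..} \<le> exp (r\<^sup>2 / 2 - r * u)"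
proof -
  interpret g: prob_space std_gauss by (rule prob_space_std_gauss)
  have "ennreal (measure std_gauss {u<..}) = (\<integral>\<^sup>+x. ennreal (std_normal_density x) * indicator {u<..} x \<partial>lborel)"
    unfolding g.emeasure_eq_measure[symmetric] unfolding std_gauss_def
    by (rule emeasure_density) auto
  also have "\<dots> \<le> (\<integral>\<^sup>+x. ennreal (exp (r\<^sup>2 / 2 - r * u)) * ennreal (normal_density r 1 x) \<partial>lborel)"
  proof (intro nn_integral_mono)
    fix x :: real
    show "ennreal (std_normal_density x) * indicator {u<..} x
        \<le> ennreal (exp (r\<^sup>2 / 2 - r * u)) * ennreal (normal_density r 1 x)"
    proof (cases "u < x")
      case True
      have "exp (r\<^sup>2 / 2 - r * u) * normal_density r 1 x = exp (r * (x - u)) * std_normal_density x"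
        by (simp add: normal_density_def std_normal_density_def exp_add[symmetric] power2_eq_square field_simps)
      moreover have "1 * std_normal_density x \<le> exp (r * (x - u)) * std_normal_density x"
        using True assms by (intro mult_right_mono) auto
      ultimately show ?thesis using True by (simp add: ennreal_mult[symmetric])
    qed simp
  qed
  also have "\<dots> = ennreal (exp (r\<^sup>2 / 2 - r * u)) * (\<integral>\<^sup>+x. ennreal (normal_density r 1 x) \<partial>lborel)"
    by (rule nn_integral_cmult) auto
  also have "(\<integral>\<^sup>+x. ennreal (normal_density r 1 x) \<partial>lborel) = 1"
    using prob_space.emeasure_space_1[OF prob_space_normal_density[of 1 r]]
    by (simp add: emeasure_density)
  finally show ?thesis by simp
qed

text \<open>
  The walk scaled by \<open>sqrt K\<close> is the value of a Brownian path at grid points; the bound does not depend on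
  the mesh of the grid.
\<close>

lemma gauss_max_tail:
  fixes K :: nat
  assumes X: "gauss_vector X {..<K}" and K: "1 \<le> K" and r: "0 \<le> r"
  shows "prob {\<omega>\<in>space M. \<exists>l\<le>K. u < \<bar>(\<Sum>k<l. X k \<omega>) / sqrt (real K)\<bar>} \<le> 4 * exp (r\<^sup>2 / 2 - r * u)"
proof -
  have one: "prob {\<omega>\<in>space M. \<exists>l\<le>K. u * sqrt (real K) < (\<Sum>k<l. Y k \<omega>)} \<le> 2 * exp (r\<^sup>2 / 2 - r * u)"
    if Y: "gauss_vector Y {..<K}" for Y :: "nat \<Rightarrow> 'a \<Rightarrow> real"
  proof -
    have "distributed M lborel (\<lambda>\<omega>. \<Sum>k<K. (1 / sqrt (real K)) * Y k \<omega>) std_normal_density"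
      using K by (intro gauss_vector_sum[OF Y]) (auto simp: power_divide)
    then have d: "distr M borel (\<lambda>\<omega>. \<Sum>k<K. (1 / sqrt (real K)) * Y k \<omega>) = std_gauss"
      and m: "(\<lambda>\<omega>. \<Sum>k<K. (1 / sqrt (real K)) * Y k \<omega>) \<in> borel_measurable M"
      by (auto intro: distributed_std_gauss simp: distributed_def)
    have "prob {\<omega>\<in>space M. u * sqrt (real K) < (\<Sum>k<K. Y k \<omega>)}
        = measure (distr M borel (\<lambda>\<omega>. \<Sum>k<K. (1 / sqrt (real K)) * Y k \<omega>)) {u<..}"
    proof -
      have "(\<Sum>k<K. (1 / sqrt (real K)) * Y k \<omega>) = (\<Sum>k<K. Y k \<omega>) / sqrt (real K)" for \<omega>
        by (simp add: sum_divide_distrib)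
      then have "(\<lambda>\<omega>. \<Sum>k<K. (1 / sqrt (real K)) * Y k \<omega>) -` {u<..} \<inter> space M
          = {\<omega>\<in>space M. u * sqrt (real K) < (\<Sum>k<K. Y k \<omega>)}"
        using K by (auto simp: pos_less_divide_eq)
      then show ?thesis by (subst measure_distr[OF m]) auto
    qed
    also have "\<dots> \<le> exp (r\<^sup>2 / 2 - r * u)" unfolding d by (rule std_gauss_tail[OF r])
    finally show ?thesis using levy_maximal_inequality[OF Y, of "u * sqrt (real K)"] by linarith
  qed
  have ev: "{\<omega>\<in>space M. \<exists>l\<le>K. u * sqrt (real K) < (\<Sum>k<l. Y k \<omega>)} \<in> sets M"
    if Y: "gauss_vector Y {..<K}" for Y :: "nat \<Rightarrow> 'a \<Rightarrow> real"
  proof -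
    have "{\<omega>\<in>space M. \<exists>l\<in>{..K}. u * sqrt (real K) < (\<Sum>k<l. Y k \<omega>)} \<in> sets M"
      using gauss_vector_measurable[OF Y]
      by (intro sets.sets_Collect_finite_Ex borel_measurable_less borel_measurable_sum) auto
    also have "{\<omega>\<in>space M. \<exists>l\<in>{..K}. u * sqrt (real K) < (\<Sum>k<l. Y k \<omega>)}
        = {\<omega>\<in>space M. \<exists>l\<le>K. u * sqrt (real K) < (\<Sum>k<l. Y k \<omega>)}" by auto
    finally show ?thesis .
  qed
  have "prob {\<omega>\<in>space M. \<exists>l\<le>K. u < \<bar>(\<Sum>k<l. X k \<omega>) / sqrt (real K)\<bar>}
      \<le> prob ({\<omega>\<in>space M. \<exists>l\<le>K. u * sqrt (real K) < (\<Sum>k<l. X k \<omega>)} \<union>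
               {\<omega>\<in>space M. \<exists>l\<le>K. u * sqrt (real K) < (\<Sum>k<l. - X k \<omega>)})"
  proof (intro finite_measure_mono sets.Un ev X gauss_vector_uminus, safe)
    fix \<omega> l
    assume "l \<le> K" "u < \<bar>(\<Sum>k<l. X k \<omega>) / sqrt (real K)\<bar>"
      and no: "\<not> (\<exists>l\<le>K. u * sqrt (real K) < (\<Sum>k<l. - X k \<omega>))"
    then have "u * sqrt (real K) < \<bar>\<Sum>k<l. X k \<omega>\<bar>" using K by (simp add: pos_less_divide_eq)
    moreover have "\<not> u * sqrt (real K) < - (\<Sum>k<l. X k \<omega>)"
      using no \<open>l \<le> K\<close> by (auto simp: sum_negf)
    ultimately have "u * sqrt (real K) < (\<Sum>k<l. X k \<omega>)" by linarith
    with \<open>l \<le> K\<close> show "\<exists>l\<le>K. u * sqrt (real K) < (\<Sum>k<l. X k \<omega>)" by auto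
  qed
  also have "\<dots> \<le> prob {\<omega>\<in>space M. \<exists>l\<le>K. u * sqrt (real K) < (\<Sum>k<l. X k \<omega>)} +
               prob {\<omega>\<in>space M. \<exists>l\<le>K. u * sqrt (real K) < (\<Sum>k<l. - X k \<omega>)}"
    by (intro measure_Un_le ev X gauss_vector_uminus)
  also have "\<dots> \<le> 4 * exp (r\<^sup>2 / 2 - r * u)"
    using one[OF X] one[OF gauss_vector_uminus[OF X]] by simp
  finally show ?thesis .
qed

end

section \<open>Paths with Gaussian increments, independent of a random element\<close>

text \<open>
  The factor \<open>sqrt K\<close> gives the increments of a standard Brownian motion over steps of length \<open>1 / K\<close> variance 1.
\<close>

definition grid_increment :: "nat \<Rightarrow> (real \<Rightarrow> real) \<Rightarrow> nat \<Rightarrow> real" where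
  "grid_increment K f l = sqrt (real K) * (f (real (Suc l) / real K) - f (real l / real K))"

definition grid_incs :: "('i \<Rightarrow> real \<Rightarrow> 'a \<Rightarrow> real) \<Rightarrow> nat \<Rightarrow> 'i \<times> nat \<Rightarrow> 'a \<Rightarrow> real" where
  "grid_incs \<beta> K x \<omega> = grid_increment K (\<lambda>t. \<beta> (fst x) t \<omega>) (snd x)"

lemma sum_grid_increment:
  assumes "1 \<le> K" "f 0 = 0"
  shows "(\<Sum>k<l. grid_increment K f k) / sqrt (real K) = f (real l / real K)"
proof -
  have "(\<Sum>k<l. grid_increment K f k) = sqrt (real K) * (\<Sum>k<l. f (real (Suc k) / real K) - f (real k / real K))"
    unfolding grid_increment_def sum_distrib_left ..
  also have "(\<Sum>k<l. f (real (Suc k) / real K) - f (real k / real K)) = f (real l / real K)"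
    using sum_lessThan_telescope[of "\<lambda>k. f (real k / real K)" l] assms(2) by simp
  finally show ?thesis using assms(1) by simp
qed

definition sup_norm :: "(real \<Rightarrow> real) \<Rightarrow> real" where
  "sup_norm f = (SUP t\<in>{0..1}. \<bar>f t\<bar>)"

lemma sup_norm_bdd:
  fixes f :: "real \<Rightarrow> real"
  assumes "continuous_on {0..1} f"
  shows "bdd_above ((\<lambda>t. \<bar>f t\<bar>) ` {0..1::real})"
proof -
  have "compact ((\<lambda>t. \<bar>f t\<bar>) ` {0..1})"
    using assms by (intro compact_continuous_image continuous_on_rabs) auto
  then show ?thesis by (intro bounded_imp_bdd_above compact_imp_bounded)
qed

lemma abs_le_sup_norm:
  assumes "continuous_on {0..1} f" "t \<in> {0..1}"
  shows "\<bar>f t\<bar> \<le> sup_norm f"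
  unfolding sup_norm_def using sup_norm_bdd[OF assms(1)] assms(2) by (intro cSUP_upper)

lemma sup_norm_le:
  assumes "\<And>t. t \<in> {0..1} \<Longrightarrow> \<bar>f t\<bar> \<le> c"
  shows "sup_norm f \<le> c"
  unfolding sup_norm_def using assms by (intro cSUP_least) auto

lemma sup_norm_nonneg: "continuous_on {0..1} f \<Longrightarrow> 0 \<le> sup_norm f"
  using abs_le_sup_norm[of f 0] by simp

lemma lip_sup_norm: "lip 1 sup_norm"
proof -
  have *: "sup_norm f \<le> sup_norm g + e"
    if "continuous_on {0..1} f" "continuous_on {0..1} g" "\<forall>t\<in>{0..1}. \<bar>f t - g t\<bar> \<le> e" for f g e
  proof (rule sup_norm_le)
    fix t :: real assume t: "t \<in> {0..1}"
    show "\<bar>f t\<bar> \<le> sup_norm g + e" using abs_le_sup_norm[OF that(2) t] that(3) t by force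
  qed
  show ?thesis
    unfolding lip_def
  proof (intro conjI allI impI)
    fix f g :: "real \<Rightarrow> real" and e :: real
    assume "continuous_on {0..1} f" "continuous_on {0..1} g" "\<forall>t\<in>{0..1}. \<bar>f t - g t\<bar> \<le> e"
    with *[of f g e] *[of g f e] show "\<bar>sup_norm f - sup_norm g\<bar> \<le> 1 * e"
      by (auto simp: abs_minus_commute abs_le_iff)
  qed simp
qed

text \<open>
  Dyadic rationals are dense, and the dyadic grids increase; the event that a path is large somewhere is thus
  an increasing union of events on finite grids.
\<close>

lemma sup_norm_dyadic:
  assumes f: "continuous_on {0..1} f" and u: "u < sup_norm f"
  shows "\<exists>q. \<exists>l\<le>2 ^ q. u < \<bar>f (real l / 2 ^ q)\<bar>"
proof (rule ccontr)
  assume no: "\<not> ?thesis"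
  have "\<bar>f t\<bar> \<le> u" if t: "t \<in> {0..1}" for t
  proof -
    define l where "l q = nat \<lfloor>2 ^ q * t\<rfloor>" for q :: nat
    have l: "real (l q) = of_int \<lfloor>2 ^ q * t\<rfloor>" for q using t by (simp add: l_def)
    have lq: "l q \<le> 2 ^ q" for q
    proof -
      have "2 ^ q * t \<le> 2 ^ q" using t by (simp add: mult_left_le)
      then have "real (l q) \<le> 2 ^ q" unfolding l using of_int_floor_le order_trans by blast
      then have "real (l q) \<le> real (2 ^ q)" by simp
      then show ?thesis using of_nat_le_iff by blast
    qed
    have "(\<lambda>q. real (l q) / 2 ^ q) \<longlonglongrightarrow> t"
    proof (rule tendsto_sandwich[of "\<lambda>q. t - (1 / 2) ^ q" _ _ "\<lambda>_. t"])
      have "(\<lambda>q. t - (1 / 2 :: real) ^ q) \<longlonglongrightarrow> t - 0"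
        by (intro tendsto_intros LIMSEQ_realpow_zero) auto
      then show "(\<lambda>q. t - (1 / 2) ^ q) \<longlonglongrightarrow> t" by simp
      show "\<forall>\<^sub>F q in sequentially. t - (1 / 2) ^ q \<le> real (l q) / 2 ^ q"
      proof (intro always_eventually allI)
        fix q :: nat
        have "2 ^ q * t - 1 \<le> real (l q)" unfolding l by linarith
        then have "(2 ^ q * t - 1) / 2 ^ q \<le> real (l q) / 2 ^ q" by (intro divide_right_mono) auto
        then show "t - (1 / 2) ^ q \<le> real (l q) / 2 ^ q"
          by (simp add: diff_divide_distrib power_divide)
      qed
      show "\<forall>\<^sub>F q in sequentially. real (l q) / 2 ^ q \<le> t"
      proof (intro always_eventually allI)
        fix q :: nat
        have "real (l q) \<le> 2 ^ q * t" unfolding l by (rule of_int_floor_le)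
        then show "real (l q) / 2 ^ q \<le> t" by (simp add: field_simps)
      qed
    qed simp
    moreover have in01: "real (l q) / 2 ^ q \<in> {0..1}" for q
    proof -
      have "real (l q) \<le> real (2 ^ q)" using lq[of q] of_nat_le_iff by blast
      then show ?thesis by simp
    qed
    ultimately have "(\<lambda>q. f (real (l q) / 2 ^ q)) \<longlonglongrightarrow> f t"
      using f t unfolding continuous_on_sequentially by (auto simp: comp_def)
    then have "(\<lambda>q. \<bar>f (real (l q) / 2 ^ q)\<bar>) \<longlonglongrightarrow> \<bar>f t\<bar>" by (rule tendsto_rabs)
    moreover have "\<bar>f (real (l q) / 2 ^ q)\<bar> \<le> u" for q using no lq[of q] by (auto simp: not_less)
    ultimately show ?thesis by (intro LIMSEQ_le_const2) auto
  qed
  then have "sup_norm f \<le> u" by (rule sup_norm_le)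
  with u show False by simp
qed

context prob_space
begin

lemma gauss_vector_AE:
  assumes Z: "gauss_vector Z T" and T: "T \<noteq> {}"
    and Y: "\<And>t. t \<in> T \<Longrightarrow> Y t \<in> borel_measurable M"
    and eq: "\<And>t. t \<in> T \<Longrightarrow> AE \<omega> in M. Y t \<omega> = Z t \<omega>"
  shows "gauss_vector Y T"
proof (rule gauss_vector_distrI)
  show fin: "finite T" using Z by (simp add: gauss_vector_def)
  have "AE \<omega> in M. \<forall>t\<in>T. Y t \<omega> = Z t \<omega>" using fin eq by (intro AE_finite_allI)
  then have "AE \<omega> in M. (\<lambda>t\<in>T. Y t \<omega>) = (\<lambda>t\<in>T. Z t \<omega>)" by eventually_elim auto
  then have "distr M (\<Pi>\<^sub>M t\<in>T. borel) (\<lambda>\<omega>. \<lambda>t\<in>T. Y t \<omega>) = distr M (\<Pi>\<^sub>M t\<in>T. borel) (\<lambda>\<omega>. \<lambda>t\<in>T. Z t \<omega>)"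
    using Y gauss_vector_measurable[OF Z] by (intro distr_cong_AE refl measurable_restrict)
  then show "distr M (\<Pi>\<^sub>M t\<in>T. borel) (\<lambda>\<omega>. \<lambda>t\<in>T. Y t \<omega>) = (\<Pi>\<^sub>M t\<in>T. std_gauss)"
    using gauss_vector_distr[OF Z T] by simp
qed (use T Y in auto)

lemma gauss_vector_reindex:
  assumes Z: "gauss_vector Z T" and h: "inj_on h T'" "h ` T' \<subseteq> T" and T': "T' \<noteq> {}"
  shows "gauss_vector (\<lambda>t. Z (h t)) T'"
proof (rule gauss_vector_distrI)
  have finT: "finite T" using Z by (simp add: gauss_vector_def)
  show "finite T'" using finT h by (meson finite_imageD finite_subset)
  have T: "T \<noteq> {}" using T' h by auto
  show m: "Z (h t) \<in> borel_measurable M" if "t \<in> T'" for t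
    using gauss_vector_measurable[OF Z] h that by auto
  have "distr M (\<Pi>\<^sub>M t\<in>T'. borel) (\<lambda>\<omega>. \<lambda>t\<in>T'. Z (h t) \<omega>)
      = distr (distr M (\<Pi>\<^sub>M t\<in>T. borel) (\<lambda>\<omega>. \<lambda>t\<in>T. Z t \<omega>)) (\<Pi>\<^sub>M t\<in>T'. borel) (\<lambda>z. \<lambda>t\<in>T'. z (h t))"
  proof (subst distr_distr)
    show "(\<lambda>z. \<lambda>t\<in>T'. z (h t)) \<in> measurable (\<Pi>\<^sub>M t\<in>T. borel) (\<Pi>\<^sub>M t\<in>T'. borel)"
      using h by (intro measurable_restrict measurable_component_singleton) auto
    show "(\<lambda>\<omega>. \<lambda>t\<in>T. Z t \<omega>) \<in> measurable M (\<Pi>\<^sub>M t\<in>T. borel)"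
      by (rule gauss_vector_restrict_measurable[OF Z])
    have "(\<lambda>t\<in>T'. Z (h t) \<omega>) = (\<lambda>t\<in>T'. (\<lambda>t\<in>T. Z t \<omega>) (h t))" for \<omega>
      using h by (intro restrict_ext) auto
    then show "distr M (\<Pi>\<^sub>M t\<in>T'. borel) (\<lambda>\<omega>. \<lambda>t\<in>T'. Z (h t) \<omega>) =
        distr M (\<Pi>\<^sub>M t\<in>T'. borel) ((\<lambda>z. \<lambda>t\<in>T'. z (h t)) \<circ> (\<lambda>\<omega>. \<lambda>t\<in>T. Z t \<omega>))"
      by (simp add: comp_def)
  qed
  also have "\<dots> = distr (\<Pi>\<^sub>M t\<in>T. std_gauss) (\<Pi>\<^sub>M t\<in>T'. std_gauss) (\<lambda>z. \<lambda>t\<in>T'. z (h t))"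
    unfolding gauss_vector_distr[OF Z T] by (intro distr_cong refl sets_PiM_cong) simp
  also have "\<dots> = (\<Pi>\<^sub>M t\<in>T'. std_gauss)"
    using distr_PiM_reindex[of T "\<lambda>_. std_gauss" h T'] h prob_space_std_gauss by (auto simp: image_subset_iff_funcset)
  finally show "distr M (\<Pi>\<^sub>M t\<in>T'. borel) (\<lambda>\<omega>. \<lambda>t\<in>T'. Z (h t) \<omega>) = (\<Pi>\<^sub>M t\<in>T'. std_gauss)" .
qed (use T' in auto)

text \<open>
  Independence of two random elements, whose values may be of different types.
\<close>

definition indep_pair :: "'s measure \<Rightarrow> ('a \<Rightarrow> 's) \<Rightarrow> 'd measure \<Rightarrow> ('a \<Rightarrow> 'd) \<Rightarrow> bool" where
  "indep_pair NS S ND D \<longleftrightarrow> S \<in> measurable M NS \<and> D \<in> measurable M ND \<and>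
     (\<forall>A\<in>sets NS. \<forall>E\<in>sets ND. prob {\<omega>\<in>space M. S \<omega> \<in> A \<and> D \<omega> \<in> E}
        = prob {\<omega>\<in>space M. S \<omega> \<in> A} * prob {\<omega>\<in>space M. D \<omega> \<in> E})"

lemma indep_pair_distr:
  assumes "indep_pair NS S ND D"
  shows "distr M (NS \<Otimes>\<^sub>M ND) (\<lambda>\<omega>. (S \<omega>, D \<omega>)) = distr M NS S \<Otimes>\<^sub>M distr M ND D"
proof (rule pair_measure_eqI[symmetric])
  have S[measurable]: "S \<in> measurable M NS" and D[measurable]: "D \<in> measurable M ND"
    using assms by (auto simp: indep_pair_def)
  interpret S: prob_space "distr M NS S" by (rule prob_space_distr[OF S])
  interpret D: prob_space "distr M ND D" by (rule prob_space_distr[OF D])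
  show "sigma_finite_measure (distr M NS S)" "sigma_finite_measure (distr M ND D)" ..
  fix A E assume "A \<in> sets (distr M NS S)" "E \<in> sets (distr M ND D)"
  then have A[measurable]: "A \<in> sets NS" and E[measurable]: "E \<in> sets ND" by auto
  have "emeasure (distr M (NS \<Otimes>\<^sub>M ND) (\<lambda>\<omega>. (S \<omega>, D \<omega>))) (A \<times> E)
      = emeasure M {\<omega>\<in>space M. S \<omega> \<in> A \<and> D \<omega> \<in> E}"
    by (subst emeasure_distr) (auto intro!: arg_cong[where f = "emeasure M"])
  also have "\<dots> = emeasure M {\<omega>\<in>space M. S \<omega> \<in> A} * emeasure M {\<omega>\<in>space M. D \<omega> \<in> E}"
    using assms A E unfolding indep_pair_def by (simp add: emeasure_eq_measure ennreal_mult)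
  also have "emeasure M {\<omega>\<in>space M. S \<omega> \<in> A} = emeasure (distr M NS S) A"
    by (subst emeasure_distr) (auto intro!: arg_cong[where f = "emeasure M"])
  also have "emeasure M {\<omega>\<in>space M. D \<omega> \<in> E} = emeasure (distr M ND D) E"
    by (subst emeasure_distr) (auto intro!: arg_cong[where f = "emeasure M"])
  finally show "emeasure (distr M NS S) A * emeasure (distr M ND D) E
      = emeasure (distr M (NS \<Otimes>\<^sub>M ND) (\<lambda>\<omega>. (S \<omega>, D \<omega>))) (A \<times> E)" ..
qed simp

lemma indep_pair_AE:
  assumes ind: "indep_pair NS S ND D" and D': "D' \<in> measurable M ND"
    and eq: "AE \<omega> in M. D' \<omega> = D \<omega>"
  shows "indep_pair NS S ND D'"
  unfolding indep_pair_def
proof (intro conjI ballI D')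
  show S[measurable]: "S \<in> measurable M NS" using ind by (simp add: indep_pair_def)
  have D[measurable]: "D \<in> measurable M ND" using ind by (simp add: indep_pair_def)
  note D'[measurable]
  fix A E assume A[measurable]: "A \<in> sets NS" and E[measurable]: "E \<in> sets ND"
  have "prob {\<omega>\<in>space M. S \<omega> \<in> A \<and> D' \<omega> \<in> E} = prob {\<omega>\<in>space M. S \<omega> \<in> A \<and> D \<omega> \<in> E}"
    using eq by (intro finite_measure_eq_AE) auto
  moreover have "prob {\<omega>\<in>space M. D' \<omega> \<in> E} = prob {\<omega>\<in>space M. D \<omega> \<in> E}"
    using eq by (intro finite_measure_eq_AE) auto
  ultimately show "prob {\<omega>\<in>space M. S \<omega> \<in> A \<and> D' \<omega> \<in> E}
      = prob {\<omega>\<in>space M. S \<omega> \<in> A} * prob {\<omega>\<in>space M. D' \<omega> \<in> E}"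
    using ind A E by (simp add: indep_pair_def)
qed

text \<open>
  Increments of one motion over disjoint intervals are independent by definition, those of different motions
  because the motions are independent as random paths; both are combined on boxes.
\<close>

lemma brownian_increments_gauss:
  assumes B: "indep_brownian_motions B I" and I0: "I0 \<subseteq> I" "finite I0" "I0 \<noteq> {}"
    and L: "1 \<le> L" and \<tau>: "0 \<le> \<tau> 0" "strict_mono_on {..L} \<tau>"
  shows "gauss_vector (\<lambda>x \<omega>. (B (fst x) (\<tau> (Suc (snd x))) \<omega> - B (fst x) (\<tau> (snd x)) \<omega>)
      / sqrt (\<tau> (Suc (snd x)) - \<tau> (snd x))) (I0 \<times> {..<L})"
proof -
  define Z where "Z x \<omega> = (B (fst x) (\<tau> (Suc (snd x))) \<omega> - B (fst x) (\<tau> (snd x)) \<omega>)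
      / sqrt (\<tau> (Suc (snd x)) - \<tau> (snd x))" for x \<omega>
  have BM: "std_brownian_motion (B i)" if "i \<in> I0" for i
    using B I0(1) that by (auto simp: indep_brownian_motions_def)
  have \<tau>0: "0 \<le> \<tau> l" if "l \<le> L" for l
  proof (cases "l = 0")
    case False
    then have "\<tau> 0 < \<tau> l" using \<tau>(2) that by (intro strict_mono_onD[of "{..L}" \<tau>]) auto
    then show ?thesis using \<tau>(1) by simp
  qed (use \<tau> in simp)
  have step: "\<tau> l < \<tau> (Suc l)" if "l < L" for l
    using \<tau>(2) that by (intro strict_mono_onD[of "{..L}" \<tau>]) auto
  have Bm: "B i (\<tau> l) \<in> borel_measurable M" if "i \<in> I0" "l \<le> L" for i l
    using BM[OF that(1)] \<tau>0[OF that(2)] by (auto simp: std_brownian_motion_def)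
  have Zm: "Z x \<in> borel_measurable M" if "x \<in> I0 \<times> {..<L}" for x
    unfolding Z_def using that by (intro borel_measurable_divide borel_measurable_diff Bm) auto
  have one: "gauss_vector (\<lambda>l. Z (i, l)) {..<L}" if i: "i \<in> I0" for i
    unfolding gauss_vector_def
  proof (intro conjI ballI)
    have "indep_vars (\<lambda>_. borel) (\<lambda>l \<omega>. B i (\<tau> (Suc l)) \<omega> - B i (\<tau> l) \<omega>) {..<L}"
      using BM[OF i] \<tau> by (auto simp: std_brownian_motion_def)
    from indep_vars_compose2[OF this, of "\<lambda>l x. x / sqrt (\<tau> (Suc l) - \<tau> l)" "\<lambda>_. borel"]
    show "indep_vars (\<lambda>_. borel) (\<lambda>l. Z (i, l)) {..<L}"
      by (simp add: Z_def[abs_def])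
    fix l assume "l \<in> {..<L}"
    then have l: "l < L" by simp
    have "distributed M lborel (\<lambda>\<omega>. B i (\<tau> (Suc l)) \<omega> - B i (\<tau> l) \<omega>)
        (normal_density 0 (sqrt (\<tau> (Suc l) - \<tau> l)))"
      using BM[OF i] \<tau>0[of l] step[OF l] l by (auto simp: std_brownian_motion_def)
    then have "distributed M lborel (Z (i, l)) std_normal_density"
      using step[OF l] normal_standard_normal_convert[of "sqrt (\<tau> (Suc l) - \<tau> l)"
        "\<lambda>\<omega>. B i (\<tau> (Suc l)) \<omega> - B i (\<tau> l) \<omega>" 0] by (simp add: Z_def[abs_def])
    then show "distr M borel (Z (i, l)) = std_gauss" by (rule distributed_std_gauss)
  qed simp
  have "gauss_vector Z (I0 \<times> {..<L})"
  proof (rule gauss_vector_boxI)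
    show "finite (I0 \<times> {..<L})" "I0 \<times> {..<L} \<noteq> {}" using I0 L by (auto simp: lessThan_empty_iff)
    fix E assume E: "\<And>t. t \<in> I0 \<times> {..<L} \<Longrightarrow> E t \<in> sets (borel :: real measure)"
    define F where "F i = {p\<in>space path_space. \<forall>l\<in>{..<L}.
        (p (\<tau> (Suc l)) - p (\<tau> l)) / sqrt (\<tau> (Suc l) - \<tau> l) \<in> E (i, l)}" for i
    have Fm: "F i \<in> sets path_space" if i: "i \<in> I0" for i
      unfolding F_def
    proof (rule sets.sets_Collect_finite_All)
      fix l assume "l \<in> {..<L}"
      then have l: "l < L" by simp
      have [measurable]: "(\<lambda>p. p (\<tau> (Suc l))) \<in> borel_measurable path_space"
        "(\<lambda>p. p (\<tau> l)) \<in> borel_measurable path_space"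
        unfolding path_space_def using \<tau>0 l by (auto intro!: measurable_component_singleton)
      have [measurable]: "E (i, l) \<in> sets borel" using E i l by auto
      show "{p\<in>space path_space. (p (\<tau> (Suc l)) - p (\<tau> l)) / sqrt (\<tau> (Suc l) - \<tau> l) \<in> E (i, l)} \<in> sets path_space"
        by measurable
    qed simp
    have vim: "path (B i) -` F i \<inter> space M = {\<omega>\<in>space M. \<forall>l\<in>{..<L}. Z (i, l) \<omega> \<in> E (i, l)}" for i
      using \<tau>0 by (auto simp: F_def path_def Z_def path_space_def space_PiM)
    have "{\<omega>\<in>space M. \<forall>t\<in>I0 \<times> {..<L}. Z t \<omega> \<in> E t} = (\<Inter>i\<in>I0. path (B i) -` F i \<inter> space M)"
      unfolding vim using I0 by auto
    also have "prob \<dots> = (\<Prod>i\<in>I0. prob (path (B i) -` F i \<inter> space M))"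
      using B unfolding indep_brownian_motions_def
      by (intro indep_varsD[where M' = "\<lambda>_. path_space" and I = I] I0 Fm) auto
    also have "\<dots> = (\<Prod>i\<in>I0. \<Prod>l<L. measure std_gauss (E (i, l)))"
    proof (rule prod.cong[OF refl])
      fix i assume i: "i \<in> I0"
      have "prob (path (B i) -` F i \<inter> space M) = prob (\<Inter>l\<in>{..<L}. Z (i, l) -` E (i, l) \<inter> space M)"
        unfolding vim using L by (auto intro!: arg_cong[where f = prob] simp: lessThan_empty_iff)
      also have "\<dots> = (\<Prod>l<L. prob (Z (i, l) -` E (i, l) \<inter> space M))"
        using one[OF i] E i L unfolding gauss_vector_def
        by (intro indep_varsD_finite[where M' = "\<lambda>_. borel"]) (auto simp: lessThan_empty_iff)
      also have "\<dots> = (\<Prod>l<L. measure std_gauss (E (i, l)))"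
      proof (rule prod.cong[OF refl])
        fix l assume l: "l \<in> {..<L}"
        have "measure std_gauss (E (i, l)) = measure (distr M borel (Z (i, l))) (E (i, l))"
          using one[OF i] l by (simp add: gauss_vector_def)
        also have "\<dots> = prob (Z (i, l) -` E (i, l) \<inter> space M)"
          using Zm[of "(i, l)"] E i l by (intro measure_distr) auto
        finally show "prob (Z (i, l) -` E (i, l) \<inter> space M) = measure std_gauss (E (i, l))" ..
      qed
      finally show "prob (path (B i) -` F i \<inter> space M) = (\<Prod>l<L. measure std_gauss (E (i, l)))" .
    qed
    also have "\<dots> = (\<Prod>t\<in>I0 \<times> {..<L}. measure std_gauss (E t))"
      by (simp add: prod.cartesian_product)
    finally show "prob {\<omega>\<in>space M. \<forall>t\<in>I0 \<times> {..<L}. Z t \<omega> \<in> E t} = (\<Prod>t\<in>I0 \<times> {..<L}. measure std_gauss (E t))" .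
  qed (use Zm in auto)
  then show ?thesis unfolding Z_def[abs_def] .
qed

text \<open>
  The paths are independent standard Brownian motions on the unit interval, jointly independent of the
  random element \<open>S\<close>. Both requirements are phrased for the increments over each uniform grid:
  these determine the law of continuous paths, and they form finite Gaussian vectors. In the applications \<open>S\<close> collects
  the starting points of the curves.
\<close>

definition indep_gauss_paths ::
    "('a \<Rightarrow> 's) \<Rightarrow> 's measure \<Rightarrow> ('i \<Rightarrow> real \<Rightarrow> 'a \<Rightarrow> real) \<Rightarrow> 'i set \<Rightarrow> bool" where
  "indep_gauss_paths S NS \<beta> I \<longleftrightarrow>
     finite I \<and> I \<noteq> {} \<and> S \<in> measurable M NS \<and>
     (\<forall>i\<in>I. \<forall>t\<in>{0..1}. \<beta> i t \<in> borel_measurable M) \<and>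
     (\<forall>i\<in>I. \<forall>\<omega>\<in>space M. continuous_on {0..1} (\<lambda>t. \<beta> i t \<omega>) \<and> \<beta> i 0 \<omega> = 0) \<and>
     (\<forall>K\<ge>1. gauss_vector (grid_incs \<beta> K) (I \<times> {..<K}) \<and>
        indep_pair NS S (\<Pi>\<^sub>M x\<in>I \<times> {..<K}. borel) (\<lambda>\<omega>. \<lambda>x\<in>I \<times> {..<K}. grid_incs \<beta> K x \<omega>))"

lemma sup_norm_measurable:
  assumes "indep_gauss_paths S NS \<beta> I" "i \<in> I"
  shows "(\<lambda>\<omega>. sup_norm (\<lambda>t. \<beta> i t \<omega>)) \<in> borel_measurable M"
  using assms by (intro seq_cont_measurable[OF lip_seq_cont[OF lip_sup_norm]])
    (auto simp: indep_gauss_paths_def)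

text \<open>
  On each dyadic grid this is the bound for Gaussian walks, multiplied by the probability of an
  independent event; the bound is the same for all grids and passes to the limit.
\<close>

lemma indep_gauss_paths_sup_tail:
  assumes G: "indep_gauss_paths S NS \<beta> I" and i: "i \<in> I" and A: "A \<in> sets NS" and r: "0 \<le> r"
  shows "prob {\<omega>\<in>space M. S \<omega> \<in> A \<and> u < sup_norm (\<lambda>t. \<beta> i t \<omega>)}
    \<le> prob {\<omega>\<in>space M. S \<omega> \<in> A} * (4 * exp (r\<^sup>2 / 2 - r * u))"
proof -
  have Sm[measurable]: "S \<in> measurable M NS" using G by (simp add: indep_gauss_paths_def)
  note A[measurable]
  have \<beta>m: "\<beta> i t \<in> borel_measurable M" if "t \<in> {0..1}" for t
    using G i that by (auto simp: indep_gauss_paths_def)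
  have cont: "continuous_on {0..1} (\<lambda>t. \<beta> i t \<omega>)" "\<beta> i 0 \<omega> = 0" if "\<omega> \<in> space M" for \<omega>
    using G i that by (auto simp: indep_gauss_paths_def)
  define C where "C q = {\<omega>\<in>space M. S \<omega> \<in> A \<and> (\<exists>l\<le>2 ^ q. u < \<bar>\<beta> i (real l / 2 ^ q) \<omega>\<bar>)}" for q :: nat
  have Cm: "C q \<in> sets M" for q
  proof -
    have "{\<omega>\<in>space M. S \<omega> \<in> A} \<inter> {\<omega>\<in>space M. \<exists>l\<in>{..2 ^ q}. u < \<bar>\<beta> i (real l / 2 ^ q) \<omega>\<bar>} \<in> sets M"
    proof (intro sets.Int sets.sets_Collect_finite_Ex)
      fix l assume "l \<in> {..2 ^ q :: nat}"
      then have "real l \<le> real (2 ^ q)" by (metis atMost_iff of_nat_le_iff)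
      then have "real l / 2 ^ q \<in> {0..1}" by simp
      from \<beta>m[OF this] show "{\<omega>\<in>space M. u < \<bar>\<beta> i (real l / 2 ^ q) \<omega>\<bar>} \<in> sets M" by measurable
    qed (auto intro: measurable_sets_Collect)
    moreover have "{\<omega>\<in>space M. S \<omega> \<in> A} \<inter> {\<omega>\<in>space M. \<exists>l\<in>{..2 ^ q}. u < \<bar>\<beta> i (real l / 2 ^ q) \<omega>\<bar>} = C q"
      by (auto simp: C_def)
    ultimately show ?thesis by simp
  qed
  have bound: "prob (C q) \<le> prob {\<omega>\<in>space M. S \<omega> \<in> A} * (4 * exp (r\<^sup>2 / 2 - r * u))" for q
  proof -
    define K where "K = (2 ^ q :: nat)"
    have K: "1 \<le> K" by (simp add: K_def)
    let ?P = "\<Pi>\<^sub>M x\<in>I \<times> {..<K}. (borel :: real measure)"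
    let ?D = "\<lambda>\<omega>. \<lambda>x\<in>I \<times> {..<K}. grid_incs \<beta> K x \<omega>"
    define F where "F = {d\<in>space ?P. \<exists>l\<in>{..K}. u < \<bar>(\<Sum>k<l. d (i, k)) / sqrt (real K)\<bar>}"
    have F: "F \<in> sets ?P"
      unfolding F_def
    proof (rule sets.sets_Collect_finite_Ex)
      fix l assume l: "l \<in> {..K}"
      have "(\<lambda>d. \<Sum>k<l. d (i, k)) \<in> borel_measurable ?P"
        using i l by (intro borel_measurable_sum measurable_component_singleton) auto
      then show "{d\<in>space ?P. u < \<bar>(\<Sum>k<l. d (i, k)) / sqrt (real K)\<bar>} \<in> sets ?P" by measurable
    qed simp
    have gv: "gauss_vector (grid_incs \<beta> K) (I \<times> {..<K})"
      and iv: "indep_pair NS S ?P ?D"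
      using G K by (auto simp: indep_gauss_paths_def)
    have sumeq: "(\<Sum>k<l. grid_incs \<beta> K (i, k) \<omega>) / sqrt (real K) = \<beta> i (real l / real K) \<omega>"
      if "\<omega> \<in> space M" for l \<omega>
      using sum_grid_increment[OF K, of "\<lambda>t. \<beta> i t \<omega>"] cont(2)[OF that] by (simp add: grid_incs_def)
    have gv1: "gauss_vector (\<lambda>k. grid_incs \<beta> K (i, k)) {..<K}"
      using i K by (intro gauss_vector_reindex[OF gv]) (auto simp: inj_on_def lessThan_empty_iff)
    have rF: "{\<omega>\<in>space M. ?D \<omega> \<in> F} = {\<omega>\<in>space M. \<exists>l\<le>K. u < \<bar>(\<Sum>k<l. grid_incs \<beta> K (i, k) \<omega>) / sqrt (real K)\<bar>}"
    proof -
      have "(\<Sum>k<l. ?D \<omega> (i, k)) = (\<Sum>k<l. grid_incs \<beta> K (i, k) \<omega>)" if "l \<le> K" for l \<omega>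
        using i that by (intro sum.cong) auto
      moreover have "?D \<omega> \<in> space ?P" for \<omega> by (simp add: space_PiM)
      ultimately show ?thesis unfolding F_def by auto
    qed
    have "C q = {\<omega>\<in>space M. S \<omega> \<in> A \<and> ?D \<omega> \<in> F}"
    proof -
      have "{\<omega>\<in>space M. S \<omega> \<in> A \<and> ?D \<omega> \<in> F} = {\<omega>\<in>space M. S \<omega> \<in> A} \<inter> {\<omega>\<in>space M. ?D \<omega> \<in> F}"
        by auto
      also have "\<dots> = C q"
      proof -
        have "(\<exists>l\<le>K. u < \<bar>(\<Sum>k<l. grid_incs \<beta> K (i, k) \<omega>) / sqrt (real K)\<bar>) \<longleftrightarrow>
            (\<exists>l\<le>2 ^ q. u < \<bar>\<beta> i (real l / 2 ^ q) \<omega>\<bar>)" if "\<omega> \<in> space M" for \<omega>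
          unfolding sumeq[OF that] by (simp add: K_def)
        then show ?thesis unfolding rF C_def by blast
      qed
      finally show ?thesis ..
    qed
    then have "prob (C q) = prob {\<omega>\<in>space M. S \<omega> \<in> A} * prob {\<omega>\<in>space M. ?D \<omega> \<in> F}"
      using iv A F by (simp add: indep_pair_def)
    also have "prob {\<omega>\<in>space M. ?D \<omega> \<in> F} \<le> 4 * exp (r\<^sup>2 / 2 - r * u)"
      unfolding rF by (rule gauss_max_tail[OF gv1 K r])
    finally show ?thesis by (simp add: mult_left_mono)
  qed
  have "incseq C"
  proof (rule incseq_SucI)
    fix q
    show "C q \<subseteq> C (Suc q)"
    proof
      fix \<omega> assume "\<omega> \<in> C q"
      then obtain l where l: "\<omega> \<in> space M" "S \<omega> \<in> A" "l \<le> 2 ^ q" "u < \<bar>\<beta> i (real l / 2 ^ q) \<omega>\<bar>"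
        by (auto simp: C_def)
      have "real (2 * l) / 2 ^ Suc q = real l / 2 ^ q" by simp
      with l have "2 * l \<le> 2 ^ Suc q" "u < \<bar>\<beta> i (real (2 * l) / 2 ^ Suc q) \<omega>\<bar>" by auto
      with l(1,2) show "\<omega> \<in> C (Suc q)" unfolding C_def by blast
    qed
  qed
  then have lim: "(\<lambda>q. prob (C q)) \<longlonglongrightarrow> prob (\<Union>q. C q)"
    using Cm by (intro finite_Lim_measure_incseq) auto
  have "prob {\<omega>\<in>space M. S \<omega> \<in> A \<and> u < sup_norm (\<lambda>t. \<beta> i t \<omega>)} \<le> prob (\<Union>q. C q)"
  proof (rule finite_measure_mono)
    show "{\<omega>\<in>space M. S \<omega> \<in> A \<and> u < sup_norm (\<lambda>t. \<beta> i t \<omega>)} \<subseteq> (\<Union>q. C q)"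
    proof safe
      fix \<omega> assume \<omega>: "\<omega> \<in> space M" "S \<omega> \<in> A" "u < sup_norm (\<lambda>t. \<beta> i t \<omega>)"
      from sup_norm_dyadic[OF cont(1)[OF \<omega>(1)] \<omega>(3)] \<omega>(1,2)
      show "\<omega> \<in> (\<Union>q. C q)" by (simp add: C_def)
    qed
  qed (use Cm in auto)
  also have "\<dots> \<le> prob {\<omega>\<in>space M. S \<omega> \<in> A} * (4 * exp (r\<^sup>2 / 2 - r * u))"
    using lim bound by (intro LIMSEQ_le_const2) auto
  finally show ?thesis .
qed

end

section \<open>Projection onto an independent random direction\<close>

context prob_space
begin

lemma gauss_vector_coordinates:
  assumes T: "finite T" "T \<noteq> {}"
  shows "prob_space.gauss_vector (\<Pi>\<^sub>M t\<in>T. std_gauss) (\<lambda>t z. z t) T"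
proof -
  interpret G: prob_space "\<Pi>\<^sub>M t\<in>T. std_gauss"
    by (intro prob_space_PiM prob_space_std_gauss)
  show ?thesis
  proof (rule G.gauss_vector_distrI[OF T])
    show "(\<lambda>z. z t) \<in> borel_measurable (\<Pi>\<^sub>M t\<in>T. std_gauss)" if "t \<in> T" for t
      using measurable_component_singleton[OF that, of "\<lambda>_. std_gauss"]
      unfolding measurable_cong_sets[OF refl sets_std_gauss] .
    have "distr (\<Pi>\<^sub>M t\<in>T. std_gauss) (\<Pi>\<^sub>M t\<in>T. borel) (\<lambda>z. \<lambda>t\<in>T. z t)
        = distr (\<Pi>\<^sub>M t\<in>T. std_gauss) (\<Pi>\<^sub>M t\<in>T. std_gauss) (\<lambda>z. z)"
      by (intro distr_cong refl sets_PiM_cong) (auto simp: space_PiM PiE_def extensional_restrict)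
    then show "distr (\<Pi>\<^sub>M t\<in>T. std_gauss) (\<Pi>\<^sub>M t\<in>T. borel) (\<lambda>z. \<lambda>t\<in>T. z t) = (\<Pi>\<^sub>M t\<in>T. std_gauss)"
      by (simp add: distr_id)
  qed
qed

text \<open>
  For each \<open>i\<close> a Gaussian vector indexed by \<open>J\<close> is projected onto a unit vector. Blocks for different indices use
  disjoint coordinates and so stay independent.
\<close>

lemma gauss_vector_rotate:
  assumes Z: "gauss_vector Z ((I \<times> J) \<times> L)" and ne: "I \<times> L \<noteq> {}" and J: "finite J" "J \<noteq> {}"
    and unit: "\<And>i. i \<in> I \<Longrightarrow> (\<Sum>j\<in>J. (c (i, j))\<^sup>2) = 1"
  shows "gauss_vector (\<lambda>x \<omega>. \<Sum>j\<in>J. c (fst x, j) * Z ((fst x, j), snd x) \<omega>) (I \<times> L)"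
  unfolding gauss_vector_def
proof (intro conjI ballI)
  have "finite ((I \<times> J) \<times> L)" using Z by (simp add: gauss_vector_def)
  then show fin: "finite (I \<times> L)" using J ne
    by (auto simp: finite_cartesian_product_iff)
  define B where "B x = (\<lambda>j. ((fst x, j), snd x)) ` J" for x :: "'b \<times> 'd"
  have Bsub: "B x \<subseteq> (I \<times> J) \<times> L" if "x \<in> I \<times> L" for x using that by (auto simp: B_def)
  have "indep_vars (\<lambda>x. PiM (B x) (\<lambda>_. borel)) (\<lambda>x \<omega>. restrict (\<lambda>t. Z t \<omega>) (B x)) (I \<times> L)"
    using Z Bsub by (intro indep_vars_restrict[where I = "(I \<times> J) \<times> L"])
      (auto simp: gauss_vector_def disjoint_family_on_def B_def)
  then have "indep_vars (\<lambda>_. borel) (\<lambda>x \<omega>. \<Sum>j\<in>J. c (fst x, j) * restrict (\<lambda>t. Z t \<omega>) (B x) ((fst x, j), snd x)) (I \<times> L)"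
  proof (rule indep_vars_compose2)
    show "(\<lambda>z. \<Sum>j\<in>J. c (fst x, j) * z ((fst x, j), snd x)) \<in> borel_measurable (PiM (B x) (\<lambda>_. borel))" for x
      by (intro borel_measurable_sum borel_measurable_times borel_measurable_const measurable_component_singleton)
        (auto simp: B_def)
  qed
  moreover have "restrict (\<lambda>t. Z t \<omega>) (B x) ((fst x, j), snd x) = Z ((fst x, j), snd x) \<omega>" if "j \<in> J" for j x \<omega>
    using that by (auto simp: B_def)
  ultimately show "indep_vars (\<lambda>_. borel) (\<lambda>x \<omega>. \<Sum>j\<in>J. c (fst x, j) * Z ((fst x, j), snd x) \<omega>) (I \<times> L)"
    by (simp cong: sum.cong)
  fix x assume x: "x \<in> I \<times> L"
  have inj: "inj_on (\<lambda>j. ((fst x, j), snd x)) J" by (auto simp: inj_on_def)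
  have "distributed M lborel (\<lambda>\<omega>. \<Sum>t\<in>B x. c (fst t) * Z t \<omega>) (normal_density 0 1)"
  proof (rule gauss_vector_sum[OF Z Bsub[OF x]])
    show "(\<Sum>t\<in>B x. (c (fst t))\<^sup>2) = 1\<^sup>2"
      unfolding B_def using unit[of "fst x"] x by (subst sum.reindex[OF inj]) (auto simp: comp_def)
  qed simp
  then have "distr M borel (\<lambda>\<omega>. \<Sum>t\<in>B x. c (fst t) * Z t \<omega>) = std_gauss"
    by (rule distributed_std_gauss)
  then show "distr M borel (\<lambda>\<omega>. \<Sum>j\<in>J. c (fst x, j) * Z ((fst x, j), snd x) \<omega>) = std_gauss"
    unfolding B_def by (subst (asm) sum.reindex[OF inj]) (simp add: comp_def)
qed

text \<open>
  The unit vectors may depend on the random element \<open>S\<close>, as long as \<open>S\<close> is independent of the paths: given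
  \<open>S\<close>, the projected increments are standard Gaussian, whatever the value of \<open>S\<close>, so
  they are also independent of \<open>S\<close>. This makes the radial part of the motion a Brownian motion.
\<close>

lemma indep_gauss_paths_rotate:
  assumes G: "indep_gauss_paths S NS b (I \<times> J)" and J: "finite J" "J \<noteq> {}"
    and \<theta>: "\<And>x. x \<in> I \<times> J \<Longrightarrow> \<theta> x \<in> borel_measurable NS"
    and unit: "\<And>i s. i \<in> I \<Longrightarrow> s \<in> space NS \<Longrightarrow> (\<Sum>j\<in>J. (\<theta> (i, j) s)\<^sup>2) = 1"
  shows "indep_gauss_paths S NS (\<lambda>i t \<omega>. \<Sum>j\<in>J. \<theta> (i, j) (S \<omega>) * b (i, j) t \<omega>) I"
proof -
  define \<beta> where "\<beta> i t \<omega> = (\<Sum>j\<in>J. \<theta> (i, j) (S \<omega>) * b (i, j) t \<omega>)" for i t \<omega>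
  have S[measurable]: "S \<in> measurable M NS" using G by (simp add: indep_gauss_paths_def)
  have I: "finite I" "I \<noteq> {}" using G J by (auto simp: indep_gauss_paths_def finite_cartesian_product_iff)
  have \<theta>S: "(\<lambda>\<omega>. \<theta> x (S \<omega>)) \<in> borel_measurable M" if "x \<in> I \<times> J" for x
    using measurable_compose[OF S \<theta>[OF that]] .
  have bm: "b x t \<in> borel_measurable M" if "x \<in> I \<times> J" "t \<in> {0..1}" for x t
    using G that by (auto simp: indep_gauss_paths_def)
  have bc: "continuous_on {0..1} (\<lambda>t. b x t \<omega>)" "b x 0 \<omega> = 0" if "x \<in> I \<times> J" "\<omega> \<in> space M" for x \<omega>
    using G that by (auto simp: indep_gauss_paths_def)
  have \<beta>m: "\<beta> i t \<in> borel_measurable M" if "i \<in> I" "t \<in> {0..1}" for i t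
    unfolding \<beta>_def using that by (intro borel_measurable_sum borel_measurable_times \<theta>S bm) auto
  have "indep_gauss_paths S NS \<beta> I"
    unfolding indep_gauss_paths_def
  proof (intro conjI ballI allI impI I S \<beta>m)
    fix i \<omega> assume i: "i \<in> I" and \<omega>: "\<omega> \<in> space M"
    show "continuous_on {0..1} (\<lambda>t. \<beta> i t \<omega>)"
      unfolding \<beta>_def using i \<omega> by (intro continuous_on_sum continuous_on_mult_left bc) auto
    show "\<beta> i 0 \<omega> = 0" unfolding \<beta>_def using bc(2) i \<omega> by (intro sum.neutral) auto
  next
    fix K :: nat assume K: "1 \<le> K"
    let ?T = "(I \<times> J) \<times> {..<K}" and ?T' = "I \<times> {..<K}"
    let ?P = "\<Pi>\<^sub>M t\<in>?T. (borel :: real measure)" and ?P' = "\<Pi>\<^sub>M t\<in>?T'. (borel :: real measure)"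
    let ?g = "\<Pi>\<^sub>M t\<in>?T. std_gauss" and ?g' = "\<Pi>\<^sub>M t\<in>?T'. std_gauss"
    have T: "finite ?T" "?T \<noteq> {}" "finite ?T'" "?T' \<noteq> {}"
      using I J K by (auto simp: lessThan_empty_iff)
    interpret g: prob_space ?g by (intro prob_space_PiM prob_space_std_gauss)
    interpret g': prob_space ?g' by (intro prob_space_PiM prob_space_std_gauss)
    define D where "D \<omega> = (\<lambda>x\<in>?T. grid_incs b K x \<omega>)" for \<omega>
    define rot where "rot s z = (\<lambda>x\<in>?T'. \<Sum>j\<in>J. \<theta> (fst x, j) s * z ((fst x, j), snd x))" for s z
    have gv: "gauss_vector (grid_incs b K) ?T" and ip: "indep_pair NS S ?P D"
      using G K by (auto simp: indep_gauss_paths_def D_def[abs_def])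
    have Dm[measurable]: "D \<in> measurable M ?P" using ip by (simp add: indep_pair_def)
    have Ddist: "distr M ?P D = ?g" unfolding D_def by (rule gauss_vector_distr[OF gv T(2)])
    have joint: "distr M (NS \<Otimes>\<^sub>M ?P) (\<lambda>\<omega>. (S \<omega>, D \<omega>)) = distr M NS S \<Otimes>\<^sub>M ?g"
      using indep_pair_distr[OF ip] Ddist by simp
    have inc: "grid_incs \<beta> K x \<omega> = rot (S \<omega>) (D \<omega>) x" if x: "x \<in> ?T'" for x \<omega>
    proof -
      have "grid_incs \<beta> K x \<omega> = (\<Sum>j\<in>J. \<theta> (fst x, j) (S \<omega>) * grid_incs b K ((fst x, j), snd x) \<omega>)"
        unfolding grid_incs_def grid_increment_def \<beta>_def
        by (simp add: sum_distrib_left sum_subtractf[symmetric] algebra_simps)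
      also have "\<dots> = rot (S \<omega>) (D \<omega>) x"
        using x by (auto simp: rot_def D_def intro!: sum.cong)
      finally show ?thesis .
    qed
    have \<beta>D: "(\<lambda>x\<in>?T'. grid_incs \<beta> K x \<omega>) = rot (S \<omega>) (D \<omega>)" for \<omega>
    proof
      fix x show "(\<lambda>x\<in>?T'. grid_incs \<beta> K x \<omega>) x = rot (S \<omega>) (D \<omega>) x"
        using inc[of x \<omega>] by (cases "x \<in> ?T'") (auto simp: rot_def)
    qed
    have rotm: "(\<lambda>(s, z). rot s z) \<in> measurable (NS \<Otimes>\<^sub>M ?P) ?P'"
      unfolding rot_def split_beta
    proof (intro measurable_restrict borel_measurable_sum borel_measurable_times)
      fix x j assume x: "x \<in> ?T'" and j: "j \<in> J"
      show "(\<lambda>p. \<theta> (fst x, j) (fst p)) \<in> borel_measurable (NS \<Otimes>\<^sub>M ?P)"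
        using x j by (intro measurable_compose[OF measurable_fst \<theta>]) auto
      show "(\<lambda>p. snd p ((fst x, j), snd x)) \<in> borel_measurable (NS \<Otimes>\<^sub>M ?P)"
        using x j by (intro measurable_compose[OF measurable_snd measurable_component_singleton]) auto
    qed
    have sliced: "distr ?g ?P' (rot s) = ?g'" if s: "s \<in> space NS" for s
    proof -
      have "g.gauss_vector (\<lambda>x z. \<Sum>j\<in>J. \<theta> (fst x, j) s * z ((fst x, j), snd x)) ?T'"
        using g.gauss_vector_rotate[OF gauss_vector_coordinates[OF T(1,2)] T(4) J, of "\<lambda>x. \<theta> x s"] unit s by simp
      from g.gauss_vector_distr[OF this T(4)] show ?thesis unfolding rot_def .
    qed
    \<comment> \<open>Fubini: integrate out the increments first, for a fixed value \<open>s\<close> of \<open>S\<close>\<close>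
    have key: "prob {\<omega>\<in>space M. S \<omega> \<in> A \<and> rot (S \<omega>) (D \<omega>) \<in> F} = prob {\<omega>\<in>space M. S \<omega> \<in> A} * measure ?g' F"
      if A[measurable]: "A \<in> sets NS" and F[measurable]: "F \<in> sets ?P'" for A F
    proof -
      define R where "R = {p\<in>space (NS \<Otimes>\<^sub>M ?P). fst p \<in> A \<and> (case p of (s, z) \<Rightarrow> rot s z) \<in> F}"
      have Rm[measurable]: "R \<in> sets (NS \<Otimes>\<^sub>M ?P)"
        unfolding R_def using rotm by measurable
      have sg: "sets ?P = sets ?g" by (intro sets_PiM_cong) auto
      have "emeasure M {\<omega>\<in>space M. S \<omega> \<in> A \<and> rot (S \<omega>) (D \<omega>) \<in> F}
          = emeasure (distr M (NS \<Otimes>\<^sub>M ?P) (\<lambda>\<omega>. (S \<omega>, D \<omega>))) R"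
      proof -
        have "(\<lambda>\<omega>. (S \<omega>, D \<omega>)) -` R \<inter> space M = {\<omega>\<in>space M. S \<omega> \<in> A \<and> rot (S \<omega>) (D \<omega>) \<in> F}"
          using measurable_space[OF S] measurable_space[OF Dm] by (auto simp: R_def space_pair_measure)
        then show ?thesis using emeasure_distr[OF measurable_Pair[OF S Dm] Rm] by simp
      qed
      also have "\<dots> = (\<integral>\<^sup>+s. emeasure ?g (Pair s -` R) \<partial>distr M NS S)"
        unfolding joint
      proof (rule g.emeasure_pair_measure_alt)
        show "R \<in> sets (distr M NS S \<Otimes>\<^sub>M ?g)" using Rm sg by (simp cong: sets_pair_measure_cong)
      qed
      also have "\<dots> = (\<integral>\<^sup>+s. emeasure ?g' F * indicator A s \<partial>distr M NS S)"
      proof (rule nn_integral_cong)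
        fix s assume "s \<in> space (distr M NS S)"
        then have s: "s \<in> space NS" by simp
        have rs: "rot s \<in> measurable ?P ?P'"
          using measurable_compose[OF measurable_Pair1'[OF s] rotm] by simp
        then have rs': "rot s \<in> measurable ?g ?P'" using sg by (simp cong: measurable_cong_sets)
        have spg: "space ?P = space ?g" by (simp add: space_PiM)
        have "emeasure ?g' F = emeasure (distr ?g ?P' (rot s)) F" by (simp add: sliced[OF s])
        also have "\<dots> = emeasure ?g (rot s -` F \<inter> space ?g)" by (rule emeasure_distr[OF rs' F])
        finally have e: "emeasure ?g' F = emeasure ?g (rot s -` F \<inter> space ?g)" .
        show "emeasure ?g (Pair s -` R) = emeasure ?g' F * indicator A s"
        proof (cases "s \<in> A")
          case True
          then have "Pair s -` R = rot s -` F \<inter> space ?g"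
            using s spg by (auto simp: R_def space_pair_measure)
          then show ?thesis using e True by simp
        next
          case False
          then have "Pair s -` R = {}" by (auto simp: R_def)
          then show ?thesis using False by simp
        qed
      qed
      also have "\<dots> = emeasure ?g' F * emeasure (distr M NS S) A"
        by (rule nn_integral_cmult_indicator) simp
      also have "emeasure (distr M NS S) A = emeasure M {\<omega>\<in>space M. S \<omega> \<in> A}"
        by (subst emeasure_distr) (auto intro!: arg_cong[where f = "emeasure M"])
      finally show ?thesis
        unfolding emeasure_eq_measure g'.emeasure_eq_measure
        by (simp add: ennreal_mult[symmetric] mult.commute)
    qed
    have m': "(\<lambda>\<omega>. rot (S \<omega>) (D \<omega>)) \<in> measurable M ?P'"
      using measurable_compose[OF measurable_Pair[OF S Dm] rotm] by simp
    have law: "prob {\<omega>\<in>space M. rot (S \<omega>) (D \<omega>) \<in> F} = measure ?g' F" if F: "F \<in> sets ?P'" for F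
    proof -
      have "{\<omega>\<in>space M. S \<omega> \<in> space NS} = space M" using measurable_space[OF S] by auto
      moreover have "{\<omega>\<in>space M. S \<omega> \<in> space NS \<and> rot (S \<omega>) (D \<omega>) \<in> F} = {\<omega>\<in>space M. rot (S \<omega>) (D \<omega>) \<in> F}"
        using measurable_space[OF S] by auto
      ultimately show ?thesis using key[OF sets.top F] by (simp add: prob_space)
    qed
    show "gauss_vector (grid_incs \<beta> K) ?T'"
    proof (rule gauss_vector_distrI[OF T(3,4)])
      show "grid_incs \<beta> K t \<in> borel_measurable M" if "t \<in> ?T'" for t
      proof -
        obtain i l where t: "t = (i, l)" "i \<in> I" "l < K" using \<open>t \<in> ?T'\<close> by auto
        have "real (Suc l) / real K \<in> {0..1}" "real l / real K \<in> {0..1}" using t(3) by auto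
        from \<beta>m[OF t(2) this(1)] \<beta>m[OF t(2) this(2)]
        show ?thesis unfolding grid_incs_def grid_increment_def t(1) fst_conv snd_conv by measurable
      qed
      show "distr M ?P' (\<lambda>\<omega>. \<lambda>t\<in>?T'. grid_incs \<beta> K t \<omega>) = ?g'"
        unfolding \<beta>D
      proof (rule measure_eqI)
        show "sets (distr M ?P' (\<lambda>\<omega>. rot (S \<omega>) (D \<omega>))) = sets ?g'" by (auto intro!: sets_PiM_cong)
        fix F assume "F \<in> sets (distr M ?P' (\<lambda>\<omega>. rot (S \<omega>) (D \<omega>)))"
        then have F: "F \<in> sets ?P'" by simp
        have "(\<lambda>\<omega>. rot (S \<omega>) (D \<omega>)) -` F \<inter> space M = {\<omega>\<in>space M. rot (S \<omega>) (D \<omega>) \<in> F}" by auto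
        then show "emeasure (distr M ?P' (\<lambda>\<omega>. rot (S \<omega>) (D \<omega>))) F = emeasure ?g' F"
          by (simp add: emeasure_distr[OF m' F] emeasure_eq_measure g'.emeasure_eq_measure law[OF F])
      qed
    qed
    show "indep_pair NS S ?P' (\<lambda>\<omega>. \<lambda>x\<in>?T'. grid_incs \<beta> K x \<omega>)"
      unfolding \<beta>D indep_pair_def using S m' key law by auto
  qed
  then show ?thesis unfolding \<beta>_def[abs_def] .
qed

text \<open>
  Brownian motions are continuous and start from 0 only almost surely. A regular version has these
  properties for every outcome, so that suprema over paths are finite and measurable.
\<close>

definition regular_version :: "('i \<Rightarrow> real \<Rightarrow> 'a \<Rightarrow> real) \<Rightarrow> ('i \<Rightarrow> real \<Rightarrow> 'a \<Rightarrow> real) \<Rightarrow> 'i set \<Rightarrow> bool" where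
  "regular_version B B' I \<longleftrightarrow>
     (\<forall>x\<in>I. \<forall>t\<ge>0. B' x t \<in> borel_measurable M) \<and>
     (\<forall>x\<in>I. \<forall>\<omega>\<in>space M. continuous_on {0..} (\<lambda>t. B' x t \<omega>) \<and> B' x 0 \<omega> = 0) \<and>
     (AE \<omega> in M. \<forall>x\<in>I. \<forall>t\<ge>0. B' x t \<omega> = B x t \<omega>)"

lemma regular_version_exists:
  assumes B: "indep_brownian_motions B I" and I: "countable I"
  shows "\<exists>B'. regular_version B B' I"
proof -
  have BM: "std_brownian_motion (B x)" if "x \<in> I" for x
    using B that by (auto simp: indep_brownian_motions_def)
  have "AE \<omega> in M. \<forall>x\<in>I. continuous_on {0..} (\<lambda>t. B x t \<omega>) \<and> B x 0 \<omega> = 0"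
    using BM by (intro AE_ball_countable'[OF _ I]) (auto simp: std_brownian_motion_def)
  then obtain C where C: "C \<in> null_sets M"
    "{\<omega>\<in>space M. \<not> (\<forall>x\<in>I. continuous_on {0..} (\<lambda>t. B x t \<omega>) \<and> B x 0 \<omega> = 0)} \<subseteq> C"
    by (auto simp: eventually_ae_filter)
  define B' where "B' x t \<omega> = (if \<omega> \<in> C then 0 else B x t \<omega>)" for x t \<omega>
  have C': "C \<in> sets M" using C by auto
  have "AE \<omega> in M. \<omega> \<notin> C" using C by (simp add: AE_not_in)
  then have "AE \<omega> in M. \<forall>x\<in>I. \<forall>t\<ge>0. B' x t \<omega> = B x t \<omega>"
    by eventually_elim (simp add: B'_def)
  moreover have "B' x t \<in> borel_measurable M" if "x \<in> I" "0 \<le> t" for x t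
  proof -
    have "B x t \<in> borel_measurable M" using BM[OF that(1)] that(2) by (auto simp: std_brownian_motion_def)
    then show ?thesis unfolding B'_def using C' by measurable
  qed
  moreover have "continuous_on {0..} (\<lambda>t. B' x t \<omega>) \<and> B' x 0 \<omega> = 0" if "x \<in> I" "\<omega> \<in> space M" for x \<omega>
    using C(2) that by (cases "\<omega> \<in> C") (auto simp: B'_def)
  ultimately show ?thesis unfolding regular_version_def by blast
qed

end

section \<open>Brownian motions as Gaussian paths\<close>

context prob_space
begin

lemma indep_gauss_paths_brownian:
  assumes B: "indep_brownian_motions B UNIV" and reg: "regular_version B B' UNIV"
    and I: "finite I" "I \<noteq> {}"
    and ind: "indep_pair NS S (\<Pi>\<^sub>M i\<in>UNIV. path_space) (\<lambda>\<omega> i. path (B i) \<omega>)"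
  shows "indep_gauss_paths S NS B' I"
  unfolding indep_gauss_paths_def
proof (intro conjI I ballI allI impI)
  show "S \<in> measurable M NS" using ind by (simp add: indep_pair_def)
  show "B' i t \<in> borel_measurable M" if "t \<in> {0..1}" for i t
    using reg that by (auto simp: regular_version_def)
  show "continuous_on {0..1} (\<lambda>t. B' i t \<omega>)" "B' i 0 \<omega> = 0" if "\<omega> \<in> space M" for i \<omega>
    using reg that by (auto simp: regular_version_def intro: continuous_on_subset[of "{0..}"])
  fix K :: nat assume K: "1 \<le> K"
  let ?T = "I \<times> {..<K}"
  let ?P = "\<Pi>\<^sub>M x\<in>?T. (borel :: real measure)"
  have T: "?T \<noteq> {}" using I K by (auto simp: lessThan_empty_iff)
  have eq: "AE \<omega> in M. grid_incs B' K x \<omega> = grid_incs B K x \<omega>" for x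
  proof -
    have "AE \<omega> in M. \<forall>x\<in>UNIV. \<forall>t\<ge>0. B' x t \<omega> = B x t \<omega>" using reg by (simp add: regular_version_def)
    then show ?thesis by eventually_elim (simp add: grid_incs_def grid_increment_def)
  qed
  have m': "grid_incs B' K x \<in> borel_measurable M" for x
  proof -
    have "B' (fst x) (real l / real K) \<in> borel_measurable M" for l
      using reg by (auto simp: regular_version_def)
    then show ?thesis unfolding grid_incs_def grid_increment_def by measurable
  qed
  define \<tau> where "\<tau> l = real l / real K" for l
  have "gauss_vector (\<lambda>x \<omega>. (B (fst x) (\<tau> (Suc (snd x))) \<omega> - B (fst x) (\<tau> (snd x)) \<omega>)
      / sqrt (\<tau> (Suc (snd x)) - \<tau> (snd x))) ?T"
    using K by (intro brownian_increments_gauss[OF B _ I]) (auto simp: \<tau>_def strict_mono_on_def divide_strict_right_mono)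
  then have gv: "gauss_vector (grid_incs B K) ?T"
  proof (rule gauss_vector_cong)
    fix t :: "'b \<times> nat"
    have "\<tau> (Suc (snd t)) - \<tau> (snd t) = 1 / real K" by (simp add: \<tau>_def diff_divide_distrib[symmetric])
    then show "(\<lambda>\<omega>. (B (fst t) (\<tau> (Suc (snd t))) \<omega> - B (fst t) (\<tau> (snd t)) \<omega>)
      / sqrt (\<tau> (Suc (snd t)) - \<tau> (snd t))) = grid_incs B K t"
      by (simp add: grid_incs_def grid_increment_def \<tau>_def real_sqrt_divide fun_eq_iff)
  qed
  show "gauss_vector (grid_incs B' K) ?T"
    by (rule gauss_vector_AE[OF gv T m' eq])
  define g where "g p = (\<lambda>x\<in>?T. grid_increment K (p (fst x)) (snd x))" for p :: "'b \<Rightarrow> real \<Rightarrow> real"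
  have gm: "g \<in> measurable (\<Pi>\<^sub>M i\<in>UNIV. path_space) ?P"
    unfolding g_def
  proof (rule measurable_restrict)
    fix x :: "'b \<times> nat" assume "x \<in> ?T"
    have "(\<lambda>p. p (fst x) (real l / real K)) \<in> borel_measurable (\<Pi>\<^sub>M i\<in>UNIV. path_space)" for l
    proof (rule measurable_compose[OF measurable_component_singleton])
      show "(\<lambda>f. f (real l / real K)) \<in> borel_measurable path_space"
        unfolding path_space_def by (intro measurable_component_singleton) auto
    qed simp
    then show "(\<lambda>p. grid_increment K (p (fst x)) (snd x)) \<in> borel_measurable (\<Pi>\<^sub>M i\<in>UNIV. path_space)"
      unfolding grid_increment_def by measurable
  qed
  have gD: "g (\<lambda>i. path (B i) \<omega>) = (\<lambda>x\<in>?T. grid_incs B K x \<omega>)" for \<omega>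
    unfolding g_def by (intro restrict_ext) (simp add: grid_incs_def grid_increment_def path_def)
  have "indep_pair NS S ?P (\<lambda>\<omega>. \<lambda>x\<in>?T. grid_incs B K x \<omega>)"
    unfolding indep_pair_def
  proof (intro conjI ballI)
    show "S \<in> measurable M NS" using ind by (simp add: indep_pair_def)
    show "(\<lambda>\<omega>. \<lambda>x\<in>?T. grid_incs B K x \<omega>) \<in> measurable M ?P"
      by (rule gauss_vector_restrict_measurable[OF gv])
    fix A E assume A: "A \<in> sets NS" and E: "E \<in> sets ?P"
    have pm: "(\<lambda>\<omega> i. path (B i) \<omega>) \<in> measurable M (\<Pi>\<^sub>M i\<in>UNIV. path_space)"
      using ind by (simp add: indep_pair_def)
    have "(\<lambda>x\<in>?T. grid_incs B K x \<omega>) \<in> E \<longleftrightarrow>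
        (\<lambda>i. path (B i) \<omega>) \<in> g -` E \<inter> space (\<Pi>\<^sub>M i\<in>UNIV. path_space)" if "\<omega> \<in> space M" for \<omega>
      using measurable_space[OF pm that] by (simp add: gD)
    then have *: "{\<omega>\<in>space M. S \<omega> \<in> A \<and> (\<lambda>x\<in>?T. grid_incs B K x \<omega>) \<in> E}
        = {\<omega>\<in>space M. S \<omega> \<in> A \<and> (\<lambda>i. path (B i) \<omega>) \<in> g -` E \<inter> space (\<Pi>\<^sub>M i\<in>UNIV. path_space)}"
      "{\<omega>\<in>space M. (\<lambda>x\<in>?T. grid_incs B K x \<omega>) \<in> E}
        = {\<omega>\<in>space M. (\<lambda>i. path (B i) \<omega>) \<in> g -` E \<inter> space (\<Pi>\<^sub>M i\<in>UNIV. path_space)}"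
      by blast+
    show "prob {\<omega>\<in>space M. S \<omega> \<in> A \<and> (\<lambda>x\<in>?T. grid_incs B K x \<omega>) \<in> E}
        = prob {\<omega>\<in>space M. S \<omega> \<in> A} * prob {\<omega>\<in>space M. (\<lambda>x\<in>?T. grid_incs B K x \<omega>) \<in> E}"
      unfolding * using ind measurable_sets[OF gm E] A unfolding indep_pair_def by blast
  qed
  then show "indep_pair NS S ?P (\<lambda>\<omega>. \<lambda>x\<in>?T. grid_incs B' K x \<omega>)"
  proof (rule indep_pair_AE)
    show "(\<lambda>\<omega>. \<lambda>x\<in>?T. grid_incs B' K x \<omega>) \<in> measurable M ?P" using m' by (intro measurable_restrict)
    have "AE \<omega> in M. \<forall>x\<in>?T. grid_incs B' K x \<omega> = grid_incs B K x \<omega>"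
      using I eq by (intro AE_finite_allI) auto
    then show "AE \<omega> in M. (\<lambda>x\<in>?T. grid_incs B' K x \<omega>) = (\<lambda>x\<in>?T. grid_incs B K x \<omega>)"
      by eventually_elim auto
  qed
qed

text \<open>
  The Markov property at time 1 and Brownian scaling. The values at time 1 are the increments over the unit interval, so
  they are coordinates of the same Gaussian vector as the later increments.
\<close>

lemma brownian_after_time_1:
  assumes B: "indep_brownian_motions B I" and reg: "regular_version B B' I"
    and I0: "I0 \<subseteq> I" "finite I0" "I0 \<noteq> {}" and b: "0 < b"
  shows "gauss_vector (\<lambda>x. B' x 1) I0"
    and "indep_gauss_paths (\<lambda>\<omega>. \<lambda>x\<in>I0. B' x 1 \<omega>) (\<Pi>\<^sub>M x\<in>I0. borel)
      (\<lambda>x t \<omega>. sqrt b * (B' x (1 + t / b) \<omega> - B' x 1 \<omega>)) I0"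
proof -
  define \<beta> where "\<beta> x t \<omega> = sqrt b * (B' x (1 + t / b) \<omega> - B' x 1 \<omega>)" for x t \<omega>
  define S where "S \<omega> = (\<lambda>x\<in>I0. B' x 1 \<omega>)" for \<omega>
  have Bm: "B' x t \<in> borel_measurable M" if "x \<in> I0" "0 \<le> t" for x t
    using reg that I0 by (auto simp: regular_version_def)
  have Bc: "continuous_on {0..} (\<lambda>t. B' x t \<omega>)" "B' x 0 \<omega> = 0" if "x \<in> I0" "\<omega> \<in> space M" for x \<omega>
    using reg that I0 by (auto simp: regular_version_def)
  have main: "gauss_vector (\<lambda>x \<omega>. case snd x of 0 \<Rightarrow> B' (fst x) 1 \<omega> | Suc l \<Rightarrow> grid_incs \<beta> K (fst x, l) \<omega>)
      (I0 \<times> {..<Suc K})" if K: "1 \<le> K" for K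
  proof -
    \<comment> \<open>the first step goes from 0 to 1; the others have length \<open>1 / (K * b)\<close>\<close>
    define \<tau> where "\<tau> l = (case l of 0 \<Rightarrow> 0 | Suc l \<Rightarrow> 1 + real l / (real K * b))" for l
    have "gauss_vector (\<lambda>x \<omega>. (B (fst x) (\<tau> (Suc (snd x))) \<omega> - B (fst x) (\<tau> (snd x)) \<omega>)
        / sqrt (\<tau> (Suc (snd x)) - \<tau> (snd x))) (I0 \<times> {..<Suc K})"
    proof (rule brownian_increments_gauss[OF B I0])
      show "strict_mono_on {..Suc K} \<tau>"
      proof (rule strict_mono_onI)
        fix r s :: nat assume "r < s"
        then show "\<tau> r < \<tau> s"
          using b K by (cases r; cases s) (auto simp: \<tau>_def divide_strict_right_mono add_pos_nonneg)
      qed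
    qed (auto simp: \<tau>_def)
    then show ?thesis
    proof (rule gauss_vector_AE)
      show "I0 \<times> {..<Suc K} \<noteq> {}" using I0 by (auto simp: lessThan_empty_iff)
      fix x :: "'b \<times> nat" assume x: "x \<in> I0 \<times> {..<Suc K}"
      have \<beta>m: "\<beta> (fst x) t \<in> borel_measurable M" if "0 \<le> t" for t
      proof -
        have [measurable]: "B' (fst x) (1 + t / b) \<in> borel_measurable M" "B' (fst x) 1 \<in> borel_measurable M"
          using Bm x b that by auto
        show ?thesis unfolding \<beta>_def by measurable
      qed
      show "(\<lambda>\<omega>. case snd x of 0 \<Rightarrow> B' (fst x) 1 \<omega> | Suc l \<Rightarrow> grid_incs \<beta> K (fst x, l) \<omega>) \<in> borel_measurable M"
      proof (cases "snd x")
        case 0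
        then show ?thesis using Bm[of "fst x" 1] x by auto
      next
        case (Suc l)
        have [measurable]: "\<beta> (fst x) (real l / real K) \<in> borel_measurable M"
          "\<beta> (fst x) (real (Suc l) / real K) \<in> borel_measurable M"
          by (intro \<beta>m; simp)+
        show ?thesis unfolding Suc grid_incs_def grid_increment_def nat.case fst_conv snd_conv by measurable
      qed
      have "AE \<omega> in M. \<forall>x\<in>I. \<forall>t\<ge>0. B' x t \<omega> = B x t \<omega>" using reg by (simp add: regular_version_def)
      then show "AE \<omega> in M. (case snd x of 0 \<Rightarrow> B' (fst x) 1 \<omega> | Suc l \<Rightarrow> grid_incs \<beta> K (fst x, l) \<omega>)
          = (B (fst x) (\<tau> (Suc (snd x))) \<omega> - B (fst x) (\<tau> (snd x)) \<omega>) / sqrt (\<tau> (Suc (snd x)) - \<tau> (snd x))"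
        using AE_space
      proof eventually_elim
        case (elim \<omega>)
        have xI: "fst x \<in> I" "fst x \<in> I0" using x I0 by auto
        have e: "B' (fst x) t \<omega> = B (fst x) t \<omega>" if "0 \<le> t" for t using elim(1) xI that by blast
        show ?case
        proof (cases "snd x")
          case 0
          then show ?thesis using e[of 1] e[of 0] Bc(2)[OF xI(2) elim(2)] by (simp add: \<tau>_def)
        next
          case (Suc l)
          have ta: "\<tau> (Suc (Suc l)) = 1 + real (Suc l) / real K / b" "\<tau> (Suc l) = 1 + real l / real K / b"
            by (auto simp: \<tau>_def)
          have td: "\<tau> (Suc (Suc l)) - \<tau> (Suc l) = 1 / (real K * b)"
            unfolding \<tau>_def by (simp add: diff_divide_distrib[symmetric])
          have "grid_incs \<beta> K (fst x, l) \<omega> = sqrt (real K) * sqrt b *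
              (B' (fst x) (\<tau> (Suc (Suc l))) \<omega> - B' (fst x) (\<tau> (Suc l)) \<omega>)"
            unfolding grid_incs_def grid_increment_def \<beta>_def ta fst_conv snd_conv by (simp add: algebra_simps)
          also have "\<dots> = (B (fst x) (\<tau> (Suc (Suc l))) \<omega> - B (fst x) (\<tau> (Suc l)) \<omega>) / sqrt (1 / (real K * b))"
            using b by (simp add: e ta real_sqrt_divide real_sqrt_mult)
          finally show ?thesis using Suc td by simp
        qed
      qed
    qed
  qed
  show "gauss_vector (\<lambda>x. B' x 1) I0"
    using gauss_vector_reindex[OF main[of 1], of "\<lambda>x. (x, 0)" I0] I0 by (simp add: inj_on_def image_subset_iff)
  have "indep_gauss_paths S (\<Pi>\<^sub>M x\<in>I0. borel) \<beta> I0"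
    unfolding indep_gauss_paths_def
  proof (intro conjI I0 ballI allI impI)
    show Sm: "S \<in> measurable M (\<Pi>\<^sub>M x\<in>I0. borel)"
      unfolding S_def using Bm by (intro measurable_restrict) auto
    fix x assume x: "x \<in> I0"
    show "\<beta> x t \<in> borel_measurable M" if "t \<in> {0..1}" for t
    proof -
      have [measurable]: "B' x (1 + t / b) \<in> borel_measurable M" "B' x 1 \<in> borel_measurable M"
        using Bm x b that by auto
      show ?thesis unfolding \<beta>_def by measurable
    qed
    fix \<omega> assume \<omega>: "\<omega> \<in> space M"
    have "continuous_on {0..1} (\<lambda>t. B' x (1 + t / b) \<omega>)"
      using b by (intro continuous_on_compose2[OF Bc(1)[OF x \<omega>]] continuous_intros) auto
    then show "continuous_on {0..1} (\<lambda>t. \<beta> x t \<omega>)"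
      unfolding \<beta>_def by (intro continuous_intros)
    show "\<beta> x 0 \<omega> = 0" by (simp add: \<beta>_def)
  next
    fix K :: nat assume K: "1 \<le> K"
    let ?T = "I0 \<times> {..<K}" and ?Z = "\<lambda>x \<omega>. case snd x of 0 \<Rightarrow> B' (fst x) 1 \<omega> | Suc l \<Rightarrow> grid_incs \<beta> K (fst x, l) \<omega>"
    let ?P = "\<Pi>\<^sub>M x\<in>?T. (borel :: real measure)"
    define h :: "'b \<times> nat \<Rightarrow> 'b \<times> nat" where "h x = (fst x, Suc (snd x))" for x
    have T: "?T \<noteq> {}" using I0 K by (auto simp: lessThan_empty_iff)
    have "gauss_vector (\<lambda>x. ?Z (h x)) ?T"
      using T by (intro gauss_vector_reindex[OF main[OF K]]) (auto simp: h_def inj_on_def)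
    then show gv: "gauss_vector (grid_incs \<beta> K) ?T"
      by (rule gauss_vector_cong) (simp add: h_def)
    \<comment> \<open>the coordinates of the first step, and those of the later steps\<close>
    define T0 where "T0 = I0 \<times> {0::nat}"
    define T1 where "T1 = h ` ?T"
    have iv: "indep_var (PiM T0 (\<lambda>_. borel)) (\<lambda>\<omega>. restrict (\<lambda>x. ?Z x \<omega>) T0) (PiM T1 (\<lambda>_. borel)) (\<lambda>\<omega>. restrict (\<lambda>x. ?Z x \<omega>) T1)"
      using main[OF K] by (intro indep_var_restrict[where I = "I0 \<times> {..<Suc K}"])
        (auto simp: gauss_vector_def T0_def T1_def h_def)
    show "indep_pair (\<Pi>\<^sub>M x\<in>I0. borel) S ?P (\<lambda>\<omega>. \<lambda>x\<in>?T. grid_incs \<beta> K x \<omega>)"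
      unfolding indep_pair_def
    proof (intro conjI ballI)
      show "S \<in> measurable M (\<Pi>\<^sub>M x\<in>I0. borel)"
        unfolding S_def using Bm by (intro measurable_restrict) auto
      show "(\<lambda>\<omega>. \<lambda>x\<in>?T. grid_incs \<beta> K x \<omega>) \<in> measurable M ?P"
        by (rule gauss_vector_restrict_measurable[OF gv])
      define p0 where "p0 z = (\<lambda>x\<in>I0. z (x, 0::nat))" for z :: "'b \<times> nat \<Rightarrow> real"
      define p1 where "p1 z = (\<lambda>x\<in>?T. z (h x))" for z :: "'b \<times> nat \<Rightarrow> real"
      have p0m: "p0 \<in> measurable (PiM T0 (\<lambda>_. borel)) (\<Pi>\<^sub>M x\<in>I0. borel)"
        unfolding p0_def by (intro measurable_restrict measurable_component_singleton) (auto simp: T0_def)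
      have p1m: "p1 \<in> measurable (PiM T1 (\<lambda>_. borel)) ?P"
        unfolding p1_def by (intro measurable_restrict measurable_component_singleton) (auto simp: T1_def)
      fix A E assume A: "A \<in> sets (\<Pi>\<^sub>M x\<in>I0. (borel :: real measure))" and E: "E \<in> sets ?P"
      have S0: "S \<omega> = p0 (restrict (\<lambda>x. ?Z x \<omega>) T0)" for \<omega>
        unfolding S_def p0_def by (intro restrict_ext) (auto simp: T0_def)
      have D1: "(\<lambda>x\<in>?T. grid_incs \<beta> K x \<omega>) = p1 (restrict (\<lambda>x. ?Z x \<omega>) T1)" for \<omega>
        unfolding p1_def by (intro restrict_ext) (auto simp: T1_def h_def)
      have sp: "restrict (\<lambda>x. ?Z x \<omega>) T0 \<in> space (PiM T0 (\<lambda>_. borel))"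
        "restrict (\<lambda>x. ?Z x \<omega>) T1 \<in> space (PiM T1 (\<lambda>_. borel))" for \<omega>
        by (auto simp: space_PiM)
      let ?A = "p0 -` A \<inter> space (PiM T0 (\<lambda>_. borel))" and ?E = "p1 -` E \<inter> space (PiM T1 (\<lambda>_. borel))"
      have "prob ((\<lambda>\<omega>. (restrict (\<lambda>x. ?Z x \<omega>) T0, restrict (\<lambda>x. ?Z x \<omega>) T1)) -` (?A \<times> ?E) \<inter> space M)
          = prob ((\<lambda>\<omega>. restrict (\<lambda>x. ?Z x \<omega>) T0) -` ?A \<inter> space M) * prob ((\<lambda>\<omega>. restrict (\<lambda>x. ?Z x \<omega>) T1) -` ?E \<inter> space M)"
        by (rule indep_varD[OF iv measurable_sets[OF p0m A] measurable_sets[OF p1m E]])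
      moreover have "(\<lambda>\<omega>. (restrict (\<lambda>x. ?Z x \<omega>) T0, restrict (\<lambda>x. ?Z x \<omega>) T1)) -` (?A \<times> ?E) \<inter> space M
          = {\<omega>\<in>space M. S \<omega> \<in> A \<and> (\<lambda>x\<in>?T. grid_incs \<beta> K x \<omega>) \<in> E}"
        unfolding S0 D1 using sp by blast
      moreover have "(\<lambda>\<omega>. restrict (\<lambda>x. ?Z x \<omega>) T0) -` ?A \<inter> space M = {\<omega>\<in>space M. S \<omega> \<in> A}"
        unfolding S0 using sp by blast
      moreover have "(\<lambda>\<omega>. restrict (\<lambda>x. ?Z x \<omega>) T1) -` ?E \<inter> space M = {\<omega>\<in>space M. (\<lambda>x\<in>?T. grid_incs \<beta> K x \<omega>) \<in> E}"
        unfolding D1 using sp by blast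
      ultimately show "prob {\<omega>\<in>space M. S \<omega> \<in> A \<and> (\<lambda>x\<in>?T. grid_incs \<beta> K x \<omega>) \<in> E}
          = prob {\<omega>\<in>space M. S \<omega> \<in> A} * prob {\<omega>\<in>space M. (\<lambda>x\<in>?T. grid_incs \<beta> K x \<omega>) \<in> E}" by simp
    qed
  qed
  then show "indep_gauss_paths (\<lambda>\<omega>. \<lambda>x\<in>I0. B' x 1 \<omega>) (\<Pi>\<^sub>M x\<in>I0. borel)
      (\<lambda>x t \<omega>. sqrt b * (B' x (1 + t / b) \<omega> - B' x 1 \<omega>)) I0"
    unfolding S_def[abs_def] \<beta>_def[abs_def] .
qed

end

section \<open>Maxima of curves that start from bins\<close>

lemma borel_measurable_Max_insert:
  fixes f :: "'i \<Rightarrow> 'a \<Rightarrow> real"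
  assumes "finite I" "\<And>i. i \<in> I \<Longrightarrow> f i \<in> borel_measurable M"
  shows "(\<lambda>\<omega>. Max (insert c ((\<lambda>i. f i \<omega>) ` I))) \<in> borel_measurable M"
  using assms borel_measurable_Max[OF assms] by (cases "I = {}") auto

lemma continuous_on_Max:
  fixes f :: "'i \<Rightarrow> real \<Rightarrow> real"
  assumes "finite I" "I \<noteq> {}" "\<And>i. i \<in> I \<Longrightarrow> continuous_on A (f i)"
  shows "continuous_on A (\<lambda>t. Max ((\<lambda>i. f i t) ` I))"
  using assms by (induction I rule: finite_ne_induct) (auto intro: continuous_on_max)

lemma continuous_on_Max_insert:
  fixes f :: "'i \<Rightarrow> real \<Rightarrow> real"
  assumes "finite I" "\<And>i. i \<in> I \<Longrightarrow> continuous_on A (f i)"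
  shows "continuous_on A (\<lambda>t. Max (insert c ((\<lambda>i. f i t) ` I)))"
  using assms continuous_on_Max[OF assms(1) _ assms(2)]
  by (cases "I = {}") (auto intro: continuous_on_max)

text \<open>
  Index \<open>i\<close> sits in bin \<open>s i\<close>, and its curve starts from the level \<open>x (s i)\<close> of this bin. Bin 0 collects
  the discarded indices, which contribute only the floor \<open>- C\<close>.
\<close>

definition binned_max :: "real \<Rightarrow> (nat \<Rightarrow> real) \<Rightarrow> 'i set \<Rightarrow> ('i \<Rightarrow> nat) \<Rightarrow> ('i \<Rightarrow> real) \<Rightarrow> real \<Rightarrow> real" where
  "binned_max C x I s v t =
     Max (insert (- C) ((\<lambda>i. if s i = 0 then - C else x (s i) + v i - t / 2) ` I))"

text \<open>
  The functional of the binned maximum, evaluated from the grid increments \<open>d\<close> of the paths: their partial sums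
  are the values of the paths on the grid, and the Bernstein polynomial interpolates the maximum.
\<close>

definition grid_value ::
    "((real \<Rightarrow> real) \<Rightarrow> real) \<Rightarrow> real \<Rightarrow> (nat \<Rightarrow> real) \<Rightarrow> nat \<Rightarrow> 'i set \<Rightarrow> ('i \<Rightarrow> nat) \<Rightarrow> ('i \<times> nat \<Rightarrow> real) \<Rightarrow> real" where
  "grid_value \<Phi> C x K I s d =
     \<Phi> (bernstein_poly K (\<lambda>l. if l \<le> K then binned_max C x I s (\<lambda>i. (\<Sum>k<l. d (i, k)) / sqrt (real K)) (real l / real K) else 0))"

definition grid_mean ::
    "((real \<Rightarrow> real) \<Rightarrow> real) \<Rightarrow> real \<Rightarrow> (nat \<Rightarrow> real) \<Rightarrow> nat \<Rightarrow> 'i set \<Rightarrow> ('i \<Rightarrow> nat) \<Rightarrow> real" where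
  "grid_mean \<Phi> C x K I s = (\<integral>d. grid_value \<Phi> C x K I s d \<partial>(\<Pi>\<^sub>M t\<in>I \<times> {..<K}. std_gauss))"

definition occupancy :: "nat \<Rightarrow> 'i set \<Rightarrow> ('i \<Rightarrow> nat) \<Rightarrow> nat \<Rightarrow> nat" where
  "occupancy J I s = (\<lambda>j\<in>{1..J}. card {i\<in>I. s i = j})"

text \<open>
  A canonical index set with occupation numbers \<open>k\<close>: the index \<open>(j, r)\<close> is the \<open>r\<close>-th one in bin \<open>j\<close>.
\<close>

definition occupied :: "nat \<Rightarrow> (nat \<Rightarrow> nat) \<Rightarrow> (nat \<times> nat) set" where
  "occupied J k = Sigma {1..J} (\<lambda>j. {..<k j})"

lemma binned_max_image:
  assumes I: "finite I" "finite I'" and f: "f ` I' \<subseteq> I" "{i\<in>I. s i \<noteq> 0} \<subseteq> f ` I'"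
    and s: "\<And>i. i \<in> I' \<Longrightarrow> s (f i) = s' i"
  shows "binned_max C x I s v t = binned_max C x I' s' (\<lambda>i. v (f i)) t"
proof -
  let ?F = "\<lambda>i. if s i = 0 then - C else x (s i) + v i - t / 2"
  have "insert (- C) (?F ` I) = insert (- C) (?F ` f ` I')"
    using f by fastforce
  also have "?F ` f ` I' = (\<lambda>i. if s' i = 0 then - C else x (s' i) + v (f i) - t / 2) ` I'"
    unfolding image_image using s by (intro image_cong refl) auto
  finally show ?thesis unfolding binned_max_def by simp
qed

lemma grid_value_measurable:
  assumes \<Phi>: "seq_cont \<Phi>" and I: "finite I"
    and s: "\<And>i. i \<in> I \<Longrightarrow> (\<lambda>z. s z i) \<in> measurable N (count_space UNIV)"
    and d: "\<And>i k. i \<in> I \<Longrightarrow> k < K \<Longrightarrow> (\<lambda>z. d z (i, k)) \<in> borel_measurable N"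
  shows "(\<lambda>z. grid_value \<Phi> C x K I (s z) (d z)) \<in> borel_measurable N"
proof -
  have "(\<lambda>z l. if l \<le> K then binned_max C x I (s z) (\<lambda>i. (\<Sum>k<l. d z (i, k)) / sqrt (real K)) (real l / real K) else 0)
      \<in> measurable N (\<Pi>\<^sub>M l\<in>UNIV. borel)"
  proof (rule measurable_PiM_single')
    fix l :: nat
    have "(\<lambda>z. binned_max C x I (s z) (\<lambda>i. (\<Sum>k<l. d z (i, k)) / sqrt (real K)) (real l / real K)) \<in> borel_measurable N"
      if l: "l \<le> K"
      unfolding binned_max_def
    proof (rule borel_measurable_Max_insert[OF I])
      fix i assume i: "i \<in> I"
      note s[OF i, measurable]
      have [measurable]: "(\<lambda>z. \<Sum>k<l. d z (i, k)) \<in> borel_measurable N"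
        using l i by (intro borel_measurable_sum d) auto
      show "(\<lambda>z. if s z i = 0 then - C else x (s z i) + (\<Sum>k<l. d z (i, k)) / sqrt (real K) - real l / real K / 2)
          \<in> borel_measurable N" by measurable
    qed
    then show "(\<lambda>z. if l \<le> K then binned_max C x I (s z) (\<lambda>i. (\<Sum>k<l. d z (i, k)) / sqrt (real K)) (real l / real K) else 0)
        \<in> borel_measurable N" by (cases "l \<le> K") simp_all
  qed auto
  from measurable_compose[OF this seq_cont_grid_measurable[OF \<Phi>, of K]]
  show ?thesis unfolding grid_value_def .
qed

lemma grid_value_coordinates_measurable:
  assumes "seq_cont \<Phi>" "finite I"
  shows "grid_value \<Phi> C x K I s \<in> borel_measurable (\<Pi>\<^sub>M t\<in>I \<times> {..<K}. std_gauss)"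
proof (rule grid_value_measurable[OF assms])
  fix i k assume "i \<in> I" "k < K"
  then have "(\<lambda>z. z (i, k)) \<in> measurable (\<Pi>\<^sub>M t\<in>I \<times> {..<K}. std_gauss) std_gauss"
    by (intro measurable_component_singleton) auto
  then show "(\<lambda>z. z (i, k)) \<in> borel_measurable (\<Pi>\<^sub>M t\<in>I \<times> {..<K}. std_gauss)"
    unfolding measurable_cong_sets[OF refl sets_std_gauss] .
qed simp

text \<open>
  The heart of the comparison of the two models. Indices in bin 0 do not matter, and a product of equal Gaussian
  measures does not change when the other indices are relabelled; only the number of indices in each bin is left.
\<close>

lemma grid_mean_occupancy:
  assumes \<Phi>: "seq_cont \<Phi>" and I: "finite I" and s: "\<And>i. i \<in> I \<Longrightarrow> s i \<le> J"
  shows "grid_mean \<Phi> C x K I s = grid_mean \<Phi> C x K (occupied J (occupancy J I s)) fst"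
proof -
  define I' where "I' = occupied J (occupancy J I s)"
  have I': "finite I'" by (simp add: I'_def occupied_def)
  have "\<exists>h. bij_betw h {..<card {i\<in>I. s i = j}} {i\<in>I. s i = j}" for j
  proof -
    have "finite {i\<in>I. s i = j}" using I by simp
    from bij_betw_from_nat_into_finite[OF this] show ?thesis by blast
  qed
  then obtain h where h: "\<And>j. bij_betw (h j) {..<card {i\<in>I. s i = j}} {i\<in>I. s i = j}" by metis
  \<comment> \<open>relabelling: the canonical index \<open>(j, r)\<close> stands for the \<open>r\<close>-th index in bin \<open>j\<close>\<close>
  define f where "f x = h (fst x) (snd x)" for x
  have I'_iff: "(j, r) \<in> I' \<longleftrightarrow> 1 \<le> j \<and> j \<le> J \<and> r < card {i\<in>I. s i = j}" for j r
    by (auto simp: I'_def occupied_def occupancy_def)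
  have f1: "f x \<in> I" "s (f x) = fst x" if "x \<in> I'" for x
    using bij_betwE[OF h[of "fst x"]] that I'_iff[of "fst x" "snd x"] by (auto simp: f_def)
  have f2: "{i\<in>I. s i \<noteq> 0} \<subseteq> f ` I'"
  proof
    fix i assume i: "i \<in> {i\<in>I. s i \<noteq> 0}"
    then have "i \<in> h (s i) ` {..<card {i'\<in>I. s i' = s i}}"
      using bij_betw_imp_surj_on[OF h[of "s i"]] by auto
    then obtain r where "r < card {i'\<in>I. s i' = s i}" "i = h (s i) r" by auto
    then have "(s i, r) \<in> I'" "i = f (s i, r)" using i s[of i] by (auto simp: I'_iff f_def)
    then show "i \<in> f ` I'" by blast
  qed
  have finj: "inj_on f I'"
  proof (rule inj_onI)
    fix x y assume xy: "x \<in> I'" "y \<in> I'" "f x = f y"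
    then have e: "fst x = fst y" using f1(2)[of x] f1(2)[of y] by simp
    have "inj_on (h (fst x)) {..<card {i\<in>I. s i = fst x}}" using h bij_betw_imp_inj_on by blast
    moreover have "snd x < card {i\<in>I. s i = fst x}" "snd y < card {i\<in>I. s i = fst x}"
    proof -
      have "(fst x, snd x) \<in> I'" "(fst y, snd y) \<in> I'" using xy by simp_all
      then show "snd x < card {i\<in>I. s i = fst x}" "snd y < card {i\<in>I. s i = fst x}"
        unfolding I'_iff e by auto
    qed
    moreover have "h (fst x) (snd x) = h (fst x) (snd y)" using xy(3) e by (simp add: f_def)
    ultimately have "snd x = snd y" by (auto dest: inj_onD)
    with e show "x = y" by (simp add: prod_eq_iff)
  qed
  define F where "F x = (f (fst x), snd x)" for x :: "(nat \<times> nat) \<times> nat"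
  let ?T = "I \<times> {..<K}" and ?T' = "I' \<times> {..<K}"
  have re: "distr (\<Pi>\<^sub>M t\<in>?T. std_gauss) (\<Pi>\<^sub>M t\<in>?T'. std_gauss) (\<lambda>d. \<lambda>t\<in>?T'. d (F t)) = (\<Pi>\<^sub>M t\<in>?T'. std_gauss)"
    using f1 finj by (intro distr_PiM_reindex prob_space_std_gauss) (auto simp: F_def inj_on_def)
  have m: "(\<lambda>d. \<lambda>t\<in>?T'. d (F t)) \<in> measurable (\<Pi>\<^sub>M t\<in>?T. std_gauss) (\<Pi>\<^sub>M t\<in>?T'. std_gauss)"
    using f1 by (intro measurable_restrict measurable_component_singleton) (auto simp: F_def)
  have gm: "grid_value \<Phi> C x K I' fst \<in> borel_measurable (\<Pi>\<^sub>M t\<in>?T'. std_gauss)"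
    by (rule grid_value_coordinates_measurable[OF \<Phi> I'])
  have "grid_mean \<Phi> C x K I' fst = (\<integral>d. grid_value \<Phi> C x K I' fst (\<lambda>t\<in>?T'. d (F t)) \<partial>(\<Pi>\<^sub>M t\<in>?T. std_gauss))"
    unfolding grid_mean_def by (subst re[symmetric], rule integral_distr[OF m gm])
  also have "\<dots> = grid_mean \<Phi> C x K I s"
    unfolding grid_mean_def
  proof (rule Bochner_Integration.integral_cong[OF refl])
    fix d :: "'a \<times> nat \<Rightarrow> real"
    have "(if l \<le> K then binned_max C x I' fst (\<lambda>i. (\<Sum>k<l. (\<lambda>t\<in>?T'. d (F t)) (i, k)) / sqrt (real K)) (real l / real K) else 0)
        = (if l \<le> K then binned_max C x I s (\<lambda>i. (\<Sum>k<l. d (i, k)) / sqrt (real K)) (real l / real K) else 0)" for l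
    proof (cases "l \<le> K")
      case True
      have "binned_max C x I s (\<lambda>i. (\<Sum>k<l. d (i, k)) / sqrt (real K)) (real l / real K)
          = binned_max C x I' fst (\<lambda>i. (\<Sum>k<l. d (f i, k)) / sqrt (real K)) (real l / real K)"
        using I I' f1 f2 by (intro binned_max_image) auto
      also have "\<dots> = binned_max C x I' fst (\<lambda>i. (\<Sum>k<l. (\<lambda>t\<in>?T'. d (F t)) (i, k)) / sqrt (real K)) (real l / real K)"
      proof -
        have "(\<Sum>k<l. d (f i, k)) = (\<Sum>k<l. (\<lambda>t\<in>?T'. d (F t)) (i, k))" if "i \<in> I'" for i
          using that True by (intro sum.cong) (auto simp: F_def)
        then show ?thesis unfolding binned_max_def
          by (intro arg_cong[where f = Max] arg_cong[where f = "insert (- C)"] image_cong refl) simp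
      qed
      finally show ?thesis using True by simp
    qed simp
    then show "grid_value \<Phi> C x K I' fst (\<lambda>t\<in>?T'. d (F t)) = grid_value \<Phi> C x K I s d"
      unfolding grid_value_def by simp
  qed
  finally show ?thesis by (simp add: I'_def)
qed

lemma grid_mean_bound:
  assumes \<Phi>: "seq_cont \<Phi>" and I: "finite I" and c: "\<And>f. continuous_on {0..1} f \<Longrightarrow> \<bar>\<Phi> f\<bar> \<le> c"
  shows "\<bar>grid_mean \<Phi> C x K I s\<bar> \<le> c"
proof -
  interpret G: prob_space "\<Pi>\<^sub>M t\<in>I \<times> {..<K}. std_gauss"
    by (intro prob_space_PiM prob_space_std_gauss)
  have b: "\<bar>grid_value \<Phi> C x K I s d\<bar> \<le> c" for d
    unfolding grid_value_def by (intro c continuous_bernstein_poly)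
  have int: "integrable (\<Pi>\<^sub>M t\<in>I \<times> {..<K}. std_gauss) (grid_value \<Phi> C x K I s)"
    using b by (intro G.integrable_const_bound[where B = c] grid_value_coordinates_measurable[OF \<Phi> I]) auto
  have "grid_value \<Phi> C x K I s d \<le> c" "- c \<le> grid_value \<Phi> C x K I s d" for d
    using b[of d] by auto
  then show ?thesis
    unfolding grid_mean_def abs_le_iff
    using G.integral_le_const[OF int, of c] G.integral_ge_const[OF int, of "- c"] by auto
qed

context prob_space
begin

lemma binned_max_cont:
  assumes "finite I" "\<And>i. i \<in> I \<Longrightarrow> continuous_on {0..1} (v i)"
  shows "continuous_on {0..1} (\<lambda>t. binned_max C x I s (\<lambda>i. v i t) t)"
  unfolding binned_max_def
proof (rule continuous_on_Max_insert[OF assms(1)])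
  fix i assume "i \<in> I"
  then show "continuous_on {0..1} (\<lambda>t. if s i = 0 then - C else x (s i) + v i t - t / 2)"
    using assms(2) by (cases "s i = 0") (auto intro!: continuous_intros)
qed

lemma binned_max_measurable:
  assumes "finite I" "\<And>i. i \<in> I \<Longrightarrow> (\<lambda>\<omega>. v \<omega> i) \<in> borel_measurable M"
    "\<And>i. i \<in> I \<Longrightarrow> (\<lambda>\<omega>. s \<omega> i) \<in> measurable M (count_space UNIV)"
  shows "(\<lambda>\<omega>. binned_max C x I (s \<omega>) (v \<omega>) t) \<in> borel_measurable M"
  unfolding binned_max_def
proof (rule borel_measurable_Max_insert[OF assms(1)])
  fix i assume i: "i \<in> I"
  note assms(2,3)[OF i, measurable]
  show "(\<lambda>\<omega>. if s \<omega> i = 0 then - C else x (s \<omega> i) + v \<omega> i - t / 2) \<in> borel_measurable M" by measurable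
qed

text \<open>
  Given the starting points, the grid increments are standard Gaussian, so the expectation on a grid is the mean
  of \<open>grid_mean\<close> over the occupation numbers; refining the grid recovers the functional of the full paths.
\<close>

lemma binned_expectation_limit:
  assumes G: "indep_gauss_paths S NS \<beta> I" and \<Phi>: "seq_cont \<Phi>"
    and c: "\<And>f. continuous_on {0..1} f \<Longrightarrow> \<bar>\<Phi> f\<bar> \<le> c"
    and s: "\<And>i. i \<in> I \<Longrightarrow> (\<lambda>z. s z i) \<in> measurable NS (count_space UNIV)"
    and sJ: "\<And>z i. i \<in> I \<Longrightarrow> s z i \<le> J"
  shows "(\<lambda>K. \<integral>\<omega>. grid_mean \<Phi> C x (Suc K) (occupied J (occupancy J I (s (S \<omega>)))) fst \<partial>M)
    \<longlonglongrightarrow> (\<integral>\<omega>. \<Phi> (\<lambda>t. binned_max C x I (s (S \<omega>)) (\<lambda>i. \<beta> i t \<omega>) t) \<partial>M)"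
proof -
  have I: "finite I" "I \<noteq> {}" and S[measurable]: "S \<in> measurable M NS"
    using G by (auto simp: indep_gauss_paths_def)
  have \<beta>m: "\<beta> i t \<in> borel_measurable M" if "i \<in> I" "t \<in> {0..1}" for i t
    using G that by (auto simp: indep_gauss_paths_def)
  have \<beta>c: "continuous_on {0..1} (\<lambda>t. \<beta> i t \<omega>)" "\<beta> i 0 \<omega> = 0" if "i \<in> I" "\<omega> \<in> space M" for i \<omega>
    using G that by (auto simp: indep_gauss_paths_def)
  have sS: "(\<lambda>\<omega>. s (S \<omega>) i) \<in> measurable M (count_space UNIV)" if "i \<in> I" for i
    by (rule measurable_compose[OF S s[OF that]])
  define Y where "Y t \<omega> = binned_max C x I (s (S \<omega>)) (\<lambda>i. \<beta> i t \<omega>) t" for t \<omega>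
  have Yc: "continuous_on {0..1} (\<lambda>t. Y t \<omega>)" if "\<omega> \<in> space M" for \<omega>
    unfolding Y_def using I \<beta>c that by (intro binned_max_cont) auto
  have Ym: "Y t \<in> borel_measurable M" if "t \<in> {0..1}" for t
    unfolding Y_def using I \<beta>m sS that by (intro binned_max_measurable) auto
  define V where "V K \<omega> = \<Phi> (bernstein_poly K (\<lambda>l. if l \<le> K then Y (real l / real K) \<omega> else 0))" for K \<omega>
  have Vm: "V K \<in> borel_measurable M" for K
  proof -
    have "(\<lambda>\<omega>. \<lambda>l::nat. if l \<le> K then Y (real l / real K) \<omega> else 0) \<in> measurable M (\<Pi>\<^sub>M l\<in>UNIV. borel)"
    proof (rule measurable_PiM_single')
      fix l :: nat
      show "(\<lambda>\<omega>. if l \<le> K then Y (real l / real K) \<omega> else 0) \<in> borel_measurable M"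
        using Ym[of "real l / real K"] by (cases "l \<le> K") (auto simp: divide_le_eq_1)
    qed auto
    from measurable_compose[OF this seq_cont_grid_measurable[OF \<Phi>, of K]]
    show ?thesis unfolding V_def .
  qed
  have lim: "(\<lambda>K. \<integral>\<omega>. V (Suc K) \<omega> \<partial>M) \<longlonglongrightarrow> (\<integral>\<omega>. \<Phi> (\<lambda>t. Y t \<omega>) \<partial>M)"
  proof (rule integral_dominated_convergence[where w = "\<lambda>_. c"])
    show "(\<lambda>\<omega>. \<Phi> (\<lambda>t. Y t \<omega>)) \<in> borel_measurable M"
      by (rule seq_cont_measurable[OF \<Phi> Yc Ym])
    show "AE \<omega> in M. (\<lambda>K. V (Suc K) \<omega>) \<longlonglongrightarrow> \<Phi> (\<lambda>t. Y t \<omega>)"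
    proof (rule AE_I2)
      fix \<omega> assume \<omega>: "\<omega> \<in> space M"
      have "V K \<omega> = \<Phi> (bernstein_poly K (\<lambda>l. Y (real l / real K) \<omega>))" for K
        unfolding V_def by (intro arg_cong[where f = \<Phi>] bernstein_poly_cong) simp
      then have "(\<lambda>K. V K \<omega>) \<longlonglongrightarrow> \<Phi> (\<lambda>t. Y t \<omega>)"
        using seq_cont_bernstein[OF \<Phi> Yc[OF \<omega>]] by simp
      then show "(\<lambda>K. V (Suc K) \<omega>) \<longlonglongrightarrow> \<Phi> (\<lambda>t. Y t \<omega>)" by (rule LIMSEQ_Suc)
    qed
    show "AE \<omega> in M. norm (V (Suc K) \<omega>) \<le> c" for K
      unfolding V_def using c[OF continuous_bernstein_poly] by simp
  qed (use Vm in auto)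
  have eq: "(\<integral>\<omega>. V K \<omega> \<partial>M) = (\<integral>\<omega>. grid_mean \<Phi> C x K (occupied J (occupancy J I (s (S \<omega>)))) fst \<partial>M)"
    if K: "1 \<le> K" for K
  proof -
    let ?T = "I \<times> {..<K}"
    let ?P = "\<Pi>\<^sub>M t\<in>?T. (borel :: real measure)" and ?g = "\<Pi>\<^sub>M t\<in>?T. std_gauss"
    have T: "?T \<noteq> {}" using I K by (auto simp: lessThan_empty_iff)
    interpret g: prob_space ?g by (intro prob_space_PiM prob_space_std_gauss)
    interpret NS: prob_space "distr M NS S" by (rule prob_space_distr[OF S])
    interpret PP: pair_prob_space "distr M NS S" ?g ..
    define D where "D \<omega> = (\<lambda>x\<in>?T. grid_incs \<beta> K x \<omega>)" for \<omega>
    have gv: "gauss_vector (grid_incs \<beta> K) ?T" and ip: "indep_pair NS S ?P D"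
      using G K by (auto simp: indep_gauss_paths_def D_def[abs_def])
    have Dm: "D \<in> measurable M ?P" using ip by (simp add: indep_pair_def)
    have joint: "distr M (NS \<Otimes>\<^sub>M ?P) (\<lambda>\<omega>. (S \<omega>, D \<omega>)) = distr M NS S \<Otimes>\<^sub>M ?g"
    proof -
      have "distr M ?P D = ?g" unfolding D_def by (rule gauss_vector_distr[OF gv T])
      then show ?thesis using indep_pair_distr[OF ip] by simp
    qed
    define H where "H p = grid_value \<Phi> C x K I (s (fst p)) (snd p)" for p
    have Hm: "H \<in> borel_measurable (NS \<Otimes>\<^sub>M ?P)"
      unfolding H_def
    proof (rule grid_value_measurable[OF \<Phi> I(1)])
      show "(\<lambda>p. s (fst p) i) \<in> measurable (NS \<Otimes>\<^sub>M ?P) (count_space UNIV)" if "i \<in> I" for i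
        by (rule measurable_compose[OF measurable_fst s[OF that]])
      show "(\<lambda>p. snd p (i, k)) \<in> borel_measurable (NS \<Otimes>\<^sub>M ?P)" if "i \<in> I" "k < K" for i k
        using that by (intro measurable_compose[OF measurable_snd measurable_component_singleton]) auto
    qed
    have Hb: "\<bar>H p\<bar> \<le> c" for p
      unfolding H_def grid_value_def by (intro c continuous_bernstein_poly)
    have VH: "V K \<omega> = H (S \<omega>, D \<omega>)" if \<omega>: "\<omega> \<in> space M" for \<omega>
    proof -
      have "(\<Sum>k<l. D \<omega> (i, k)) / sqrt (real K) = \<beta> i (real l / real K) \<omega>" if "i \<in> I" "l \<le> K" for i l
      proof -
        have "(\<Sum>k<l. D \<omega> (i, k)) = (\<Sum>k<l. grid_increment K (\<lambda>t. \<beta> i t \<omega>) k)"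
          using that by (intro sum.cong) (auto simp: D_def grid_incs_def)
        then show ?thesis using sum_grid_increment[OF K, of "\<lambda>t. \<beta> i t \<omega>"] \<beta>c(2)[OF that(1) \<omega>] by simp
      qed
      then have "binned_max C x I (s (S \<omega>)) (\<lambda>i. (\<Sum>k<l. D \<omega> (i, k)) / sqrt (real K)) (real l / real K)
          = Y (real l / real K) \<omega>" if "l \<le> K" for l
        using that unfolding Y_def binned_max_def
        by (intro arg_cong[where f = Max] arg_cong[where f = "insert (- C)"] image_cong refl) simp
      then show ?thesis unfolding V_def H_def grid_value_def fst_conv snd_conv
        by (intro arg_cong[where f = \<Phi>] bernstein_poly_cong) simp
    qed
    have sg: "sets (distr M NS S \<Otimes>\<^sub>M ?g) = sets (NS \<Otimes>\<^sub>M ?P)"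
      unfolding joint[symmetric] by simp
    have Hm': "H \<in> borel_measurable (distr M NS S \<Otimes>\<^sub>M ?g)"
      using Hm measurable_cong_sets[OF sg refl] by blast
    have Hint: "integrable (distr M NS S \<Otimes>\<^sub>M ?g) H"
      by (rule PP.integrable_const_bound[where B = c]) (use Hb Hm' in auto)
    have "(\<integral>\<omega>. V K \<omega> \<partial>M) = (\<integral>\<omega>. H (S \<omega>, D \<omega>) \<partial>M)"
      using VH by (intro Bochner_Integration.integral_cong refl) auto
    also have "\<dots> = (\<integral>p. H p \<partial>(distr M NS S \<Otimes>\<^sub>M ?g))"
      unfolding joint[symmetric] by (rule integral_distr[OF measurable_Pair[OF S Dm] Hm, symmetric])
    also have "\<dots> = (\<integral>z. (\<integral>d. H (z, d) \<partial>?g) \<partial>distr M NS S)"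
      using PP.integral_fst'[of H] Hint by simp
    also have "\<dots> = (\<integral>z. grid_mean \<Phi> C x K I (s z) \<partial>distr M NS S)"
      by (simp add: H_def grid_mean_def)
    also have "\<dots> = (\<integral>\<omega>. grid_mean \<Phi> C x K I (s (S \<omega>)) \<partial>M)"
    proof (rule integral_distr[OF S])
      have "(\<lambda>z. \<integral>d. H (z, d) \<partial>?g) \<in> borel_measurable (distr M NS S)"
        using g.borel_measurable_lebesgue_integral[of "\<lambda>z d. H (z, d)" "distr M NS S"] Hm' by simp
      then show "(\<lambda>z. grid_mean \<Phi> C x K I (s z)) \<in> borel_measurable NS"
        by (simp add: H_def grid_mean_def)
    qed
    also have "\<dots> = (\<integral>\<omega>. grid_mean \<Phi> C x K (occupied J (occupancy J I (s (S \<omega>)))) fst \<partial>M)"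
      by (intro Bochner_Integration.integral_cong refl grid_mean_occupancy[OF \<Phi> I(1)] sJ)
    finally show ?thesis .
  qed
  show ?thesis using lim eq unfolding Y_def by simp
qed

end

section \<open>Occupation numbers of bins: multinomial and Poisson laws\<close>

text \<open>
  An assignment of \<open>n\<close> indices to bins, read as a word, is a permutation of the multiset that contains each bin as often
  as it is occupied; the number of these permutations is the multinomial coefficient.
\<close>

lemma card_occupancy:
  fixes k :: "nat \<Rightarrow> nat"
  assumes k: "k \<in> extensional {1..J}" and n: "(\<Sum>j=1..J. k j) \<le> n"
  shows "real (card {f \<in> {1..n} \<rightarrow>\<^sub>E {..J}. occupancy J {1..n} f = k})
    = fact n / (fact (n - (\<Sum>j=1..J. k j)) * (\<Prod>j=1..J. fact (k j)))"
proof -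
  define s where "s = (\<Sum>j=1..J. k j)"
  define A where "A = (\<Sum>j\<in>{1..J}. replicate_mset (k j) j) + replicate_mset (n - s) (0::nat)"
  have cA0: "count A 0 = n - s"
    by (simp add: A_def count_sum)
  have cAj: "count A j = k j" if "j \<in> {1..J}" for j
  proof -
    have "(\<Sum>i\<in>{1..J}. count (replicate_mset (k i) i) j) = (\<Sum>i\<in>{1..J}. if i = j then k j else 0)"
      by (intro sum.cong) auto
    then show ?thesis using that by (simp add: A_def count_sum)
  qed
  have cAo: "count A j = 0" if "j > J" for j
    using that by (auto simp: A_def count_sum)
  have size: "size A = n"
  proof -
    have "size (\<Sum>j\<in>X. replicate_mset (k j) j) = (\<Sum>j\<in>X. k j)" if "finite X" for X :: "nat set"
      using that by induction auto
    then show ?thesis using n by (simp add: A_def s_def)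
  qed
  let ?F = "{f \<in> {1..n} \<rightarrow>\<^sub>E {..J}. occupancy J {1..n} f = k}"
  define \<phi> where "\<phi> f = map f [1..<Suc n]" for f :: "nat \<Rightarrow> nat"
  have cnt: "count (mset (\<phi> f)) j = card {i\<in>{1..n}. f i = j}" for f j
  proof -
    have "mset [1..<Suc n] = mset_set {1..n}"
      by (simp add: mset_upt atLeastLessThanSuc_atLeastAtMost del: upt_Suc)
    then have "mset (\<phi> f) = image_mset f (mset_set {1..n})" by (simp add: \<phi>_def del: upt_Suc)
    then have "count (mset (\<phi> f)) j = (\<Sum>x\<in>f -` {j} \<inter> {1..n}. 1)"
      by (simp add: count_image_mset)
    also have "f -` {j} \<inter> {1..n} = {i\<in>{1..n}. f i = j}" by auto
    finally show ?thesis by simp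
  qed
  have len: "length (\<phi> f) = n" for f by (simp add: \<phi>_def del: upt_Suc)
  have nth: "\<phi> f ! i = f (Suc i)" if "i < n" for f i using that by (simp add: \<phi>_def del: upt_Suc)
  have inF: "mset (\<phi> f) = A" if f: "f \<in> ?F" for f
  proof (rule multiset_eqI)
    fix j
    have occ: "card {i\<in>{1..n}. f i = j} = k j" if "j \<in> {1..J}" for j
      using f that by (auto simp: occupancy_def fun_eq_iff split: if_splits)
    have gt: "card {i\<in>{1..n}. f i = j} = 0" if "j > J" for j
    proof -
      have "f i \<le> J" if "i \<in> {1..n}" for i using f that by (auto dest!: PiE_mem)
      then have "{i\<in>{1..n}. f i = j} = {}" using that by fastforce
      then show ?thesis by simp
    qed
    consider "j = 0" | "j \<in> {1..J}" | "j > J" by force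
    then show "count (mset (\<phi> f)) j = count A j"
    proof cases
      case 1
      have "f i \<le> J" if "i \<in> {1..n}" for i using f that by (auto dest!: PiE_mem)
      then have "{1..n} = (\<Union>j\<in>{..J}. {i\<in>{1..n}. f i = j})" by blast
      then have "card {1..n} = card (\<Union>j\<in>{..J}. {i\<in>{1..n}. f i = j})" by (rule arg_cong)
      also have "\<dots> = (\<Sum>j\<le>J. card {i\<in>{1..n}. f i = j})"
        by (rule card_UN_disjoint) auto
      also have "\<dots> = card {i\<in>{1..n}. f i = 0} + (\<Sum>j=1..J. card {i\<in>{1..n}. f i = j})"
        by (simp add: atMost_atLeast0 sum.atLeast_Suc_atMost)
      also have "(\<Sum>j=1..J. card {i\<in>{1..n}. f i = j}) = s"
        unfolding s_def using occ by (intro sum.cong) auto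
      finally have "n = card {i\<in>{1..n}. f i = 0} + s" by simp
      then show ?thesis using 1 cA0 cnt by simp
    qed (use cnt occ gt cAj cAo in auto)
  qed
  have "bij_betw \<phi> ?F (permutations_of_multiset A)"
  proof (rule bij_betw_byWitness[where f' = "\<lambda>xs. \<lambda>i\<in>{1..n}. xs ! (i - 1)"])
    show "\<forall>f\<in>?F. (\<lambda>i\<in>{1..n}. \<phi> f ! (i - 1)) = f"
    proof
      fix f assume f: "f \<in> ?F"
      show "(\<lambda>i\<in>{1..n}. \<phi> f ! (i - 1)) = f"
      proof
        fix i show "(\<lambda>i\<in>{1..n}. \<phi> f ! (i - 1)) i = f i"
          using f nth[of "i - 1" f] by (cases "i \<in> {1..n}") (auto simp: PiE_iff extensional_def)
      qed
    qed
    have inv_\<phi>: "\<phi> (\<lambda>i\<in>{1..n}. xs ! (i - 1)) = xs" if "xs \<in> permutations_of_multiset A" for xs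
    proof (rule nth_equalityI)
      have "mset xs = A" using that by (simp add: permutations_of_multiset_def)
      then have "length xs = n" using size by (metis size_mset)
      then show "length (\<phi> (\<lambda>i\<in>{1..n}. xs ! (i - 1))) = length xs" by (simp add: len)
      fix i assume "i < length (\<phi> (\<lambda>i\<in>{1..n}. xs ! (i - 1)))"
      then show "\<phi> (\<lambda>i\<in>{1..n}. xs ! (i - 1)) ! i = xs ! i" by (simp add: len nth)
    qed
    then show "\<forall>xs\<in>permutations_of_multiset A. \<phi> (\<lambda>i\<in>{1..n}. xs ! (i - 1)) = xs" by blast
    show "\<phi> ` ?F \<subseteq> permutations_of_multiset A"
      using inF by (auto simp: permutations_of_multiset_def)
    show "(\<lambda>xs. \<lambda>i\<in>{1..n}. xs ! (i - 1)) ` permutations_of_multiset A \<subseteq> ?F"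
    proof
      fix f assume "f \<in> (\<lambda>xs. \<lambda>i\<in>{1..n}. xs ! (i - 1)) ` permutations_of_multiset A"
      then obtain xs where xs: "xs \<in> permutations_of_multiset A" "f = (\<lambda>i\<in>{1..n}. xs ! (i - 1))" by blast
      have lx: "length xs = n" and mx: "mset xs = A"
        using xs(1) size by (auto simp: permutations_of_multiset_def)
      have c: "card {i\<in>{1..n}. f i = j} = count A j" for j
        using cnt[of f j] inv_\<phi>[OF xs(1)] xs(2) mx by simp
      have "xs ! (i - 1) \<le> J" if "i \<in> {1..n}" for i
      proof (rule ccontr)
        assume "\<not> ?thesis"
        then have "count A (xs ! (i - 1)) = 0" by (intro cAo) simp
        moreover have "xs ! (i - 1) \<in># A"
        proof -
          have "i - 1 < length xs" using that lx by auto
          from nth_mem_mset[OF this] show ?thesis unfolding mx .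
        qed
        ultimately show False by (simp add: count_eq_zero_iff)
      qed
      then have "f \<in> {1..n} \<rightarrow>\<^sub>E {..J}" using xs(2) by auto
      moreover have "occupancy J {1..n} f = k"
      proof
        fix j show "occupancy J {1..n} f j = k j"
          using c[of j] cAj[of j] k by (cases "j \<in> {1..J}") (auto simp: occupancy_def extensional_def)
      qed
      ultimately show "f \<in> ?F" by blast
    qed
  qed
  then have "card ?F = card (permutations_of_multiset A)" by (rule bij_betw_same_card)
  moreover have "card (permutations_of_multiset A) * (\<Prod>x\<in>set_mset A. fact (count A x)) = fact (size A)"
    by (rule card_permutations_of_multiset_aux)
  moreover have "(\<Prod>x\<in>set_mset A. fact (count A x)) = (\<Prod>x\<in>{..J}. fact (count A x) :: nat)"
  proof (rule prod.mono_neutral_left)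
    show "set_mset A \<subseteq> {..J}"
    proof
      fix x assume "x \<in># A"
      then have "count A x \<noteq> 0" by simp
      then show "x \<in> {..J}" using cAo[of x] by (cases "x \<le> J") auto
    qed
    show "\<forall>x\<in>{..J} - set_mset A. fact (count A x) = (1 :: nat)"
      by (auto simp: not_in_iff)
  qed simp
  moreover have "(\<Prod>x\<in>{..J}. fact (count A x) :: nat) = fact (n - s) * (\<Prod>j=1..J. fact (k j))"
    using cA0 cAj by (simp add: atMost_atLeast0 prod.atLeast_Suc_atMost)
  ultimately have "card ?F * (fact (n - s) * (\<Prod>j=1..J. fact (k j))) = (fact n :: nat)"
    using size by simp
  then have "real (card ?F * (fact (n - s) * (\<Prod>j=1..J. fact (k j)))) = real (fact n)" by (rule arg_cong)
  then have "real (card ?F) * (fact (n - s) * (\<Prod>j=1..J. fact (k j))) = fact n"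
    by simp
  moreover have "(fact (n - s) * (\<Prod>j=1..J. fact (k j)) :: real) \<noteq> 0" by simp
  ultimately show ?thesis unfolding s_def[symmetric] by (simp add: nonzero_eq_divide_eq)
qed

lemma fact_ratio_limit: "(\<lambda>n. fact n / (fact (n - s) * real n ^ s)) \<longlonglongrightarrow> (1::real)"
proof (induction s)
  case 0
  then show ?case by simp
next
  case (Suc s)
  have "(\<lambda>n. (real n - real s) / real n) \<longlonglongrightarrow> 1" by real_asymp
  from tendsto_mult[OF Suc this]
  have "(\<lambda>n. fact n / (fact (n - s) * real n ^ s) * ((real n - real s) / real n)) \<longlonglongrightarrow> 1" by simp
  moreover have "\<forall>\<^sub>F n in sequentially. fact n / (fact (n - s) * real n ^ s) * ((real n - real s) / real n)
      = fact n / (fact (n - Suc s) * real n ^ Suc s)"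
    using eventually_gt_at_top[of s]
  proof eventually_elim
    case (elim n)
    have "fact (n - s) = (real n - real s) * fact (n - Suc s)"
      using elim by (subst fact_reduce) (auto simp: of_nat_diff)
    then show ?case using elim by simp
  qed
  ultimately show ?case by (rule Lim_transform_eventually)
qed

text \<open>
  Both bounds come from \<open>1 + x \<le> exp x\<close>, applied to \<open>- q\<close> and to \<open>q / (1 - q)\<close>.
\<close>

lemma one_minus_power_limit:
  assumes q: "\<And>n. 0 \<le> q n" and lim: "(\<lambda>n. real n * q n) \<longlonglongrightarrow> \<mu>"
  shows "(\<lambda>n. (1 - q n) ^ n) \<longlonglongrightarrow> exp (- \<mu>)" and "q \<longlonglongrightarrow> 0"
proof -
  have "(\<lambda>n. (real n * q n) * (1 / real n)) \<longlonglongrightarrow> \<mu> * 0"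
    by (intro tendsto_mult lim lim_1_over_n)
  moreover have "\<forall>\<^sub>F n in sequentially. (real n * q n) * (1 / real n) = q n"
    using eventually_gt_at_top[of 0] by eventually_elim simp
  ultimately show q0: "q \<longlonglongrightarrow> 0" using Lim_transform_eventually by fastforce
  have ev: "\<forall>\<^sub>F n in sequentially. q n < 1" using order_tendstoD(2)[OF q0, of 1] by simp
  show "(\<lambda>n. (1 - q n) ^ n) \<longlonglongrightarrow> exp (- \<mu>)"
  proof (rule tendsto_sandwich[of "\<lambda>n. exp (- (real n * q n / (1 - q n)))" _ _ "\<lambda>n. exp (- (real n * q n))"])
    show "(\<lambda>n. exp (- (real n * q n))) \<longlonglongrightarrow> exp (- \<mu>)" by (intro tendsto_intros lim)
    have "(\<lambda>n. exp (- (real n * q n / (1 - q n)))) \<longlonglongrightarrow> exp (- (\<mu> / (1 - 0)))"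
      by (intro tendsto_exp tendsto_minus tendsto_divide lim tendsto_diff tendsto_const q0) simp
    then show "(\<lambda>n. exp (- (real n * q n / (1 - q n)))) \<longlonglongrightarrow> exp (- \<mu>)" by simp
    show "\<forall>\<^sub>F n in sequentially. (1 - q n) ^ n \<le> exp (- (real n * q n))"
      using ev
    proof eventually_elim
      case (elim n)
      have "1 - q n \<le> exp (- q n)" using exp_ge_add_one_self[of "- q n"] by simp
      then have "(1 - q n) ^ n \<le> exp (- q n) ^ n" using elim by (intro power_mono) auto
      then show ?case by (simp add: exp_of_nat_mult[symmetric])
    qed
    show "\<forall>\<^sub>F n in sequentially. exp (- (real n * q n / (1 - q n))) \<le> (1 - q n) ^ n"
      using ev
    proof eventually_elim
      case (elim n)
      have "1 / (1 - q n) = 1 + q n / (1 - q n)" using elim by (simp add: field_simps)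
      also have "\<dots> \<le> exp (q n / (1 - q n))" by (rule exp_ge_add_one_self)
      finally have "1 / exp (q n / (1 - q n)) \<le> 1 - q n" using elim by (simp add: field_simps)
      then have "exp (- (q n / (1 - q n))) \<le> 1 - q n" by (simp add: exp_minus inverse_eq_divide)
      then have "exp (- (q n / (1 - q n))) ^ n \<le> (1 - q n) ^ n" by (intro power_mono) auto
      then show ?case by (simp add: exp_of_nat_mult[symmetric])
    qed
  qed
qed

definition poisson_occ :: "nat \<Rightarrow> (nat \<Rightarrow> real) \<Rightarrow> (nat \<Rightarrow> nat) \<Rightarrow> real" where
  "poisson_occ J \<mu> k = (\<Prod>j=1..J. \<mu> j ^ k j / fact (k j) * exp (- \<mu> j))"

text \<open>
  The multinomial probability that the occupation numbers of the bins \<open>1, \<dots>, J\<close> are \<open>k\<close>, all other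
  trials falling into bin 0.
\<close>

definition multinomial_occ :: "nat \<Rightarrow> nat \<Rightarrow> (nat \<Rightarrow> real) \<Rightarrow> (nat \<Rightarrow> nat) \<Rightarrow> real" where
  "multinomial_occ n J p k = fact n / (fact (n - (\<Sum>j=1..J. k j)) * (\<Prod>j=1..J. fact (k j))) *
     ((\<Prod>j=1..J. p j ^ k j) * (1 - (\<Sum>j=1..J. p j)) ^ (n - (\<Sum>j=1..J. k j)))"

text \<open>
  The quotient \<open>n! / (n - s)!\<close> is asymptotically \<open>n ^ s\<close>, which supplies one factor \<open>n\<close> for each of the \<open>s\<close> factors
  \<open>p j\<close>; the power of the remaining probability tends to the exponential.
\<close>

lemma multinomial_poisson_limit:
  assumes p: "\<And>n j. 0 \<le> p n j" and lim: "\<And>j. j \<in> {1..J} \<Longrightarrow> (\<lambda>n. real n * p n j) \<longlonglongrightarrow> \<mu> j"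
  shows "(\<lambda>n. multinomial_occ n J (p n) k) \<longlonglongrightarrow> poisson_occ J \<mu> k"
proof -
  define s where "s = (\<Sum>j=1..J. k j)"
  define q where "q n = (\<Sum>j=1..J. p n j)" for n
  have q: "0 \<le> q n" for n unfolding q_def using p by (intro sum_nonneg) auto
  have limq: "(\<lambda>n. real n * q n) \<longlonglongrightarrow> (\<Sum>j=1..J. \<mu> j)"
    unfolding q_def sum_distrib_left by (intro tendsto_sum lim) auto
  note pw = one_minus_power_limit[OF q limq]
  have "(\<lambda>n. fact n / (fact (n - s) * real n ^ s) * (\<Prod>j=1..J. (real n * p n j) ^ k j / fact (k j)) *
      ((1 - q n) ^ n / (1 - q n) ^ s)) \<longlonglongrightarrow> 1 * (\<Prod>j=1..J. \<mu> j ^ k j / fact (k j)) * (exp (- (\<Sum>j=1..J. \<mu> j)) / (1 - 0) ^ s)"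
    by (intro tendsto_mult fact_ratio_limit tendsto_prod tendsto_divide tendsto_power lim pw tendsto_diff tendsto_const) auto
  moreover have "1 * (\<Prod>j=1..J. \<mu> j ^ k j / fact (k j)) * (exp (- (\<Sum>j=1..J. \<mu> j)) / (1 - 0) ^ s) = poisson_occ J \<mu> k"
  proof -
    have "(\<Prod>j=1..J. exp (- \<mu> j)) = exp (- (\<Sum>j=1..J. \<mu> j))" by (simp add: exp_sum[symmetric] sum_negf)
    then show ?thesis unfolding poisson_occ_def prod.distrib by simp
  qed
  moreover have "\<forall>\<^sub>F n in sequentially. fact n / (fact (n - s) * real n ^ s) * (\<Prod>j=1..J. (real n * p n j) ^ k j / fact (k j)) *
      ((1 - q n) ^ n / (1 - q n) ^ s) = multinomial_occ n J (p n) k"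
    using eventually_ge_at_top[of "max s 1"] order_tendstoD(2)[OF pw(2), of 1, simplified]
  proof eventually_elim
    case (elim n)
    have 1: "(\<Prod>j=1..J. (real n * p n j) ^ k j / fact (k j)) = real n ^ s * (\<Prod>j=1..J. p n j ^ k j) / (\<Prod>j=1..J. fact (k j))"
      by (simp add: prod_dividef power_mult_distrib prod.distrib s_def power_sum)
    have 2: "(1 - q n) ^ n / (1 - q n) ^ s = (1 - q n) ^ (n - s)"
      using elim by (subst power_diff) auto
    have gen: "a / (b * r) * (r * P / F) * X = a / (b * F) * (P * X)" if "r \<noteq> 0" for a b P F X r :: real
      using that by simp
    have "real n ^ s \<noteq> 0" using elim by simp
    from gen[OF this] show ?case
      unfolding 1 2 multinomial_occ_def s_def[symmetric] q_def[symmetric] .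
  qed
  ultimately show ?thesis by (simp add: filterlim_cong)
qed

lemma occupancy_eq_iff:
  "occupancy J I s = k \<longleftrightarrow> k \<in> extensional {1..J} \<and> (\<forall>j\<in>{1..J}. card {i\<in>I. s i = j} = k j)"
proof
  assume "occupancy J I s = k"
  then have k: "k = occupancy J I s" by (rule sym)
  show "k \<in> extensional {1..J} \<and> (\<forall>j\<in>{1..J}. card {i\<in>I. s i = j} = k j)"
    unfolding k occupancy_def by simp
next
  assume k: "k \<in> extensional {1..J} \<and> (\<forall>j\<in>{1..J}. card {i\<in>I. s i = j} = k j)"
  show "occupancy J I s = k"
  proof (rule extensionalityI)
    show "occupancy J I s \<in> extensional {1..J}" by (simp add: occupancy_def)
    show "k \<in> extensional {1..J}" using k by simp
  qed (use k in \<open>simp add: occupancy_def\<close>)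
qed

lemma occupancy_finite_range:
  assumes "finite I"
  shows "occupancy J I s \<in> {1..J} \<rightarrow>\<^sub>E {..card I}"
  unfolding occupancy_def using assms by (auto intro!: card_mono)

context prob_space
begin

lemma occupancy_events:
  assumes I: "finite I" and s: "\<And>i. i \<in> I \<Longrightarrow> (\<lambda>\<omega>. s \<omega> i) \<in> measurable M (count_space (UNIV :: nat set))"
  shows "{\<omega>\<in>space M. occupancy J I (s \<omega>) = k} \<in> sets M"
proof -
  have card: "(\<lambda>\<omega>. card {i\<in>I. s \<omega> i = j}) \<in> measurable M (count_space UNIV)" for j
  proof -
    have "card {i\<in>I. s \<omega> i = j} = (\<Sum>i\<in>I. if s \<omega> i = j then 1 else 0)" for \<omega>
      using I by (simp add: sum.If_cases Int_def)
    moreover have "(\<lambda>\<omega>. \<Sum>i\<in>I. if s \<omega> i = j then 1 else 0 :: nat) \<in> measurable M (count_space UNIV)"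
    proof (rule measurable_sum_nat)
      fix i assume "i \<in> I"
      note s[OF this, measurable]
      show "(\<lambda>\<omega>. if s \<omega> i = j then 1 else 0 :: nat) \<in> measurable M (count_space UNIV)" by measurable
    qed
    ultimately show ?thesis by simp
  qed
  have "{\<omega>\<in>space M. occupancy J I (s \<omega>) = k} = (if k \<in> extensional {1..J}
      then {\<omega>\<in>space M. \<forall>j\<in>{1..J}. card {i\<in>I. s \<omega> i = j} = k j} else {})"
    unfolding occupancy_eq_iff by simp
  moreover have "{\<omega>\<in>space M. \<forall>j\<in>{1..J}. card {i\<in>I. s \<omega> i = j} = k j} \<in> sets M"
  proof (rule sets.sets_Collect_finite_All)
    fix j
    note card[of j, measurable]
    show "{\<omega>\<in>space M. card {i\<in>I. s \<omega> i = j} = k j} \<in> sets M" by measurable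
  qed simp
  ultimately show ?thesis by simp
qed

lemma occupancy_expectation:
  assumes I: "finite I" and s: "\<And>i. i \<in> I \<Longrightarrow> (\<lambda>\<omega>. s \<omega> i) \<in> measurable M (count_space (UNIV :: nat set))"
    and R: "finite R" "{1..J} \<rightarrow>\<^sub>E {..card I} \<subseteq> R"
  shows "(\<integral>\<omega>. (G (occupancy J I (s \<omega>)) :: real) \<partial>M) = (\<Sum>k\<in>R. G k * prob {\<omega>\<in>space M. occupancy J I (s \<omega>) = k})"
    and "(\<Sum>k\<in>R. prob {\<omega>\<in>space M. occupancy J I (s \<omega>) = k}) = 1"
proof -
  have *: "(\<integral>\<omega>. (G (occupancy J I (s \<omega>)) :: real) \<partial>M) = (\<Sum>k\<in>R. G k * prob {\<omega>\<in>space M. occupancy J I (s \<omega>) = k})"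
    for G :: "(nat \<Rightarrow> nat) \<Rightarrow> real"
  proof -
    have "(\<integral>\<omega>. G (occupancy J I (s \<omega>)) \<partial>M)
        = (\<integral>\<omega>. (\<Sum>k\<in>R. G k * indicator {\<omega>\<in>space M. occupancy J I (s \<omega>) = k} \<omega>) \<partial>M)"
    proof (rule Bochner_Integration.integral_cong[OF refl])
      fix \<omega> assume \<omega>: "\<omega> \<in> space M"
      have "occupancy J I (s \<omega>) \<in> R" using occupancy_finite_range[OF I] R by blast
      moreover have "(\<Sum>k\<in>R. G k * indicator {\<omega>\<in>space M. occupancy J I (s \<omega>) = k} \<omega>)
          = (\<Sum>k\<in>R. if k = occupancy J I (s \<omega>) then G k else 0)"
        using \<omega> by (intro sum.cong) (auto simp: indicator_def)
      ultimately show "G (occupancy J I (s \<omega>)) = (\<Sum>k\<in>R. G k * indicator {\<omega>\<in>space M. occupancy J I (s \<omega>) = k} \<omega>)"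
        using R by simp
    qed
    also have "\<dots> = (\<Sum>k\<in>R. G k * prob {\<omega>\<in>space M. occupancy J I (s \<omega>) = k})"
    proof -
      have "{\<omega>\<in>space M. occupancy J I (s \<omega>) = k} \<in> sets M" for k
        by (rule occupancy_events[where s = s, OF I s])
      then have "integrable M (indicat_real {\<omega>\<in>space M. occupancy J I (s \<omega>) = k})" for k
        by (intro integrable_real_indicator) (auto simp: emeasure_eq_measure)
      moreover have "{\<omega>\<in>space M. occupancy J I (s \<omega>) = k} \<inter> space M = {\<omega>\<in>space M. occupancy J I (s \<omega>) = k}" for k
        by blast
      ultimately show ?thesis by (subst Bochner_Integration.integral_sum) simp_all
    qed
    finally show ?thesis .
  qed
  show "(\<integral>\<omega>. (G (occupancy J I (s \<omega>)) :: real) \<partial>M) = (\<Sum>k\<in>R. G k * prob {\<omega>\<in>space M. occupancy J I (s \<omega>) = k})"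
    by (rule *)
  show "(\<Sum>k\<in>R. prob {\<omega>\<in>space M. occupancy J I (s \<omega>) = k}) = 1"
    using *[of "\<lambda>_. 1"] by (simp add: prob_space)
qed

lemma occupancy_multinomial:
  assumes s: "\<And>i. i \<in> {1..n} \<Longrightarrow> (\<lambda>\<omega>. s \<omega> i) \<in> measurable M (count_space (UNIV :: nat set))"
    and sJ: "\<And>\<omega> i. i \<in> {1..n} \<Longrightarrow> \<omega> \<in> space M \<Longrightarrow> s \<omega> i \<le> J"
    and ind: "\<And>f. f \<in> {1..n} \<rightarrow>\<^sub>E {..J} \<Longrightarrow> prob {\<omega>\<in>space M. \<forall>i\<in>{1..n}. s \<omega> i = f i} = (\<Prod>i=1..n. p (f i))"
    and p0: "p 0 = 1 - (\<Sum>j=1..J. p j)"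
    and k: "k \<in> extensional {1..J}" "(\<Sum>j=1..J. k j) \<le> n"
  shows "prob {\<omega>\<in>space M. occupancy J {1..n} (s \<omega>) = k} = multinomial_occ n J p k"
proof -
  define t where "t = (\<Sum>j=1..J. k j)"
  let ?F = "{f \<in> {1..n} \<rightarrow>\<^sub>E {..J}. occupancy J {1..n} f = k}"
  let ?E = "\<lambda>f. {\<omega>\<in>space M. \<forall>i\<in>{1..n}. s \<omega> i = f i}"
  have finF: "finite ?F" by (intro finite_subset[OF _ finite_PiE[of "{1..n}" "\<lambda>_. {..J}"]]) auto
  have Em: "?E f \<in> sets M" for f
  proof (rule sets.sets_Collect_finite_All)
    fix i assume "i \<in> {1..n}"
    note s[OF this, measurable]
    show "{\<omega>\<in>space M. s \<omega> i = f i} \<in> sets M" by measurable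
  qed simp
  have "{\<omega>\<in>space M. occupancy J {1..n} (s \<omega>) = k} = (\<Union>f\<in>?F. ?E f)"
  proof (intro equalityI subsetI)
    fix \<omega> assume \<omega>: "\<omega> \<in> {\<omega>\<in>space M. occupancy J {1..n} (s \<omega>) = k}"
    define f where "f = restrict (s \<omega>) {1..n}"
    have "f \<in> {1..n} \<rightarrow>\<^sub>E {..J}" using sJ \<omega> by (auto simp: f_def)
    moreover have "occupancy J {1..n} f = occupancy J {1..n} (s \<omega>)"
      unfolding occupancy_def f_def by (intro restrict_ext arg_cong[where f = card]) auto
    ultimately have "f \<in> ?F" using \<omega> by simp
    moreover have "\<omega> \<in> ?E f" using \<omega> by (simp add: f_def)
    ultimately show "\<omega> \<in> (\<Union>f\<in>?F. ?E f)" by blast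
  next
    fix \<omega> assume "\<omega> \<in> (\<Union>f\<in>?F. ?E f)"
    then obtain f where f: "occupancy J {1..n} f = k" "\<omega> \<in> space M" "\<forall>i\<in>{1..n}. s \<omega> i = f i" by auto
    have "occupancy J {1..n} (s \<omega>) = occupancy J {1..n} f"
      unfolding occupancy_def using f(3) by (intro restrict_ext arg_cong[where f = card]) auto
    with f show "\<omega> \<in> {\<omega>\<in>space M. occupancy J {1..n} (s \<omega>) = k}" by simp
  qed
  then have "prob {\<omega>\<in>space M. occupancy J {1..n} (s \<omega>) = k} = prob (\<Union>f\<in>?F. ?E f)" by simp
  also have "\<dots> = (\<Sum>f\<in>?F. prob (?E f))"
  proof (rule finite_measure_finite_Union[OF finF])
    show "disjoint_family_on ?E ?F"
      unfolding disjoint_family_on_def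
    proof (intro ballI impI)
      fix f g assume fg: "f \<in> ?F" "g \<in> ?F" "f \<noteq> g"
      then obtain i where "i \<in> {1..n}" "f i \<noteq> g i" by (metis (no_types, lifting) PiE_ext mem_Collect_eq)
      then show "?E f \<inter> ?E g = {}" by force
    qed
  qed (use Em in auto)
  also have "\<dots> = (\<Sum>f\<in>?F. (\<Prod>j=1..J. p j ^ k j) * (1 - (\<Sum>j=1..J. p j)) ^ (n - t))"
  proof (rule sum.cong[OF refl])
    fix f assume f: "f \<in> ?F"
    have occ: "card {i\<in>{1..n}. f i = j} = k j" if "j \<in> {1..J}" for j
      using f that by (auto simp: occupancy_def fun_eq_iff split: if_splits)
    have cards: "(\<Sum>j\<le>J. card {i\<in>{1..n}. f i = j}) = n"
    proof -
      have "(\<Sum>j\<le>J. card {i\<in>{1..n}. f i = j}) = card (\<Union>j\<in>{..J}. {i\<in>{1..n}. f i = j})"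
        by (rule card_UN_disjoint[symmetric]) auto
      also have "(\<Union>j\<in>{..J}. {i\<in>{1..n}. f i = j}) = {1..n}"
      proof -
        have "f i \<le> J" if "i \<in> {1..n}" for i using f that by (auto dest!: PiE_mem)
        then show ?thesis by blast
      qed
      finally show ?thesis by simp
    qed
    then have c0: "card {i\<in>{1..n}. f i = 0} = n - t"
      using occ unfolding t_def by (simp add: atMost_atLeast0 sum.atLeast_Suc_atMost)
    have "prob (?E f) = (\<Prod>i=1..n. p (f i))" using f by (intro ind) auto
    also have "\<dots> = (\<Prod>j\<le>J. \<Prod>i | i \<in> {1..n} \<and> f i = j. p (f i))"
      using f by (intro prod.group[symmetric]) auto
    also have "\<dots> = (\<Prod>j\<le>J. p j ^ card {i\<in>{1..n}. f i = j})" by (intro prod.cong) auto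
    also have "\<dots> = p 0 ^ (n - t) * (\<Prod>j=1..J. p j ^ k j)"
      using occ c0 by (simp add: atMost_atLeast0 prod.atLeast_Suc_atMost)
    finally show "prob (?E f) = (\<Prod>j=1..J. p j ^ k j) * (1 - (\<Sum>j=1..J. p j)) ^ (n - t)"
      by (simp add: p0 mult.commute)
  qed
  also have "\<dots> = multinomial_occ n J p k"
    using card_occupancy[OF k] by (simp add: multinomial_occ_def t_def)
  finally show ?thesis .
qed

end

text \<open>
  Both expectations are means of one and the same bounded function of the occupation numbers, in
  the limit of fine grids. So they differ by at most \<open>c\<close> times the \<open>l\<^sup>1\<close> distance of the laws of these numbers, which is
  computed on a finite set \<open>T\<close> and estimated by the missing masses outside of it.
\<close>

lemma binned_compare:
  assumes M: "prob_space M" and N: "prob_space N"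
    and GM: "prob_space.indep_gauss_paths M S1 NS1 \<beta>1 I1" and GN: "prob_space.indep_gauss_paths N S2 NS2 \<beta>2 I2"
    and \<Phi>: "seq_cont \<Phi>" and c: "\<And>f. continuous_on {0..1} f \<Longrightarrow> \<bar>\<Phi> f\<bar> \<le> c"
    and s1: "\<And>i. i \<in> I1 \<Longrightarrow> (\<lambda>z. s1 z i) \<in> measurable NS1 (count_space UNIV)" "\<And>z i. i \<in> I1 \<Longrightarrow> s1 z i \<le> J"
    and s2: "\<And>i. i \<in> I2 \<Longrightarrow> (\<lambda>z. s2 z i) \<in> measurable NS2 (count_space UNIV)" "\<And>z i. i \<in> I2 \<Longrightarrow> s2 z i \<le> J"
    and T: "finite T"
  shows "\<bar>(\<integral>\<omega>. \<Phi> (\<lambda>t. binned_max C x I1 (s1 (S1 \<omega>)) (\<lambda>i. \<beta>1 i t \<omega>) t) \<partial>M) -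
      (\<integral>\<omega>. \<Phi> (\<lambda>t. binned_max C x I2 (s2 (S2 \<omega>)) (\<lambda>i. \<beta>2 i t \<omega>) t) \<partial>N)\<bar>
    \<le> c * ((\<Sum>k\<in>T. \<bar>measure M {\<omega>\<in>space M. occupancy J I1 (s1 (S1 \<omega>)) = k} -
                        measure N {\<omega>\<in>space N. occupancy J I2 (s2 (S2 \<omega>)) = k}\<bar>)
          + (1 - (\<Sum>k\<in>T. measure M {\<omega>\<in>space M. occupancy J I1 (s1 (S1 \<omega>)) = k}))
          + (1 - (\<Sum>k\<in>T. measure N {\<omega>\<in>space N. occupancy J I2 (s2 (S2 \<omega>)) = k})))"
    (is "\<bar>?EM - ?EN\<bar> \<le> ?B")
proof -
  interpret M: prob_space M by fact
  interpret N: prob_space N by fact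
  have I1: "finite I1" and S1: "S1 \<in> measurable M NS1" using GM by (auto simp: M.indep_gauss_paths_def)
  have I2: "finite I2" and S2: "S2 \<in> measurable N NS2" using GN by (auto simp: N.indep_gauss_paths_def)
  define pM where "pM k = measure M {\<omega>\<in>space M. occupancy J I1 (s1 (S1 \<omega>)) = k}" for k
  define pN where "pN k = measure N {\<omega>\<in>space N. occupancy J I2 (s2 (S2 \<omega>)) = k}" for k
  define G where "G K k = grid_mean \<Phi> C x (Suc K) (occupied J k) fst" for K k
  have Gb: "\<bar>G K k\<bar> \<le> c" for K k
    unfolding G_def by (intro grid_mean_bound[OF \<Phi> _ c]) (auto simp: occupied_def)
  have c0: "0 \<le> c" using Gb[of 0 undefined] by linarith
  define R where "R = ({1..J} \<rightarrow>\<^sub>E {..card I1}) \<union> ({1..J} \<rightarrow>\<^sub>E {..card I2}) \<union> T"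
  have R: "finite R" using T by (auto simp: R_def intro!: finite_PiE)
  have m1: "(\<lambda>\<omega>. s1 (S1 \<omega>) i) \<in> measurable M (count_space UNIV)" if "i \<in> I1" for i
    by (rule measurable_compose[OF S1 s1(1)[OF that]])
  have m2: "(\<lambda>\<omega>. s2 (S2 \<omega>) i) \<in> measurable N (count_space UNIV)" if "i \<in> I2" for i
    by (rule measurable_compose[OF S2 s2(1)[OF that]])
  have R12: "{1..J} \<rightarrow>\<^sub>E {..card I1} \<subseteq> R" "{1..J} \<rightarrow>\<^sub>E {..card I2} \<subseteq> R" by (auto simp: R_def)
  have EM: "(\<integral>\<omega>. G K (occupancy J I1 (s1 (S1 \<omega>))) \<partial>M) = (\<Sum>k\<in>R. G K k * pM k)" for K
    unfolding pM_def by (rule M.occupancy_expectation(1)[where s = "\<lambda>\<omega>. s1 (S1 \<omega>)", OF I1 m1 R R12(1)])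
  have EN: "(\<integral>\<omega>. G K (occupancy J I2 (s2 (S2 \<omega>))) \<partial>N) = (\<Sum>k\<in>R. G K k * pN k)" for K
    unfolding pN_def by (rule N.occupancy_expectation(1)[where s = "\<lambda>\<omega>. s2 (S2 \<omega>)", OF I2 m2 R R12(2)])
  have pM1: "(\<Sum>k\<in>R. pM k) = 1" unfolding pM_def by (rule M.occupancy_expectation(2)[where s = "\<lambda>\<omega>. s1 (S1 \<omega>)", OF I1 m1 R R12(1)])
  have pN1: "(\<Sum>k\<in>R. pN k) = 1" unfolding pN_def by (rule N.occupancy_expectation(2)[where s = "\<lambda>\<omega>. s2 (S2 \<omega>)", OF I2 m2 R R12(2)])
  have TR: "T \<subseteq> R" by (simp add: R_def)
  have bound: "\<bar>(\<Sum>k\<in>R. G K k * pM k) - (\<Sum>k\<in>R. G K k * pN k)\<bar>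
      \<le> c * ((\<Sum>k\<in>T. \<bar>pM k - pN k\<bar>) + (1 - (\<Sum>k\<in>T. pM k)) + (1 - (\<Sum>k\<in>T. pN k)))" for K
  proof -
    have "\<bar>(\<Sum>k\<in>R. G K k * pM k) - (\<Sum>k\<in>R. G K k * pN k)\<bar> = \<bar>\<Sum>k\<in>R. G K k * (pM k - pN k)\<bar>"
      by (simp only: sum_subtractf[symmetric] right_diff_distrib)
    also have "\<dots> \<le> (\<Sum>k\<in>R. \<bar>G K k * (pM k - pN k)\<bar>)" by (rule sum_abs)
    also have "\<dots> \<le> (\<Sum>k\<in>R. c * \<bar>pM k - pN k\<bar>)"
      using Gb by (intro sum_mono) (auto simp: abs_mult intro!: mult_right_mono)
    also have "\<dots> = c * (\<Sum>k\<in>R. \<bar>pM k - pN k\<bar>)" by (rule sum_distrib_left[symmetric])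
    also have "(\<Sum>k\<in>R. \<bar>pM k - pN k\<bar>) = (\<Sum>k\<in>R - T. \<bar>pM k - pN k\<bar>) + (\<Sum>k\<in>T. \<bar>pM k - pN k\<bar>)"
      by (rule sum.subset_diff[OF TR R])
    also have "c * ((\<Sum>k\<in>R - T. \<bar>pM k - pN k\<bar>) + (\<Sum>k\<in>T. \<bar>pM k - pN k\<bar>)) \<le> c * ((\<Sum>k\<in>R - T. pM k + pN k) + (\<Sum>k\<in>T. \<bar>pM k - pN k\<bar>))"
    proof -
      have "\<bar>pM k - pN k\<bar> \<le> pM k + pN k" for k
      proof -
        have "0 \<le> pM k" "0 \<le> pN k" by (simp_all add: pM_def pN_def)
        then show ?thesis by linarith
      qed
      then show ?thesis using c0 by (intro mult_left_mono add_right_mono sum_mono) auto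
    qed
    also have "(\<Sum>k\<in>R - T. pM k + pN k) = (1 - (\<Sum>k\<in>T. pM k)) + (1 - (\<Sum>k\<in>T. pN k))"
      using sum.subset_diff[OF TR R, of pM] sum.subset_diff[OF TR R, of pN] pM1 pN1
      by (simp add: sum.distrib)
    finally show ?thesis by (simp add: algebra_simps)
  qed
  have "(\<lambda>K. \<bar>(\<integral>\<omega>. G K (occupancy J I1 (s1 (S1 \<omega>))) \<partial>M) - (\<integral>\<omega>. G K (occupancy J I2 (s2 (S2 \<omega>))) \<partial>N)\<bar>)
      \<longlonglongrightarrow> \<bar>?EM - ?EN\<bar>"
    unfolding G_def
    by (intro tendsto_rabs tendsto_diff M.binned_expectation_limit[OF GM \<Phi> c s1]
        N.binned_expectation_limit[OF GN \<Phi> c s2])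
  then show ?thesis
  proof (rule LIMSEQ_le_const2, intro exI[of _ 0] allI impI)
    fix K
    show "\<bar>(\<integral>\<omega>. G K (occupancy J I1 (s1 (S1 \<omega>))) \<partial>M) - (\<integral>\<omega>. G K (occupancy J I2 (s2 (S2 \<omega>))) \<partial>N)\<bar> \<le> ?B"
      unfolding EM EN using bound[of K] unfolding pM_def pN_def .
  qed
qed

section \<open>Binning the starting points and discarding the low ones\<close>

definition level :: "real \<Rightarrow> real \<Rightarrow> nat \<Rightarrow> real" where
  "level A \<delta> j = - A + real j * \<delta>"

text \<open>
  The window \<open>(- A, level A \<delta> J]\<close> is cut into \<open>J\<close> half-open bins of width \<open>\<delta>\<close>, numbered from 1; all other points go to
  bin 0.
\<close>

definition bin :: "real \<Rightarrow> real \<Rightarrow> nat \<Rightarrow> real \<Rightarrow> nat" where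
  "bin A \<delta> J x = (if - A < x \<and> x \<le> level A \<delta> J then nat \<lceil>(x + A) / \<delta>\<rceil> else 0)"

lemma bin_eq_iff:
  assumes \<delta>: "0 < \<delta>" and j: "1 \<le> j" "j \<le> J"
  shows "bin A \<delta> J x = j \<longleftrightarrow> level A \<delta> (j - 1) < x \<and> x \<le> level A \<delta> j"
proof
  assume b: "bin A \<delta> J x = j"
  then have c: "- A < x" "nat \<lceil>(x + A) / \<delta>\<rceil> = j" using j by (auto simp: bin_def split: if_splits)
  then have "\<lceil>(x + A) / \<delta>\<rceil> = int j" using j by auto
  then have "real j - 1 < (x + A) / \<delta>" "(x + A) / \<delta> \<le> real j" by linarith+
  then show "level A \<delta> (j - 1) < x \<and> x \<le> level A \<delta> j"
    using \<delta> j by (simp add: level_def pos_less_divide_eq pos_divide_le_eq of_nat_diff)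
next
  assume x: "level A \<delta> (j - 1) < x \<and> x \<le> level A \<delta> j"
  then have "real j - 1 < (x + A) / \<delta>" "(x + A) / \<delta> \<le> real j"
    using \<delta> j by (auto simp: level_def pos_less_divide_eq pos_divide_le_eq of_nat_diff)
  then have "\<lceil>(x + A) / \<delta>\<rceil> = int j" by linarith
  moreover have "- A < x"
  proof -
    have "0 \<le> real (j - 1) * \<delta>" using \<delta> by simp
    then show ?thesis using x by (simp add: level_def)
  qed
  moreover have "x \<le> level A \<delta> J"
  proof -
    have "real j * \<delta> \<le> real J * \<delta>" using \<delta> j by (intro mult_right_mono) auto
    then show ?thesis using x by (simp add: level_def)
  qed
  ultimately show "bin A \<delta> J x = j" by (simp add: bin_def)
qed

lemma bin_le: 
  assumes "0 < \<delta>"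
  shows "bin A \<delta> J x \<le> J"
proof -
  have "(x + A) / \<delta> \<le> real J" if "x \<le> level A \<delta> J"
    using that assms by (simp add: level_def pos_divide_le_eq)
  then show ?thesis by (auto simp: bin_def nat_le_iff ceiling_le_iff)
qed

lemma bin_eq_0_iff:
  assumes "0 < \<delta>"
  shows "bin A \<delta> J x = 0 \<longleftrightarrow> x \<le> - A \<or> level A \<delta> J < x"
proof -
  have "0 < \<lceil>(x + A) / \<delta>\<rceil>" if "- A < x" using that assms by (simp add: zero_less_ceiling)
  then show ?thesis by (auto simp: bin_def)
qed

lemma bin_level:
  assumes "0 < \<delta>" "bin A \<delta> J x \<noteq> 0"
  shows "x \<le> level A \<delta> (bin A \<delta> J x)" "level A \<delta> (bin A \<delta> J x) \<le> x + \<delta>"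
  using bin_eq_iff[OF assms(1), of "bin A \<delta> J x" J A x] bin_le[OF assms(1), of A J x] assms(2)
  by (auto simp: level_def of_nat_diff left_diff_distrib)

lemma bin_measurable [measurable]: "bin A \<delta> J \<in> measurable borel (count_space UNIV)"
  unfolding bin_def by measurable

text \<open>
  The floor \<open>- C\<close> makes the maximum insensitive to all low curves, and well-defined for empty index sets.
\<close>

definition floor_max :: "real \<Rightarrow> 'i set \<Rightarrow> ('i \<Rightarrow> real) \<Rightarrow> real" where
  "floor_max C I v = Max (insert (- C) (v ` I))"

lemma floor_max_le_iff: "finite I \<Longrightarrow> floor_max C I v \<le> y \<longleftrightarrow> - C \<le> y \<and> (\<forall>i\<in>I. v i \<le> y)"
  by (simp add: floor_max_def)

lemma floor_max_ge: "finite I \<Longrightarrow> - C \<le> floor_max C I v" "finite I \<Longrightarrow> i \<in> I \<Longrightarrow> v i \<le> floor_max C I v"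
  by (simp_all add: floor_max_def)

lemma binned_max_le_iff:
  "finite I \<Longrightarrow> binned_max C x I s v t \<le> y \<longleftrightarrow> - C \<le> y \<and> (\<forall>i\<in>I. s i \<noteq> 0 \<longrightarrow> x (s i) + v i - t / 2 \<le> y)"
  by (auto simp: binned_max_def)

text \<open>
  Rounding a starting point up to the next level moves its curve by at most \<open>\<delta>\<close>; as no
  point lies above the window, those in bin 0 are the low ones, whose curves stay below the floor.
\<close>

lemma floor_max_binned_max:
  assumes I: "finite I" and \<delta>: "0 < \<delta>" and e: "0 \<le> e"
    and high: "\<And>i. i \<in> I \<Longrightarrow> X i \<le> level A \<delta> J"
    and low: "\<And>i. i \<in> I \<Longrightarrow> X i \<le> - A \<Longrightarrow> z i \<le> - C"
    and close: "\<And>i. i \<in> I \<Longrightarrow> - A < X i \<Longrightarrow> \<bar>z i - (X i + v i - t / 2)\<bar> \<le> e"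
  shows "\<bar>floor_max C I z - binned_max C (level A \<delta>) I (\<lambda>i. bin A \<delta> J (X i)) v t\<bar> \<le> e + \<delta>"
proof -
  let ?b = "\<lambda>i. bin A \<delta> J (X i)"
  let ?F = "floor_max C I z" and ?B = "binned_max C (level A \<delta>) I ?b v t"
  have B: "- C \<le> ?B" "\<And>i. i \<in> I \<Longrightarrow> ?b i \<noteq> 0 \<Longrightarrow> level A \<delta> (?b i) + v i - t / 2 \<le> ?B"
    using binned_max_le_iff[OF I, of C "level A \<delta>" ?b v t ?B] by auto
  have "?F \<le> ?B + (e + \<delta>)"
    unfolding floor_max_le_iff[OF I]
  proof (intro conjI ballI)
    show "- C \<le> ?B + (e + \<delta>)" using B(1) \<delta> e by simp
    fix i assume i: "i \<in> I"
    show "z i \<le> ?B + (e + \<delta>)"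
    proof (cases "X i \<le> - A")
      case True
      then show ?thesis using low[OF i] B(1) \<delta> e by simp
    next
      case False
      then have nz: "?b i \<noteq> 0" using high[OF i] bin_eq_0_iff[OF \<delta>] by auto
      show ?thesis using close[OF i] False B(2)[OF i nz] bin_level(1)[OF \<delta> nz] \<delta> by simp
    qed
  qed
  moreover have "?B \<le> ?F + (e + \<delta>)"
    unfolding binned_max_le_iff[OF I]
  proof (intro conjI ballI impI)
    show "- C \<le> ?F + (e + \<delta>)" using floor_max_ge(1)[OF I, of C z] \<delta> e by simp
    fix i assume i: "i \<in> I" and nz: "?b i \<noteq> 0"
    have "- A < X i" using nz bin_eq_0_iff[OF \<delta>] by auto
    then show "level A \<delta> (?b i) + v i - t / 2 \<le> ?F + (e + \<delta>)"
      using close[OF i] floor_max_ge(2)[OF I i, of z C] bin_level(2)[OF \<delta> nz] by simp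
  qed
  ultimately show ?thesis by simp
qed

context prob_space
begin

lemma lip_expectation_close:
  assumes \<Phi>: "lip L \<Phi>" and c: "\<And>f. continuous_on {0..1} f \<Longrightarrow> \<bar>\<Phi> f\<bar> \<le> c" and e: "0 \<le> e"
    and Y: "\<And>\<omega>. \<omega> \<in> space M \<Longrightarrow> continuous_on {0..1} (\<lambda>t. Y t \<omega>)" "\<And>t. t \<in> {0..1} \<Longrightarrow> Y t \<in> borel_measurable M"
    and Z: "\<And>\<omega>. \<omega> \<in> space M \<Longrightarrow> continuous_on {0..1} (\<lambda>t. Z t \<omega>)" "\<And>t. t \<in> {0..1} \<Longrightarrow> Z t \<in> borel_measurable M"
    and bad: "bad \<in> sets M"
    and close: "\<And>\<omega> t. \<omega> \<in> space M \<Longrightarrow> \<omega> \<notin> bad \<Longrightarrow> t \<in> {0..1} \<Longrightarrow> \<bar>Y t \<omega> - Z t \<omega>\<bar> \<le> e"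
  shows "\<bar>(\<integral>\<omega>. \<Phi> (\<lambda>t. Y t \<omega>) \<partial>M) - (\<integral>\<omega>. \<Phi> (\<lambda>t. Z t \<omega>) \<partial>M)\<bar> \<le> L * e + 2 * c * prob bad"
proof -
  have L: "0 \<le> L" using \<Phi> by (simp add: lip_def)
  have Ym: "(\<lambda>\<omega>. \<Phi> (\<lambda>t. Y t \<omega>)) \<in> borel_measurable M"
    by (rule seq_cont_measurable[OF lip_seq_cont[OF \<Phi>] Y])
  have Zm: "(\<lambda>\<omega>. \<Phi> (\<lambda>t. Z t \<omega>)) \<in> borel_measurable M"
    by (rule seq_cont_measurable[OF lip_seq_cont[OF \<Phi>] Z])
  have Yi: "integrable M (\<lambda>\<omega>. \<Phi> (\<lambda>t. Y t \<omega>))"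
    by (rule integrable_const_bound[where B = c]) (use c Y Ym in auto)
  have Zi: "integrable M (\<lambda>\<omega>. \<Phi> (\<lambda>t. Z t \<omega>))"
    by (rule integrable_const_bound[where B = c]) (use c Z Zm in auto)
  have bi: "integrable M (indicat_real bad)"
    using bad by (intro integrable_real_indicator) (auto simp: emeasure_eq_measure)
  have "\<bar>(\<integral>\<omega>. \<Phi> (\<lambda>t. Y t \<omega>) \<partial>M) - (\<integral>\<omega>. \<Phi> (\<lambda>t. Z t \<omega>) \<partial>M)\<bar>
      = \<bar>\<integral>\<omega>. \<Phi> (\<lambda>t. Y t \<omega>) - \<Phi> (\<lambda>t. Z t \<omega>) \<partial>M\<bar>"
    using Yi Zi by simp
  also have "\<dots> \<le> (\<integral>\<omega>. \<bar>\<Phi> (\<lambda>t. Y t \<omega>) - \<Phi> (\<lambda>t. Z t \<omega>)\<bar> \<partial>M)"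
    by (rule integral_abs_bound)
  also have "\<dots> \<le> (\<integral>\<omega>. L * e + 2 * c * indicator bad \<omega> \<partial>M)"
  proof (rule integral_mono)
    show "integrable M (\<lambda>\<omega>. \<bar>\<Phi> (\<lambda>t. Y t \<omega>) - \<Phi> (\<lambda>t. Z t \<omega>)\<bar>)" using Yi Zi by simp
    show "integrable M (\<lambda>\<omega>. L * e + 2 * c * indicator bad \<omega>)" using bi by simp
    fix \<omega> assume \<omega>: "\<omega> \<in> space M"
    show "\<bar>\<Phi> (\<lambda>t. Y t \<omega>) - \<Phi> (\<lambda>t. Z t \<omega>)\<bar> \<le> L * e + 2 * c * indicator bad \<omega>"
    proof (cases "\<omega> \<in> bad")
      case True
      have "\<bar>\<Phi> (\<lambda>t. Y t \<omega>)\<bar> \<le> c" "\<bar>\<Phi> (\<lambda>t. Z t \<omega>)\<bar> \<le> c" using c Y Z \<omega> by auto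
      moreover have "0 \<le> L * e" using L e by simp
      ultimately show ?thesis using True by simp
    next
      case False
      then show ?thesis using lipD[OF \<Phi> Y(1)[OF \<omega>] Z(1)[OF \<omega>] close[OF \<omega> False]] by simp
    qed
  qed
  also have "\<dots> = L * e + 2 * c * prob bad"
  proof -
    have "bad \<inter> space M = bad" using bad sets.sets_into_space by blast
    then show ?thesis using bi by (simp add: prob_space)
  qed
  finally show ?thesis .
qed

text \<open>
  Slice the points below \<open>- a\<close> into unit intervals. A point near \<open>- k\<close> needs an excursion \<open>U\<close> of size \<open>k - C\<close>, which costs
  \<open>exp (- 4 k)\<close> and beats the number \<open>exp (2 k)\<close> of such points; a geometric series with ratio
  \<open>exp (- 2)\<close> remains.
\<close>

lemma low_points_bound:
  assumes I: "finite I"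
    and X: "\<And>i. i \<in> I \<Longrightarrow> X i \<in> borel_measurable M" and U: "\<And>i. i \<in> I \<Longrightarrow> U i \<in> borel_measurable M"
    and tail: "\<And>i u (k::nat). i \<in> I \<Longrightarrow> prob {\<omega>\<in>space M. (- real (Suc k) < X i \<omega> \<and> X i \<omega> \<le> - real k) \<and> u < U i \<omega>}
        \<le> prob {\<omega>\<in>space M. - real (Suc k) < X i \<omega> \<and> X i \<omega> \<le> - real k} * (\<kappa> * exp (- 4 * u))"
    and Q: "\<And>k::nat. (\<Sum>i\<in>I. prob {\<omega>\<in>space M. - real k < X i \<omega>}) \<le> Q * exp (2 * real k)"
    and pos: "0 \<le> \<kappa>" "0 \<le> Q"
  shows "(\<Sum>i\<in>I. prob {\<omega>\<in>space M. X i \<omega> \<le> - real a \<and> - C < X i \<omega> + U i \<omega>})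
    \<le> 2 * Q * \<kappa> * exp (2 + 4 * C) * exp (- 2 * real a)"
proof -
  define p where "p i k = prob {\<omega>\<in>space M. (- real (Suc (k + a)) < X i \<omega> \<and> X i \<omega> \<le> - real (k + a)) \<and> real (k + a) - C < U i \<omega>}" for i k
  define g where "g k = Q * \<kappa> * exp (2 + 4 * C) * exp (- 2 * real a) * exp (- 2) ^ k" for k :: nat
  have ev: "{\<omega>\<in>space M. (- real (Suc k) < X i \<omega> \<and> X i \<omega> \<le> - real k) \<and> u < U i \<omega>} \<in> sets M"
    "{\<omega>\<in>space M. - real (Suc k) < X i \<omega> \<and> X i \<omega> \<le> - real k} \<in> sets M"
    "{\<omega>\<in>space M. - real k < X i \<omega>} \<in> sets M"
    "{\<omega>\<in>space M. X i \<omega> \<le> - real k \<and> - C < X i \<omega> + U i \<omega>} \<in> sets M" if "i \<in> I" for i u k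
    using X[OF that] U[OF that] by measurable
  have pg: "(\<Sum>i\<in>I. p i k) \<le> g k" for k
  proof -
    have "(\<Sum>i\<in>I. p i k) \<le> (\<Sum>i\<in>I. prob {\<omega>\<in>space M. - real (Suc (k + a)) < X i \<omega>} * (\<kappa> * exp (- 4 * (real (k + a) - C))))"
    proof (rule sum_mono)
      fix i assume i: "i \<in> I"
      have "p i k \<le> prob {\<omega>\<in>space M. - real (Suc (k + a)) < X i \<omega> \<and> X i \<omega> \<le> - real (k + a)} * (\<kappa> * exp (- 4 * (real (k + a) - C)))"
        unfolding p_def by (rule tail[OF i])
      also have "\<dots> \<le> prob {\<omega>\<in>space M. - real (Suc (k + a)) < X i \<omega>} * (\<kappa> * exp (- 4 * (real (k + a) - C)))"
        using ev(3)[OF i, of "Suc (k + a)"] pos by (intro mult_right_mono finite_measure_mono) auto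
      finally show "p i k \<le> prob {\<omega>\<in>space M. - real (Suc (k + a)) < X i \<omega>} * (\<kappa> * exp (- 4 * (real (k + a) - C)))" .
    qed
    also have "\<dots> = (\<Sum>i\<in>I. prob {\<omega>\<in>space M. - real (Suc (k + a)) < X i \<omega>}) * (\<kappa> * exp (- 4 * (real (k + a) - C)))"
      by (rule sum_distrib_right[symmetric])
    also have "\<dots> \<le> (Q * exp (2 * real (Suc (k + a)))) * (\<kappa> * exp (- 4 * (real (k + a) - C)))"
      using pos by (intro mult_right_mono Q) auto
    also have "\<dots> = Q * \<kappa> * (exp (2 * real (Suc (k + a))) * exp (- 4 * (real (k + a) - C)))" by (simp only: mult_ac)
    also have "exp (2 * real (Suc (k + a))) * exp (- 4 * (real (k + a) - C)) = exp (2 + 4 * C) * exp (- 2 * real a) * exp (- 2 * real k)"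
      by (simp add: exp_add[symmetric] algebra_simps)
    also have "exp (- 2 * real k) = exp (- 2) ^ k" by (simp add: exp_of_nat_mult[symmetric] mult.commute)
    finally show ?thesis by (simp add: g_def mult.assoc)
  qed
  have p0: "0 \<le> p i k" for i k by (simp add: p_def)
  have pik: "p i k \<le> g k" if "i \<in> I" for i k
    using member_le_sum[OF that, of "\<lambda>i. p i k"] p0 I pg[of k] by force
  have r: "exp (- 2) < (1 / 2 :: real)"
  proof -
    have "(1 + 2 :: real) \<le> exp 2" by (rule exp_ge_add_one_self)
    then show ?thesis by (simp add: exp_minus field_simps)
  qed
  have gs: "summable g" unfolding g_def using r by (intro summable_mult summable_geometric) auto
  have ps: "summable (p i)" if "i \<in> I" for i
    by (rule summable_comparison_test'[OF gs, of 0]) (use pik[OF that] p0 in auto)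
  have "prob {\<omega>\<in>space M. X i \<omega> \<le> - real a \<and> - C < X i \<omega> + U i \<omega>} \<le> (\<Sum>k. p i k)" if i: "i \<in> I" for i
  proof -
    let ?E = "\<lambda>k. {\<omega>\<in>space M. (- real (Suc (k + a)) < X i \<omega> \<and> X i \<omega> \<le> - real (k + a)) \<and> real (k + a) - C < U i \<omega>}"
    have "{\<omega>\<in>space M. X i \<omega> \<le> - real a \<and> - C < X i \<omega> + U i \<omega>} \<subseteq> (\<Union>k. ?E k)"
    proof
      fix \<omega> assume \<omega>: "\<omega> \<in> {\<omega>\<in>space M. X i \<omega> \<le> - real a \<and> - C < X i \<omega> + U i \<omega>}"
      define q where "q = nat \<lfloor>- X i \<omega>\<rfloor>"
      have "real a \<le> - X i \<omega>" using \<omega> by simp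
      then have "int a \<le> \<lfloor>- X i \<omega>\<rfloor>" by (simp add: le_floor_iff)
      then have q: "a \<le> q" "real q = of_int \<lfloor>- X i \<omega>\<rfloor>" by (auto simp: q_def)
      have "real q \<le> - X i \<omega>" "- X i \<omega> < real q + 1" unfolding q(2) by linarith+
      then have "\<omega> \<in> ?E (q - a)" using \<omega> q(1) by auto
      then show "\<omega> \<in> (\<Union>k. ?E k)" by blast
    qed
    moreover have Em: "range ?E \<subseteq> sets M" using ev(1)[OF i] by blast
    ultimately have "prob {\<omega>\<in>space M. X i \<omega> \<le> - real a \<and> - C < X i \<omega> + U i \<omega>} \<le> prob (\<Union>k. ?E k)"
      by (intro finite_measure_mono sets.countable_UN)
    also have "\<dots> \<le> (\<Sum>k. prob (?E k))"
      using ps[OF i] unfolding p_def by (intro finite_measure_subadditive_countably Em)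
    finally show ?thesis unfolding p_def .
  qed
  then have "(\<Sum>i\<in>I. prob {\<omega>\<in>space M. X i \<omega> \<le> - real a \<and> - C < X i \<omega> + U i \<omega>}) \<le> (\<Sum>i\<in>I. \<Sum>k. p i k)"
    by (rule sum_mono)
  also have "\<dots> = (\<Sum>k. \<Sum>i\<in>I. p i k)" using ps by (rule suminf_sum[symmetric])
  also have "\<dots> \<le> (\<Sum>k. g k)" using ps pg gs by (intro suminf_le summable_sum) auto
  also have "\<dots> = Q * \<kappa> * exp (2 + 4 * C) * exp (- 2 * real a) * (1 / (1 - exp (- 2)))"
    unfolding g_def using r by (subst suminf_mult) (auto simp: suminf_geometric intro!: summable_geometric)
  also have "\<dots> \<le> Q * \<kappa> * exp (2 + 4 * C) * exp (- 2 * real a) * 2"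
  proof (intro mult_left_mono)
    show "1 / (1 - exp (- 2)) \<le> (2::real)" using r by (simp add: divide_le_eq)
  qed (use pos in auto)
  finally show ?thesis by (simp add: mult_ac)
qed

end

section \<open>Poisson points with exponential intensity\<close>

abbreviation exp_intensity :: "real measure" where
  "exp_intensity \<equiv> density lborel (\<lambda>x. ennreal (exp (- x)))"

lemma emeasure_exp_intensity_Ioi: "emeasure exp_intensity {a<..} = ennreal (exp (- a))"
proof -
  have "emeasure exp_intensity {a<..} = (\<integral>\<^sup>+x. ennreal (exp (- x)) * indicator {a<..} x \<partial>lborel)"
    by (rule emeasure_density) auto
  also have "\<dots> = (\<integral>\<^sup>+x. ennreal (exp (- x)) * indicator {a..} x \<partial>lborel)"
  proof (rule nn_integral_cong_AE)
    show "AE x in lborel. ennreal (exp (- x)) * indicator {a<..} x = ennreal (exp (- x)) * indicator {a..} x"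
      using AE_lborel_singleton[of a] by eventually_elim (auto split: split_indicator)
  qed
  also have "\<dots> = ennreal (0 - (- exp (- a)))"
  proof (rule nn_integral_FTC_atLeast)
    show "((\<lambda>x::real. - exp (- x)) \<longlongrightarrow> 0) at_top" by real_asymp
  qed (auto intro!: derivative_eq_intros)
  finally show ?thesis by simp
qed

lemma emeasure_exp_intensity_Ioc:
  assumes "a \<le> b"
  shows "emeasure exp_intensity {a<..b} = ennreal (exp (- a) - exp (- b))"
proof -
  have "{a<..b} = {a<..} - {b<..}" by auto
  also have "emeasure exp_intensity ({a<..} - {b<..}) = emeasure exp_intensity {a<..} - emeasure exp_intensity {b<..}"
    using assms by (intro emeasure_Diff) (auto simp: emeasure_exp_intensity_Ioi)
  also have "\<dots> = ennreal (exp (- a) - exp (- b))"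
    by (simp add: emeasure_exp_intensity_Ioi ennreal_minus)
  finally show ?thesis .
qed

text \<open>
  If only finitely many curves ever exceed any given level, then, one fixed curve being bounded below, the
  supremum is attained among finitely many curves, and the same finitely many serve all times.
\<close>

lemma greatest_of_tail_finite:
  fixes z :: "nat \<Rightarrow> real \<Rightarrow> real"
  assumes cont: "\<And>i. continuous_on {0..1} (z i)"
    and fin: "\<And>C::nat. finite {i. \<exists>t\<in>{0..1}. - real C < z i t}"
  shows "continuous_on {0..1} (\<lambda>t. GREATEST y. \<exists>i. y = z i t)"
    and "\<exists>n0\<ge>1. \<forall>n\<ge>n0. \<forall>t\<in>{0..1}. \<forall>C. floor_max C {..<n} (\<lambda>i. z i t) = max (- C) (GREATEST y. \<exists>i. y = z i t)
      \<and> Max ((\<lambda>i. z i t) ` {..<n}) = (GREATEST y. \<exists>i. y = z i t)"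
proof -
  have "compact (z 0 ` {0..1})" using cont by (intro compact_continuous_image) auto
  then have "bdd_below (z 0 ` {0..1})" by (intro bounded_imp_bdd_below compact_imp_bounded)
  then obtain m where m: "m \<le> z 0 t" if "t \<in> {0..1}" for t unfolding bdd_below_def by blast
  obtain C0 :: nat where C0: "- m < real C0" using reals_Archimedean2 by blast
  \<comment> \<open>below the minimum of curve 0 no curve can be the greatest\<close>
  define S where "S = insert 0 {i. \<exists>t\<in>{0..1}. - real C0 < z i t}"
  have S: "finite S" "S \<noteq> {}" using fin by (auto simp: S_def)
  define G where "G t = Max ((\<lambda>i. z i t) ` S)" for t
  have Gge: "z i t \<le> G t" if t: "t \<in> {0..1}" for i t
  proof (cases "i \<in> S")
    case True
    then show ?thesis unfolding G_def using S by (intro Max_ge) auto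
  next
    case False
    then have "z i t \<le> - real C0" using t by (auto simp: S_def not_less)
    also have "\<dots> \<le> z 0 t" using m[OF t] C0 by simp
    also have "\<dots> \<le> G t" unfolding G_def using S by (intro Max_ge) (auto simp: S_def)
    finally show ?thesis .
  qed
  have Gin: "\<exists>i\<in>S. G t = z i t" for t
  proof -
    have "G t \<in> (\<lambda>i. z i t) ` S" unfolding G_def using S by (intro Max_in) auto
    then show ?thesis by blast
  qed
  have eq: "(GREATEST y. \<exists>i. y = z i t) = G t" if t: "t \<in> {0..1}" for t
    using Gge[OF t] Gin[of t] by (intro Greatest_equality) auto
  have "continuous_on {0..1} G"
    unfolding G_def by (intro continuous_on_Max S cont)
  then show "continuous_on {0..1} (\<lambda>t. GREATEST y. \<exists>i. y = z i t)"
    by (rule continuous_on_eq) (simp add: eq)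
  show "\<exists>n0\<ge>1. \<forall>n\<ge>n0. \<forall>t\<in>{0..1}. \<forall>C. floor_max C {..<n} (\<lambda>i. z i t) = max (- C) (GREATEST y. \<exists>i. y = z i t)
      \<and> Max ((\<lambda>i. z i t) ` {..<n}) = (GREATEST y. \<exists>i. y = z i t)"
  proof (intro exI[of _ "Suc (Max S)"] conjI allI impI ballI)
    fix n t C assume n: "Suc (Max S) \<le> n" and t: "t \<in> {0..1::real}"
    have Sn: "S \<subseteq> {..<n}"
    proof
      fix i assume "i \<in> S"
      then have "i \<le> Max S" using S by (intro Max_ge) auto
      then show "i \<in> {..<n}" using n by simp
    qed
    have M: "Max ((\<lambda>i. z i t) ` {..<n}) = G t"
    proof (rule Max_eqI)
      show "y \<le> G t" if "y \<in> (\<lambda>i. z i t) ` {..<n}" for y using that Gge[OF t] by auto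
      show "G t \<in> (\<lambda>i. z i t) ` {..<n}" using Gin[of t] Sn by auto
    qed simp
    show "Max ((\<lambda>i. z i t) ` {..<n}) = (GREATEST y. \<exists>i. y = z i t)" using M eq[OF t] by simp
    have "(\<lambda>i. z i t) ` {..<n} \<noteq> {}" using n by (auto simp: lessThan_empty_iff)
    then show "floor_max C {..<n} (\<lambda>i. z i t) = max (- C) (GREATEST y. \<exists>i. y = z i t)"
      unfolding floor_max_def using M eq[OF t] by simp
  qed simp
qed

context prob_space
begin

lemma poisson_points_count_measurable:
  assumes P: "poisson_points \<mu> X" and A: "A \<in> sets borel"
  shows "point_count X A \<in> borel_measurable M"
proof -
  have "indep_vars (\<lambda>_. borel) (\<lambda>j. point_count X ((\<lambda>_. A) j)) {..<1::nat}"
    using P[unfolded poisson_points_def, THEN conjunct2, THEN conjunct2, rule_format, of "\<lambda>_. A" 1] A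
    by (auto simp: disjoint_family_on_def)
  then show ?thesis by (auto simp: indep_vars_def)
qed

text \<open>
  The Poisson probabilities of the finite values add up to 1.
\<close>

lemma poisson_points_count_AE:
  assumes P: "poisson_points \<mu> X" and A: "A \<in> sets borel" "emeasure \<mu> A < \<infinity>"
  shows "AE \<omega> in M. \<exists>k::nat. point_count X A \<omega> = of_nat k"
proof -
  note m[measurable] = poisson_points_count_measurable[OF P A(1)]
  let ?E = "\<lambda>k::nat. {\<omega>\<in>space M. point_count X A \<omega> = of_nat k}"
  have p: "prob (?E k) = measure \<mu> A ^ k / fact k * exp (- measure \<mu> A)" for k
    using P A unfolding poisson_points_def by blast
  have "disjoint_family ?E" by (auto simp: disjoint_family_on_def)
  then have "(\<lambda>k. prob (?E k)) sums prob (\<Union>k. ?E k)" by (intro finite_measure_UNION) auto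
  moreover have "(\<lambda>k. prob (?E k)) sums 1"
  proof -
    have "(\<lambda>k. measure \<mu> A ^ k /\<^sub>R fact k * exp (- measure \<mu> A)) sums (exp (measure \<mu> A) * exp (- measure \<mu> A))"
      by (intro sums_mult2 exp_converges)
    then show ?thesis unfolding p by (simp add: exp_add[symmetric] divide_inverse mult.commute)
  qed
  ultimately have "prob (\<Union>k. ?E k) = 1" using sums_unique2 by blast
  then have "AE \<omega> in M. \<omega> \<in> (\<Union>k. ?E k)" by (rule prob_eq_1[THEN iffD1, rotated]) auto
  then show ?thesis by eventually_elim auto
qed

lemma poisson_points_expected_count:
  assumes P: "poisson_points \<mu> X" and A: "A \<in> sets borel" "emeasure \<mu> A < \<infinity>"
  shows "(\<integral>\<^sup>+\<omega>. point_count X A \<omega> \<partial>M) = ennreal (measure \<mu> A)"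
proof -
  note m[measurable] = poisson_points_count_measurable[OF P A(1)]
  let ?E = "\<lambda>k::nat. {\<omega>\<in>space M. point_count X A \<omega> = of_nat k}"
  define \<nu> where "\<nu> = measure \<mu> A"
  have p: "prob (?E k) = \<nu> ^ k / fact k * exp (- \<nu>)" for k
    using P A unfolding poisson_points_def \<nu>_def by blast
  have "(\<integral>\<^sup>+\<omega>. point_count X A \<omega> \<partial>M) = (\<integral>\<^sup>+\<omega>. (\<Sum>k. of_nat k * indicator (?E k) \<omega>) \<partial>M)"
  proof (rule nn_integral_cong_AE)
    show "AE \<omega> in M. point_count X A \<omega> = (\<Sum>k. of_nat k * indicator (?E k) \<omega>)"
      using poisson_points_count_AE[OF P A] AE_space
    proof eventually_elim
      case (elim \<omega>)
      then obtain k :: nat where k: "point_count X A \<omega> = of_nat k" by auto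
      have "(\<Sum>l. of_nat l * indicator (?E l) \<omega>) = (\<Sum>l\<in>{k}. of_nat l * indicator (?E l) \<omega> :: ennreal)"
        using k elim(2) by (intro suminf_finite) (auto simp: indicator_def)
      then show ?case using k elim(2) by simp
    qed
  qed
  also have "\<dots> = (\<Sum>k. \<integral>\<^sup>+\<omega>. of_nat k * indicator (?E k) \<omega> \<partial>M)"
    by (rule nn_integral_suminf) measurable
  also have "\<dots> = (\<Sum>k. ennreal (real k * (\<nu> ^ k / fact k * exp (- \<nu>))))"
  proof (rule suminf_cong)
    fix k
    have "(\<integral>\<^sup>+\<omega>. of_nat k * indicator (?E k) \<omega> \<partial>M) = of_nat k * emeasure M (?E k)"
      by (rule nn_integral_cmult_indicator) measurable
    also have "\<dots> = ennreal (real k) * ennreal (\<nu> ^ k / fact k * exp (- \<nu>))"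
      unfolding emeasure_eq_measure p by (simp only: ennreal_of_nat_eq_real_of_nat)
    also have "\<dots> = ennreal (real k * (\<nu> ^ k / fact k * exp (- \<nu>)))"
      by (rule ennreal_mult[symmetric]) (auto simp: \<nu>_def)
    finally show "(\<integral>\<^sup>+\<omega>. of_nat k * indicator (?E k) \<omega> \<partial>M) = ennreal (real k * (\<nu> ^ k / fact k * exp (- \<nu>)))" .
  qed
  also have "\<dots> = ennreal \<nu>"
  proof (rule suminf_ennreal_eq)
    show "0 \<le> real k * (\<nu> ^ k / fact k * exp (- \<nu>))" for k by (simp add: \<nu>_def)
    have "(\<lambda>k. \<nu> ^ k /\<^sub>R fact k * (\<nu> * exp (- \<nu>))) sums (exp \<nu> * (\<nu> * exp (- \<nu>)))"
      by (intro sums_mult2 exp_converges)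
    moreover have "exp \<nu> * (\<nu> * exp (- \<nu>)) = \<nu>" by (simp add: exp_minus)
    moreover have "\<nu> ^ k /\<^sub>R fact k * (\<nu> * exp (- \<nu>)) = real (Suc k) * (\<nu> ^ Suc k / fact (Suc k) * exp (- \<nu>))" for k
    proof -
      have "real (Suc k) * (\<nu> ^ Suc k / (real (Suc k) * fact k) * exp (- \<nu>)) = \<nu> ^ Suc k / fact k * exp (- \<nu>)"
        by (simp del: of_nat_Suc)
      then show ?thesis by (simp add: divide_inverse mult_ac)
    qed
    ultimately have "(\<lambda>k. real (Suc k) * (\<nu> ^ Suc k / fact (Suc k) * exp (- \<nu>))) sums \<nu>" by simp
    then show "(\<lambda>k. real k * (\<nu> ^ k / fact k * exp (- \<nu>))) sums \<nu>"
      using sums_Suc[of "\<lambda>k. real k * (\<nu> ^ k / fact k * exp (- \<nu>))" \<nu>] by simp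
  qed
  finally show ?thesis by (simp add: \<nu>_def)
qed

text \<open>
  The sum is the expected number of points in \<open>A\<close> with index in \<open>I\<close>.
\<close>

lemma poisson_points_sum_prob_le:
  assumes P: "poisson_points \<mu> X" and A: "A \<in> sets borel" "emeasure \<mu> A < \<infinity>" and I: "finite I"
  shows "(\<Sum>i\<in>I. prob {\<omega>\<in>space M. X i \<omega> \<in> A}) \<le> measure \<mu> A"
proof -
  have Xm[measurable]: "X i \<in> borel_measurable M" for i using P by (auto simp: poisson_points_def)
  note A(1)[measurable]
  have "ennreal (\<Sum>i\<in>I. prob {\<omega>\<in>space M. X i \<omega> \<in> A}) = (\<Sum>i\<in>I. emeasure M {\<omega>\<in>space M. X i \<omega> \<in> A})"
    by (simp add: emeasure_eq_measure sum_ennreal)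
  also have "\<dots> = (\<integral>\<^sup>+\<omega>. (\<Sum>i\<in>I. indicator {\<omega>\<in>space M. X i \<omega> \<in> A} \<omega>) \<partial>M)"
    by (subst nn_integral_sum) auto
  also have "\<dots> \<le> (\<integral>\<^sup>+\<omega>. point_count X A \<omega> \<partial>M)"
  proof (rule nn_integral_mono)
    fix \<omega> assume \<omega>: "\<omega> \<in> space M"
    have "(\<Sum>i\<in>I. indicator {\<omega>\<in>space M. X i \<omega> \<in> A} \<omega> :: ennreal) = (\<Sum>i\<in>I. if X i \<omega> \<in> A then 1 else 0)"
      using \<omega> by (intro sum.cong) (auto simp: indicator_def)
    also have "\<dots> = of_nat (card {i\<in>I. X i \<omega> \<in> A})"
      using I by (simp add: sum.If_cases Int_def)
    also have "\<dots> = emeasure (count_space UNIV) {i\<in>I. X i \<omega> \<in> A}"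
      using I by (subst emeasure_count_space_finite) auto
    also have "\<dots> \<le> point_count X A \<omega>" unfolding point_count_def by (intro emeasure_mono) auto
    finally show "(\<Sum>i\<in>I. indicator {\<omega>\<in>space M. X i \<omega> \<in> A} \<omega>) \<le> point_count X A \<omega>" .
  qed
  also have "\<dots> = ennreal (measure \<mu> A)" by (rule poisson_points_expected_count[OF P A])
  finally show ?thesis by simp
qed

lemma poisson_points_finite_AE:
  assumes P: "poisson_points \<mu> X" and A: "A \<in> sets borel" "emeasure \<mu> A < \<infinity>"
  shows "AE \<omega> in M. finite {i. X i \<omega> \<in> A}"
  using poisson_points_count_AE[OF P A]
proof eventually_elim
  case (elim \<omega>)
  then obtain k :: nat where "emeasure (count_space UNIV) {i. X i \<omega> \<in> A} = of_nat k" by (auto simp: point_count_def)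
  then have "emeasure (count_space UNIV) {i. X i \<omega> \<in> A} \<noteq> \<top>" by simp
  then show ?case by (simp add: emeasure_count_space split: if_splits)
qed

text \<open>
  The window contains finitely many points, so from some \<open>n\<close> on all of them are among the first \<open>n\<close>
  and the occupation numbers are the Poisson counts of disjoint intervals.
\<close>

lemma poisson_occupancy_limit:
  assumes P: "poisson_points exp_intensity X" and \<delta>: "0 < \<delta>" and k: "k \<in> extensional {1..J}"
  shows "(\<lambda>n. prob {\<omega>\<in>space M. occupancy J {..<n} (\<lambda>i. bin A \<delta> J (X i \<omega>)) = k})
    \<longlonglongrightarrow> poisson_occ J (\<lambda>j. exp (- level A \<delta> (j - 1)) - exp (- level A \<delta> j)) k"
proof -
  define I where "I j = {level A \<delta> (j - 1)<..level A \<delta> j}" for j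
  define \<mu> where "\<mu> j = exp (- level A \<delta> (j - 1)) - exp (- level A \<delta> j)" for j
  have Xm[measurable]: "X i \<in> borel_measurable M" for i using P by (auto simp: poisson_points_def)
  have lev: "level A \<delta> i \<le> level A \<delta> j" if "i \<le> j" for i j
    using that \<delta> by (simp add: level_def mult_right_mono)
  have I: "I j \<in> sets borel" "emeasure exp_intensity (I j) < \<infinity>" "measure exp_intensity (I j) = \<mu> j" for j
  proof -
    have e: "emeasure exp_intensity (I j) = ennreal (\<mu> j)"
      unfolding I_def \<mu>_def by (intro emeasure_exp_intensity_Ioc lev) simp
    have "0 \<le> \<mu> j" unfolding \<mu>_def using lev[of "j - 1" j] by simp
    then show "I j \<in> sets borel" "emeasure exp_intensity (I j) < \<infinity>" "measure exp_intensity (I j) = \<mu> j"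
      using e by (auto simp: I_def measure_def)
  qed
  define F where "F = {\<omega>\<in>space M. \<forall>j\<in>{1..J}. point_count X (I j) \<omega> = of_nat (k j)}"
  have pcm: "point_count X (I j) \<in> borel_measurable M" for j
    by (rule poisson_points_count_measurable[OF P I(1)])
  have Fm: "F \<in> sets M"
    unfolding F_def
  proof (rule sets.sets_Collect_finite_All)
    fix j show "{\<omega>\<in>space M. point_count X (I j) \<omega> = of_nat (k j)} \<in> sets M"
      using pcm[of j] by measurable
  qed simp
  have pF: "prob F = poisson_occ J \<mu> k"
  proof (cases "J = 0")
    case True
    then have "F = space M" by (auto simp: F_def)
    then show ?thesis using True by (simp add: poisson_occ_def prob_space)
  next
    case False
    have "disjoint_family_on (\<lambda>j. I (Suc j)) {..<J}"
    proof (unfold disjoint_family_on_def, intro ballI impI)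
      fix a b :: nat assume "a \<noteq> b"
      then consider "Suc a \<le> b" | "Suc b \<le> a" by linarith
      then show "I (Suc a) \<inter> I (Suc b) = {}"
      proof cases
        case 1
        then show ?thesis using lev[of "Suc a" b] by (auto simp: I_def)
      next
        case 2
        then show ?thesis using lev[of "Suc b" a] by (auto simp: I_def)
      qed
    qed
    then have "indep_vars (\<lambda>_. borel) (\<lambda>j. point_count X (I (Suc j))) {..<J}"
      using I(1)
      by (intro P[unfolded poisson_points_def, THEN conjunct2, THEN conjunct2, rule_format, of "\<lambda>j. I (Suc j)" J]) auto
    then have "prob (\<Inter>j\<in>{..<J}. point_count X (I (Suc j)) -` {of_nat (k (Suc j))} \<inter> space M)
        = (\<Prod>j<J. prob (point_count X (I (Suc j)) -` {of_nat (k (Suc j))} \<inter> space M))"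
      using False by (intro indep_varsD_finite[where M' = "\<lambda>_. borel"]) (auto simp: lessThan_empty_iff)
    also have "(\<Inter>j\<in>{..<J}. point_count X (I (Suc j)) -` {of_nat (k (Suc j))} \<inter> space M) = F"
    proof -
      have img: "{1..J} = Suc ` {..<J}" by (simp add: lessThan_atLeast0 image_Suc_atLeastLessThan atLeastLessThanSuc_atLeastAtMost)
      have "0 \<in> {..<J}" using False by simp
      then show ?thesis
        unfolding F_def img
        by (intro set_eqI, unfold INT_iff Int_iff vimage_eq singleton_iff mem_Collect_eq ball_simps) blast
    qed
    also have "(\<Prod>j<J. prob (point_count X (I (Suc j)) -` {of_nat (k (Suc j))} \<inter> space M))
        = (\<Prod>j<J. \<mu> (Suc j) ^ k (Suc j) / fact (k (Suc j)) * exp (- \<mu> (Suc j)))"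
    proof (rule prod.cong[OF refl])
      fix j
      have "point_count X (I (Suc j)) -` {of_nat (k (Suc j))} \<inter> space M = {\<omega>\<in>space M. point_count X (I (Suc j)) \<omega> = of_nat (k (Suc j))}"
        by auto
      moreover have "prob {\<omega>\<in>space M. point_count X (I (Suc j)) \<omega> = of_nat (k (Suc j))}
          = measure exp_intensity (I (Suc j)) ^ k (Suc j) / fact (k (Suc j)) * exp (- measure exp_intensity (I (Suc j)))"
        by (rule P[unfolded poisson_points_def, THEN conjunct2, THEN conjunct1, rule_format, OF I(1,2)])
      ultimately show "prob (point_count X (I (Suc j)) -` {of_nat (k (Suc j))} \<inter> space M)
          = \<mu> (Suc j) ^ k (Suc j) / fact (k (Suc j)) * exp (- \<mu> (Suc j))" by (simp add: I(3))
    qed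
    also have "\<dots> = poisson_occ J \<mu> k"
    proof -
      have img: "{1..J} = Suc ` {..<J}" by (simp add: lessThan_atLeast0 image_Suc_atLeastLessThan atLeastLessThanSuc_atLeastAtMost)
      show ?thesis unfolding poisson_occ_def img by (subst prod.reindex) auto
    qed
    finally show ?thesis .
  qed
  have fin: "AE \<omega> in M. finite {i. X i \<omega> \<in> {- A<..}}"
    by (rule poisson_points_finite_AE[OF P]) (auto simp: emeasure_exp_intensity_Ioi)
  let ?E = "\<lambda>n. {\<omega>\<in>space M. occupancy J {..<n} (\<lambda>i. bin A \<delta> J (X i \<omega>)) = k}"
  have Em: "?E n \<in> sets M" for n
  proof (rule occupancy_events[where s = "\<lambda>\<omega> i. bin A \<delta> J (X i \<omega>)"])
    show "(\<lambda>\<omega>. bin A \<delta> J (X i \<omega>)) \<in> measurable M (count_space UNIV)" for i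
      by (rule measurable_compose[OF Xm bin_measurable])
  qed simp
  have "(\<lambda>n. \<integral>\<omega>. indicat_real (?E n) \<omega> \<partial>M) \<longlonglongrightarrow> (\<integral>\<omega>. indicat_real F \<omega> \<partial>M)"
  proof (rule integral_dominated_convergence[where w = "\<lambda>_. 1"])
    show "AE \<omega> in M. (\<lambda>n. indicat_real (?E n) \<omega>) \<longlonglongrightarrow> indicat_real F \<omega>"
      using fin AE_space
    proof eventually_elim
      case (elim \<omega>)
      have binj: "bin A \<delta> J (X i \<omega>) = j \<longleftrightarrow> X i \<omega> \<in> I j" if "j \<in> {1..J}" for i j
        using bin_eq_iff[OF \<delta>, of j J A "X i \<omega>"] that by (auto simp: I_def)
      have sub: "{i. X i \<omega> \<in> I j} \<subseteq> {i. X i \<omega> \<in> {- A<..}}" for j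
        using lev[of 0 "j - 1"] by (auto simp: I_def level_def)
      obtain n0 where "{i. X i \<omega> \<in> {- A<..}} \<subseteq> {..<n0}"
        using finite_nat_iff_bounded[THEN iffD1, OF elim(1)] by blast
      then have n0: "i < n0" if "X i \<omega> \<in> {- A<..}" for i using that by blast
      have "indicat_real (?E n) \<omega> = indicat_real F \<omega>" if n: "n0 \<le> n" for n
      proof -
        have c: "point_count X (I j) \<omega> = of_nat (card {i\<in>{..<n}. bin A \<delta> J (X i \<omega>) = j})" if j: "j \<in> {1..J}" for j
        proof -
          have "i < n" if "X i \<omega> \<in> I j" for i
          proof -
            have "X i \<omega> \<in> {- A<..}" using sub[of j] that by blast
            from n0[OF this] n show ?thesis by simp
          qed
          then have "{i. X i \<omega> \<in> I j} = {i\<in>{..<n}. bin A \<delta> J (X i \<omega>) = j}"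
            unfolding binj[OF j] by blast
          moreover have "finite {i\<in>{..<n}. bin A \<delta> J (X i \<omega>) = j}" by simp
          ultimately show ?thesis unfolding point_count_def by (simp add: emeasure_count_space_finite)
        qed
        have "\<omega> \<in> ?E n \<longleftrightarrow> \<omega> \<in> F"
          using elim(2) k c unfolding F_def occupancy_eq_iff by (simp add: of_nat_eq_iff)
        then show ?thesis by (simp add: indicator_def)
      qed
      then show ?case
        by (intro tendsto_eventually) (auto simp: eventually_sequentially)
    qed
  qed (use Em Fm in auto)
  moreover have "(\<integral>\<omega>. indicat_real (?E n) \<omega> \<partial>M) = prob (?E n)" for n
  proof -
    have "?E n \<inter> space M = ?E n" by blast
    then show ?thesis using Em[of n] by simp
  qed
  moreover have "(\<integral>\<omega>. indicat_real F \<omega> \<partial>M) = prob F"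
    using Fm sets.sets_into_space[OF Fm] by (simp add: Int_absorb2)
  ultimately show ?thesis using pF unfolding \<mu>_def by simp
qed

end

section \<open>Curves of the Brown-Resnick process\<close>

lemma floor_max_cont:
  fixes z :: "real \<Rightarrow> 'i \<Rightarrow> real"
  assumes "finite I" "\<And>i. i \<in> I \<Longrightarrow> continuous_on {0..1} (\<lambda>t. z t i)"
  shows "continuous_on {0..1} (\<lambda>t. floor_max C I (z t))"
  unfolding floor_max_def by (rule continuous_on_Max_insert[where f = "\<lambda>i t. z t i", OF assms])

lemma floor_max_measurable:
  assumes "finite I" "\<And>i. i \<in> I \<Longrightarrow> (\<lambda>\<omega>. z \<omega> i) \<in> borel_measurable M"
  shows "(\<lambda>\<omega>. floor_max C I (z \<omega>)) \<in> borel_measurable M"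
  unfolding floor_max_def by (rule borel_measurable_Max_insert[where f = "\<lambda>i \<omega>. z \<omega> i", OF assms])

locale brown_resnick_setting = prob_space +
  fixes X :: "nat \<Rightarrow> 'a \<Rightarrow> real" and W W' :: "nat \<Rightarrow> real \<Rightarrow> 'a \<Rightarrow> real"
  assumes data: "brown_resnick_data X W" and reg: "regular_version W W' UNIV"
begin

definition points :: "'a \<Rightarrow> nat \<Rightarrow> real" where "points \<omega> i = X i \<omega>"

definition curve :: "nat \<Rightarrow> real \<Rightarrow> 'a \<Rightarrow> real" where "curve i t \<omega> = X i \<omega> + W' i t \<omega> - t / 2"

definition excursion :: "nat \<Rightarrow> 'a \<Rightarrow> real" where "excursion i \<omega> = sup_norm (\<lambda>t. W' i t \<omega>)"

abbreviation point_space :: "(nat \<Rightarrow> real) measure" where "point_space \<equiv> \<Pi>\<^sub>M i\<in>UNIV. borel"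

lemma poisson: "poisson_points exp_intensity X"
  using data by (simp add: brown_resnick_data_def)

lemma X_measurable [measurable]: "X i \<in> borel_measurable M"
  using poisson by (auto simp: poisson_points_def)

lemma W'_measurable: "0 \<le> t \<Longrightarrow> W' i t \<in> borel_measurable M"
  using reg by (auto simp: regular_version_def)

lemma W'_cont: "\<omega> \<in> space M \<Longrightarrow> continuous_on {0..1} (\<lambda>t. W' i t \<omega>)"
  using reg by (auto simp: regular_version_def intro: continuous_on_subset[of "{0..}"])

lemma curve_cont: "\<omega> \<in> space M \<Longrightarrow> continuous_on {0..1} (\<lambda>t. curve i t \<omega>)"
  unfolding curve_def by (intro continuous_intros W'_cont) auto

lemma curve_measurable: "0 \<le> t \<Longrightarrow> curve i t \<in> borel_measurable M"
  unfolding curve_def using W'_measurable[of t i] by measurable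

lemma curve_le: "\<omega> \<in> space M \<Longrightarrow> t \<in> {0..1} \<Longrightarrow> curve i t \<omega> \<le> X i \<omega> + excursion i \<omega>"
  using abs_le_sup_norm[OF W'_cont, of \<omega> t i] by (auto simp: curve_def excursion_def)

lemma indep_pair_points_paths:
  "indep_pair point_space points (\<Pi>\<^sub>M i\<in>(UNIV :: nat set). path_space) (\<lambda>\<omega> i. path (W i) \<omega>)"
proof -
  have ind: "indep_set
       (sets (vimage_algebra (space M) (\<lambda>\<omega> i. X i \<omega>) point_space))
       (sets (vimage_algebra (space M) (\<lambda>\<omega> i. path (W i) \<omega>) (\<Pi>\<^sub>M i\<in>(UNIV :: nat set). path_space)))"
    using data by (simp add: brown_resnick_data_def)
  have iv: "indep_vars (\<lambda>_. path_space) (\<lambda>i. path (W i)) UNIV"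
    using data by (simp add: brown_resnick_data_def indep_brownian_motions_def)
  have p: "points = (\<lambda>\<omega> i. X i \<omega>)" by (simp add: points_def fun_eq_iff)
  show ?thesis
    unfolding indep_pair_def p
  proof (intro conjI ballI)
    show Sm: "(\<lambda>\<omega> i. X i \<omega>) \<in> measurable M point_space"
      by (rule measurable_PiM_single') auto
    show Pm: "(\<lambda>\<omega> i. path (W i) \<omega>) \<in> measurable M (\<Pi>\<^sub>M i\<in>(UNIV :: nat set). path_space)"
    proof (rule measurable_PiM_single')
      show m: "path (W i) \<in> measurable M path_space" for i using iv by (auto simp: indep_vars_def)
      show "(\<lambda>\<omega> i. path (W i) \<omega>) \<in> space M \<rightarrow> (\<Pi>\<^sub>E i\<in>UNIV. space path_space)"
        using measurable_space[OF m] by auto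
    qed
    fix A E assume A: "A \<in> sets point_space" and E: "E \<in> sets (\<Pi>\<^sub>M i\<in>(UNIV :: nat set). path_space)"
    have a: "(\<lambda>\<omega> i. X i \<omega>) -` A \<inter> space M \<in> sets (vimage_algebra (space M) (\<lambda>\<omega> i. X i \<omega>) point_space)"
      by (rule in_vimage_algebra[OF A])
    have e: "(\<lambda>\<omega> i. path (W i) \<omega>) -` E \<inter> space M \<in> sets (vimage_algebra (space M) (\<lambda>\<omega> i. path (W i) \<omega>) (\<Pi>\<^sub>M i\<in>(UNIV :: nat set). path_space))"
      by (rule in_vimage_algebra[OF E])
    have "prob (((\<lambda>\<omega> i. X i \<omega>) -` A \<inter> space M) \<inter> ((\<lambda>\<omega> i. path (W i) \<omega>) -` E \<inter> space M))
        = prob ((\<lambda>\<omega> i. X i \<omega>) -` A \<inter> space M) * prob ((\<lambda>\<omega> i. path (W i) \<omega>) -` E \<inter> space M)"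
      by (rule indep_setD[OF ind a e])
    moreover have "((\<lambda>\<omega> i. X i \<omega>) -` A \<inter> space M) \<inter> ((\<lambda>\<omega> i. path (W i) \<omega>) -` E \<inter> space M)
        = {\<omega>\<in>space M. (\<lambda>i. X i \<omega>) \<in> A \<and> (\<lambda>i. path (W i) \<omega>) \<in> E}"
      "(\<lambda>\<omega> i. X i \<omega>) -` A \<inter> space M = {\<omega>\<in>space M. (\<lambda>i. X i \<omega>) \<in> A}"
      "(\<lambda>\<omega> i. path (W i) \<omega>) -` E \<inter> space M = {\<omega>\<in>space M. (\<lambda>i. path (W i) \<omega>) \<in> E}" by blast+
    ultimately show "prob {\<omega>\<in>space M. (\<lambda>i. X i \<omega>) \<in> A \<and> (\<lambda>i. path (W i) \<omega>) \<in> E}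
        = prob {\<omega>\<in>space M. (\<lambda>i. X i \<omega>) \<in> A} * prob {\<omega>\<in>space M. (\<lambda>i. path (W i) \<omega>) \<in> E}" by simp
  qed
qed

lemma gauss_paths:
  assumes "finite I" "I \<noteq> {}"
  shows "indep_gauss_paths points point_space W' I"
proof (rule indep_gauss_paths_brownian[OF _ reg assms indep_pair_points_paths])
  show "indep_brownian_motions W UNIV" using data by (simp add: brown_resnick_data_def)
qed

lemma excursion_measurable [measurable]: "excursion i \<in> borel_measurable M"
  unfolding excursion_def by (rule sup_norm_measurable[OF gauss_paths[of "{i}"]]) auto

text \<open>
  The maximal inequality with \<open>r = 4\<close>: the rate has to exceed the rate 2 at which points accumulate.
\<close>

lemma excursion_tail:
  assumes B: "B \<in> sets borel"
  shows "prob {\<omega>\<in>space M. X i \<omega> \<in> B \<and> u < excursion i \<omega>}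
    \<le> prob {\<omega>\<in>space M. X i \<omega> \<in> B} * (4 * exp 8 * exp (- 4 * u))"
proof -
  have A: "{x\<in>space point_space. x i \<in> B} \<in> sets point_space"
    using B measurable_component_singleton[of i UNIV "\<lambda>_. borel"] by measurable
  have e: "4 * exp ((4::real)\<^sup>2 / 2 - 4 * u) = 4 * exp 8 * exp (- 4 * u)"
    by (simp add: exp_add[symmetric])
  show ?thesis
    using indep_gauss_paths_sup_tail[OF gauss_paths[of "{i}"] _ A, of i 4 u] unfolding e excursion_def
    by (simp add: points_def space_PiM)
qed

lemma sum_prob_gt:
  assumes "finite I"
  shows "(\<Sum>i\<in>I. prob {\<omega>\<in>space M. a < X i \<omega>}) \<le> exp (- a)"
proof -
  have "(\<Sum>i\<in>I. prob {\<omega>\<in>space M. X i \<omega> \<in> {a<..}}) \<le> measure exp_intensity {a<..}"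
    by (rule poisson_points_sum_prob_le[OF poisson _ _ assms]) (auto simp: emeasure_exp_intensity_Ioi)
  then show ?thesis by (simp add: measure_def emeasure_exp_intensity_Ioi)
qed

lemma low_points:
  assumes "finite I"
  shows "(\<Sum>i\<in>I. prob {\<omega>\<in>space M. X i \<omega> \<le> - real a \<and> - C < X i \<omega> + excursion i \<omega>})
    \<le> 2 * 1 * (4 * exp 8) * exp (2 + 4 * C) * exp (- 2 * real a)"
proof (rule low_points_bound[OF assms])
  fix i u and k :: nat
  show "prob {\<omega>\<in>space M. (- real (Suc k) < X i \<omega> \<and> X i \<omega> \<le> - real k) \<and> u < excursion i \<omega>}
      \<le> prob {\<omega>\<in>space M. - real (Suc k) < X i \<omega> \<and> X i \<omega> \<le> - real k} * (4 * exp 8 * exp (- 4 * u))"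
    using excursion_tail[of "{- real (Suc k)<..- real k}" i u] by simp
next
  fix k :: nat
  have "(\<Sum>i\<in>I. prob {\<omega>\<in>space M. - real k < X i \<omega>}) \<le> exp (- (- real k))" by (rule sum_prob_gt[OF assms])
  also have "\<dots> \<le> 1 * exp (2 * real k)" by simp
  finally show "(\<Sum>i\<in>I. prob {\<omega>\<in>space M. - real k < X i \<omega>}) \<le> 1 * exp (2 * real k)" .
qed auto

text \<open>
  Borel-Cantelli: the probabilities that a curve ever exceeds \<open>- C\<close> are summable, by the bounds on the
  number of positive points and on low points with large excursions.
\<close>

lemma finitely_many_high_curves:
  "AE \<omega> in M. \<forall>C::nat. finite {i. \<exists>t\<in>{0..1}. - real C < curve i t \<omega>}"
  unfolding AE_all_countable
proof
  fix C :: nat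
  let ?E = "\<lambda>i. {\<omega>\<in>space M. - real C < X i \<omega> + excursion i \<omega>}"
  have Em: "?E i \<in> sets M" for i by measurable
  have "summable (\<lambda>i. prob (?E i))"
  proof (rule summableI_nonneg_bounded)
    fix n
    have "(\<Sum>i<n. prob (?E i)) \<le> (\<Sum>i<n. prob {\<omega>\<in>space M. 0 < X i \<omega>} + prob {\<omega>\<in>space M. X i \<omega> \<le> - real 0 \<and> - real C < X i \<omega> + excursion i \<omega>})"
    proof (rule sum_mono)
      fix i
      have "prob (?E i) \<le> prob ({\<omega>\<in>space M. 0 < X i \<omega>} \<union> {\<omega>\<in>space M. X i \<omega> \<le> - real 0 \<and> - real C < X i \<omega> + excursion i \<omega>})"
        by (intro finite_measure_mono) auto
      also have "\<dots> \<le> prob {\<omega>\<in>space M. 0 < X i \<omega>} + prob {\<omega>\<in>space M. X i \<omega> \<le> - real 0 \<and> - real C < X i \<omega> + excursion i \<omega>}"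
        by (rule measure_Un_le) measurable
      finally show "prob (?E i) \<le> prob {\<omega>\<in>space M. 0 < X i \<omega>} + prob {\<omega>\<in>space M. X i \<omega> \<le> - real 0 \<and> - real C < X i \<omega> + excursion i \<omega>}" .
    qed
    also have "\<dots> \<le> exp (- 0) + 2 * 1 * (4 * exp 8) * exp (2 + 4 * real C) * exp (- 2 * real 0)"
      unfolding sum.distrib by (intro add_mono sum_prob_gt low_points) auto
    finally show "(\<Sum>i<n. prob (?E i)) \<le> exp (- 0) + 2 * 1 * (4 * exp 8) * exp (2 + 4 * real C) * exp (- 2 * real 0)" .
  qed simp
  then have "AE \<omega> in M. eventually (\<lambda>i. \<omega> \<in> space M - ?E i) sequentially"
    using Em by (intro borel_cantelli_AE1) (auto simp: emeasure_eq_measure)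
  then show "AE \<omega> in M. finite {i. \<exists>t\<in>{0..1}. - real C < curve i t \<omega>}"
    using AE_space
  proof eventually_elim
    case (elim \<omega>)
    then obtain n where n: "\<And>i. n \<le> i \<Longrightarrow> \<omega> \<notin> ?E i" by (auto simp: eventually_sequentially)
    have "{i. \<exists>t\<in>{0..1}. - real C < curve i t \<omega>} \<subseteq> {..<n}"
    proof
      fix i assume "i \<in> {i. \<exists>t\<in>{0..1}. - real C < curve i t \<omega>}"
      then obtain t where "t \<in> {0..1}" "- real C < curve i t \<omega>" by blast
      then have "- real C < X i \<omega> + excursion i \<omega>" using curve_le[OF elim(2), of t i] by linarith
      then have "\<omega> \<in> ?E i" using elim(2) by simp
      then show "i \<in> {..<n}" using n[of i] by (cases "n \<le> i") auto
    qed
    then show ?case by (rule finite_subset) simp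
  qed
qed

text \<open>
  Off a null set the maximum over all curves is, on the whole unit interval, a maximum over finitely many of them, hence
  continuous and a limit of random variables. On the null set the process is set to 0.
\<close>

lemma continuous_version:
  "\<exists>R. (\<forall>t\<in>{0..1}. R t \<in> borel_measurable M) \<and> (\<forall>\<omega>\<in>space M. continuous_on {0..1} (\<lambda>t. R t \<omega>)) \<and>
     (AE \<omega> in M. \<forall>t\<in>{0..1}. R t \<omega> = brown_resnick X W t \<omega>) \<and>
     (AE \<omega> in M. \<exists>n0. \<forall>n\<ge>n0. \<forall>t\<in>{0..1}. \<forall>C. floor_max C {..<n} (\<lambda>i. curve i t \<omega>) = max (- C) (R t \<omega>))"
proof -
  obtain D where D: "D \<in> null_sets M"
    "{\<omega>\<in>space M. \<not> (\<forall>C::nat. finite {i. \<exists>t\<in>{0..1}. - real C < curve i t \<omega>})} \<subseteq> D"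
    using finitely_many_high_curves by (auto simp: eventually_ae_filter)
  have Dm: "D \<in> sets M" using D by auto
  define G where "G t \<omega> = (GREATEST y. \<exists>i. y = curve i t \<omega>)" for t \<omega>
  define R where "R t \<omega> = (if \<omega> \<in> D then 0 else G t \<omega>)" for t \<omega>
  have fin: "finite {i. \<exists>t\<in>{0..1}. - real C < curve i t \<omega>}" if "\<omega> \<in> space M" "\<omega> \<notin> D" for \<omega> and C :: nat
    using D(2) that by blast
  have "R t \<in> borel_measurable M" if t: "t \<in> {0..1}" for t
  proof (rule borel_measurable_LIMSEQ_metric)
    fix n
    have "(\<lambda>\<omega>. Max ((\<lambda>i. curve i t \<omega>) ` {..<Suc n})) \<in> borel_measurable M"
      using t by (intro borel_measurable_Max curve_measurable) auto
    then show "(\<lambda>\<omega>. if \<omega> \<in> D then 0 else Max ((\<lambda>i. curve i t \<omega>) ` {..<Suc n})) \<in> borel_measurable M"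
      using Dm by measurable
  next
    fix \<omega> assume \<omega>: "\<omega> \<in> space M"
    show "(\<lambda>n. if \<omega> \<in> D then 0 else Max ((\<lambda>i. curve i t \<omega>) ` {..<Suc n})) \<longlonglongrightarrow> R t \<omega>"
    proof (cases "\<omega> \<in> D")
      case False
      from greatest_of_tail_finite(2)[of "\<lambda>i t. curve i t \<omega>", OF curve_cont[OF \<omega>] fin[OF \<omega> False]]
      obtain n0 where n0: "\<And>n. n0 \<le> n \<Longrightarrow> Max ((\<lambda>i. curve i t \<omega>) ` {..<n}) = G t \<omega>"
        using t unfolding G_def by blast
      have "\<forall>\<^sub>F n in sequentially. (if \<omega> \<in> D then 0 else Max ((\<lambda>i. curve i t \<omega>) ` {..<Suc n})) = R t \<omega>"
        using eventually_ge_at_top[of n0]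
      proof eventually_elim
        case (elim n)
        show ?case using n0[of "Suc n"] elim False by (simp add: R_def)
      qed
      then show ?thesis by (rule tendsto_eventually)
    qed (simp add: R_def)
  qed
  moreover have "continuous_on {0..1} (\<lambda>t. R t \<omega>)" if \<omega>: "\<omega> \<in> space M" for \<omega>
    using greatest_of_tail_finite(1)[of "\<lambda>i t. curve i t \<omega>", OF curve_cont[OF \<omega>] fin[OF \<omega>]]
    by (cases "\<omega> \<in> D") (auto simp: R_def G_def)
  moreover have "AE \<omega> in M. \<forall>t\<in>{0..1}. R t \<omega> = brown_resnick X W t \<omega>"
  proof -
    have "AE \<omega> in M. \<forall>x\<in>UNIV. \<forall>t\<ge>0. W' x t \<omega> = W x t \<omega>" using reg by (simp add: regular_version_def)
    then show ?thesis using AE_not_in[OF D(1)]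
    proof eventually_elim
      case (elim \<omega>)
      then show ?case by (simp add: R_def G_def brown_resnick_def curve_def)
    qed
  qed
  moreover have "AE \<omega> in M. \<exists>n0. \<forall>n\<ge>n0. \<forall>t\<in>{0..1}. \<forall>C. floor_max C {..<n} (\<lambda>i. curve i t \<omega>) = max (- C) (R t \<omega>)"
    using AE_not_in[OF D(1)] AE_space
  proof eventually_elim
    case (elim \<omega>)
    from greatest_of_tail_finite(2)[of "\<lambda>i t. curve i t \<omega>", OF curve_cont[OF elim(2)] fin[OF elim(2,1)]]
    obtain n0 where n0: "\<And>n t C. n0 \<le> n \<Longrightarrow> t \<in> {0..1} \<Longrightarrow> floor_max C {..<n} (\<lambda>i. curve i t \<omega>) = max (- C) (G t \<omega>)"
      unfolding G_def by blast
    show ?case by (intro exI[of _ n0]) (use n0 elim(1) in \<open>auto simp: R_def\<close>)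
  qed
  ultimately show ?thesis by blast
qed

text \<open>
  Almost surely the floored maximum of the first \<open>n\<close> curves is eventually constant in \<open>n\<close>.
\<close>

lemma floored_limit:
  assumes \<Phi>: "lip L \<Phi>" and c: "\<And>f. continuous_on {0..1} f \<Longrightarrow> \<bar>\<Phi> f\<bar> \<le> c"
    and Rm: "\<And>t. t \<in> {0..1} \<Longrightarrow> R t \<in> borel_measurable M"
    and Rc: "\<And>\<omega>. \<omega> \<in> space M \<Longrightarrow> continuous_on {0..1} (\<lambda>t. R t \<omega>)"
    and R: "AE \<omega> in M. \<exists>n0. \<forall>n\<ge>n0. \<forall>t\<in>{0..1}. \<forall>C. floor_max C {..<n} (\<lambda>i. curve i t \<omega>) = max (- C) (R t \<omega>)"
  shows "(\<lambda>n. \<integral>\<omega>. \<Phi> (\<lambda>t. floor_max C {..<n} (\<lambda>i. curve i t \<omega>)) \<partial>M) \<longlonglongrightarrow> (\<integral>\<omega>. \<Phi> (\<lambda>t. max (- C) (R t \<omega>)) \<partial>M)"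
proof (rule integral_dominated_convergence[where w = "\<lambda>_. c"])
  have fc: "continuous_on {0..1} (\<lambda>t. floor_max C {..<n} (\<lambda>i. curve i t \<omega>))" if "\<omega> \<in> space M" for \<omega> n
    by (intro floor_max_cont curve_cont that) simp
  have mc: "continuous_on {0..1} (\<lambda>t. max (- C) (R t \<omega>))" if "\<omega> \<in> space M" for \<omega>
    by (intro continuous_on_max continuous_on_const Rc that)
  show "(\<lambda>\<omega>. \<Phi> (\<lambda>t. max (- C) (R t \<omega>))) \<in> borel_measurable M"
    by (rule seq_cont_measurable[OF lip_seq_cont[OF \<Phi>] mc]) (use Rm in auto)
  show "(\<lambda>\<omega>. \<Phi> (\<lambda>t. floor_max C {..<n} (\<lambda>i. curve i t \<omega>))) \<in> borel_measurable M" for n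
    by (rule seq_cont_measurable[OF lip_seq_cont[OF \<Phi>] fc]) (auto intro!: floor_max_measurable curve_measurable)
  show "AE \<omega> in M. norm (\<Phi> (\<lambda>t. floor_max C {..<n} (\<lambda>i. curve i t \<omega>))) \<le> c" for n
    using c fc by auto
  show "AE \<omega> in M. (\<lambda>n. \<Phi> (\<lambda>t. floor_max C {..<n} (\<lambda>i. curve i t \<omega>))) \<longlonglongrightarrow> \<Phi> (\<lambda>t. max (- C) (R t \<omega>))"
    using R AE_space
  proof eventually_elim
    case (elim \<omega>)
    then obtain n0 where n0: "\<And>n t. n0 \<le> n \<Longrightarrow> t \<in> {0..1} \<Longrightarrow> floor_max C {..<n} (\<lambda>i. curve i t \<omega>) = max (- C) (R t \<omega>)"
      by blast
    have "\<forall>\<^sub>F n in sequentially. \<Phi> (\<lambda>t. floor_max C {..<n} (\<lambda>i. curve i t \<omega>)) = \<Phi> (\<lambda>t. max (- C) (R t \<omega>))"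
      using eventually_ge_at_top[of n0]
    proof eventually_elim
      case (elim n)
      show ?case by (rule lip_cong[OF \<Phi> fc[OF \<open>\<omega> \<in> space M\<close>]]) (use n0 elim in auto)
    qed
    then show ?case by (rule tendsto_eventually)
  qed
qed simp

text \<open>
  The functional changes by at most \<open>L * \<delta>\<close> unless some point lies above the window, or some point below it
  carries an excursion above the floor.
\<close>

lemma binned_approximation:
  assumes \<Phi>: "lip L \<Phi>" and c: "\<And>f. continuous_on {0..1} f \<Longrightarrow> \<bar>\<Phi> f\<bar> \<le> c" and \<delta>: "0 < \<delta>" and n: "1 \<le> n"
  shows "\<bar>(\<integral>\<omega>. \<Phi> (\<lambda>t. floor_max C {..<n} (\<lambda>i. curve i t \<omega>)) \<partial>M) -
      (\<integral>\<omega>. \<Phi> (\<lambda>t. binned_max C (level (real a) \<delta>) {..<n} (\<lambda>i. bin (real a) \<delta> J (points \<omega> i)) (\<lambda>i. W' i t \<omega>) t) \<partial>M)\<bar>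
    \<le> L * \<delta> + 2 * c * (exp (- level (real a) \<delta> J) + 2 * 1 * (4 * exp 8) * exp (2 + 4 * C) * exp (- 2 * real a))"
proof -
  let ?H = "\<lambda>i. {\<omega>\<in>space M. level (real a) \<delta> J < X i \<omega>}"
  let ?Lo = "\<lambda>i. {\<omega>\<in>space M. X i \<omega> \<le> - real a \<and> - C < X i \<omega> + excursion i \<omega>}"
  define bad where "bad = (\<Union>i\<in>{..<n}. ?H i \<union> ?Lo i)"
  have Hm: "?H i \<in> sets M" and Lm: "?Lo i \<in> sets M" for i by measurable
  have badm: "bad \<in> sets M" unfolding bad_def using Hm Lm by (intro sets.finite_UN) auto
  have "prob bad \<le> (\<Sum>i<n. prob (?H i \<union> ?Lo i))"
    unfolding bad_def using Hm Lm by (intro finite_measure_subadditive_finite) auto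
  also have "\<dots> \<le> (\<Sum>i<n. prob (?H i) + prob (?Lo i))"
    using Hm Lm by (intro sum_mono measure_Un_le) auto
  also have "\<dots> \<le> exp (- level (real a) \<delta> J) + 2 * 1 * (4 * exp 8) * exp (2 + 4 * C) * exp (- 2 * real a)"
    unfolding sum.distrib by (intro add_mono sum_prob_gt low_points) auto
  finally have pb: "prob bad \<le> exp (- level (real a) \<delta> J) + 2 * 1 * (4 * exp 8) * exp (2 + 4 * C) * exp (- 2 * real a)" .
  have c0: "0 \<le> c" using c[of "\<lambda>_. 0"] by (simp add: continuous_on_const order_trans[OF abs_ge_zero])
  have "\<bar>(\<integral>\<omega>. \<Phi> (\<lambda>t. floor_max C {..<n} (\<lambda>i. curve i t \<omega>)) \<partial>M) -
      (\<integral>\<omega>. \<Phi> (\<lambda>t. binned_max C (level (real a) \<delta>) {..<n} (\<lambda>i. bin (real a) \<delta> J (points \<omega> i)) (\<lambda>i. W' i t \<omega>) t) \<partial>M)\<bar>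
    \<le> L * \<delta> + 2 * c * prob bad"
  proof (rule lip_expectation_close[OF \<Phi> c _ _ _ _ _ badm])
    show "0 \<le> \<delta>" using \<delta> by simp
    show "continuous_on {0..1} (\<lambda>t. floor_max C {..<n} (\<lambda>i. curve i t \<omega>))" if "\<omega> \<in> space M" for \<omega>
      by (intro floor_max_cont curve_cont that) simp
    show "(\<lambda>\<omega>. floor_max C {..<n} (\<lambda>i. curve i t \<omega>)) \<in> borel_measurable M" if "t \<in> {0..1}" for t
      using that by (intro floor_max_measurable curve_measurable) auto
    show "continuous_on {0..1} (\<lambda>t. binned_max C (level (real a) \<delta>) {..<n} (\<lambda>i. bin (real a) \<delta> J (points \<omega> i)) (\<lambda>i. W' i t \<omega>) t)"
      if "\<omega> \<in> space M" for \<omega>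
      by (intro binned_max_cont W'_cont that) simp
    show "(\<lambda>\<omega>. binned_max C (level (real a) \<delta>) {..<n} (\<lambda>i. bin (real a) \<delta> J (points \<omega> i)) (\<lambda>i. W' i t \<omega>) t) \<in> borel_measurable M"
      if "t \<in> {0..1}" for t
      using that unfolding points_def
      by (intro binned_max_measurable W'_measurable measurable_compose[OF X_measurable bin_measurable]) auto
    fix \<omega> t assume \<omega>: "\<omega> \<in> space M" "\<omega> \<notin> bad" and t: "t \<in> {0..1::real}"
    have "\<bar>floor_max C {..<n} (\<lambda>i. curve i t \<omega>) - binned_max C (level (real a) \<delta>) {..<n} (\<lambda>i. bin (real a) \<delta> J (points \<omega> i)) (\<lambda>i. W' i t \<omega>) t\<bar> \<le> 0 + \<delta>"
    proof (rule floor_max_binned_max)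
      fix i assume i: "i \<in> {..<n}"
      show "points \<omega> i \<le> level (real a) \<delta> J" using \<omega> i by (auto simp: bad_def points_def not_less)
      show "curve i t \<omega> \<le> - C" if "points \<omega> i \<le> - real a"
      proof -
        have "X i \<omega> + excursion i \<omega> \<le> - C" using \<omega> i that by (auto simp: bad_def points_def not_less)
        with curve_le[OF \<omega>(1) t, of i] show ?thesis by linarith
      qed
      show "\<bar>curve i t \<omega> - (points \<omega> i + W' i t \<omega> - t / 2)\<bar> \<le> 0" by (simp add: curve_def points_def)
    qed (use \<delta> in auto)
    then show "\<bar>floor_max C {..<n} (\<lambda>i. curve i t \<omega>) - binned_max C (level (real a) \<delta>) {..<n} (\<lambda>i. bin (real a) \<delta> J (points \<omega> i)) (\<lambda>i. W' i t \<omega>) t\<bar> \<le> \<delta>"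
      by simp
  qed
  also have "\<dots> \<le> L * \<delta> + 2 * c * (exp (- level (real a) \<delta> J) + 2 * 1 * (4 * exp 8) * exp (2 + 4 * C) * exp (- 2 * real a))"
    using pb c0 by (intro add_left_mono mult_left_mono) auto
  finally show ?thesis .
qed

end

section \<open>Curves of the rescaled squared Bessel processes\<close>

text \<open>
  The norming constant enters as an arbitrary positive number \<open>b\<close>; its dependence on \<open>n\<close> matters only in the limit.
\<close>

locale bessel_setting = prob_space +
  fixes m n :: nat and b :: real and B B' :: "nat \<times> nat \<Rightarrow> real \<Rightarrow> 'a \<Rightarrow> real"
  assumes m: "1 \<le> m" and n: "1 \<le> n" and b: "0 < b"
    and brownian: "indep_brownian_motions B ({1..} \<times> {1..m})"
    and reg: "regular_version B B' ({1..} \<times> {1..m})"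
begin

abbreviation "idx \<equiv> {1..n} \<times> {1..m}"

definition start :: "'a \<Rightarrow> nat \<times> nat \<Rightarrow> real" where "start \<omega> = (\<lambda>x\<in>idx. B' x 1 \<omega>)"

abbreviation start_space :: "(nat \<times> nat \<Rightarrow> real) measure" where "start_space \<equiv> \<Pi>\<^sub>M x\<in>idx. borel"

text \<open>
  The increment after time 1 on the time scale \<open>1 / b\<close>, magnified to a standard Brownian motion.
\<close>

definition zoom :: "nat \<times> nat \<Rightarrow> real \<Rightarrow> 'a \<Rightarrow> real" where
  "zoom x t \<omega> = sqrt b * (B' x (1 + t / b) \<omega> - B' x 1 \<omega>)"

definition sq_radius :: "nat \<Rightarrow> (nat \<times> nat \<Rightarrow> real) \<Rightarrow> real" where
  "sq_radius i s = (\<Sum>j=1..m. (s (i, j))\<^sup>2)"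

text \<open>
  The unit vector in the direction of the position at time 1. At the origin, where there is no direction, the first
  basis vector keeps the length equal to 1.
\<close>

definition direction :: "nat \<times> nat \<Rightarrow> (nat \<times> nat \<Rightarrow> real) \<Rightarrow> real" where
  "direction x s = (if sq_radius (fst x) s = 0 then (if snd x = 1 then 1 else 0) else s x / sqrt (sq_radius (fst x) s))"

definition point :: "nat \<Rightarrow> (nat \<times> nat \<Rightarrow> real) \<Rightarrow> real" where "point i s = (sq_radius i s - b) / 2"

definition radial :: "nat \<Rightarrow> real \<Rightarrow> 'a \<Rightarrow> real" where
  "radial i t \<omega> = (\<Sum>j=1..m. direction (i, j) (start \<omega>) * zoom (i, j) t \<omega>)"

definition curve :: "nat \<Rightarrow> real \<Rightarrow> 'a \<Rightarrow> real" where
  "curve i t \<omega> = ((\<Sum>j=1..m. (B' (i, j) (1 + t / b) \<omega>)\<^sup>2) - b * (1 + t / b)) / 2"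

text \<open>
  The sum over the coordinates dominates both the Euclidean norm of the magnified increment and its
  radial part.
\<close>

definition excursion :: "nat \<Rightarrow> 'a \<Rightarrow> real" where
  "excursion i \<omega> = (\<Sum>j=1..m. sup_norm (\<lambda>t. zoom (i, j) t \<omega>))"

lemma idx: "idx \<subseteq> {1..} \<times> {1..m}" "finite idx" "idx \<noteq> {}" "{1..n} \<noteq> {}" "{1..m} \<noteq> {}"
  using m n by auto

lemma start_gauss: "gauss_vector (\<lambda>x. B' x 1) idx"
  by (rule brownian_after_time_1(1)[OF brownian reg idx(1-3) b])

lemma zoom_paths: "indep_gauss_paths start start_space zoom idx"
  using brownian_after_time_1(2)[OF brownian reg idx(1-3) b] unfolding start_def[abs_def] zoom_def[abs_def] .

lemma start_measurable [measurable]: "start \<in> measurable M start_space"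
  using zoom_paths by (simp add: indep_gauss_paths_def)

lemma sq_radius_measurable: "i \<in> {1..n} \<Longrightarrow> sq_radius i \<in> borel_measurable start_space"
  unfolding sq_radius_def
  by (intro borel_measurable_sum borel_measurable_power measurable_component_singleton) auto

lemma point_measurable: "i \<in> {1..n} \<Longrightarrow> point i \<in> borel_measurable start_space"
  unfolding point_def using sq_radius_measurable by measurable

lemma sq_radius_nonneg: "0 \<le> sq_radius i s"
  unfolding sq_radius_def by (intro sum_nonneg) auto

lemma direction_unit: "(\<Sum>j=1..m. (direction (i, j) s)\<^sup>2) = 1"
proof (cases "sq_radius i s = 0")
  case True
  then have "(\<Sum>j=1..m. (direction (i, j) s)\<^sup>2) = (\<Sum>j=1..m. if j = 1 then 1 else 0)"
    by (intro sum.cong) (auto simp: direction_def)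
  then show ?thesis using m by simp
next
  case False
  then have "(\<Sum>j=1..m. (direction (i, j) s)\<^sup>2) = (\<Sum>j=1..m. (s (i, j))\<^sup>2 / sq_radius i s)"
    using sq_radius_nonneg[of i s] by (intro sum.cong) (auto simp: direction_def power_divide)
  then show ?thesis using False by (simp add: sum_divide_distrib[symmetric] sq_radius_def)
qed

lemma direction_measurable: "x \<in> idx \<Longrightarrow> direction x \<in> borel_measurable start_space"
proof -
  assume x: "x \<in> idx"
  have [measurable]: "sq_radius (fst x) \<in> borel_measurable start_space"
    using x by (intro sq_radius_measurable) auto
  have [measurable]: "(\<lambda>s. s x) \<in> borel_measurable start_space"
    using x by (intro measurable_component_singleton)
  show ?thesis unfolding direction_def by measurable
qed

text \<open>
  The direction depends only on the positions at time 1, which are independent of the later increments.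
\<close>

lemma radial_paths: "indep_gauss_paths start start_space radial {1..n}"
  unfolding radial_def[abs_def]
  by (rule indep_gauss_paths_rotate[OF zoom_paths _ idx(5) direction_measurable direction_unit]) auto

lemma zoom_cont: "x \<in> idx \<Longrightarrow> \<omega> \<in> space M \<Longrightarrow> continuous_on {0..1} (\<lambda>t. zoom x t \<omega>)"
  using zoom_paths unfolding indep_gauss_paths_def by blast

lemma excursion_measurable: "i \<in> {1..n} \<Longrightarrow> excursion i \<in> borel_measurable M"
  unfolding excursion_def by (intro borel_measurable_sum sup_norm_measurable[OF zoom_paths]) auto

lemma zoom_le: "i \<in> {1..n} \<Longrightarrow> \<omega> \<in> space M \<Longrightarrow> t \<in> {0..1} \<Longrightarrow> (\<Sum>j=1..m. \<bar>zoom (i, j) t \<omega>\<bar>) \<le> excursion i \<omega>"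
  unfolding excursion_def by (intro sum_mono abs_le_sup_norm zoom_cont) auto

lemma excursion_nonneg: "i \<in> {1..n} \<Longrightarrow> \<omega> \<in> space M \<Longrightarrow> 0 \<le> excursion i \<omega>"
  unfolding excursion_def by (intro sum_nonneg sup_norm_nonneg zoom_cont) auto

lemma B'_cont: "x \<in> idx \<Longrightarrow> \<omega> \<in> space M \<Longrightarrow> continuous_on {0..} (\<lambda>t. B' x t \<omega>)"
  using reg idx(1) unfolding regular_version_def by blast

lemma B'_measurable: "x \<in> idx \<Longrightarrow> 0 \<le> t \<Longrightarrow> B' x t \<in> borel_measurable M"
  using reg idx(1) unfolding regular_version_def by blast

lemma curve_cont: "i \<in> {1..n} \<Longrightarrow> \<omega> \<in> space M \<Longrightarrow> continuous_on {0..1} (\<lambda>t. curve i t \<omega>)"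
proof -
  assume i: "i \<in> {1..n}" and \<omega>: "\<omega> \<in> space M"
  have c: "continuous_on {0..1} (\<lambda>t. B' (i, j) (1 + t / b) \<omega>)" if "j \<in> {1..m}" for j
    using b that i by (intro continuous_on_compose2[OF B'_cont[OF _ \<omega>]] continuous_intros) auto
  show ?thesis unfolding curve_def using b by (intro continuous_intros c) auto
qed

lemma curve_measurable: "i \<in> {1..n} \<Longrightarrow> t \<in> {0..1} \<Longrightarrow> curve i t \<in> borel_measurable M"
  unfolding curve_def using b
  by (intro borel_measurable_divide borel_measurable_diff borel_measurable_sum borel_measurable_power
      borel_measurable_const B'_measurable) auto

text \<open>
  Expansion of the square of the norm: the cross term is the radial part of the increment, times the radius.
\<close>

lemma curve_decomposition:
  assumes i: "i \<in> {1..n}"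
  shows "curve i t \<omega> = point i (start \<omega>) + sqrt (sq_radius i (start \<omega>)) / sqrt b * radial i t \<omega>
    + (\<Sum>j=1..m. (zoom (i, j) t \<omega>)\<^sup>2) / (2 * b) - t / 2"
proof -
  let ?s = "\<lambda>j. start \<omega> (i, j)" and ?w = "\<lambda>j. zoom (i, j) t \<omega>"
  have B: "B' (i, j) (1 + t / b) \<omega> = ?s j + ?w j / sqrt b" if "j \<in> {1..m}" for j
    using that i b by (simp add: start_def zoom_def)
  have "(\<Sum>j=1..m. (B' (i, j) (1 + t / b) \<omega>)\<^sup>2) = (\<Sum>j=1..m. (?s j)\<^sup>2 + 2 / sqrt b * (?s j * ?w j) + (?w j)\<^sup>2 / b)"
    using b by (intro sum.cong refl) (simp add: B power2_sum power_divide)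
  also have "\<dots> = sq_radius i (start \<omega>) + 2 / sqrt b * (\<Sum>j=1..m. ?s j * ?w j) + (\<Sum>j=1..m. (?w j)\<^sup>2) / b"
    by (simp add: sum.distrib sum_distrib_left sum_divide_distrib sq_radius_def)
  also have "(\<Sum>j=1..m. ?s j * ?w j) = sqrt (sq_radius i (start \<omega>)) * radial i t \<omega>"
  proof (cases "sq_radius i (start \<omega>) = 0")
    case True
    then have "\<forall>j\<in>{1..m}. (?s j)\<^sup>2 = 0"
      unfolding sq_radius_def by (subst (asm) sum_nonneg_eq_0_iff) auto
    then have "(\<Sum>j=1..m. ?s j * ?w j) = 0" by (intro sum.neutral) auto
    then show ?thesis using True by simp
  next
    case False
    then have "sqrt (sq_radius i (start \<omega>)) * direction (i, j) (start \<omega>) = ?s j" for j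
      by (simp add: direction_def)
    then have "?s j * ?w j = sqrt (sq_radius i (start \<omega>)) * (direction (i, j) (start \<omega>) * ?w j)" for j
      by (metis mult.assoc)
    then show ?thesis by (simp only: radial_def sum_distrib_left)
  qed
  finally show ?thesis
    unfolding curve_def point_def using b by (simp add: field_simps)
qed

text \<open>
  For low points the quadratic term of the decomposition need not be small. By the triangle inequality the radius
  at time \<open>1 + t / b\<close> is at most \<open>r + U / sqrt b\<close> with the initial radius \<open>r\<close> and the excursion \<open>U\<close>. This is at most
  \<open>y = sqrt (b - 2 C)\<close>, since \<open>(y - r) * (y + r) \<ge> 2 U\<close> and both radii are at most \<open>sqrt b\<close>.
\<close>

lemma curve_low:
  assumes i: "i \<in> {1..n}" and \<omega>: "\<omega> \<in> space M" and t: "t \<in> {0..1}" and C: "0 \<le> C" "2 * C \<le> b"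
    and low: "point i (start \<omega>) \<le> 0" "point i (start \<omega>) + excursion i \<omega> \<le> - C"
  shows "curve i t \<omega> \<le> - C"
proof -
  let ?s = "\<lambda>j. start \<omega> (i, j)" and ?w = "\<lambda>j. zoom (i, j) t \<omega>"
  define r where "r = sqrt (sq_radius i (start \<omega>))"
  define y where "y = sqrt (b - 2 * C)"
  define U where "U = excursion i \<omega>"
  have U: "0 \<le> U" "(\<Sum>j=1..m. \<bar>?w j\<bar>) \<le> U" unfolding U_def using zoom_le excursion_nonneg i \<omega> t by auto
  have r2: "r\<^sup>2 = b + 2 * point i (start \<omega>)" and r0: "0 \<le> r"
  proof -
    have "2 * point i (start \<omega>) = sq_radius i (start \<omega>) - b" by (simp add: point_def)
    then show "r\<^sup>2 = b + 2 * point i (start \<omega>)" "0 \<le> r"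
      using sq_radius_nonneg[of i "start \<omega>"] by (auto simp: r_def)
  qed
  have y2: "y\<^sup>2 = b - 2 * C" and y0: "0 \<le> y" using C by (auto simp: y_def)
  have rb: "r \<le> sqrt b" unfolding r_def using low(1) by (simp add: point_def)
  have yb: "y \<le> sqrt b" unfolding y_def using C by simp
  have "(y - r) * (y + r) = y\<^sup>2 - r\<^sup>2" by (simp add: power2_eq_square algebra_simps)
  also have "\<dots> \<ge> 2 * U" using low(2) r2 y2 by (simp add: U_def)
  finally have yr: "2 * U \<le> (y - r) * (y + r)" .
  have "r + U / sqrt b \<le> y"
  proof (cases "y \<le> r")
    case True
    then have "(y - r) * (y + r) \<le> 0" using y0 r0 by (intro mult_nonpos_nonneg) auto
    with yr U(1) have "U = 0" by simp
    moreover have "r \<le> y"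
    proof -
      have "r\<^sup>2 \<le> y\<^sup>2" using low(2) r2 y2 \<open>U = 0\<close> by (simp add: U_def)
      then show ?thesis using y0 by (rule power2_le_imp_le)
    qed
    ultimately show ?thesis by simp
  next
    case False
    then have "(y - r) * (y + r) \<le> (y - r) * (2 * sqrt b)" using rb yb by (intro mult_left_mono) auto
    with yr have "U \<le> (y - r) * sqrt b" by simp
    then have "U / sqrt b \<le> y - r" using b by (simp add: pos_divide_le_eq)
    then show ?thesis by simp
  qed
  moreover have "sqrt (\<Sum>j=1..m. (B' (i, j) (1 + t / b) \<omega>)\<^sup>2) \<le> r + U / sqrt b"
  proof -
    have "sqrt (\<Sum>j=1..m. (B' (i, j) (1 + t / b) \<omega>)\<^sup>2) = L2_set (\<lambda>j. ?s j + ?w j / sqrt b) {1..m}"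
      unfolding L2_set_def using i b by (intro arg_cong[where f = sqrt] sum.cong refl) (simp add: start_def zoom_def)
    also have "\<dots> \<le> L2_set ?s {1..m} + L2_set (\<lambda>j. ?w j / sqrt b) {1..m}" by (rule L2_set_triangle_ineq)
    also have "L2_set (\<lambda>j. ?w j / sqrt b) {1..m} \<le> (\<Sum>j=1..m. \<bar>?w j / sqrt b\<bar>)" by (rule L2_set_le_sum_abs)
    also have "\<dots> = (\<Sum>j=1..m. \<bar>?w j\<bar>) / sqrt b" using b by (simp add: sum_divide_distrib)
    also have "\<dots> \<le> U / sqrt b" using U b by (intro divide_right_mono) auto
    finally show ?thesis by (simp add: L2_set_def r_def sq_radius_def)
  qed
  ultimately have "sqrt (\<Sum>j=1..m. (B' (i, j) (1 + t / b) \<omega>)\<^sup>2) \<le> y" by simp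
  then have "(\<Sum>j=1..m. (B' (i, j) (1 + t / b) \<omega>)\<^sup>2) \<le> b - 2 * C" unfolding y_def by simp
  moreover have "b \<le> b * (1 + t / b)" using b t by (simp add: field_simps)
  moreover have "(x - y) / 2 \<le> - C" if "x \<le> b - 2 * C" "b \<le> y" for x y :: real
    using that by simp
  ultimately show ?thesis unfolding curve_def by blast
qed

text \<open>
  For bounded points the factor \<open>q = radius / sqrt b\<close> of the radial part is close to 1, as
  \<open>|q - 1| \<le> |q\<^sup>2 - 1| = 2 |p| / b\<close> for the point \<open>p\<close>; the quadratic term is divided by \<open>2 b\<close>.
\<close>

lemma curve_close:
  assumes i: "i \<in> {1..n}" and \<omega>: "\<omega> \<in> space M" and t: "t \<in> {0..1}"
    and H: "\<bar>point i (start \<omega>)\<bar> \<le> H" and u: "excursion i \<omega> \<le> u"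
  shows "\<bar>curve i t \<omega> - (point i (start \<omega>) + radial i t \<omega> - t / 2)\<bar> \<le> (2 * H * u + u\<^sup>2 / 2) / b"
proof -
  let ?w = "\<lambda>j. zoom (i, j) t \<omega>"
  define q where "q = sqrt (sq_radius i (start \<omega>)) / sqrt b"
  have U: "0 \<le> u" "(\<Sum>j=1..m. \<bar>?w j\<bar>) \<le> u"
    using zoom_le[OF i \<omega> t] excursion_nonneg[OF i \<omega>] u by auto
  have q0: "0 \<le> q" unfolding q_def using sq_radius_nonneg b by simp
  have q2: "q\<^sup>2 - 1 = 2 * point i (start \<omega>) / b"
    unfolding q_def using sq_radius_nonneg[of i "start \<omega>"] b by (simp add: power_divide point_def field_simps)
  have "\<bar>q - 1\<bar> * 1 \<le> \<bar>q - 1\<bar> * (q + 1)" using q0 by (intro mult_left_mono) auto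
  also have "\<dots> = \<bar>(q - 1) * (q + 1)\<bar>" using q0 by (simp add: abs_mult)
  also have "(q - 1) * (q + 1) = q\<^sup>2 - 1" by (simp add: power2_eq_square algebra_simps)
  also have "\<bar>q\<^sup>2 - 1\<bar> \<le> 2 * H / b" unfolding q2 using H b by (simp add: abs_mult divide_right_mono)
  finally have q1: "\<bar>q - 1\<bar> \<le> 2 * H / b" by simp
  have d1: "\<bar>direction (i, j) s\<bar> \<le> 1" if "j \<in> {1..m}" for j s
  proof -
    have "(direction (i, j) s)\<^sup>2 \<le> (\<Sum>j=1..m. (direction (i, j) s)\<^sup>2)"
      by (rule member_le_sum[OF that]) auto
    then show ?thesis unfolding direction_unit by (simp add: abs_square_le_1)
  qed
  have "\<bar>radial i t \<omega>\<bar> \<le> (\<Sum>j=1..m. \<bar>direction (i, j) (start \<omega>) * ?w j\<bar>)"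
    unfolding radial_def by (rule sum_abs)
  also have "\<dots> \<le> (\<Sum>j=1..m. 1 * \<bar>?w j\<bar>)"
    unfolding abs_mult using d1 by (intro sum_mono mult_right_mono) auto
  finally have rad: "\<bar>radial i t \<omega>\<bar> \<le> u" using U(2) by simp
  have "sqrt (\<Sum>j=1..m. (?w j)\<^sup>2) \<le> (\<Sum>j=1..m. \<bar>?w j\<bar>)"
    using L2_set_le_sum_abs[of ?w "{1..m}"] by (simp add: L2_set_def)
  with U have "sqrt (\<Sum>j=1..m. (?w j)\<^sup>2) \<le> u" by linarith
  then have w2: "(\<Sum>j=1..m. (?w j)\<^sup>2) \<le> u\<^sup>2" by (rule sqrt_le_D)
  have w0: "0 \<le> (\<Sum>j=1..m. (?w j)\<^sup>2)" by (intro sum_nonneg) auto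
  have H0: "0 \<le> H" using H by simp
  have "curve i t \<omega> - (point i (start \<omega>) + radial i t \<omega> - t / 2) = (q - 1) * radial i t \<omega> + (\<Sum>j=1..m. (?w j)\<^sup>2) / (2 * b)"
    unfolding curve_decomposition[OF i] q_def by (simp add: algebra_simps)
  also have "\<bar>\<dots>\<bar> \<le> \<bar>q - 1\<bar> * \<bar>radial i t \<omega>\<bar> + (\<Sum>j=1..m. (?w j)\<^sup>2) / (2 * b)"
    using w0 b by (intro order_trans[OF abs_triangle_ineq]) (simp add: abs_mult)
  also have "\<dots> \<le> 2 * H / b * u + u\<^sup>2 / (2 * b)"
    using q1 rad w2 b H0 by (intro add_mono mult_mono divide_right_mono) auto
  finally show ?thesis using b by (simp add: add_divide_distrib)
qed

text \<open>
  One of the \<open>m\<close> coordinates has to exceed \<open>u / m\<close>; the maximal inequality with \<open>r = 4 m\<close> keeps the rate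
  at 4 in terms of \<open>u\<close>.
\<close>

lemma excursion_tail:
  assumes i: "i \<in> {1..n}" and D: "D \<in> sets borel"
  shows "prob {\<omega>\<in>space M. point i (start \<omega>) \<in> D \<and> u < excursion i \<omega>}
    \<le> prob {\<omega>\<in>space M. point i (start \<omega>) \<in> D} * (4 * real m * exp (8 * (real m)\<^sup>2) * exp (- 4 * u))"
proof -
  have A: "{s\<in>space start_space. point i s \<in> D} \<in> sets start_space"
    using point_measurable[OF i] D by measurable
  have pm: "(\<lambda>\<omega>. point i (start \<omega>)) \<in> borel_measurable M"
    by (rule measurable_compose[OF start_measurable point_measurable[OF i]])
  have eqA: "start \<omega> \<in> {s\<in>space start_space. point i s \<in> D} \<longleftrightarrow> point i (start \<omega>) \<in> D" if "\<omega> \<in> space M" for \<omega>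
    using measurable_space[OF start_measurable that] by simp
  let ?E = "\<lambda>j. {\<omega>\<in>space M. point i (start \<omega>) \<in> D \<and> u / real m < sup_norm (\<lambda>t. zoom (i, j) t \<omega>)}"
  have Em: "?E j \<in> sets M" if "j \<in> {1..m}" for j
  proof -
    note pm[measurable] D[measurable]
    have [measurable]: "(\<lambda>\<omega>. sup_norm (\<lambda>t. zoom (i, j) t \<omega>)) \<in> borel_measurable M"
      using that i by (intro sup_norm_measurable[OF zoom_paths]) auto
    show ?thesis by measurable
  qed
  have one: "prob (?E j) \<le> prob {\<omega>\<in>space M. point i (start \<omega>) \<in> D} * (4 * exp (8 * (real m)\<^sup>2) * exp (- 4 * u))"
    if j: "j \<in> {1..m}" for j
  proof -
    have "prob {\<omega>\<in>space M. start \<omega> \<in> {s\<in>space start_space. point i s \<in> D} \<and> u / real m < sup_norm (\<lambda>t. zoom (i, j) t \<omega>)}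
        \<le> prob {\<omega>\<in>space M. start \<omega> \<in> {s\<in>space start_space. point i s \<in> D}} * (4 * exp ((4 * real m)\<^sup>2 / 2 - (4 * real m) * (u / real m)))"
      using i j by (intro indep_gauss_paths_sup_tail[OF zoom_paths _ A]) auto
    moreover have "4 * exp ((4 * real m)\<^sup>2 / 2 - (4 * real m) * (u / real m)) = 4 * exp (8 * (real m)\<^sup>2) * exp (- 4 * u)"
      using m by (simp add: exp_add[symmetric] power2_eq_square)
    moreover have "{\<omega>\<in>space M. start \<omega> \<in> {s\<in>space start_space. point i s \<in> D} \<and> u / real m < sup_norm (\<lambda>t. zoom (i, j) t \<omega>)} = ?E j"
      "{\<omega>\<in>space M. start \<omega> \<in> {s\<in>space start_space. point i s \<in> D}} = {\<omega>\<in>space M. point i (start \<omega>) \<in> D}"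
      using eqA by blast+
    ultimately show ?thesis by simp
  qed
  have "{\<omega>\<in>space M. point i (start \<omega>) \<in> D \<and> u < excursion i \<omega>} \<subseteq> (\<Union>j\<in>{1..m}. ?E j)"
  proof
    fix \<omega> assume \<omega>: "\<omega> \<in> {\<omega>\<in>space M. point i (start \<omega>) \<in> D \<and> u < excursion i \<omega>}"
    show "\<omega> \<in> (\<Union>j\<in>{1..m}. ?E j)"
    proof (rule ccontr)
      assume "\<omega> \<notin> (\<Union>j\<in>{1..m}. ?E j)"
      then have "sup_norm (\<lambda>t. zoom (i, j) t \<omega>) \<le> u / real m" if "j \<in> {1..m}" for j
        using that \<omega> by (auto simp: not_less)
      then have "excursion i \<omega> \<le> (\<Sum>j=1..m. u / real m)" unfolding excursion_def by (intro sum_mono) auto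
      then show False using \<omega> m by simp
    qed
  qed
  then have "prob {\<omega>\<in>space M. point i (start \<omega>) \<in> D \<and> u < excursion i \<omega>} \<le> prob (\<Union>j\<in>{1..m}. ?E j)"
    using Em by (intro finite_measure_mono sets.finite_UN) auto
  also have "\<dots> \<le> (\<Sum>j=1..m. prob (?E j))"
    using Em by (intro finite_measure_subadditive_finite) auto
  also have "\<dots> \<le> (\<Sum>j=1..m. prob {\<omega>\<in>space M. point i (start \<omega>) \<in> D} * (4 * exp (8 * (real m)\<^sup>2) * exp (- 4 * u)))"
    by (intro sum_mono one)
  finally show ?thesis by (simp add: mult_ac)
qed

lemma start_block:
  assumes i: "i \<in> {1..n}"
  shows "distr M (\<Pi>\<^sub>M j\<in>{1..m}. borel) (\<lambda>\<omega>. \<lambda>j\<in>{1..m}. B' (i, j) 1 \<omega>) = (\<Pi>\<^sub>M j\<in>{1..m}. std_gauss)"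
proof (rule gauss_vector_distr)
  show "gauss_vector (\<lambda>j. B' (i, j) 1) {1..m}"
    using i m by (intro gauss_vector_reindex[OF start_gauss]) (auto simp: inj_on_def)
qed (use m in auto)

lemma point_law:
  assumes i: "i \<in> {1..n}" and D: "D \<in> sets borel"
  shows "prob {\<omega>\<in>space M. point i (start \<omega>) \<in> D}
    = measure (\<Pi>\<^sub>M j\<in>{1..m}. std_gauss) {z\<in>space (\<Pi>\<^sub>M j\<in>{1..m}. std_gauss). ((\<Sum>j=1..m. (z j)\<^sup>2) - b) / 2 \<in> D}"
proof -
  let ?P = "\<Pi>\<^sub>M j\<in>{1..m}. (borel :: real measure)"
  have sp: "space (\<Pi>\<^sub>M j\<in>{1..m}. std_gauss) = space ?P" by (simp add: space_PiM)
  have vm: "(\<lambda>\<omega>. \<lambda>j\<in>{1..m}. B' (i, j) 1 \<omega>) \<in> measurable M ?P"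
    using i by (intro measurable_restrict B'_measurable) auto
  have Em: "{z\<in>space ?P. ((\<Sum>j=1..m. (z j)\<^sup>2) - b) / 2 \<in> D} \<in> sets ?P"
  proof -
    have "(\<lambda>z. ((\<Sum>j=1..m. (z j)\<^sup>2) - b) / 2) \<in> borel_measurable ?P" by measurable
    with D show ?thesis by measurable
  qed
  show ?thesis
    unfolding start_block[OF i, symmetric] sp
  proof (subst measure_distr[OF vm])
    show "{z \<in> space (distr M ?P (\<lambda>\<omega>. \<lambda>j\<in>{1..m}. B' (i, j) 1 \<omega>)). ((\<Sum>j=1..m. (z j)\<^sup>2) - b) / 2 \<in> D} \<in> sets ?P"
      using Em by simp
    define v where "v \<omega> = (\<lambda>j\<in>{1..m}. B' (i, j) 1 \<omega>)" for \<omega>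
    have p: "point i (start \<omega>) = ((\<Sum>j=1..m. (v \<omega> j)\<^sup>2) - b) / 2" for \<omega>
      unfolding point_def sq_radius_def using i
      by (intro arg_cong[where f = "\<lambda>x. (x - b) / 2"] sum.cong) (auto simp: start_def v_def)
    have "v \<omega> \<in> space ?P" if "\<omega> \<in> space M" for \<omega>
      using measurable_space[OF vm that] by (simp add: v_def)
    then have "prob {\<omega>\<in>space M. point i (start \<omega>) \<in> D} = prob (v -`
        {z \<in> space (distr M ?P v). ((\<Sum>j=1..m. (z j)\<^sup>2) - b) / 2 \<in> D} \<inter> space M)"
      unfolding p by (intro arg_cong[where f = prob]) auto
    then show "prob {\<omega>\<in>space M. point i (start \<omega>) \<in> D} = prob ((\<lambda>\<omega>. \<lambda>j\<in>{1..m}. B' (i, j) 1 \<omega>) -`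
        {z \<in> space (distr M ?P (\<lambda>\<omega>. \<lambda>j\<in>{1..m}. B' (i, j) 1 \<omega>)). ((\<Sum>j=1..m. (z j)\<^sup>2) - b) / 2 \<in> D} \<inter> space M)"
      unfolding v_def[abs_def] .
  qed
qed

lemma point_tail:
  assumes i: "i \<in> {1..n}"
  shows "prob {\<omega>\<in>space M. x < point i (start \<omega>)} = chi_tail m (b + 2 * x)"
proof -
  have "prob {\<omega>\<in>space M. point i (start \<omega>) \<in> {x<..}} = chi_tail m (b + 2 * x)"
    unfolding point_law[OF i borel_open[OF open_greaterThan]] chi_tail_def
    by (intro arg_cong2[where f = measure] refl Collect_cong) (auto simp: field_simps)
  then show ?thesis by simp
qed

definition bin_prob :: "real \<Rightarrow> real \<Rightarrow> nat \<Rightarrow> nat \<Rightarrow> real" where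
  "bin_prob A \<delta> J j = prob {\<omega>\<in>space M. bin A \<delta> J (point 1 (start \<omega>)) = j}"

lemma bin_prob_eq:
  assumes i: "i \<in> {1..n}"
  shows "prob {\<omega>\<in>space M. bin A \<delta> J (point i (start \<omega>)) = j} = bin_prob A \<delta> J j"
proof -
  have D: "bin A \<delta> J -` {j} \<in> sets borel" using measurable_sets[OF bin_measurable, of "{j}"] by simp
  have "1 \<in> {1..n}" using n by simp
  then show ?thesis unfolding bin_prob_def using point_law[OF i D] point_law[OF _ D] by simp
qed

lemma bin_prob_tail:
  assumes \<delta>: "0 < \<delta>" and j: "1 \<le> j" "j \<le> J"
  shows "bin_prob A \<delta> J j = chi_tail m (b + 2 * level A \<delta> (j - 1)) - chi_tail m (b + 2 * level A \<delta> j)"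
proof -
  have 1: "1 \<in> {1..n}" using n by simp
  have pm[measurable]: "(\<lambda>\<omega>. point 1 (start \<omega>)) \<in> borel_measurable M"
    by (rule measurable_compose[OF start_measurable point_measurable[OF 1]])
  have le: "level A \<delta> (j - 1) \<le> level A \<delta> j" using \<delta> by (simp add: level_def mult_right_mono)
  let ?U = "\<lambda>l. {\<omega>\<in>space M. level A \<delta> l < point 1 (start \<omega>)}"
  have eq: "{\<omega>\<in>space M. bin A \<delta> J (point 1 (start \<omega>)) = j} = ?U (j - 1) - ?U j"
    unfolding bin_eq_iff[OF \<delta> j] by auto
  have Um: "?U l \<in> sets M" for l by measurable
  have "?U j \<subseteq> ?U (j - 1)"
  proof
    fix \<omega> assume "\<omega> \<in> ?U j"
    then have "\<omega> \<in> space M" "level A \<delta> j < point 1 (start \<omega>)" by blast+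
    with le show "\<omega> \<in> ?U (j - 1)" by (blast intro: le_less_trans)
  qed
  then show ?thesis
    unfolding bin_prob_def eq by (simp only: finite_measure_Diff[OF Um Um] point_tail[OF 1])
qed

lemma bin_prob_0:
  assumes \<delta>: "0 < \<delta>"
  shows "bin_prob A \<delta> J 0 = 1 - (\<Sum>j=1..J. bin_prob A \<delta> J j)"
proof -
  have 1: "1 \<in> {1..n}" using n by simp
  have pm: "(\<lambda>\<omega>. point 1 (start \<omega>)) \<in> borel_measurable M"
    by (rule measurable_compose[OF start_measurable point_measurable[OF 1]])
  let ?E = "\<lambda>j. {\<omega>\<in>space M. bin A \<delta> J (point 1 (start \<omega>)) = j}"
  have Em: "?E j \<in> sets M" for j
    using measurable_compose[OF pm bin_measurable[of A \<delta> J]] by measurable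
  have "(\<Sum>j\<le>J. prob (?E j)) = prob (\<Union>j\<in>{..J}. ?E j)"
    using Em by (intro finite_measure_finite_Union[symmetric]) (auto simp: disjoint_family_on_def)
  also have "(\<Union>j\<in>{..J}. ?E j) = space M" using bin_le[OF \<delta>] by auto
  finally have "(\<Sum>j\<le>J. bin_prob A \<delta> J j) = 1" by (simp add: bin_prob_def prob_space)
  then show ?thesis by (simp add: atMost_atLeast0 sum.atLeast_Suc_atMost)
qed

text \<open>
  The points of different indices are functions of disjoint blocks of the Gaussian vector of positions.
\<close>

lemma bins_independent:
  "prob {\<omega>\<in>space M. \<forall>i\<in>{1..n}. bin A \<delta> J (point i (start \<omega>)) = f i} = (\<Prod>i=1..n. bin_prob A \<delta> J (f i))"
proof -
  define K where "K i = {i} \<times> {1..m}" for i :: nat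
  have "indep_vars (\<lambda>i. PiM (K i) (\<lambda>_. borel)) (\<lambda>i \<omega>. restrict (\<lambda>x. B' x 1 \<omega>) (K i)) {1..n}"
    using start_gauss by (intro indep_vars_restrict[where I = idx])
      (auto simp: gauss_vector_def K_def disjoint_family_on_def)
  then have "indep_vars (\<lambda>_. count_space UNIV)
      (\<lambda>i \<omega>. bin A \<delta> J (((\<Sum>j=1..m. (restrict (\<lambda>x. B' x 1 \<omega>) (K i) (i, j))\<^sup>2) - b) / 2)) {1..n}"
  proof (rule indep_vars_compose2)
    fix i
    have "(\<lambda>z. ((\<Sum>j=1..m. (z (i, j))\<^sup>2) - b) / 2) \<in> borel_measurable (PiM (K i) (\<lambda>_. borel))"
      by (intro borel_measurable_divide borel_measurable_diff borel_measurable_sum borel_measurable_power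
          borel_measurable_const measurable_component_singleton) (auto simp: K_def)
    then show "(\<lambda>z. bin A \<delta> J (((\<Sum>j=1..m. (z (i, j))\<^sup>2) - b) / 2)) \<in> measurable (PiM (K i) (\<lambda>_. borel)) (count_space UNIV)"
      by (rule measurable_compose[OF _ bin_measurable])
  qed
  moreover have "((\<Sum>j=1..m. (restrict (\<lambda>x. B' x 1 \<omega>) (K i) (i, j))\<^sup>2) - b) / 2 = point i (start \<omega>)" if "i \<in> {1..n}" for i \<omega>
    unfolding point_def sq_radius_def using that
    by (intro arg_cong[where f = "\<lambda>x. (x - b) / 2"] sum.cong) (auto simp: start_def K_def)
  ultimately have iv: "indep_vars (\<lambda>_. count_space UNIV) (\<lambda>i \<omega>. bin A \<delta> J (point i (start \<omega>))) {1..n}"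
    by (subst indep_vars_cong[OF refl _ refl]) auto
  have "prob {\<omega>\<in>space M. \<forall>i\<in>{1..n}. bin A \<delta> J (point i (start \<omega>)) = f i}
      = prob (\<Inter>i\<in>{1..n}. (\<lambda>\<omega>. bin A \<delta> J (point i (start \<omega>))) -` {f i} \<inter> space M)"
    using n by (intro arg_cong[where f = prob]) auto
  also have "\<dots> = (\<Prod>i=1..n. prob ((\<lambda>\<omega>. bin A \<delta> J (point i (start \<omega>))) -` {f i} \<inter> space M))"
    using n by (intro indep_varsD_finite[OF iv]) auto
  also have "\<dots> = (\<Prod>i=1..n. bin_prob A \<delta> J (f i))"
  proof (rule prod.cong[OF refl])
    fix i assume i: "i \<in> {1..n}"
    have "(\<lambda>\<omega>. bin A \<delta> J (point i (start \<omega>))) -` {f i} \<inter> space M = {\<omega>\<in>space M. bin A \<delta> J (point i (start \<omega>)) = f i}"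
      by auto
    then show "prob ((\<lambda>\<omega>. bin A \<delta> J (point i (start \<omega>))) -` {f i} \<inter> space M) = bin_prob A \<delta> J (f i)"
      using bin_prob_eq[OF i] by simp
  qed
  finally show ?thesis .
qed

lemma occupancy_law:
  assumes \<delta>: "0 < \<delta>" and k: "k \<in> extensional {1..J}" "(\<Sum>j=1..J. k j) \<le> n"
  shows "prob {\<omega>\<in>space M. occupancy J {1..n} (\<lambda>i. bin A \<delta> J (point i (start \<omega>))) = k}
    = multinomial_occ n J (bin_prob A \<delta> J) k"
proof (rule occupancy_multinomial[where s = "\<lambda>\<omega> i. bin A \<delta> J (point i (start \<omega>))", OF _ _ _ bin_prob_0[OF \<delta>] k])
  show "(\<lambda>\<omega>. bin A \<delta> J (point i (start \<omega>))) \<in> measurable M (count_space UNIV)" if "i \<in> {1..n}" for i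
    by (rule measurable_compose[OF measurable_compose[OF start_measurable point_measurable[OF that]] bin_measurable])
qed (use bin_le[OF \<delta>] bins_independent in auto)

lemma low_points:
  assumes Q: "\<And>k::nat. real n * chi_tail m (b - 2 * real k) \<le> Q * exp (2 * real k)" and Q0: "0 \<le> Q"
  shows "(\<Sum>i=1..n. prob {\<omega>\<in>space M. point i (start \<omega>) \<le> - real a \<and> - C < point i (start \<omega>) + excursion i \<omega>})
    \<le> 2 * Q * (4 * real m * exp (8 * (real m)\<^sup>2)) * exp (2 + 4 * C) * exp (- 2 * real a)"
proof (rule low_points_bound)
  fix i u and k :: nat assume i: "i \<in> {1..n}"
  show "prob {\<omega>\<in>space M. (- real (Suc k) < point i (start \<omega>) \<and> point i (start \<omega>) \<le> - real k) \<and> u < excursion i \<omega>}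
      \<le> prob {\<omega>\<in>space M. - real (Suc k) < point i (start \<omega>) \<and> point i (start \<omega>) \<le> - real k} * (4 * real m * exp (8 * (real m)\<^sup>2) * exp (- 4 * u))"
    using excursion_tail[OF i, of "{- real (Suc k)<..- real k}" u] by simp
next
  fix k :: nat
  have "(\<Sum>i=1..n. prob {\<omega>\<in>space M. - real k < point i (start \<omega>)}) = (\<Sum>i=1..n. chi_tail m (b - 2 * real k))"
    using point_tail[of _ "- real k"] by (intro sum.cong refl) simp
  then show "(\<Sum>i=1..n. prob {\<omega>\<in>space M. - real k < point i (start \<omega>)}) \<le> Q * exp (2 * real k)"
    using Q[of k] by simp
qed (use Q0 excursion_measurable measurable_compose[OF start_measurable point_measurable] in auto)

text \<open>
  As for the Brown-Resnick curves, but the curves in the window only approximate those of the binned maximum: the additional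
  error \<open>e\<close> is valid for excursions up to \<open>u\<close>, and the last term of the bound accounts for the larger ones.
\<close>

lemma binned_approximation:
  assumes \<Phi>: "lip L \<Phi>" and c: "\<And>f. continuous_on {0..1} f \<Longrightarrow> \<bar>\<Phi> f\<bar> \<le> c" and \<delta>: "0 < \<delta>"
    and C: "0 \<le> C" "2 * C \<le> b" and e: "0 \<le> e"
    and eu: "(2 * max (real a) (level (real a) \<delta> J) * u + u\<^sup>2 / 2) / b \<le> e"
    and Q: "\<And>k::nat. real n * chi_tail m (b - 2 * real k) \<le> Q * exp (2 * real k)" and Q0: "0 \<le> Q"
  shows "\<bar>(\<integral>\<omega>. \<Phi> (\<lambda>t. floor_max C {1..n} (\<lambda>i. curve i t \<omega>)) \<partial>M) -
      (\<integral>\<omega>. \<Phi> (\<lambda>t. binned_max C (level (real a) \<delta>) {1..n} (\<lambda>i. bin (real a) \<delta> J (point i (start \<omega>))) (\<lambda>i. radial i t \<omega>) t) \<partial>M)\<bar>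
    \<le> L * (e + \<delta>) + 2 * c * (real n * chi_tail m (b + 2 * level (real a) \<delta> J)
        + 2 * Q * (4 * real m * exp (8 * (real m)\<^sup>2)) * exp (2 + 4 * C) * exp (- 2 * real a)
        + Q * exp (2 * real a) * (4 * real m * exp (8 * (real m)\<^sup>2) * exp (- 4 * u)))"
proof -
  let ?p = "\<lambda>i \<omega>. point i (start \<omega>)"
  let ?\<kappa> = "4 * real m * exp (8 * (real m)\<^sup>2)"
  let ?H = "\<lambda>i. {\<omega>\<in>space M. level (real a) \<delta> J < ?p i \<omega>}"
  let ?Lo = "\<lambda>i. {\<omega>\<in>space M. ?p i \<omega> \<le> - real a \<and> - C < ?p i \<omega> + excursion i \<omega>}"
  let ?F = "\<lambda>i. {\<omega>\<in>space M. ?p i \<omega> \<in> {- real a<..} \<and> u < excursion i \<omega>}"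
  define bad where "bad = (\<Union>i\<in>{1..n}. (?H i \<union> ?Lo i) \<union> ?F i)"
  have pm: "(\<lambda>\<omega>. ?p i \<omega>) \<in> borel_measurable M" if "i \<in> {1..n}" for i
    by (rule measurable_compose[OF start_measurable point_measurable[OF that]])
  have Hm: "?H i \<in> sets M" and Lm: "?Lo i \<in> sets M" and Fm: "?F i \<in> sets M" if "i \<in> {1..n}" for i
    using pm[OF that] excursion_measurable[OF that] by measurable
  have badm: "bad \<in> sets M" unfolding bad_def using Hm Lm Fm by (intro sets.finite_UN sets.Un) auto
  have pH: "(\<Sum>i=1..n. prob (?H i)) = real n * chi_tail m (b + 2 * level (real a) \<delta> J)"
    using point_tail by simp
  have pL: "(\<Sum>i=1..n. prob (?Lo i)) \<le> 2 * Q * ?\<kappa> * exp (2 + 4 * C) * exp (- 2 * real a)"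
    by (rule low_points[OF Q Q0])
  have pF: "(\<Sum>i=1..n. prob (?F i)) \<le> Q * exp (2 * real a) * (?\<kappa> * exp (- 4 * u))"
  proof -
    have "(\<Sum>i=1..n. prob (?F i)) \<le> (\<Sum>i=1..n. chi_tail m (b - 2 * real a) * (?\<kappa> * exp (- 4 * u)))"
    proof (rule sum_mono)
      fix i assume i: "i \<in> {1..n}"
      show "prob (?F i) \<le> chi_tail m (b - 2 * real a) * (?\<kappa> * exp (- 4 * u))"
        using excursion_tail[OF i, of "{- real a<..}" u] point_tail[OF i, of "- real a"] by simp
    qed
    also have "\<dots> = (real n * chi_tail m (b - 2 * real a)) * (?\<kappa> * exp (- 4 * u))" by simp
    also have "\<dots> \<le> Q * exp (2 * real a) * (?\<kappa> * exp (- 4 * u))"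
      by (intro mult_right_mono Q) auto
    finally show ?thesis .
  qed
  have "prob bad \<le> (\<Sum>i=1..n. prob ((?H i \<union> ?Lo i) \<union> ?F i))"
    unfolding bad_def using Hm Lm Fm by (intro finite_measure_subadditive_finite) auto
  also have "\<dots> \<le> (\<Sum>i=1..n. (prob (?H i) + prob (?Lo i)) + prob (?F i))"
  proof (rule sum_mono)
    fix i assume i: "i \<in> {1..n}"
    have "prob ((?H i \<union> ?Lo i) \<union> ?F i) \<le> prob (?H i \<union> ?Lo i) + prob (?F i)"
      by (rule measure_Un_le[OF sets.Un[OF Hm[OF i] Lm[OF i]] Fm[OF i]])
    also have "prob (?H i \<union> ?Lo i) \<le> prob (?H i) + prob (?Lo i)"
      by (rule measure_Un_le[OF Hm[OF i] Lm[OF i]])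
    finally show "prob ((?H i \<union> ?Lo i) \<union> ?F i) \<le> (prob (?H i) + prob (?Lo i)) + prob (?F i)" by simp
  qed
  also have "\<dots> = (\<Sum>i=1..n. prob (?H i)) + (\<Sum>i=1..n. prob (?Lo i)) + (\<Sum>i=1..n. prob (?F i))"
    by (simp only: sum.distrib)
  finally have pb: "prob bad \<le> real n * chi_tail m (b + 2 * level (real a) \<delta> J)
        + 2 * Q * ?\<kappa> * exp (2 + 4 * C) * exp (- 2 * real a) + Q * exp (2 * real a) * (?\<kappa> * exp (- 4 * u))"
    using pH pL pF by linarith
  have c0: "0 \<le> c" using c[of "\<lambda>_. 0"] by (simp add: continuous_on_const order_trans[OF abs_ge_zero])
  have rc: "continuous_on {0..1} (\<lambda>t. radial i t \<omega>)" if "i \<in> {1..n}" "\<omega> \<in> space M" for i \<omega>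
    using radial_paths that unfolding indep_gauss_paths_def by blast
  have rm: "radial i t \<in> borel_measurable M" if "i \<in> {1..n}" "t \<in> {0..1}" for i t
    using radial_paths that unfolding indep_gauss_paths_def by blast
  have "\<bar>(\<integral>\<omega>. \<Phi> (\<lambda>t. floor_max C {1..n} (\<lambda>i. curve i t \<omega>)) \<partial>M) -
      (\<integral>\<omega>. \<Phi> (\<lambda>t. binned_max C (level (real a) \<delta>) {1..n} (\<lambda>i. bin (real a) \<delta> J (?p i \<omega>)) (\<lambda>i. radial i t \<omega>) t) \<partial>M)\<bar>
    \<le> L * (e + \<delta>) + 2 * c * prob bad"
  proof (rule lip_expectation_close[OF \<Phi> c _ _ _ _ _ badm])
    show "0 \<le> e + \<delta>" using \<delta> e by simp
    show "continuous_on {0..1} (\<lambda>t. floor_max C {1..n} (\<lambda>i. curve i t \<omega>))" if "\<omega> \<in> space M" for \<omega>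
      by (intro floor_max_cont curve_cont that) simp_all
    show "(\<lambda>\<omega>. floor_max C {1..n} (\<lambda>i. curve i t \<omega>)) \<in> borel_measurable M" if "t \<in> {0..1}" for t
      using that by (intro floor_max_measurable curve_measurable) auto
    show "continuous_on {0..1} (\<lambda>t. binned_max C (level (real a) \<delta>) {1..n} (\<lambda>i. bin (real a) \<delta> J (?p i \<omega>)) (\<lambda>i. radial i t \<omega>) t)"
      if "\<omega> \<in> space M" for \<omega>
      by (intro binned_max_cont rc that) auto
    show "(\<lambda>\<omega>. binned_max C (level (real a) \<delta>) {1..n} (\<lambda>i. bin (real a) \<delta> J (?p i \<omega>)) (\<lambda>i. radial i t \<omega>) t) \<in> borel_measurable M"
      if "t \<in> {0..1}" for t
      by (intro binned_max_measurable rm that measurable_compose[OF pm bin_measurable]) auto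
    fix \<omega> t assume \<omega>: "\<omega> \<in> space M" "\<omega> \<notin> bad" and t: "t \<in> {0..1::real}"
    show "\<bar>floor_max C {1..n} (\<lambda>i. curve i t \<omega>) - binned_max C (level (real a) \<delta>) {1..n} (\<lambda>i. bin (real a) \<delta> J (?p i \<omega>)) (\<lambda>i. radial i t \<omega>) t\<bar> \<le> e + \<delta>"
    proof (rule floor_max_binned_max)
      fix i assume i: "i \<in> {1..n}"
      have nb: "\<omega> \<notin> ?H i" "\<omega> \<notin> ?Lo i" "\<omega> \<notin> ?F i" using \<omega>(2) i unfolding bad_def by blast+
      show hi: "?p i \<omega> \<le> level (real a) \<delta> J" using nb(1) \<omega>(1) by simp
      show "curve i t \<omega> \<le> - C" if "?p i \<omega> \<le> - real a"
      proof (rule curve_low[OF i \<omega>(1) t C])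
        show "?p i \<omega> \<le> 0" using that by simp
        show "?p i \<omega> + excursion i \<omega> \<le> - C" using nb(2) \<omega>(1) that by simp
      qed
      show "\<bar>curve i t \<omega> - (?p i \<omega> + radial i t \<omega> - t / 2)\<bar> \<le> e" if lo: "- real a < ?p i \<omega>"
      proof -
        have "excursion i \<omega> \<le> u" using nb(3) \<omega>(1) lo by simp
        moreover have "\<bar>?p i \<omega>\<bar> \<le> max (real a) (level (real a) \<delta> J)" using hi lo by linarith
        ultimately have "\<bar>curve i t \<omega> - (?p i \<omega> + radial i t \<omega> - t / 2)\<bar>
            \<le> (2 * max (real a) (level (real a) \<delta> J) * u + u\<^sup>2 / 2) / b"
          by (intro curve_close[OF i \<omega>(1) t])
        with eu show ?thesis by linarith
      qed
    qed (use \<delta> e in auto)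
  qed
  also have "\<dots> \<le> L * (e + \<delta>) + 2 * c * (real n * chi_tail m (b + 2 * level (real a) \<delta> J)
        + 2 * Q * ?\<kappa> * exp (2 + 4 * C) * exp (- 2 * real a) + Q * exp (2 * real a) * (?\<kappa> * exp (- 4 * u)))"
    by (rule add_left_mono[OF mult_left_mono[OF pb]]) (use c0 in simp)
  finally show ?thesis .
qed

end

section \<open>Convergence in law\<close>

text \<open>
  A box of occupation numbers has as its mass a product of partial sums of the Poisson distributions.
\<close>

lemma poisson_occ_tight:
  assumes \<mu>: "\<And>j. 0 \<le> \<mu> j" and \<eta>: "0 < \<eta>"
  shows "\<exists>T. finite T \<and> T \<subseteq> extensional {1..J} \<and> 1 - \<eta> \<le> (\<Sum>k\<in>T. poisson_occ J \<mu> k)"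
proof -
  define T where "T r = ({1..J} \<rightarrow>\<^sub>E {..r})" for r :: nat
  have "(\<Sum>k\<in>T r. poisson_occ J \<mu> k) = (\<Prod>j=1..J. \<Sum>i\<le>r. \<mu> j ^ i / fact i * exp (- \<mu> j))" for r
    unfolding poisson_occ_def T_def by (rule prod_sum_PiE[symmetric]) auto
  moreover have "(\<lambda>r. \<Prod>j=1..J. \<Sum>i\<le>r. \<mu> j ^ i / fact i * exp (- \<mu> j)) \<longlonglongrightarrow> (\<Prod>j=1..J. 1)"
  proof (rule tendsto_prod)
    fix j
    have "(\<lambda>i. \<mu> j ^ i /\<^sub>R fact i * exp (- \<mu> j)) sums (exp (\<mu> j) * exp (- \<mu> j))"
      by (intro sums_mult2 exp_converges)
    then have "(\<lambda>i. \<mu> j ^ i / fact i * exp (- \<mu> j)) sums 1"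
      by (simp add: exp_add[symmetric] divide_inverse mult.commute)
    then show "(\<lambda>r. \<Sum>i\<le>r. \<mu> j ^ i / fact i * exp (- \<mu> j)) \<longlonglongrightarrow> 1"
      by (simp add: sums_def_le)
  qed
  ultimately have "(\<lambda>r. \<Sum>k\<in>T r. poisson_occ J \<mu> k) \<longlonglongrightarrow> 1" by simp
  then have "\<forall>\<^sub>F r in sequentially. 1 - \<eta> < (\<Sum>k\<in>T r. poisson_occ J \<mu> k)"
    using \<eta> by (intro order_tendstoD(1)) auto
  then obtain r where r: "1 - \<eta> < (\<Sum>k\<in>T r. poisson_occ J \<mu> k)" by (auto simp: eventually_sequentially)
  show ?thesis
  proof (intro exI[of _ "T r"] conjI)
    show "finite (T r)" unfolding T_def by (intro finite_PiE) auto
    show "T r \<subseteq> extensional {1..J}" unfolding T_def by (auto simp: PiE_iff)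
  qed (use r in simp)
qed

text \<open>
  Both floored maxima are replaced by binned ones, and these are compared through their occupation numbers. The parameters are
  chosen in this order: the depth \<open>a\<close> of the window, the width of the bins, a finite set \<open>T\<close> of occupation
  numbers, the bound \<open>u\<close> on excursions, then \<open>n\<close>, and last the number \<open>r\<close> of curves of the limit.
\<close>

lemma floored_convergence:
  fixes C :: nat
  assumes M: "prob_space M" and m: "1 \<le> m"
    and B: "prob_space.indep_brownian_motions M B ({1..} \<times> {1..m})"
    and regB: "prob_space.regular_version M B B' ({1..} \<times> {1..m})"
    and NS: "brown_resnick_setting N X W W'"
    and Rm: "\<And>t. t \<in> {0..1} \<Longrightarrow> R t \<in> borel_measurable N"
    and Rc: "\<And>\<omega>. \<omega> \<in> space N \<Longrightarrow> continuous_on {0..1} (\<lambda>t. R t \<omega>)"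
    and R: "AE \<omega> in N. \<exists>n0. \<forall>n\<ge>n0. \<forall>t\<in>{0..1}. \<forall>C. floor_max C {..<n} (\<lambda>i. brown_resnick_setting.curve X W' i t \<omega>) = max (- C) (R t \<omega>)"
    and \<Phi>: "lip L \<Phi>" and c: "\<And>f. continuous_on {0..1} f \<Longrightarrow> \<bar>\<Phi> f\<bar> \<le> c"
  shows "(\<lambda>n. \<integral>\<omega>. \<Phi> (\<lambda>t. floor_max (real C) {1..n} (\<lambda>i. rescaled m B' n i t \<omega>)) \<partial>M)
    \<longlonglongrightarrow> (\<integral>\<omega>. \<Phi> (\<lambda>t. max (- real C) (R t \<omega>)) \<partial>N)"
proof (rule tendstoI)
  interpret M: prob_space M by fact
  interpret N: brown_resnick_setting N X W W' by fact
  fix \<epsilon> :: real assume \<epsilon>: "0 < \<epsilon>"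
  define v where "v n = (\<integral>\<omega>. \<Phi> (\<lambda>t. floor_max (real C) {..<n} (\<lambda>i. N.curve i t \<omega>)) \<partial>N)" for n
  define l where "l = (\<integral>\<omega>. \<Phi> (\<lambda>t. max (- real C) (R t \<omega>)) \<partial>N)"
  have vl: "v \<longlonglongrightarrow> l" unfolding v_def l_def by (rule N.floored_limit[OF \<Phi> c Rm Rc R])
  have L: "0 \<le> L" using \<Phi> by (simp add: lip_def)
  have c0: "0 \<le> c" using c[of "\<lambda>_. 0"] by (simp add: continuous_on_const order_trans[OF abs_ge_zero])
  \<comment> \<open>the errors below add up to \<open>(3 * L + 16 * c + 1) * \<eta>\<close>\<close>
  define \<eta> where "\<eta> = \<epsilon> / (2 * (3 * L + 16 * c + 1))"
  have den: "0 < 3 * L + 16 * c + 1" using L c0 by simp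
  have "(3 * L + 16 * c + 1) * \<eta> = \<epsilon> / 2" unfolding \<eta>_def using den by (simp del: distrib_left_numeral)
  then have \<eta>: "0 < \<eta>" "(3 * L + 16 * c + 1) * \<eta> < \<epsilon>"
    using \<epsilon> den by (auto simp: \<eta>_def simp del: distrib_left_numeral)
  obtain Q where Q: "0 < Q" "\<forall>\<^sub>F n in sequentially. \<forall>k::nat. real n * chi_tail m (norming m n - 2 * real k) \<le> Q * exp (2 * real k)"
    using norming_tail_bound[OF m] by blast
  define \<kappa> where "\<kappa> = 4 * real m * exp (8 * (real m)\<^sup>2)"
  \<comment> \<open>the truncation level\<close>
  have lim_a: "(\<lambda>a. K * exp (- 2 * real a)) \<longlonglongrightarrow> 0" for K :: real by real_asymp
  have "\<forall>\<^sub>F a in sequentially. exp (- real a) < \<eta> \<and> (2 * Q * \<kappa> * exp (2 + 4 * real C)) * exp (- 2 * real a) < \<eta> \<and>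
      (2 * 1 * (4 * exp 8) * exp (2 + 4 * real C)) * exp (- 2 * real a) < \<eta>"
  proof (intro eventually_conj)
    have "(\<lambda>a. exp (- real a)) \<longlonglongrightarrow> 0" by real_asymp
    then show "\<forall>\<^sub>F a in sequentially. exp (- real a) < \<eta>" using \<eta>(1) by (rule order_tendstoD(2))
  qed (use order_tendstoD(2)[OF lim_a \<eta>(1)] in blast)+
  then obtain a where a: "exp (- real a) < \<eta>" "(2 * Q * \<kappa> * exp (2 + 4 * real C)) * exp (- 2 * real a) < \<eta>"
      "(2 * 1 * (4 * exp 8) * exp (2 + 4 * real C)) * exp (- 2 * real a) < \<eta>"
    by (auto simp: eventually_sequentially)
  \<comment> \<open>bins of width \<open>\<delta>\<close> covering the interval from \<open>- a\<close> to \<open>a\<close>\<close>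
  obtain q :: nat where q: "1 / \<eta> < real q" using reals_Archimedean2 by blast
  have q0: "0 < real q" using q \<eta>(1) by (meson less_trans zero_less_divide_1_iff)
  define \<delta> where "\<delta> = 1 / real q"
  define J where "J = 2 * a * q"
  have \<delta>: "0 < \<delta>" "\<delta> \<le> \<eta>" using q q0 \<eta>(1) by (auto simp: \<delta>_def field_simps)
  have lev: "level (real a) \<delta> J = real a" using q0 by (simp add: level_def \<delta>_def J_def)
  define \<mu> where "\<mu> j = exp (- level (real a) \<delta> (j - 1)) - exp (- level (real a) \<delta> j)" for j
  have \<mu>: "0 \<le> \<mu> j" for j using \<delta>(1) by (simp add: \<mu>_def level_def mult_right_mono)
  obtain T where T: "finite T" "T \<subseteq> extensional {1..J}" "1 - \<eta> \<le> (\<Sum>k\<in>T. poisson_occ J \<mu> k)"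
    using poisson_occ_tight[of \<mu> \<eta> J] \<mu> \<eta>(1) by blast
  define \<tau> where "\<tau> = \<eta> / (real (card T) + 1)"
  have \<tau>: "0 < \<tau>" "real (card T) * \<tau> \<le> \<eta>" using \<eta>(1) by (auto simp: \<tau>_def field_simps)
  \<comment> \<open>a bound for the excursions of the points above \<open>- a\<close>\<close>
  have "(\<lambda>u. Q * exp (2 * real a) * (\<kappa> * exp (- 4 * real u))) \<longlonglongrightarrow> 0" by real_asymp
  then have "\<forall>\<^sub>F u in sequentially. Q * exp (2 * real a) * (\<kappa> * exp (- 4 * real u)) < \<eta>"
    using \<eta>(1) by (rule order_tendstoD(2))
  then obtain u :: nat where u: "Q * exp (2 * real a) * (\<kappa> * exp (- 4 * real u)) < \<eta>"
    by (auto simp: eventually_sequentially)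
  have bt: "filterlim (norming m) at_top sequentially" using norming_at_top[of m 0] by simp
  define H where "H = 2 * max (real a) (level (real a) \<delta> J) * real u + (real u)\<^sup>2 / 2"
  have ev_b: "\<forall>\<^sub>F n in sequentially. max 1 (max (2 * real C) (H / \<eta>)) \<le> norming m n"
    using bt unfolding filterlim_at_top by blast
  have ev_high: "\<forall>\<^sub>F n in sequentially. real n * chi_tail m (norming m n + 2 * level (real a) \<delta> J) < \<eta>"
    using order_tendstoD(2)[OF norming_tail_limit[OF m, of "real a"] a(1)] unfolding lev .
  define p where "p n j = chi_tail m (norming m n + 2 * level (real a) \<delta> (j - 1)) - chi_tail m (norming m n + 2 * level (real a) \<delta> j)" for n j
  have p0: "0 \<le> p n j" for n j
    using \<delta>(1) by (simp add: p_def chi_tail_antimono level_def mult_right_mono)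
  have ev_occ: "\<forall>\<^sub>F n in sequentially. \<forall>k\<in>T. \<bar>multinomial_occ n J (p n) k - poisson_occ J \<mu> k\<bar> < \<tau>"
  proof (rule eventually_ball_finite[OF T(1)], rule ballI)
    fix k
    have "(\<lambda>n. multinomial_occ n J (p n) k) \<longlonglongrightarrow> poisson_occ J \<mu> k"
    proof (rule multinomial_poisson_limit)
      fix j
      show "(\<lambda>n. real n * p n j) \<longlonglongrightarrow> \<mu> j"
        unfolding \<mu>_def p_def right_diff_distrib by (intro tendsto_diff norming_tail_limit[OF m])
    qed (rule p0)
    from tendstoD[OF this \<tau>(1)] show "\<forall>\<^sub>F n in sequentially. \<bar>multinomial_occ n J (p n) k - poisson_occ J \<mu> k\<bar> < \<tau>"
      by (simp add: dist_real_def)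
  qed
  have ev_k: "\<forall>\<^sub>F n in sequentially. \<forall>k\<in>T. (\<Sum>j=1..J. k j) \<le> n"
    using eventually_ge_at_top by (intro eventually_ball_finite[OF T(1)]) blast
  show "\<forall>\<^sub>F n in sequentially. dist (\<integral>\<omega>. \<Phi> (\<lambda>t. floor_max (real C) {1..n} (\<lambda>i. rescaled m B' n i t \<omega>)) \<partial>M)
      (\<integral>\<omega>. \<Phi> (\<lambda>t. max (- real C) (R t \<omega>)) \<partial>N) < \<epsilon>"
    using ev_b ev_high ev_occ ev_k Q(2) eventually_ge_at_top[of 1]
  proof eventually_elim
    case (elim n)
    define b where "b = norming m n"
    have b: "0 < b" "2 * real C \<le> b" "H / \<eta> \<le> b" using elim(1) by (auto simp: b_def)
    interpret S: bessel_setting M m n b B B'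
      by unfold_locales (use m elim(6) b(1) B regB in auto)
    have curve: "S.curve i t \<omega> = rescaled m B' n i t \<omega>" for i t \<omega>
      unfolding S.curve_def rescaled_def sq_bessel_def b_def[symmetric] by simp
    have eu: "(2 * max (real a) (level (real a) \<delta> J) * real u + (real u)\<^sup>2 / 2) / b \<le> \<eta>"
      using b(1,3) \<eta>(1) unfolding H_def[symmetric] by (simp add: field_simps)
    have Qb: "real n * chi_tail m (b - 2 * real k) \<le> Q * exp (2 * real k)" for k using elim(5) by (simp add: b_def)
    define EM where "EM = (\<integral>\<omega>. \<Phi> (\<lambda>t. floor_max (real C) {1..n} (\<lambda>i. rescaled m B' n i t \<omega>)) \<partial>M)"
    define BM where "BM = (\<integral>\<omega>. \<Phi> (\<lambda>t. binned_max (real C) (level (real a) \<delta>) {1..n} (\<lambda>i. bin (real a) \<delta> J (S.point i (S.start \<omega>))) (\<lambda>i. S.radial i t \<omega>) t) \<partial>M)"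
    have "\<bar>EM - BM\<bar> \<le> L * (\<eta> + \<delta>) + 2 * c * (real n * chi_tail m (b + 2 * level (real a) \<delta> J)
        + 2 * Q * \<kappa> * exp (2 + 4 * real C) * exp (- 2 * real a) + Q * exp (2 * real a) * (\<kappa> * exp (- 4 * real u)))"
      unfolding EM_def BM_def curve[symmetric] \<kappa>_def
      by (rule S.binned_approximation[OF \<Phi> c \<delta>(1) of_nat_0_le_iff b(2) less_imp_le[OF \<eta>(1)] eu Qb less_imp_le[OF Q(1)]]) simp
    also have "\<dots> \<le> L * (2 * \<eta>) + 2 * c * (3 * \<eta>)"
      using \<delta>(2) elim(2) a(2) u L c0 by (intro add_mono mult_left_mono) (auto simp: b_def)
    finally have E1: "\<bar>EM - BM\<bar> \<le> L * (2 * \<eta>) + 2 * c * (3 * \<eta>)" .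
    define pM where "pM k = M.prob {\<omega>\<in>space M. occupancy J {1..n} (\<lambda>i. bin (real a) \<delta> J (S.point i (S.start \<omega>))) = k}" for k
    have pM: "\<bar>pM k - poisson_occ J \<mu> k\<bar> < \<tau>" if k: "k \<in> T" for k
    proof -
      have "pM k = multinomial_occ n J (S.bin_prob (real a) \<delta> J) k"
        unfolding pM_def using T(2) k elim(4) by (intro S.occupancy_law[OF \<delta>(1)]) auto
      also have "\<dots> = multinomial_occ n J (p n) k"
      proof -
        have "S.bin_prob (real a) \<delta> J j = p n j" if "j \<in> {1..J}" for j
          using that S.bin_prob_tail[OF \<delta>(1), of j J "real a"] by (simp add: p_def b_def)
        then show ?thesis unfolding multinomial_occ_def by simp
      qed
      finally show ?thesis using elim(3) k by simp
    qed
    define pN where "pN r k = measure N {\<omega>\<in>space N. occupancy J {..<r} (\<lambda>i. bin (real a) \<delta> J (N.points \<omega> i)) = k}" for r k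
    have ev_pN: "\<forall>\<^sub>F r in sequentially. \<forall>k\<in>T. \<bar>pN r k - poisson_occ J \<mu> k\<bar> < \<tau>"
    proof (rule eventually_ball_finite[OF T(1)], rule ballI)
      fix k assume "k \<in> T"
      then have "k \<in> extensional {1..J}" using T(2) by blast
      from N.poisson_occupancy_limit[OF N.poisson \<delta>(1) this, of "real a"]
      have "(\<lambda>r. pN r k) \<longlonglongrightarrow> poisson_occ J \<mu> k" unfolding pN_def \<mu>_def N.points_def .
      from tendstoD[OF this \<tau>(1)] show "\<forall>\<^sub>F r in sequentially. \<bar>pN r k - poisson_occ J \<mu> k\<bar> < \<tau>"
        by (simp add: dist_real_def)
    qed
    have "\<forall>\<^sub>F r in sequentially. (\<forall>k\<in>T. \<bar>pN r k - poisson_occ J \<mu> k\<bar> < \<tau>) \<and> \<bar>v r - l\<bar> < \<eta> \<and> 1 \<le> r"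
      using ev_pN tendstoD[OF vl \<eta>(1)] eventually_ge_at_top[of 1]
      by eventually_elim (simp add: dist_real_def)
    then obtain r where r: "\<And>k. k \<in> T \<Longrightarrow> \<bar>pN r k - poisson_occ J \<mu> k\<bar> < \<tau>" "\<bar>v r - l\<bar> < \<eta>" "1 \<le> r"
      unfolding eventually_sequentially by blast
    define BN where "BN = (\<integral>\<omega>. \<Phi> (\<lambda>t. binned_max (real C) (level (real a) \<delta>) {..<r} (\<lambda>i. bin (real a) \<delta> J (N.points \<omega> i)) (\<lambda>i. W' i t \<omega>) t) \<partial>N)"
    have "\<bar>v r - BN\<bar> \<le> L * \<delta> + 2 * c * (exp (- level (real a) \<delta> J) + 2 * 1 * (4 * exp 8) * exp (2 + 4 * real C) * exp (- 2 * real a))"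
      unfolding v_def BN_def by (rule N.binned_approximation[OF \<Phi> c \<delta>(1) r(3)])
    also have "\<dots> \<le> L * \<eta> + 2 * c * (2 * \<eta>)"
      using \<delta>(2) a(1,3) L c0 unfolding lev by (intro add_mono mult_left_mono) auto
    finally have E2: "\<bar>v r - BN\<bar> \<le> L * \<eta> + 2 * c * (2 * \<eta>)" .
    have gp: "N.indep_gauss_paths N.points N.point_space W' {..<r}"
      using r(3) by (intro N.gauss_paths) (auto simp: lessThan_empty_iff)
    have "\<bar>BM - BN\<bar> \<le> c * ((\<Sum>k\<in>T. \<bar>pM k - pN r k\<bar>) + (1 - (\<Sum>k\<in>T. pM k)) + (1 - (\<Sum>k\<in>T. pN r k)))"
      unfolding BM_def BN_def pM_def pN_def
    proof (rule binned_compare[where ?s1.0 = "\<lambda>z i. bin (real a) \<delta> J (S.point i z)" and ?s2.0 = "\<lambda>z i. bin (real a) \<delta> J (z i)",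
          OF M N.prob_space_axioms S.radial_paths gp lip_seq_cont[OF \<Phi>] c _ bin_le[OF \<delta>(1)] _ bin_le[OF \<delta>(1)] T(1)])
      show "(\<lambda>z. bin (real a) \<delta> J (S.point i z)) \<in> measurable S.start_space (count_space UNIV)" if "i \<in> {1..n}" for i
        by (rule measurable_compose[OF S.point_measurable[OF that] bin_measurable])
      show "(\<lambda>z. bin (real a) \<delta> J (z i)) \<in> measurable N.point_space (count_space UNIV)" if "i \<in> {..<r}" for i
      proof (rule measurable_compose[OF _ bin_measurable])
        show "(\<lambda>z. z i) \<in> borel_measurable N.point_space" by (rule measurable_component_singleton) simp
      qed
    qed
    also have "\<dots> \<le> c * (6 * \<eta>)"
    proof -
      have s1: "(\<Sum>k\<in>T. \<bar>pM k - pN r k\<bar>) \<le> 2 * \<eta>"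
      proof -
        have "(\<Sum>k\<in>T. \<bar>pM k - pN r k\<bar>) \<le> (\<Sum>k\<in>T. 2 * \<tau>)"
        proof (rule sum_mono)
          fix k assume "k \<in> T"
          from pM[OF this] r(1)[OF this] show "\<bar>pM k - pN r k\<bar> \<le> 2 * \<tau>" by linarith
        qed
        also have "\<dots> = 2 * (real (card T) * \<tau>)" by simp
        finally show ?thesis using \<tau>(2) by simp
      qed
      have lower: "1 - 2 * \<eta> \<le> (\<Sum>k\<in>T. p k)" if "\<And>k. k \<in> T \<Longrightarrow> \<bar>p k - poisson_occ J \<mu> k\<bar> < \<tau>" for p
      proof -
        have "(\<Sum>k\<in>T. poisson_occ J \<mu> k - \<tau>) \<le> (\<Sum>k\<in>T. p k)"
        proof (rule sum_mono)
          fix k assume "k \<in> T"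
          from that[OF this] show "poisson_occ J \<mu> k - \<tau> \<le> p k" by linarith
        qed
        then show ?thesis using T(3) \<tau>(2) by (simp add: sum_subtractf)
      qed
      show ?thesis
        using s1 lower[of pM] lower[of "pN r"] pM r(1) c0 by (intro mult_left_mono) auto
    qed
    finally have E3: "\<bar>BM - BN\<bar> \<le> c * (6 * \<eta>)" .
    have "\<bar>EM - l\<bar> \<le> (L * (2 * \<eta>) + 2 * c * (3 * \<eta>)) + c * (6 * \<eta>) + (L * \<eta> + 2 * c * (2 * \<eta>)) + \<eta>"
      using E1 E2 E3 r(2) by linarith
    also have "\<dots> = (3 * L + 16 * c + 1) * \<eta>" by (simp add: algebra_simps)
    also have "\<dots> < \<epsilon>" by (rule \<eta>(2))
    finally show ?case unfolding EM_def l_def dist_real_def .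
  qed
qed

text \<open>
  How far a path falls below \<open>- C\<close>, capped at 1. Flooring the path at \<open>- (C + 1)\<close> does not change this
  quantity, and has no effect on the path itself if the quantity is less than 1.
\<close>

definition dip :: "real \<Rightarrow> (real \<Rightarrow> real) \<Rightarrow> real" where
  "dip C f = sup_norm (\<lambda>t. max 0 (min 1 (- C - f t)))"

lemma dip_cont: "continuous_on {0..1} f \<Longrightarrow> continuous_on {0..1} (\<lambda>t. max 0 (min 1 (- C - f t :: real)))"
  by (intro continuous_on_max continuous_on_min continuous_intros)

lemma dip_range:
  assumes "continuous_on {0..1} f"
  shows "0 \<le> dip C f" "dip C f \<le> 1"
  unfolding dip_def using sup_norm_nonneg[OF dip_cont[OF assms, of C]] by (auto intro!: sup_norm_le)

lemma lip_dip: "lip 1 (dip C)"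
  unfolding lip_def
proof (intro conjI allI impI)
  fix f g :: "real \<Rightarrow> real" and e :: real
  assume fg: "continuous_on {0..1} f" "continuous_on {0..1} g" "\<forall>t\<in>{0..1}. \<bar>f t - g t\<bar> \<le> e"
  show "\<bar>dip C f - dip C g\<bar> \<le> 1 * e"
    unfolding dip_def
  proof (rule lipD[OF lip_sup_norm dip_cont[OF fg(1)] dip_cont[OF fg(2)]])
    fix t :: real assume "t \<in> {0..1}"
    then have "\<bar>f t - g t\<bar> \<le> e" using fg(3) by blast
    then show "\<bar>max 0 (min 1 (- C - f t)) - max 0 (min 1 (- C - g t))\<bar> \<le> e" by linarith
  qed
qed simp

lemma dip_floor: "dip C (\<lambda>t. max (- (C + 1)) (f t)) = dip C f"
  unfolding dip_def by (intro arg_cong[where f = sup_norm] ext) (auto simp: max_def min_def)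

lemma dip_less_1:
  assumes "continuous_on {0..1} f" "dip C f < 1" "t \<in> {0..1}"
  shows "max (- (C + 1)) (f t) = f t"
proof -
  have "\<bar>max 0 (min 1 (- C - f t))\<bar> \<le> dip C f"
    unfolding dip_def by (rule abs_le_sup_norm[OF dip_cont[OF assms(1)] assms(3)])
  with assms(2) show ?thesis by (auto simp: max_def min_def split: if_splits)
qed

text \<open>
  The functional can change only if the dip equals 1, and then by at most \<open>2 * c\<close>; Markov's inequality.
\<close>

lemma (in prob_space) floor_removal_bound:
  assumes \<Phi>: "lip L \<Phi>" and c: "\<And>f. continuous_on {0..1} f \<Longrightarrow> \<bar>\<Phi> f\<bar> \<le> c"
    and Y: "\<And>\<omega>. \<omega> \<in> space M \<Longrightarrow> continuous_on {0..1} (\<lambda>t. Y t \<omega>)" "\<And>t. t \<in> {0..1} \<Longrightarrow> Y t \<in> borel_measurable M"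
  shows "\<bar>(\<integral>\<omega>. \<Phi> (\<lambda>t. Y t \<omega>) \<partial>M) - (\<integral>\<omega>. \<Phi> (\<lambda>t. max (- (C + 1)) (Y t \<omega>)) \<partial>M)\<bar>
    \<le> 2 * c * (\<integral>\<omega>. dip C (\<lambda>t. Y t \<omega>) \<partial>M)"
proof -
  have Fc: "continuous_on {0..1} (\<lambda>t. max (- (C + 1)) (Y t \<omega>))" if "\<omega> \<in> space M" for \<omega>
    by (intro continuous_on_max continuous_on_const Y that)
  have Ym: "(\<lambda>\<omega>. \<Phi> (\<lambda>t. Y t \<omega>)) \<in> borel_measurable M"
    by (rule seq_cont_measurable[OF lip_seq_cont[OF \<Phi>] Y])
  have Fm: "(\<lambda>\<omega>. \<Phi> (\<lambda>t. max (- (C + 1)) (Y t \<omega>))) \<in> borel_measurable M"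
    by (rule seq_cont_measurable[OF lip_seq_cont[OF \<Phi>] Fc]) (use Y in auto)
  have Dm: "(\<lambda>\<omega>. dip C (\<lambda>t. Y t \<omega>)) \<in> borel_measurable M"
    by (rule seq_cont_measurable[OF lip_seq_cont[OF lip_dip] Y])
  have Yi: "integrable M (\<lambda>\<omega>. \<Phi> (\<lambda>t. Y t \<omega>))"
    by (rule integrable_const_bound[where B = c]) (use c Y Ym in auto)
  have Fi: "integrable M (\<lambda>\<omega>. \<Phi> (\<lambda>t. max (- (C + 1)) (Y t \<omega>)))"
    by (rule integrable_const_bound[where B = c]) (use c Fc Fm in auto)
  have Di: "integrable M (\<lambda>\<omega>. dip C (\<lambda>t. Y t \<omega>))"
    by (rule integrable_const_bound[where B = 1]) (use dip_range[OF Y(1)] Dm in \<open>auto simp: abs_le_iff\<close>)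
  have "\<bar>(\<integral>\<omega>. \<Phi> (\<lambda>t. Y t \<omega>) \<partial>M) - (\<integral>\<omega>. \<Phi> (\<lambda>t. max (- (C + 1)) (Y t \<omega>)) \<partial>M)\<bar>
      = \<bar>\<integral>\<omega>. \<Phi> (\<lambda>t. Y t \<omega>) - \<Phi> (\<lambda>t. max (- (C + 1)) (Y t \<omega>)) \<partial>M\<bar>"
    using Bochner_Integration.integral_diff[OF Yi Fi] by simp
  also have "\<dots> \<le> (\<integral>\<omega>. \<bar>\<Phi> (\<lambda>t. Y t \<omega>) - \<Phi> (\<lambda>t. max (- (C + 1)) (Y t \<omega>))\<bar> \<partial>M)"
    by (rule integral_abs_bound)
  also have "\<dots> \<le> (\<integral>\<omega>. 2 * c * dip C (\<lambda>t. Y t \<omega>) \<partial>M)"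
  proof (rule integral_mono)
    show "integrable M (\<lambda>\<omega>. \<bar>\<Phi> (\<lambda>t. Y t \<omega>) - \<Phi> (\<lambda>t. max (- (C + 1)) (Y t \<omega>))\<bar>)"
      by (intro integrable_abs Bochner_Integration.integrable_diff Yi Fi)
    show "integrable M (\<lambda>\<omega>. 2 * c * dip C (\<lambda>t. Y t \<omega>))" by (intro integrable_mult_right Di)
    fix \<omega> assume \<omega>: "\<omega> \<in> space M"
    have c0: "0 \<le> c" using c[OF Y(1)[OF \<omega>]] by linarith
    show "\<bar>\<Phi> (\<lambda>t. Y t \<omega>) - \<Phi> (\<lambda>t. max (- (C + 1)) (Y t \<omega>))\<bar> \<le> 2 * c * dip C (\<lambda>t. Y t \<omega>)"
    proof (cases "dip C (\<lambda>t. Y t \<omega>) < 1")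
      case True
      have "\<Phi> (\<lambda>t. Y t \<omega>) = \<Phi> (\<lambda>t. max (- (C + 1)) (Y t \<omega>))"
        by (rule lip_cong[OF \<Phi> Y(1)[OF \<omega>]]) (rule dip_less_1[OF Y(1)[OF \<omega>] True, symmetric])
      then show ?thesis using dip_range(1)[OF Y(1)[OF \<omega>], of C] c0 by simp
    next
      case False
      then have "2 * c * 1 \<le> 2 * c * dip C (\<lambda>t. Y t \<omega>)" using c0 by (intro mult_left_mono) auto
      then show ?thesis using c[OF Y(1)[OF \<omega>]] c[OF Fc[OF \<omega>]] by linarith
    qed
  qed
  also have "\<dots> = 2 * c * (\<integral>\<omega>. dip C (\<lambda>t. Y t \<omega>) \<partial>M)" by (rule integral_mult_right_zero)
  finally show ?thesis .
qed

text \<open>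
  The dip of a path is a Lipschitz functional of the floored path, so its expectation converges as well. For the limit process
  it is small for large \<open>C\<close>, since continuous paths are bounded; hence it is small for large \<open>n\<close> too, which
  says that the maxima are rarely below the floor.
\<close>

lemma remove_floor:
  assumes M: "prob_space M" and N: "prob_space N"
    and Y: "\<forall>\<^sub>F n in sequentially. (\<forall>\<omega>\<in>space M. continuous_on {0..1} (\<lambda>t. Y n t \<omega>)) \<and> (\<forall>t\<in>{0..1}. Y n t \<in> borel_measurable M)"
    and R: "\<And>\<omega>. \<omega> \<in> space N \<Longrightarrow> continuous_on {0..1} (\<lambda>t. R t \<omega>)" "\<And>t. t \<in> {0..1} \<Longrightarrow> R t \<in> borel_measurable N"
    and lim: "\<And>\<Phi> L c (C::nat). lip L \<Phi> \<Longrightarrow> (\<And>f. continuous_on {0..1} f \<Longrightarrow> \<bar>\<Phi> f\<bar> \<le> c) \<Longrightarrow>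
      (\<lambda>n. \<integral>\<omega>. \<Phi> (\<lambda>t. max (- real C) (Y n t \<omega>)) \<partial>M) \<longlonglongrightarrow> (\<integral>\<omega>. \<Phi> (\<lambda>t. max (- real C) (R t \<omega>)) \<partial>N)"
    and \<Phi>: "lip L \<Phi>" and c: "\<And>f. continuous_on {0..1} f \<Longrightarrow> \<bar>\<Phi> f\<bar> \<le> c"
  shows "(\<lambda>n. \<integral>\<omega>. \<Phi> (\<lambda>t. Y n t \<omega>) \<partial>M) \<longlonglongrightarrow> (\<integral>\<omega>. \<Phi> (\<lambda>t. R t \<omega>) \<partial>N)"
proof (rule tendstoI)
  interpret M: prob_space M by fact
  interpret N: prob_space N by fact
  fix \<epsilon> :: real assume \<epsilon>: "0 < \<epsilon>"
  have c0: "0 \<le> c" using c[of "\<lambda>_. 0"] by (simp add: continuous_on_const order_trans[OF abs_ge_zero])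
  define \<eta> where "\<eta> = \<epsilon> / (2 * (4 * c + 1))"
  have den: "0 < 4 * c + 1" using c0 by simp
  have "(4 * c + 1) * \<eta> = \<epsilon> / 2" unfolding \<eta>_def using den by (simp del: distrib_left_numeral)
  then have \<eta>: "0 < \<eta>" "(4 * c + 1) * \<eta> < \<epsilon>"
    using \<epsilon> den by (auto simp: \<eta>_def simp del: distrib_left_numeral)
  have "(\<lambda>C. \<integral>\<omega>. dip (real C) (\<lambda>t. R t \<omega>) \<partial>N) \<longlonglongrightarrow> (\<integral>\<omega>. 0 \<partial>N)"
  proof (rule integral_dominated_convergence[where w = "\<lambda>_. 1"])
    show "(\<lambda>\<omega>. dip (real C) (\<lambda>t. R t \<omega>)) \<in> borel_measurable N" for C
      by (rule seq_cont_measurable[OF lip_seq_cont[OF lip_dip] R])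
    show "AE \<omega> in N. norm (dip (real C) (\<lambda>t. R t \<omega>)) \<le> 1" for C
      using dip_range[OF R(1)] by (intro AE_I2) (auto simp: abs_le_iff)
    show "AE \<omega> in N. (\<lambda>C. dip (real C) (\<lambda>t. R t \<omega>)) \<longlonglongrightarrow> 0"
    proof (rule AE_I2)
      fix \<omega> assume \<omega>: "\<omega> \<in> space N"
      obtain C0 :: nat where C0: "sup_norm (\<lambda>t. R t \<omega>) < real C0" using reals_Archimedean2 by blast
      have "dip (real C) (\<lambda>t. R t \<omega>) = 0" if C: "C0 \<le> C" for C
      proof -
        have "\<bar>max 0 (min 1 (- real C - R t \<omega>))\<bar> \<le> 0" if t: "t \<in> {0..1}" for t
        proof -
          have "\<bar>R t \<omega>\<bar> \<le> sup_norm (\<lambda>t. R t \<omega>)" by (rule abs_le_sup_norm[OF R(1)[OF \<omega>] t])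
          moreover have "real C0 \<le> real C" using C by simp
          ultimately have "- real C - R t \<omega> \<le> 0" using C0 by linarith
          then show ?thesis by simp
        qed
        then have "dip (real C) (\<lambda>t. R t \<omega>) \<le> 0" unfolding dip_def by (rule sup_norm_le)
        then show ?thesis using dip_range(1)[OF R(1)[OF \<omega>], of "real C"] by linarith
      qed
      then show "(\<lambda>C. dip (real C) (\<lambda>t. R t \<omega>)) \<longlonglongrightarrow> 0"
        by (intro tendsto_eventually) (auto simp: eventually_sequentially)
    qed
  qed auto
  then have "\<forall>\<^sub>F C in sequentially. (\<integral>\<omega>. dip (real C) (\<lambda>t. R t \<omega>) \<partial>N) < \<eta>"
    using \<eta>(1) by (intro order_tendstoD(2)) auto
  then obtain C :: nat where C: "(\<integral>\<omega>. dip (real C) (\<lambda>t. R t \<omega>) \<partial>N) < \<eta>" by (auto simp: eventually_sequentially)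
  have SC: "- (real C + 1) = - real (Suc C)" by simp
  have dipS: "dip (real C) (\<lambda>t. max (- real (Suc C)) (f t)) = dip (real C) f" for f
    using dip_floor[of "real C" f] unfolding SC .
  have "(\<lambda>n. \<integral>\<omega>. dip (real C) (\<lambda>t. max (- real (Suc C)) (Y n t \<omega>)) \<partial>M) \<longlonglongrightarrow> (\<integral>\<omega>. dip (real C) (\<lambda>t. max (- real (Suc C)) (R t \<omega>)) \<partial>N)"
    by (rule lim[OF lip_dip, of _ 1]) (use dip_range in \<open>auto simp: abs_le_iff\<close>)
  then have "(\<lambda>n. \<integral>\<omega>. dip (real C) (\<lambda>t. Y n t \<omega>) \<partial>M) \<longlonglongrightarrow> (\<integral>\<omega>. dip (real C) (\<lambda>t. R t \<omega>) \<partial>N)"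
    unfolding dipS .
  then have evd: "\<forall>\<^sub>F n in sequentially. (\<integral>\<omega>. dip (real C) (\<lambda>t. Y n t \<omega>) \<partial>M) < \<eta>"
    using C by (rule order_tendstoD(2))
  have evl: "\<forall>\<^sub>F n in sequentially. dist (\<integral>\<omega>. \<Phi> (\<lambda>t. max (- real (Suc C)) (Y n t \<omega>)) \<partial>M) (\<integral>\<omega>. \<Phi> (\<lambda>t. max (- real (Suc C)) (R t \<omega>)) \<partial>N) < \<eta>"
    by (rule tendstoD[OF lim[OF \<Phi> c] \<eta>(1)])
  show "\<forall>\<^sub>F n in sequentially. dist (\<integral>\<omega>. \<Phi> (\<lambda>t. Y n t \<omega>) \<partial>M) (\<integral>\<omega>. \<Phi> (\<lambda>t. R t \<omega>) \<partial>N) < \<epsilon>"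
    using evd evl Y
  proof eventually_elim
    case (elim n)
    have 1: "\<bar>(\<integral>\<omega>. \<Phi> (\<lambda>t. Y n t \<omega>) \<partial>M) - (\<integral>\<omega>. \<Phi> (\<lambda>t. max (- real (Suc C)) (Y n t \<omega>)) \<partial>M)\<bar> \<le> 2 * c * (\<integral>\<omega>. dip (real C) (\<lambda>t. Y n t \<omega>) \<partial>M)"
      using M.floor_removal_bound[OF \<Phi> c, of "Y n" "real C"] elim(3) unfolding SC by blast
    have 2: "\<bar>(\<integral>\<omega>. \<Phi> (\<lambda>t. R t \<omega>) \<partial>N) - (\<integral>\<omega>. \<Phi> (\<lambda>t. max (- real (Suc C)) (R t \<omega>)) \<partial>N)\<bar> \<le> 2 * c * (\<integral>\<omega>. dip (real C) (\<lambda>t. R t \<omega>) \<partial>N)"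
      using N.floor_removal_bound[OF \<Phi> c R, of "real C"] unfolding SC by blast
    have "2 * c * (\<integral>\<omega>. dip (real C) (\<lambda>t. Y n t \<omega>) \<partial>M) \<le> 2 * c * \<eta>" "2 * c * (\<integral>\<omega>. dip (real C) (\<lambda>t. R t \<omega>) \<partial>N) \<le> 2 * c * \<eta>"
      using elim(1) C c0 by (auto intro!: mult_left_mono)
    with 1 2 elim(2) have "\<bar>(\<integral>\<omega>. \<Phi> (\<lambda>t. Y n t \<omega>) \<partial>M) - (\<integral>\<omega>. \<Phi> (\<lambda>t. R t \<omega>) \<partial>N)\<bar> < 2 * c * \<eta> + 2 * c * \<eta> + \<eta>"
      unfolding dist_real_def by linarith
    also have "\<dots> = (4 * c + 1) * \<eta>" by (simp add: algebra_simps)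
    also have "\<dots> < \<epsilon>" by (rule \<eta>(2))
    finally show ?case unfolding dist_real_def .
  qed
qed

theorem theorem2p1:
  fixes m :: nat
    and M :: "'a measure" and B :: "nat \<times> nat \<Rightarrow> real \<Rightarrow> 'a \<Rightarrow> real"
    and N :: "'b measure" and X :: "nat \<Rightarrow> 'b \<Rightarrow> real" and W :: "nat \<Rightarrow> real \<Rightarrow> 'b \<Rightarrow> real"
  assumes "m \<ge> 1"
    and "prob_space M"
    and "prob_space.indep_brownian_motions M B ({1..} \<times> {1..m})"
    and "prob_space N"
    and "prob_space.brown_resnick_data N X W"
  shows "converges_in_law_C01 M (\<lambda>n t \<omega>. MAX i\<in>{1..n}. rescaled m B n i t \<omega>)
           N (brown_resnick X W)"
proof -
  interpret M: prob_space M by fact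
  interpret N: prob_space N by fact
  obtain B' where B': "M.regular_version B B' ({1..} \<times> {1..m})"
    using M.regular_version_exists[OF assms(3)] by auto
  have "N.indep_brownian_motions W UNIV" using assms(5) by (simp add: N.brown_resnick_data_def)
  then obtain W' where W': "N.regular_version W W' UNIV"
    using N.regular_version_exists[of W UNIV] by auto
  interpret BR: brown_resnick_setting N X W W'
    by unfold_locales (use assms(5) W' in auto)
  obtain R where R: "\<And>t. t \<in> {0..1} \<Longrightarrow> R t \<in> borel_measurable N"
    "\<And>\<omega>. \<omega> \<in> space N \<Longrightarrow> continuous_on {0..1} (\<lambda>t. R t \<omega>)"
    "AE \<omega> in N. \<forall>t\<in>{0..1}. R t \<omega> = brown_resnick X W t \<omega>"
    "AE \<omega> in N. \<exists>n0. \<forall>n\<ge>n0. \<forall>t\<in>{0..1}. \<forall>C. floor_max C {..<n} (\<lambda>i. BR.curve i t \<omega>) = max (- C) (R t \<omega>)"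
    using BR.continuous_version by blast
  \<comment> \<open>regular versions make the maximum continuous for every outcome\<close>
  define Y where "Y n t \<omega> = (MAX i\<in>{1..n}. rescaled m B' n i t \<omega>)" for n t \<omega>
  have floorY: "floor_max C {1..n} (\<lambda>i. rescaled m B' n i t \<omega>) = max (- C) (Y n t \<omega>)" if "1 \<le> n" for C n t \<omega>
    unfolding floor_max_def Y_def using that by (subst Max_insert) auto
  have ev: "\<forall>\<^sub>F n in sequentially. 1 \<le> n \<and> 0 < norming m n"
  proof (rule eventually_conj[OF eventually_ge_at_top])
    show "\<forall>\<^sub>F n in sequentially. 0 < norming m n"
      using norming_at_top[of m 0] unfolding filterlim_at_top_dense by simp
  qed
  have Y: "\<forall>\<^sub>F n in sequentially. (\<forall>\<omega>\<in>space M. continuous_on {0..1} (\<lambda>t. Y n t \<omega>)) \<and> (\<forall>t\<in>{0..1}. Y n t \<in> borel_measurable M)"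
    using ev
  proof eventually_elim
    case (elim n)
    interpret S: bessel_setting M m n "norming m n" B B'
      by unfold_locales (use assms(1,3) elim B' in auto)
    have curve: "S.curve i t \<omega> = rescaled m B' n i t \<omega>" for i t \<omega>
      by (simp add: S.curve_def rescaled_def sq_bessel_def)
    show ?case
    proof (intro conjI ballI)
      fix \<omega> assume \<omega>: "\<omega> \<in> space M"
      show "continuous_on {0..1} (\<lambda>t. Y n t \<omega>)"
        unfolding Y_def curve[symmetric] using elim by (intro continuous_on_Max S.curve_cont \<omega>) auto
    next
      fix t :: real assume t: "t \<in> {0..1}"
      have "(\<lambda>\<omega>. MAX i\<in>{1..n}. S.curve i t \<omega>) \<in> borel_measurable M"
        using t by (intro borel_measurable_Max S.curve_measurable) auto
      moreover have "Y n t = (\<lambda>\<omega>. MAX i\<in>{1..n}. S.curve i t \<omega>)" by (simp add: Y_def curve fun_eq_iff)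
      ultimately show "Y n t \<in> borel_measurable M" by simp
    qed
  qed
  define Zn where "Zn n \<omega> = restrict (\<lambda>t. Y n t \<omega>) {0..1}" for n \<omega>
  define Z where "Z \<omega> = restrict (\<lambda>t. R t \<omega>) {0..1}" for \<omega>
  have Znm: "\<forall>\<^sub>F n in sequentially. Zn n \<in> measurable M borel_C01"
    using Y
  proof eventually_elim
    case (elim n)
    then show ?case unfolding Zn_def by (intro restrict_C01_measurable) auto
  qed
  have Zm: "Z \<in> measurable N borel_C01"
    unfolding Z_def by (rule restrict_C01_measurable[OF R(2,1)])
  have law_n: "\<forall>\<^sub>F n in sequentially. has_law_C01 M (\<lambda>t \<omega>. MAX i\<in>{1..n}. rescaled m B n i t \<omega>) (distr M borel_C01 (Zn n))"
    using Znm ev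
  proof eventually_elim
    case (elim n)
    have "AE \<omega> in M. \<forall>x\<in>{1..} \<times> {1..m}. \<forall>t\<ge>0. B' x t \<omega> = B x t \<omega>"
      using B' by (simp add: M.regular_version_def)
    then have "AE \<omega> in M. \<forall>t\<in>{0..1}. Zn n \<omega> t = (MAX i\<in>{1..n}. rescaled m B n i t \<omega>)"
    proof eventually_elim
      case (elim \<omega>)
      show ?case
      proof
        fix t :: real assume t: "t \<in> {0..1}"
        have "rescaled m B' n i t \<omega> = rescaled m B n i t \<omega>" if "i \<in> {1..n}" for i
        proof -
          have "0 \<le> 1 + t / norming m n" using t \<open>1 \<le> n \<and> 0 < norming m n\<close> by (intro add_nonneg_nonneg divide_nonneg_pos) auto
          then have "(\<Sum>j=1..m. (B' (i, j) (1 + t / norming m n) \<omega>)\<^sup>2) = (\<Sum>j=1..m. (B (i, j) (1 + t / norming m n) \<omega>)\<^sup>2)"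
            using elim that by (intro sum.cong refl) auto
          then show ?thesis by (simp only: rescaled_def sq_bessel_def)
        qed
        then have "(\<lambda>i. rescaled m B' n i t \<omega>) ` {1..n} = (\<lambda>i. rescaled m B n i t \<omega>) ` {1..n}" by (intro image_cong refl)
        then show "Zn n \<omega> t = (MAX i\<in>{1..n}. rescaled m B n i t \<omega>)" using t by (simp add: Zn_def Y_def)
      qed
    qed
    then show ?case unfolding has_law_C01_def using elim(1) by blast
  qed
  have law: "has_law_C01 N (brown_resnick X W) (distr N borel_C01 Z)"
    unfolding has_law_C01_def
  proof (intro bexI[OF _ Zm] conjI refl)
    show "AE \<omega> in N. \<forall>t\<in>{0..1}. Z \<omega> t = brown_resnick X W t \<omega>"
      using R(3) by eventually_elim (simp add: Z_def)
  qed
  have floored: "(\<lambda>n. \<integral>\<omega>. \<Phi> (\<lambda>t. max (- real C) (Y n t \<omega>)) \<partial>M) \<longlonglongrightarrow> (\<integral>\<omega>. \<Phi> (\<lambda>t. max (- real C) (R t \<omega>)) \<partial>N)"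
    if \<Phi>: "lip L \<Phi>" and c: "\<And>f. continuous_on {0..1} f \<Longrightarrow> \<bar>\<Phi> f\<bar> \<le> c" for \<Phi> L c and C :: nat
  proof (rule Lim_transform_eventually)
    show "(\<lambda>n. \<integral>\<omega>. \<Phi> (\<lambda>t. floor_max (real C) {1..n} (\<lambda>i. rescaled m B' n i t \<omega>)) \<partial>M) \<longlonglongrightarrow> (\<integral>\<omega>. \<Phi> (\<lambda>t. max (- real C) (R t \<omega>)) \<partial>N)"
      by (rule floored_convergence[OF assms(2,1,3) B' BR.brown_resnick_setting_axioms R(1,2,4) \<Phi> c])
    show "\<forall>\<^sub>F n in sequentially. (\<integral>\<omega>. \<Phi> (\<lambda>t. floor_max (real C) {1..n} (\<lambda>i. rescaled m B' n i t \<omega>)) \<partial>M) = (\<integral>\<omega>. \<Phi> (\<lambda>t. max (- real C) (Y n t \<omega>)) \<partial>M)"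
      using eventually_ge_at_top[of 1] by eventually_elim (simp only: floorY)
  qed
  have "weak_conv_C01 (\<lambda>n. distr M borel_C01 (Zn n)) (distr N borel_C01 Z)"
  proof (rule weak_conv_C01_lipI[OF assms(2,4) Znm Zm])
    fix \<Phi> L c assume \<Phi>: "lip L \<Phi>" and c: "\<And>f. continuous_on {0..1} f \<Longrightarrow> \<bar>\<Phi> f\<bar> \<le> c"
    have res: "\<Phi> (restrict f {0..1}) = \<Phi> f" if "continuous_on {0..1} f" for f
      by (rule lip_cong[OF \<Phi> that, symmetric]) simp
    have "(\<lambda>n. \<integral>\<omega>. \<Phi> (\<lambda>t. Y n t \<omega>) \<partial>M) \<longlonglongrightarrow> (\<integral>\<omega>. \<Phi> (\<lambda>t. R t \<omega>) \<partial>N)"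
      by (rule remove_floor[OF assms(2,4) Y R(2,1) floored \<Phi> c])
    moreover have "(\<integral>\<omega>. \<Phi> (\<lambda>t. R t \<omega>) \<partial>N) = (\<integral>\<omega>. \<Phi> (Z \<omega>) \<partial>N)"
      unfolding Z_def by (intro Bochner_Integration.integral_cong refl res[symmetric] R(2))
    moreover have "\<forall>\<^sub>F n in sequentially. (\<integral>\<omega>. \<Phi> (\<lambda>t. Y n t \<omega>) \<partial>M) = (\<integral>\<omega>. \<Phi> (Zn n \<omega>) \<partial>M)"
      using Y
    proof eventually_elim
      case (elim n)
      show ?case unfolding Zn_def using elim by (intro Bochner_Integration.integral_cong refl res[symmetric]) blast
    qed
    ultimately show "(\<lambda>n. \<integral>\<omega>. \<Phi> (Zn n \<omega>) \<partial>M) \<longlonglongrightarrow> (\<integral>\<omega>. \<Phi> (Z \<omega>) \<partial>N)"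
      using Lim_transform_eventually by force
  qed
  with law_n law have "(\<forall>\<^sub>F n in sequentially. has_law_C01 M (\<lambda>t \<omega>. MAX i\<in>{1..n}. rescaled m B n i t \<omega>) (distr M borel_C01 (Zn n))) \<and>
      has_law_C01 N (brown_resnick X W) (distr N borel_C01 Z) \<and> weak_conv_C01 (\<lambda>n. distr M borel_C01 (Zn n)) (distr N borel_C01 Z)"
    by simp
  then show ?thesis unfolding converges_in_law_C01_def by (intro exI)
qed

end
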